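(* Let $d\ge 1$ be an integer, $\alpha\in(0,d\wedge 2)$ and $\delta\in(0,\alpha)$, and let $\tilde p(t,x,y)$ be the heat kernel of $\mathcal L=\Delta^{\alpha/2}+\kappa_\delta|x|^{-\alpha}$ described in the context. Then $\tilde p$ is jointly continuous on $(0,\infty)\times\mathbb{R}^d\times\mathbb{R}^d$, and there is a constant $c\ge1$ such that for all $t>0$ and $x,y\in\mathbb{R}^d$, $$c^{-1}F(t,x,y)\le \tilde p(t,x,y)\le c\,F(t,x,y),\qquad F(t,x,y):=\Big(1\wedge \frac{|x|}{t^{1/\alpha}}\Big)^{\delta}\Big(1\wedge \frac{|y|}{t^{1/\alpha}}\Big)^{\delta}\Big(t^{-d/\alpha}\wedge \frac{t}{|x-y|^{d+\alpha}}\Big).$$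
   Context: Let $p(t,x,y)=p(t,x-y)$ ($t>0$, $x,y\in\mathbb{R}^d$) be the heat kernel of the fractional Laplacian $\Delta^{\alpha/2}=-(-\Delta)^{\alpha/2}$, i.e. the transition density of the rotationally symmetric $\alpha$-stable Lévy process $(X_t)_{t\ge0}$ on $\mathbb{R}^d$ (with $\int e^{i\xi\cdot z}p(t,z)\,dz=e^{-t|\xi|^\alpha}$). For $\beta\in(0,\alpha)$ put $\kappa_\beta=\frac{2^\alpha\Gamma(\frac{\alpha-\beta}{2})\Gamma(\frac{d+\beta}{2})}{\Gamma(\frac{-\beta}{2})\Gamma(\frac{d+\beta-\alpha}{2})}$, where $\Gamma(-\beta/2)=\int_0^\infty r^{-1-\beta/2}(e^{-r}-1)\,dr<0$; so $\kappa_\beta<0$. Let $q(x)=\kappa_\delta|x|^{-\alpha}$ and $\mathbb{R}^d_0=\mathbb{R}^d\setminus\{0\}$. The Feynman–Kac semigroup $\tilde P_tf(x)=\mathbb{E}^x\big[f(X_t)\exp(\int_0^t q(X_s)\,ds)\big]$, $f\in C_\infty(\mathbb{R}^d_0)$, $x\in\mathbb{R}^d_0$, has a symmetric kernel $\tilde p(t,x,y)$ on $(0,\infty)\times\mathbb{R}^d_0\times\mathbb{R}^d_0$ (i.e. $\tilde P_tf(x)=\int\tilde p(t,x,y)f(y)\,dy$) satisfying the Chapman–Kolmogorov equations; it is extended by $\tilde p(t,x,y)=0$ when $x=0$ or $y=0$. This $\tilde p$ is called the heat kernel of $\mathcal L$. *)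

theory Defs
  imports "HOL-Probability.Probability"
begin

text \<open>Constant kappa_beta (d = dimension). Gamma is the library Gamma function
  (analytic continuation; for -beta/2 in (-1,0) it equals the integral in the paper).\<close>
definition kappa :: "nat \<Rightarrow> real \<Rightarrow> real \<Rightarrow> real" where
  "kappa d \<alpha> \<beta> = 2 powr \<alpha> * Gamma ((\<alpha> - \<beta>) / 2) * Gamma ((real d + \<beta>) / 2)
      / (Gamma (- \<beta> / 2) * Gamma ((real d + \<beta> - \<alpha>) / 2))"

text \<open>X is a rotationally symmetric alpha-stable Levy process started at 0 on the
  probability space M (with cadlag paths); the process started at x is x + X.\<close>
definition is_stable_process ::
  "'b measure \<Rightarrow> real \<Rightarrow> (real \<Rightarrow> 'b \<Rightarrow> 'a::euclidean_space) \<Rightarrow> bool" where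
  "is_stable_process M \<alpha> X \<longleftrightarrow>
     prob_space M \<and>
     (\<forall>t. X t \<in> borel_measurable M) \<and>
     (\<forall>\<omega>\<in>space M. X 0 \<omega> = 0) \<and>
     (\<forall>\<omega>\<in>space M. \<forall>s. continuous (at_right s) (\<lambda>r. X r \<omega>) \<and>
                        (\<exists>l. ((\<lambda>r. X r \<omega>) \<longlongrightarrow> l) (at_left s))) \<and>
     (\<forall>(n::nat) (\<tau>::nat \<Rightarrow> real). 0 \<le> \<tau> 0 \<longrightarrow> (\<forall>i<n. \<tau> i < \<tau> (Suc i)) \<longrightarrow>
        prob_space.indep_vars M (\<lambda>_. borel) (\<lambda>i \<omega>. X (\<tau> (Suc i)) \<omega> - X (\<tau> i) \<omega>) {..<n}) \<and>
     (\<forall>s t (\<xi>::'a). 0 \<le> s \<longrightarrow> s \<le> t \<longrightarrow>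
        (LINT \<omega>|M. cis (\<xi> \<bullet> (X t \<omega> - X s \<omega>))) = complex_of_real (exp (- (t - s) * norm \<xi> powr \<alpha>)))"

text \<open>Feynman-Kac weight exp(int_0^t q(x + X_s) ds) with q(z) = kap |z|^(-alpha) \<le> 0
  (kap < 0); the integral of -q \<ge> 0 is a nonnegative integral, and the weight is 0 when it is infinite.\<close>
definition FK_weight ::
  "real \<Rightarrow> real \<Rightarrow> (real \<Rightarrow> 'b \<Rightarrow> 'a::euclidean_space) \<Rightarrow> real \<Rightarrow> 'a \<Rightarrow> 'b \<Rightarrow> real" where
  "FK_weight kap \<alpha> X t x \<omega> =
     (let I = (\<integral>\<^sup>+ s\<in>{0..t}. ennreal (- kap * norm (x + X s \<omega>) powr (- \<alpha>)) \<partial>lborel)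
      in if I = \<infinity> then 0 else exp (- enn2real I))"

text \<open>C_infinity(R^d_0): continuous functions on R^d \ {0} vanishing at infinity and at 0,
  identified with continuous functions on R^d with f 0 = 0 vanishing at infinity.\<close>
definition C_infty_punctured :: "('a::euclidean_space \<Rightarrow> real) set" where
  "C_infty_punctured = {f. continuous_on (UNIV - {0}) f \<and> (f \<longlongrightarrow> 0) (at 0)
                          \<and> (f \<longlongrightarrow> 0) at_infinity \<and> f 0 = 0}"

definition is_FK_heat_kernel ::
  "'b measure \<Rightarrow> real \<Rightarrow> real \<Rightarrow> (real \<Rightarrow> 'b \<Rightarrow> 'a::euclidean_space)
     \<Rightarrow> (real \<Rightarrow> 'a \<Rightarrow> 'a \<Rightarrow> real) \<Rightarrow> bool" where
  "is_FK_heat_kernel M kap \<alpha> X pt \<longleftrightarrow>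
     (\<forall>t>0. \<forall>x y. pt t x y = pt t y x) \<and>
     (\<forall>t>0. \<forall>x. pt t x 0 = 0 \<and> pt t 0 x = 0) \<and>
     (\<forall>s>0. \<forall>t>0. \<forall>x y. integrable lborel (\<lambda>z. pt s x z * pt t z y) \<and>
        pt (s + t) x y = (LINT z|lborel. pt s x z * pt t z y)) \<and>
     (\<forall>f\<in>C_infty_punctured. \<forall>t>0. \<forall>x. x \<noteq> 0 \<longrightarrow>
        integrable lborel (\<lambda>y. pt t x y * f y) \<and>
        (LINT y|lborel. pt t x y * f y) = (LINT \<omega>|M. f (x + X t \<omega>) * FK_weight kap \<alpha> X t x \<omega>))"

text \<open>The two-sided bound F(t,x,y); t/|x-y|^(d+alpha) is read as +infinity when x = y.\<close>
definition Fbound :: "nat \<Rightarrow> real \<Rightarrow> real \<Rightarrow> real \<Rightarrow> 'a::real_normed_vector \<Rightarrow> 'a \<Rightarrow> real" where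
  "Fbound d \<alpha> \<delta> t x y =
     (min 1 (norm x / t powr (1 / \<alpha>))) powr \<delta> * (min 1 (norm y / t powr (1 / \<alpha>))) powr \<delta> *
     (if x = y then t powr (- real d / \<alpha>)
      else min (t powr (- real d / \<alpha>)) (t / norm (x - y) powr (real d + \<alpha>)))"

end

theory Submission
  imports Defs
begin

text \<open>
  The function \<open>h x = |x|\<^sup>\<delta>\<close> is invariant for the Feynman-Kac semigroup: the stable semigroup satisfies
  \<open>P\<^sub>t h = h + |\<kappa>| \<integral>\<^sub>0\<^sup>t P\<^sub>s |z|\<^bsup>\<delta>-\<alpha>\<^esup> ds\<close> (Gamma integrals and Fourier inversion), so the increments
  of \<open>t \<mapsto> \<integral> pt t x z h z dz\<close> are \<open>o(\<epsilon>)\<close> and this function is constant. Invariance combined with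
  \<open>pt \<le> C t\<^bsup>-d/\<alpha>\<^esup>\<close> gives a recursion between times \<open>t\<close> and \<open>t/2\<close> for the mass
  \<open>m t x = \<integral> pt t x z dz\<close>, whose iteration yields \<open>m t x \<le> C (1 \<and> |x|/t\<^bsup>1/\<alpha>\<^esup>)\<^sup>\<delta>\<close>; by Chapman-Kolmogorov
  this mass controls \<open>pt\<close> near the diagonal, and a second iteration, convergent because \<open>\<delta> < \<alpha>\<close>, controls it
  far from the diagonal. Conversely, invariance and the upper bound force a mass of order
  \<open>(1 \<and> |x|/t\<^bsup>1/\<alpha>\<^esup>)\<^sup>\<delta>\<close> into an annulus of radii comparable to \<open>t\<^bsup>1/\<alpha>\<^esup>\<close>, where Jensen's inequality bounds
  \<open>pt\<close> from below by the stable density. The latter is built by subordinating Gaussian densities; only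
  one-time and two-time laws of the process enter.
\<close>

section \<open>Characteristic functions and Gaussian densities\<close>

text \<open>The value of \<open>kappa\<close> is forced by Fourier analysis:
  \<open>|x| powr \<delta>\<close> and \<open>|x| powr (\<delta> - \<alpha>)\<close> both arise from
  Gaussians by integrating over their time parameter, and the quotient of the two resulting
  constants is exactly the coupling at which the gain of the free semigroup on the first function
  balances the killing. Two obstacles shape the proof. The kernel is given only through integrals
  against \<open>C_infty_punctured\<close>, so its sign and its domination by the stable density
  hold at first almost everywhere; Chapman-Kolmogorov at half the time turns them into pointwise
  bounds. And a Duhamel formula for the invariant function would need the Markov property of the
  whole path; a pointwise small-time analysis, with a majorant integrable against the stable
  density, replaces it. Expectations conditioned on the endpoint are avoided as well: the inequality
  \<open>p s x * p t y \<le> C * S (s + t) (x + y) * (p s x + p t y)\<close>, which rests on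
  comparability with \<open>sbound\<close> alone, takes their place.\<close>

lemma open_indicator_tendsto:
  fixes U :: "'a::metric_space set"
  assumes "open U" "U \<noteq> UNIV"
  shows "(\<lambda>n. min 1 (real n * infdist x (- U))) \<longlonglongrightarrow> indicator U x"
proof (cases "x \<in> U")
  case True
  \<comment> \<open>\<open>U \<noteq> UNIV\<close> matters here: the distance to the empty set is 0
    by convention, so for \<open>U = UNIV\<close> the approximations would vanish.\<close>
  have pos: "infdist x (- U) > 0"
    using assms True in_closed_iff_infdist_zero[of "- U" x] infdist_nonneg[of x "- U"] by fastforce
  obtain N :: nat where N: "1 / infdist x (- U) < real N" using reals_Archimedean2 by blast
  have "eventually (\<lambda>n. min 1 (real n * infdist x (- U)) = 1) sequentially"
    using eventually_ge_at_top[of N]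
  proof eventually_elim
    case (elim n)
    have "1 < real N * infdist x (- U)" using N pos by (simp add: field_simps)
    also have "\<dots> \<le> real n * infdist x (- U)" using elim pos by (intro mult_right_mono) auto
    finally show ?case by simp
  qed
  then show ?thesis using True by (simp add: tendsto_eventually)
next
  case False
  then show ?thesis by simp
qed

lemma finite_measure_eqI_continuous:
  fixes M N :: "'a::metric_space measure"
  assumes fin: "finite_measure M" "finite_measure N"
    and sets[measurable_cong]: "sets M = sets borel" "sets N = sets borel"
    and eq: "\<And>f :: 'a \<Rightarrow> real. continuous_on UNIV f \<Longrightarrow> (\<And>x. 0 \<le> f x) \<Longrightarrow> (\<And>x. f x \<le> 1) \<Longrightarrow>
                (LINT x|M. f x) = (LINT x|N. f x)"
  shows "M = N"
proof -
  interpret M: finite_measure M by fact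
  interpret N: finite_measure N by fact
  have sp: "space M = UNIV" "space N = UNIV" using sets[THEN sets_eq_imp_space_eq] by simp_all
  have UNIV: "measure M UNIV = measure N UNIV"
    using eq[of "\<lambda>_. 1"] by (simp add: sp)
  have op: "emeasure M U = emeasure N U" if U: "open U" for U
  proof (cases "U = UNIV")
    case True
    then show ?thesis using UNIV by (simp add: M.emeasure_eq_measure N.emeasure_eq_measure)
  next
    case False
    let ?f = "\<lambda>n x. min 1 (real n * infdist x (- U))"
    have cont: "continuous_on UNIV (?f n)" for n by (intro continuous_intros)
    have [measurable]: "?f n \<in> borel_measurable borel" for n
      using cont by (rule borel_measurable_continuous_onI)
    have U': "U \<in> sets borel" using U by simp
    have nn: "0 \<le> ?f n x" for n x by (simp add: infdist_nonneg)
    have limM: "(\<lambda>n. LINT x|M. ?f n x) \<longlonglongrightarrow> (LINT x|M. indicator U x)"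
      by (rule integral_dominated_convergence[where w="\<lambda>_. 1"])
         (use open_indicator_tendsto[OF U False] nn U' in \<open>auto intro!: borel_measurable_indicator\<close>)
    have limN: "(\<lambda>n. LINT x|N. ?f n x) \<longlonglongrightarrow> (LINT x|N. indicator U x)"
      by (rule integral_dominated_convergence[where w="\<lambda>_. 1"])
         (use open_indicator_tendsto[OF U False] nn U' in \<open>auto intro!: borel_measurable_indicator\<close>)
    have "(LINT x|M. indicator U x) = (LINT x|N. (indicator U x :: real))"
      using limM limN eq[OF cont nn] by (simp add: LIMSEQ_unique)
    then show ?thesis using U' sets
      by (simp add: M.emeasure_eq_measure N.emeasure_eq_measure sp)
  qed
  show ?thesis
  proof (rule measure_eqI_generator_eq[where E="{U. open U}" and \<Omega>=UNIV and A="\<lambda>_. UNIV"])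
    show "Int_stable {U::'a set. open U}" by (auto simp: Int_stable_def)
    show "sets M = sigma_sets UNIV {U. open U}" "sets N = sigma_sets UNIV {U. open U}"
      by (simp_all add: sets borel_def)
    show "emeasure M UNIV \<noteq> \<infinity>" for i :: nat using M.emeasure_finite[of UNIV] by simp
  qed (use op in auto)
qed

text \<open>Heat kernel of the Laplacian at time \<open>u\<close>, with variance
  \<open>2 * u\<close> in each coordinate. Its characteristic function is
  \<open>exp (- u * |xi|^2)\<close>, so averaging over a one-sided stable \<open>u\<close> produces
  \<open>exp (- |xi| powr \<alpha>)\<close>.\<close>

definition gauss :: "real \<Rightarrow> 'a::euclidean_space \<Rightarrow> real" where
  "gauss u x = (4 * pi * u) powr (- real DIM('a) / 2) * exp (- (norm x)\<^sup>2 / (4 * u))"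

lemma gauss_nonneg [simp]: "0 \<le> gauss u x"
  by (simp add: gauss_def)

lemma gauss_minus [simp]: "gauss u (- x) = gauss u x"
  by (simp add: gauss_def)

lemma borel_measurable_gauss [measurable]: "gauss u \<in> borel_measurable borel"
  unfolding gauss_def[abs_def] by measurable

lemma char_normal_density:
  fixes t :: real
  assumes "u > 0"
  shows "integrable lborel (\<lambda>x. complex_of_real (normal_density 0 (sqrt (2 * u)) x) * cis (t * x))"
    and "(LINT x|lborel. complex_of_real (normal_density 0 (sqrt (2 * u)) x) * cis (t * x)) = exp (- u * t\<^sup>2)"
proof -
  let ?s = "sqrt (2 * u)"
  have s: "?s > 0" using assms by simp
  show int: "integrable lborel (\<lambda>x. complex_of_real (normal_density 0 ?s x) * cis (t * x))"
    by (rule Bochner_Integration.integrable_bound[OF integrable_normal_density[of ?s 0]])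
       (use s in \<open>auto simp: norm_mult cis_conv_exp\<close>)
  have "(LINT x|lborel. complex_of_real (normal_density 0 ?s x) * cis (t * x))
     = ?s *\<^sub>R (LINT x|lborel. complex_of_real (normal_density 0 ?s (?s * x)) * cis (t * (?s * x)))"
    using lborel_integral_real_affine[of ?s "\<lambda>x. complex_of_real (normal_density 0 ?s x) * cis (t * x)" 0] s by simp
  also have "\<dots> = (LINT x|lborel. std_normal_density x *\<^sub>R cis (t * ?s * x))"
  proof -
    have "?s * normal_density 0 ?s (?s * x) = std_normal_density x" for x
      using s assms by (simp add: normal_density_def real_sqrt_mult power_mult_distrib field_simps)
    then have "?s *\<^sub>R (complex_of_real (normal_density 0 ?s (?s * x)) * cis (t * (?s * x)))
            = std_normal_density x *\<^sub>R cis (t * ?s * x)" for x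
      by (simp add: scaleR_conv_of_real mult.assoc[symmetric] of_real_mult[symmetric] del: of_real_mult)
    then show ?thesis by (subst integral_scaleR_right[symmetric]) simp
  qed
  also have "\<dots> = char std_normal_distribution (t * ?s)"
    unfolding char_def by (subst integral_density) (auto simp: cis_conv_exp)
  also have "\<dots> = exp (- u * t\<^sup>2)"
  proof -
    have "(t * ?s)\<^sup>2 = 2 * u * t\<^sup>2" using assms by (simp add: power_mult_distrib)
    then show ?thesis by (simp add: char_std_normal_distribution)
  qed
  finally show "(LINT x|lborel. complex_of_real (normal_density 0 ?s x) * cis (t * x)) = exp (- u * t\<^sup>2)" .
qed

lemma cis_sum: "finite A \<Longrightarrow> cis (sum f A) = (\<Prod>i\<in>A. cis (f i))"
  by (induction A rule: finite_induct) (auto simp: cis_mult[symmetric])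

lemma gauss_eq_prod:
  fixes x :: "'a::euclidean_space"
  assumes "u > 0"
  shows "gauss u x = (\<Prod>b\<in>Basis. normal_density 0 (sqrt (2 * u)) (x \<bullet> b))"
proof -
  have 1: "(\<Prod>b\<in>(Basis :: 'a set). 1 / sqrt (4 * pi * u)) = (4 * pi * u) powr (- real DIM('a) / 2)"
    using assms by (simp add: powr_half_sqrt[symmetric] powr_minus_divide powr_powr powr_realpow[symmetric] power_one_over)
  have 2: "(\<Prod>b\<in>Basis. exp (- (x \<bullet> b)\<^sup>2 / (4 * u))) = exp (- (norm x)\<^sup>2 / (4 * u))"
    by (simp add: exp_sum[symmetric] sum_divide_distrib[symmetric] sum_negf norm_eq_sqrt_inner
        euclidean_inner[of x x] power2_eq_square sum_nonneg)
  show ?thesis unfolding gauss_def 1[symmetric] 2[symmetric] prod.distrib[symmetric]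
    using assms by (intro prod.cong) (auto simp: normal_density_def mult.assoc)
qed

text \<open>The Gaussian factorises over \<open>Basis\<close>, and \<open>lborel\<close> is the
  image of the product measure over \<open>Basis\<close>; everything reduces to the one-dimensional
  normal law.\<close>

lemma
  fixes xi :: "'a::euclidean_space"
  assumes "u > 0"
  shows integrable_gauss_cis: "integrable lborel (\<lambda>x::'a. complex_of_real (gauss u x) * cis (xi \<bullet> x))"
    and char_gauss: "(LINT x|lborel. complex_of_real (gauss u x) * cis (xi \<bullet> x)) = exp (- u * (norm xi)\<^sup>2)"
proof -
  interpret product_sigma_finite "\<lambda>_::'a. lborel :: real measure" ..
  let ?f = "\<lambda>b y. complex_of_real (normal_density 0 (sqrt (2 * u)) y) * cis ((xi \<bullet> b) * y)"
  have eq: "complex_of_real (gauss u x) * cis (xi \<bullet> x) = (\<Prod>b\<in>Basis. ?f b (x \<bullet> b))" for x :: 'a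
    by (simp add: gauss_eq_prod[OF assms] prod.distrib cis_sum[symmetric] euclidean_inner[of xi x])
  have *: "(\<Sum>b\<in>Basis. f b *\<^sub>R b) \<bullet> c = f c" if "c \<in> Basis" for f :: "'a \<Rightarrow> real" and c
    using that by (simp add: inner_sum_left inner_Basis if_distrib cong: if_cong)
  have m: "(\<lambda>f. \<Sum>b\<in>Basis. f b *\<^sub>R b) \<in> (\<Pi>\<^sub>M b\<in>(Basis::'a set). lborel) \<rightarrow>\<^sub>M borel"
    by measurable
  have meas: "(\<lambda>x::'a. complex_of_real (gauss u x) * cis (xi \<bullet> x)) \<in> borel_measurable borel"
    unfolding cis_conv_exp by measurable
  have i: "integrable lborel (?f b)" for b :: 'a by (rule char_normal_density(1)[OF assms])
  have "integrable (\<Pi>\<^sub>M b\<in>(Basis::'a set). lborel) (\<lambda>f. \<Prod>b\<in>Basis. ?f b (f b))"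
    by (rule product_integrable_prod) (use i in auto)
  then show "integrable lborel (\<lambda>x::'a. complex_of_real (gauss u x) * cis (xi \<bullet> x))"
    by (subst lborel_eq, subst integrable_distr_eq[OF m meas]) (simp add: eq * cong: prod.cong)
  have "(LINT x|lborel. complex_of_real (gauss u x) * cis (xi \<bullet> x))
      = integral\<^sup>L (\<Pi>\<^sub>M b\<in>(Basis::'a set). lborel) (\<lambda>f. \<Prod>b\<in>Basis. ?f b (f b))"
    by (subst lborel_eq, subst integral_distr[OF m meas]) (simp add: eq * cong: prod.cong)
  also have "\<dots> = (\<Prod>b\<in>(Basis::'a set). complex_of_real (exp (- u * (xi \<bullet> b)\<^sup>2)))"
    by (subst product_integral_prod) (use i char_normal_density(2)[OF assms] in auto)
  also have "\<dots> = exp (- u * (norm xi)\<^sup>2)"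
    by (simp add: of_real_prod[symmetric] exp_sum[symmetric] norm_eq_sqrt_inner sum_nonneg sum_negf
        euclidean_inner[of xi xi] power2_eq_square sum_distrib_left[symmetric] mult.assoc
        del: of_real_prod)
  finally show "(LINT x|lborel. complex_of_real (gauss u x) * cis (xi \<bullet> x)) = exp (- u * (norm xi)\<^sup>2)" .
qed

lemma integrable_gauss: "u > 0 \<Longrightarrow> integrable lborel (gauss u :: 'a::euclidean_space \<Rightarrow> real)"
  using integrable_gauss_cis[of u "0::'a"] by (simp add: complex_of_real_integrable_eq)

lemma integral_gauss: "u > 0 \<Longrightarrow> (LINT x|lborel. gauss u (x::'a::euclidean_space)) = 1"
  using char_gauss[of u "0::'a"] by (simp add: integral_complex_of_real)

section \<open>Affine substitutions and Gaussian rescaling\<close>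

lemma nn_integral_lborel_affine:
  fixes f :: "'a::euclidean_space \<Rightarrow> ennreal"
  assumes [measurable]: "f \<in> borel_measurable borel" and c: "c > 0"
  shows "(\<integral>\<^sup>+x. f x \<partial>lborel) = ennreal (c ^ DIM('a)) * (\<integral>\<^sup>+x. f (t + c *\<^sub>R x) \<partial>lborel)"
  using c by (subst lborel_affine[of c t]) (simp_all add: nn_integral_density nn_integral_distr nn_integral_cmult ennreal_mult'')

lemma integral_lborel_affine:
  fixes f :: "'a::euclidean_space \<Rightarrow> 'b::{banach, second_countable_topology}"
  assumes [measurable]: "f \<in> borel_measurable borel" and c: "c > 0"
  shows "(LINT x|lborel. f x) = c ^ DIM('a) *\<^sub>R (LINT x|lborel. f (t + c *\<^sub>R x))"
  using c by (subst lborel_affine[of c t]) (simp_all add: integral_density integral_distr)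

lemma integrable_lborel_affine_iff:
  fixes f :: "'a::euclidean_space \<Rightarrow> 'b::{banach, second_countable_topology}"
  assumes [measurable]: "f \<in> borel_measurable borel" and c: "c > 0"
  shows "integrable lborel (\<lambda>x. f (t + c *\<^sub>R x)) \<longleftrightarrow> integrable lborel f"
proof -
  have "integrable lborel f \<longleftrightarrow> integrable lborel (\<lambda>x. c ^ DIM('a) *\<^sub>R f (t + c *\<^sub>R x))"
    using c by (subst lborel_affine[of c t]) (simp_all add: integrable_density integrable_distr_eq)
  also have "\<dots> \<longleftrightarrow> integrable lborel (\<lambda>x. f (t + c *\<^sub>R x))"
  proof
    assume "integrable lborel (\<lambda>x. c ^ DIM('a) *\<^sub>R f (t + c *\<^sub>R x))"
    from integrable_scaleR_right[OF this, of "1 / c ^ DIM('a)"] c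
    show "integrable lborel (\<lambda>x. f (t + c *\<^sub>R x))" by simp
  qed simp
  finally show ?thesis by simp
qed

lemma gauss_scale:
  fixes x :: "'a::euclidean_space"
  assumes "c > 0" "u > 0"
  shows "gauss (c\<^sup>2 * u) (c *\<^sub>R x) = gauss u x / c ^ DIM('a)"
proof -
  have "(4 * pi * (c\<^sup>2 * u)) powr (- real DIM('a) / 2) = (4 * pi * u) powr (- real DIM('a) / 2) * (c\<^sup>2) powr (- real DIM('a) / 2)"
    using assms by (simp add: powr_mult[symmetric] mult_ac)
  also have "(c\<^sup>2) powr (- real DIM('a) / 2) = 1 / c ^ DIM('a)"
    using assms by (simp add: powr_powr powr_minus_divide powr_realpow flip: powr_numeral)
  finally show ?thesis using assms by (simp add: gauss_def power_mult_distrib)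
qed

lemma integral_gauss_translate:
  fixes f :: "'a::euclidean_space \<Rightarrow> real"
  assumes [measurable]: "f \<in> borel_measurable borel" and c: "c > 0"
  shows "(LINT z|lborel. f z * gauss (c\<^sup>2) (z - y)) = (LINT v|lborel. f (y + c *\<^sub>R v) * gauss 1 v)"
proof -
  have "(LINT z|lborel. f z * gauss (c\<^sup>2) (z - y)) =
    c ^ DIM('a) *\<^sub>R (LINT v|lborel. f (y + c *\<^sub>R v) * gauss (c\<^sup>2) (y + c *\<^sub>R v - y))"
    by (rule integral_lborel_affine) (use c in auto)
  then show ?thesis using c gauss_scale[of c 1, where 'a='a] by simp
qed

lemma integrable_gauss_translate:
  fixes y :: "'a::euclidean_space"
  assumes "u > 0"
  shows "integrable lborel (\<lambda>z. gauss u (z - y))"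
  using integrable_lborel_affine_iff[of "gauss u" 1 "- y"] integrable_gauss[OF assms, where 'a='a]
  by simp

section \<open>Uniqueness of finite measures with given characteristic function\<close>

text \<open>A Gaussian is a Fourier integral of a Gaussian with reciprocal parameter
  \<open>1 / (4 * u)\<close>. After exchanging the integrals, the smoothed measure depends on
  \<open>M\<close> only through its characteristic function.\<close>

lemma gauss_smoothing_char:
  fixes M :: "'a::euclidean_space measure"
  assumes "finite_measure M" and sets[measurable_cong]: "sets M = sets borel" and u: "u > 0"
  shows "complex_of_real (LINT y|M. gauss u (z - y)) =
     of_real ((4 * pi * u) powr (- real DIM('a) / 2)) *
       (LINT xi|lborel. of_real (gauss (1 / (4 * u)) xi) * cis (z \<bullet> xi) * (LINT y|M. cis ((- xi) \<bullet> y)))"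
proof -
  interpret M: finite_measure M by fact
  interpret P: pair_sigma_finite M "lborel :: 'a measure" ..
  let ?r = "1 / (4 * u)"
  have r: "?r > 0" using u by simp
  let ?F = "\<lambda>y xi. complex_of_real (gauss ?r xi) * cis ((z - y) \<bullet> xi)"
  have sp: "space M = UNIV" using sets[THEN sets_eq_imp_space_eq] by simp
  have [measurable]: "(\<lambda>(y, xi). ?F y xi) \<in> borel_measurable (M \<Otimes>\<^sub>M lborel)"
    unfolding cis_conv_exp by measurable
  have int: "integrable (M \<Otimes>\<^sub>M lborel) (\<lambda>(y, xi). ?F y xi)"
  proof (rule P.Fubini_integrable)
    show "integrable M (\<lambda>x. LINT y|lborel. cmod (case (x, y) of (y, xi) \<Rightarrow> ?F y xi))"
      using integral_gauss[OF r, where 'a='a] by (simp add: norm_mult)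
    show "AE x in M. integrable lborel (\<lambda>y. case (x, y) of (y, xi) \<Rightarrow> ?F y xi)"
      using integrable_gauss_cis[OF r] by (intro AE_I2) auto
  qed measurable
  have "gauss u (z - y) = (4 * pi * u) powr (- real DIM('a) / 2) * exp (- ?r * (norm (z - y))\<^sup>2)" for y
    using u by (simp add: gauss_def)
  then have g: "complex_of_real (gauss u (z - y)) = of_real ((4 * pi * u) powr (- real DIM('a) / 2)) * (LINT xi|lborel. ?F y xi)" for y
    using char_gauss[OF r, of "z - y"] by simp
  have "complex_of_real (LINT y|M. gauss u (z - y)) = (LINT y|M. complex_of_real (gauss u (z - y)))" by simp
  also have "\<dots> = of_real ((4 * pi * u) powr (- real DIM('a) / 2)) * (LINT y|M. LINT xi|lborel. ?F y xi)"
    unfolding g by simp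
  also have "(LINT y|M. LINT xi|lborel. ?F y xi) = (LINT xi|lborel. LINT y|M. ?F y xi)"
    using P.Fubini_integral[OF int] by simp
  also have "\<dots> = (LINT xi|lborel. of_real (gauss ?r xi) * cis (z \<bullet> xi) * (LINT y|M. cis ((- xi) \<bullet> y)))"
  proof (rule Bochner_Integration.integral_cong[OF refl])
    fix xi
    have "?F y xi = of_real (gauss ?r xi) * cis (z \<bullet> xi) * cis ((- xi) \<bullet> y)" for y
      by (simp add: cis_mult inner_diff_left inner_commute[of xi] mult.assoc)
    then show "(LINT y|M. ?F y xi) = of_real (gauss ?r xi) * cis (z \<bullet> xi) * (LINT y|M. cis ((- xi) \<bullet> y))"
      by (simp only: integral_mult_right_zero)
  qed
  finally show ?thesis .
qed

text \<open>Fubini moves the smoothing onto the test function. What remains are the averages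
  \<open>J n y\<close> of \<open>f\<close> over Gaussians of width \<open>1 / Suc n\<close> around
  \<open>y\<close>, which converge boundedly to \<open>f y\<close>.\<close>

lemma gauss_smoothing_tendsto:
  fixes M :: "'a::euclidean_space measure" and f :: "'a \<Rightarrow> real"
  assumes "finite_measure M" and sets[measurable_cong]: "sets M = sets borel"
    and f: "continuous_on UNIV f" "\<And>x. 0 \<le> f x" "\<And>x. f x \<le> 1"
  shows "(\<lambda>n. LINT z|lborel. f z * (LINT y|M. gauss ((1 / Suc n)\<^sup>2) (z - y))) \<longlonglongrightarrow> (LINT y|M. f y)"
proof -
  interpret M: finite_measure M by fact
  interpret P: pair_sigma_finite "lborel :: 'a measure" M ..
  have sp: "space M = UNIV" using sets[THEN sets_eq_imp_space_eq] by simp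
  have [measurable]: "f \<in> borel_measurable borel" using f(1) by (rule borel_measurable_continuous_onI)
  define J where "J n y = (LINT v|lborel. f (y + (1 / real (Suc n)) *\<^sub>R v) * gauss 1 v)" for n :: nat and y
  have g1: "integrable lborel (gauss 1 :: 'a \<Rightarrow> real)" by (rule integrable_gauss) simp
  have fb: "norm (f x * gauss u w) \<le> norm (gauss u w)" for x u and w :: 'a
    using f(2,3)[of x] by (simp add: abs_mult mult_left_le_one_le)
  have [measurable]: "J n \<in> borel_measurable borel" for n unfolding J_def by measurable
  have J01: "norm (J n y) \<le> 1" for n y
  proof -
    have "norm (J n y) \<le> (LINT v|lborel. gauss 1 (v::'a))" unfolding J_def
      by (rule Bochner_Integration.integral_norm_bound_integral) (use fb f(2) g1 in \<open>auto intro!: Bochner_Integration.integrable_bound[OF g1]\<close>)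
    then show ?thesis by (simp add: integral_gauss)
  qed
  have lim: "(\<lambda>n. J n y) \<longlonglongrightarrow> f y" for y
  proof -
    have "(\<lambda>n. J n y) \<longlonglongrightarrow> (LINT v|lborel. f y * gauss 1 (v::'a))" unfolding J_def
    proof (rule integral_dominated_convergence[where w="gauss 1"])
      show "AE x in lborel. (\<lambda>n. f (y + (1 / real (Suc n)) *\<^sub>R x) * gauss 1 x) \<longlonglongrightarrow> f y * gauss 1 x"
      proof (intro AE_I2 tendsto_mult tendsto_const)
        fix x
        have "(\<lambda>n. y + (1 / real (Suc n)) *\<^sub>R x) \<longlonglongrightarrow> y + 0 *\<^sub>R x"
          using LIMSEQ_inverse_real_of_nat by (intro tendsto_intros) (simp add: inverse_eq_divide)
        moreover have "isCont f y" using f(1) by (simp add: continuous_on_eq_continuous_at)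
        ultimately show "(\<lambda>n. f (y + (1 / real (Suc n)) *\<^sub>R x)) \<longlonglongrightarrow> f y"
          by (intro isCont_tendsto_compose[of y f]) auto
      qed
    qed (use g1 fb in auto)
    then show ?thesis by (simp add: integral_gauss)
  qed
  have "(LINT z|lborel. f z * (LINT y|M. gauss ((1 / Suc n)\<^sup>2) (z - y))) = (LINT y|M. J n y)" for n
  proof -
    define u :: real where "u = (1 / Suc n)\<^sup>2"
    have u: "u > 0" by (simp add: u_def)
    have m[measurable]: "(\<lambda>(z, y). f z * gauss u (z - y)) \<in> borel_measurable (lborel \<Otimes>\<^sub>M M)" by measurable
    have int: "integrable (lborel \<Otimes>\<^sub>M M) (\<lambda>(z, y). f z * gauss u (z - y))"
    proof -
      interpret Q: pair_sigma_finite M "lborel :: 'a measure" ..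
      have i: "integrable lborel (\<lambda>z. f z * gauss u (z - y))" for y
        by (rule Bochner_Integration.integrable_bound[OF integrable_gauss_translate[OF u, of y]]) (use fb in auto)
      have eq: "(LINT z|lborel. norm (f z * gauss u (z - y))) = J n y" for y
        using integral_gauss_translate[of f "1 / Suc n" y] f(2) by (simp add: J_def u_def abs_mult)
      have "integrable (M \<Otimes>\<^sub>M lborel) (\<lambda>(y, z). f z * gauss u (z - y))"
      proof (rule Q.Fubini_integrable)
        show "integrable M (\<lambda>x. LINT y|lborel. norm (case (x, y) of (y, z) \<Rightarrow> f z * gauss u (z - y)))"
          using J01 by (simp only: prod.case eq) (intro M.integrable_const_bound[where B=1], auto)
      qed (use i in auto)
      then show ?thesis using Q.integrable_product_swap_iff[of "\<lambda>(y, z). f z * gauss u (z - y)"]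
        by (simp add: case_prod_beta')
    qed
    have "(LINT z|lborel. f z * (LINT y|M. gauss u (z - y))) = (LINT z|lborel. (LINT y|M. f z * gauss u (z - y)))" by simp
    also have "\<dots> = (LINT y|M. (LINT z|lborel. f z * gauss u (z - y)))"
      using P.Fubini_integral[OF int] by simp
    also have "\<dots> = (LINT y|M. J n y)"
      using integral_gauss_translate[of f "1 / Suc n"] by (simp add: J_def u_def)
    finally show ?thesis unfolding u_def .
  qed
  moreover have "(\<lambda>n. LINT y|M. J n y) \<longlonglongrightarrow> (LINT y|M. f y)"
    by (rule integral_dominated_convergence[where w="\<lambda>_. 1"]) (use lim J01 in auto)
  ultimately show ?thesis by simp
qed

lemma finite_measure_eqI_char:
  fixes M N :: "'a::euclidean_space measure"
  assumes fin: "finite_measure M" "finite_measure N"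
    and sets: "sets M = sets borel" "sets N = sets borel"
    and char: "\<And>xi. (LINT y|M. cis (xi \<bullet> y)) = (LINT y|N. cis (xi \<bullet> y))"
  shows "M = N"
proof (rule finite_measure_eqI_continuous[OF fin sets])
  fix f :: "'a \<Rightarrow> real" assume f: "continuous_on UNIV f" "\<And>x. 0 \<le> f x" "\<And>x. f x \<le> 1"
  have eq: "(LINT y|M. gauss u (z - y)) = (LINT y|N. gauss u (z - y))" if "u > 0" for u z
    using gauss_smoothing_char[OF fin(1) sets(1) that, of z] gauss_smoothing_char[OF fin(2) sets(2) that, of z]
    unfolding char by (metis of_real_eq_iff)
  show "(LINT x|M. f x) = (LINT x|N. f x)"
    using gauss_smoothing_tendsto[OF fin(1) sets(1) f] gauss_smoothing_tendsto[OF fin(2) sets(2) f]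
    by (simp add: eq LIMSEQ_unique)
qed

section \<open>The one-sided stable law\<close>

lemma nn_integral_powr_from_0:
  fixes s R :: real
  assumes "s > 0" "R \<ge> 0"
  shows "(\<integral>\<^sup>+v. ennreal (indicator {0..R} v * v powr (s - 1)) \<partial>lborel) = ennreal (R powr s / s)"
proof -
  have "((\<lambda>v. v powr (s - 1)) has_integral (R powr s / s)) {0..R}"
    using has_integral_powr_from_0[of "s - 1" R] assms by simp
  then have "((\<lambda>v. indicator {0..R} v * v powr (s - 1)) has_integral (R powr s / s)) UNIV"
    by (subst (asm) has_integral_restrict_UNIV[symmetric], elim has_integral_eq[rotated]) (auto simp: indicator_def)
  then show ?thesis by (intro nn_integral_has_integral_lborel) auto
qed

lemma nn_integral_powr_to_inf:
  fixes s R :: real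
  assumes "s > 0" "R > 0"
  shows "(\<integral>\<^sup>+v. ennreal (indicator {R..} v * v powr (- s - 1)) \<partial>lborel) = ennreal (R powr (- s) / s)"
proof -
  have "((\<lambda>v. v powr (- s - 1)) has_integral (R powr (- s) / s)) {R..}"
    using has_integral_powr_to_inf[of "- s - 1" R] assms by simp
  then have "((\<lambda>v. indicator {R..} v * v powr (- s - 1)) has_integral (R powr (- s) / s)) UNIV"
    by (subst (asm) has_integral_restrict_UNIV[symmetric], elim has_integral_eq[rotated]) (auto simp: indicator_def)
  then show ?thesis by (intro nn_integral_has_integral_lborel) auto
qed

lemma one_minus_exp_ge:
  fixes v :: real
  assumes "0 \<le> v" "v \<le> 1"
  shows "(1 - exp (- 1)) * v \<le> 1 - exp (- v)"
proof -
  have "convex_on UNIV (exp :: real \<Rightarrow> real)" by (rule exp_convex)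
  from convex_onD[OF this, of v 0 "-1"] assms
  show ?thesis by (simp add: algebra_simps)
qed

section \<open>The one-sided stable law as a limit of normalised Pareto sums\<close>

locale pareto =
  fixes a :: real
  assumes a: "0 < a" "a < 1"
begin

text \<open>Pareto law with tail \<open>u powr (- a)\<close> beyond 1, a simple law in the domain of
  attraction of the one-sided \<open>a\<close>-stable law.\<close>

definition rho :: "real measure" where
  "rho = density lborel (\<lambda>u. ennreal (a * (indicator {1..} u * u powr (- a - 1))))"

text \<open>Integrand of the Levy-Khintchine exponent of the stable law. \<open>K\<close> is its
  full integral, \<open>T l\<close> the part above the cut-off \<open>l\<close> that comes from the
  Pareto law starting at 1.\<close>

definition G :: "real \<Rightarrow> real" where
  "G v = indicator {0<..} v * ((1 - exp (- v)) * (a * v powr (- a - 1)))"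

definition T :: "real \<Rightarrow> real" where "T l = (LINT v|lborel. indicator {l..} v * G v)"

definition K :: real where "K = (LINT v|lborel. G v)"

lemma G_nonneg [simp]: "0 \<le> G v" using a by (auto simp: G_def indicator_def)

lemma G_meas [measurable]: "G \<in> borel_measurable borel" unfolding G_def[abs_def] by measurable

lemma sets_rho [measurable_cong, simp]: "sets rho = sets borel" by (simp add: rho_def)

lemma space_rho [simp]: "space rho = UNIV" by (simp add: rho_def)

lemma prob_rho: "prob_space rho"
proof
  have "emeasure rho UNIV = (\<integral>\<^sup>+u. ennreal a * ennreal (indicator {1..} u * u powr (- a - 1)) \<partial>lborel)"
    unfolding rho_def using a by (subst emeasure_density) (auto simp: ennreal_mult)
  also have "\<dots> = 1"
    using a nn_integral_powr_to_inf[of a 1] by (subst nn_integral_cmult) (auto simp flip: ennreal_mult)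
  finally show "emeasure rho (space rho) = 1" by simp
qed

lemma integrable_G: "integrable lborel G"
proof (rule integrableI_nonneg)
  have "(\<integral>\<^sup>+v. ennreal (G v) \<partial>lborel) \<le>
    (\<integral>\<^sup>+v. ennreal (indicator {0..1} v * v powr ((1 - a) - 1)) + ennreal (indicator {1..} v * v powr (- a - 1)) \<partial>lborel)"
  proof (rule nn_integral_mono)
    fix v :: real
    show "ennreal (G v) \<le> ennreal (indicator {0..1} v * v powr ((1 - a) - 1)) + ennreal (indicator {1..} v * v powr (- a - 1))"
    proof (cases "v > 0")
      case True
      have "1 - exp (- v) \<le> v" using exp_ge_add_one_self[of "- v"] by simp
      then have "(1 - exp (- v)) * (a * v powr (- a - 1)) \<le> v * (1 * v powr (- a - 1))"
        using a True by (intro mult_mono) auto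
      also have "\<dots> = v powr (- a)" using True by (simp add: powr_diff powr_minus)
      finally have 1: "G v \<le> v powr (- a)" using True by (simp add: G_def)
      have "(1 - exp (- v)) * (a * v powr (- a - 1)) \<le> 1 * (1 * v powr (- a - 1))"
        using a True by (intro mult_mono) auto
      then have 2: "G v \<le> v powr (- a - 1)" using True by (simp add: G_def)
      show ?thesis
      proof (cases "v \<le> 1")
        case le: True
        then have "ennreal (G v) \<le> ennreal (indicator {0..1} v * v powr ((1 - a) - 1))" using True 1 by (intro ennreal_leI) simp
        then show ?thesis by (rule add_increasing2[rotated]) simp
      next
        case False
        then have "ennreal (G v) \<le> ennreal (indicator {1..} v * v powr (- a - 1))" using 2 by (intro ennreal_leI) simp
        then show ?thesis by (rule add_increasing[rotated]) simp
      qed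
    qed (auto simp: G_def)
  qed
  also have "\<dots> < \<infinity>"
    using a nn_integral_powr_from_0[of "1 - a" 1] nn_integral_powr_to_inf[of a 1]
    by (subst nn_integral_add) auto
  finally show "(\<integral>\<^sup>+v. ennreal (G v) \<partial>lborel) < \<infinity>" .
qed auto

lemma integrable_ind_G: "integrable lborel (\<lambda>v. indicator {l..} v * G v)"
  by (rule Bochner_Integration.integrable_bound[OF integrable_G]) (auto simp: indicator_def)

lemma T_le: "T l \<le> K"
  unfolding T_def K_def by (rule integral_mono[OF integrable_ind_G integrable_G]) (auto simp: indicator_def)

lemma T_tendsto:
  assumes "X \<longlonglongrightarrow> 0" "\<And>n. X n > 0"
  shows "(\<lambda>n. T (X n)) \<longlonglongrightarrow> K"
  unfolding T_def K_def
proof (rule integral_dominated_convergence[OF _ _ integrable_G])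
  show "AE v in lborel. (\<lambda>n. indicator {X n..} v * G v) \<longlonglongrightarrow> G v"
  proof (intro AE_I2)
    fix v :: real
    show "(\<lambda>n. indicator {X n..} v * G v) \<longlonglongrightarrow> G v"
    proof (cases "v > 0")
      case True
      have "eventually (\<lambda>n. X n < v) sequentially" using assms(1) True by (rule order_tendstoD)
      then have "eventually (\<lambda>n. indicator {X n..} v * G v = G v) sequentially"
        by eventually_elim (auto simp: indicator_def)
      then show ?thesis by (rule tendsto_eventually)
    qed (simp add: G_def)
  qed
qed (auto simp: indicator_def)

definition phi :: "real \<Rightarrow> real" where "phi l = (LINT u|rho. exp (- (l * u)))"

lemma integrable_exp_rho: "l > 0 \<Longrightarrow> integrable rho (\<lambda>u. exp (- (l * u)))"
proof -
  assume l: "l > 0"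
  interpret prob_space rho by (rule prob_rho)
  have "AE u in rho. 1 \<le> u" unfolding rho_def
    by (subst AE_density) (auto simp: indicator_def intro!: AE_I2)
  then show ?thesis using l
    by (intro integrable_const_bound[where B=1]) (auto elim: AE_mp)
qed

lemma AE_rho: "AE u in rho. 1 \<le> u" unfolding rho_def
  by (subst AE_density) (auto simp: indicator_def intro!: AE_I2)

text \<open>The substitution \<open>u -> u / l\<close> puts the Laplace defect of the Pareto law
  into exact scaling form; the cut-off at 1 moves to \<open>l\<close>.\<close>

lemma one_minus_phi:
  assumes l: "l > 0"
  shows "1 - phi l = l powr a * T l"
proof -
  interpret prob_space rho by (rule prob_rho)
  have "1 - phi l = (LINT u|rho. 1 - exp (- (l * u)))"
    using integrable_exp_rho[OF l] prob_space unfolding phi_def by (subst Bochner_Integration.integral_diff) auto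
  also have "\<dots> = (LINT u|lborel. (a * (indicator {1..} u * u powr (- a - 1))) * (1 - exp (- (l * u))))"
    unfolding rho_def using a by (subst integral_density) (auto simp: indicator_def)
  also have "\<dots> = (1 / l) * (LINT u|lborel. (a * (indicator {1..} (u / l) * (u / l) powr (- a - 1))) * (1 - exp (- u)))"
    using lborel_integral_real_affine[of "1 / l" "\<lambda>u. (a * (indicator {1..} u * u powr (- a - 1))) * (1 - exp (- (l * u)))" 0] l
    by simp
  also have "\<dots> = (LINT u|lborel. (1 / l) * ((a * (indicator {1..} (u / l) * (u / l) powr (- a - 1))) * (1 - exp (- u))))"
    by simp
  also have "\<dots> = (LINT u|lborel. l powr a * (indicator {l..} u * G u))"
  proof (rule Bochner_Integration.integral_cong[OF refl])
    fix u :: real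
    have "(1 / l) * (u / l) powr (- a - 1) = l powr a * u powr (- a - 1)" if "u > 0"
      using that l by (simp add: powr_divide powr_diff powr_minus field_simps)
    then show "(1 / l) * ((a * (indicator {1..} (u / l) * (u / l) powr (- a - 1))) * (1 - exp (- u))) = l powr a * (indicator {l..} u * G u)"
      using l by (cases "u \<ge> l") (auto simp: G_def indicator_def field_simps)
  qed
  finally show ?thesis by (simp add: T_def)
qed

lemma phi_01: "l > 0 \<Longrightarrow> 0 \<le> phi l \<and> phi l \<le> 1"
proof -
  assume l: "l > 0"
  interpret prob_space rho by (rule prob_rho)
  have "T l \<ge> 0" unfolding T_def by (rule integral_nonneg_AE) auto
  then have "phi l \<le> 1" using one_minus_phi[OF l] l by (metis diff_ge_0_iff_ge mult_nonneg_nonneg powr_ge_zero)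
  moreover have "0 \<le> phi l" unfolding phi_def by (rule integral_nonneg_AE) auto
  ultimately show ?thesis by simp
qed

lemma K_pos: "K > 0"
proof -
  interpret prob_space rho by (rule prob_rho)
  have "phi 1 \<le> (LINT u|rho. exp (- 1))" unfolding phi_def
    by (rule integral_mono_AE) (use integrable_exp_rho[of 1] AE_rho in auto)
  also have "\<dots> = exp (- 1)" using prob_space by simp
  also have "\<dots> < 1" by simp
  finally show ?thesis using one_minus_phi[of 1] T_le[of 1] by simp
qed

text \<open>Solves \<open>Suc n * K * c n powr a = 1\<close>, which makes the limiting Laplace
  exponent exactly \<open>l powr a\<close>.\<close>

definition c :: "nat \<Rightarrow> real" where "c n = (real (Suc n) * K) powr (- 1 / a)"

definition mu :: "nat \<Rightarrow> real measure" where
  "mu n = distr (\<Pi>\<^sub>M i\<in>{..<Suc n}. rho) borel (\<lambda>w. c n * (\<Sum>i<Suc n. w i))"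

lemma c_pos: "c n > 0" using K_pos by (simp add: c_def)

lemma c_powr: "c n powr a = 1 / (real (Suc n) * K)"
  unfolding c_def powr_powr using a K_pos by (simp add: powr_minus_divide)

lemma real_distribution_mu: "real_distribution (mu n)"
proof -
  interpret prob_space rho by (rule prob_rho)
  interpret P: product_prob_space "\<lambda>_. rho" "{..<Suc n}" ..
  show ?thesis unfolding mu_def by (rule P.real_distribution_distr) measurable
qed

lemma mu_nonneg: "AE u in mu n. 0 \<le> u"
proof -
  interpret prob_space rho by (rule prob_rho)
  interpret P: finite_product_prob_space "\<lambda>_. rho" "{..<Suc n}" by standard simp
  have "AE w in (\<Pi>\<^sub>M i\<in>{..<Suc n}. rho). 1 \<le> w i" if "i < Suc n" for i
    by (rule AE_PiM_component) (use that AE_rho prob_rho in auto)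
  then have "AE w in (\<Pi>\<^sub>M i\<in>{..<Suc n}. rho). \<forall>i\<in>{..<Suc n}. 1 \<le> w i"
    by (intro AE_finite_allI) auto
  then have "AE w in (\<Pi>\<^sub>M i\<in>{..<Suc n}. rho). 0 \<le> c n * (\<Sum>i<Suc n. w i)"
  proof eventually_elim
    case (elim w)
    have "0 \<le> w i" if "i < Suc n" for i using elim[rule_format, of i] that by simp
    then show ?case using c_pos[of n] by (intro mult_nonneg_nonneg sum_nonneg) auto
  qed
  then show ?thesis unfolding mu_def by (subst AE_distr_iff) auto
qed

lemma laplace_mu:
  assumes l: "l > 0"
  shows "(LINT u|mu n. exp (- (l * u))) = phi (l * c n) ^ Suc n"
proof -
  interpret prob_space rho by (rule prob_rho)
  interpret product_sigma_finite "\<lambda>_::nat. rho" ..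
  have "(LINT u|mu n. exp (- (l * u))) = integral\<^sup>L (\<Pi>\<^sub>M i\<in>{..<Suc n}. rho) (\<lambda>w. exp (- (l * (c n * (\<Sum>i<Suc n. w i)))))"
    unfolding mu_def by (subst integral_distr) auto
  also have "\<dots> = integral\<^sup>L (\<Pi>\<^sub>M i\<in>{..<Suc n}. rho) (\<lambda>w. \<Prod>i<Suc n. exp (- (l * c n * w i)))"
    by (simp add: exp_sum[symmetric] sum_negf sum_distrib_left mult.assoc del: sum.lessThan_Suc prod.lessThan_Suc)
  also have "\<dots> = (\<Prod>i<Suc n. phi (l * c n))" unfolding phi_def
    by (subst product_integral_prod) (use integrable_exp_rho[of "l * c n"] l c_pos[of n] in auto)
  finally show ?thesis by simp
qed

text \<open>Bernoulli's inequality bounds the defect of the \<open>Suc n\<close>-th power by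
  \<open>Suc n\<close> single defects, and \<open>T l \<le> K\<close> makes the result uniform in
  \<open>n\<close>. Tightness rests on this uniformity.\<close>

lemma one_minus_laplace_mu_le:
  assumes l: "l > 0"
  shows "1 - (LINT u|mu n. exp (- (l * u))) \<le> l powr a"
proof -
  let ?y = "1 - phi (l * c n)"
  have lc: "l * c n > 0" using l c_pos[of n] by simp
  have "1 + real (Suc n) * (- ?y) \<le> (1 + - ?y) ^ Suc n"
    by (rule Bernoulli_inequality) (use phi_01[OF lc] in auto)
  then have "1 - phi (l * c n) ^ Suc n \<le> real (Suc n) * ?y" by (simp add: algebra_simps)
  also have "\<dots> = real (Suc n) * ((l powr a * c n powr a) * T (l * c n))"
    using one_minus_phi[OF lc] l c_pos[of n] by (simp add: powr_mult)
  also have "\<dots> \<le> real (Suc n) * ((l powr a * c n powr a) * K)"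
    by (intro mult_left_mono T_le) auto
  also have "\<dots> = l powr a" using K_pos by (simp add: c_powr del: of_nat_Suc)
  finally show ?thesis using laplace_mu[OF l] by simp
qed

lemma laplace_mu_tendsto:
  assumes l: "l > 0"
  shows "(\<lambda>n. LINT u|mu n. exp (- (l * u))) \<longlonglongrightarrow> exp (- (l powr a))"
proof -
  let ?L = "l powr a"
  let ?z = "\<lambda>n. phi (l * c n)"
  have lc: "l * c n > 0" for n using l c_pos[of n] by simp
  have c0: "(\<lambda>n. l * c n) \<longlonglongrightarrow> 0"
  proof -
    have "filterlim (\<lambda>n. real (Suc n) * K) at_top sequentially"
      using K_pos by real_asymp
    then have "(\<lambda>n. (real (Suc n) * K) powr (- 1 / a)) \<longlonglongrightarrow> 0"
      by (rule tendsto_neg_powr[rotated]) (use a in simp)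
    then show ?thesis unfolding c_def using tendsto_mult_right_zero by blast
  qed
  have y: "(\<lambda>n. real (Suc n) * (1 - ?z n)) \<longlonglongrightarrow> ?L"
  proof -
    have "real (Suc n) * (1 - ?z n) = (?L / K) * T (l * c n)" for n
      unfolding one_minus_phi[OF lc[of n]] using l c_pos[of n] K_pos by (simp add: powr_mult c_powr del: of_nat_Suc)
    moreover have "(\<lambda>n. (?L / K) * T (l * c n)) \<longlonglongrightarrow> (?L / K) * K"
      using T_tendsto[OF c0 lc] by (intro tendsto_intros)
    ultimately show ?thesis using K_pos by simp
  qed
  have e: "(\<lambda>n. (1 + (- ?L) / real (Suc n)) ^ Suc n) \<longlonglongrightarrow> exp (- ?L)"
    using tendsto_exp_limit_sequentially[of "- ?L"] by (rule LIMSEQ_Suc)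
  \<comment> \<open>Numbers of modulus at most 1 satisfy
    \<open>|a^n - b^n| \<le> n * |a - b|\<close>, so the powers can be compared with those in the
    exponential limit.\<close>
  have "(\<lambda>n. ?z n ^ Suc n - (1 + (- ?L) / real (Suc n)) ^ Suc n) \<longlonglongrightarrow> 0"
  proof (rule Lim_null_comparison)
    obtain N :: nat where N: "?L \<le> real N" using real_arch_simple by blast
    show "\<forall>\<^sub>F n in sequentially. norm (?z n ^ Suc n - (1 + (- ?L) / real (Suc n)) ^ Suc n) \<le> \<bar>real (Suc n) * (1 - ?z n) - ?L\<bar>"
      using eventually_ge_at_top[of N]
    proof eventually_elim
      case (elim n)
      have L: "?L / real (Suc n) \<le> 1" using N elim by (simp add: field_simps)
      have "0 \<le> ?L / real (Suc n)" by simp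
      then have "norm (?z n ^ Suc n - (1 + (- ?L) / real (Suc n)) ^ Suc n) \<le> real (Suc n) * norm (?z n - (1 + (- ?L) / real (Suc n)))"
        using phi_01[OF lc[of n]] L by (intro norm_power_diff) (auto simp: abs_if)
      also have "\<dots> = \<bar>real (Suc n) * (?z n - (1 + (- ?L) / real (Suc n)))\<bar>" by (simp add: abs_mult)
      also have "real (Suc n) * (?z n - (1 + (- ?L) / real (Suc n))) = - (real (Suc n) * (1 - ?z n) - ?L)"
        by (simp add: field_simps)
      finally show ?case by simp
    qed
    show "(\<lambda>n. \<bar>real (Suc n) * (1 - ?z n) - ?L\<bar>) \<longlonglongrightarrow> 0"
      using y by (intro tendsto_rabs_zero) (simp add: LIM_zero_iff)
  qed
  from tendsto_add[OF this e] show ?thesis by (simp add: laplace_mu[OF l])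
qed

text \<open>On \<open>u > R\<close> the function \<open>1 - exp (- u / R)\<close> is at least
  \<open>1 - exp (- 1)\<close>, so a tail probability is controlled by the Laplace defect at
  \<open>1 / R\<close>.\<close>

lemma mu_tail:
  assumes "R > 0"
  shows "(1 - exp (- 1)) * measure (mu n) {R<..} \<le> R powr (- a)"
proof -
  interpret real_distribution "mu n" by (rule real_distribution_mu)
  have i: "integrable (mu n) (\<lambda>u. exp (- (1 / R * u)))"
    by (rule integrable_const_bound[where B=1]) (use mu_nonneg[of n] assms in \<open>auto elim!: eventually_mono\<close>)
  have ii: "integrable (mu n) (\<lambda>u. (1 - exp (- 1)) * indicator {R<..} u :: real)"
    by (rule integrable_const_bound[where B=1]) (auto simp: indicator_def)
  have "(1 - exp (- 1)) * measure (mu n) {R<..} = (LINT u|mu n. (1 - exp (- 1)) * indicator {R<..} u)"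
    by simp
  also have "\<dots> \<le> (LINT u|mu n. 1 - exp (- (1 / R * u)))"
  proof (rule integral_mono_AE[OF ii])
    show "AE u in mu n. (1 - exp (- 1)) * indicator {R<..} u \<le> 1 - exp (- (1 / R * u))"
      using mu_nonneg[of n] by eventually_elim (use assms in \<open>auto simp: indicator_def field_simps\<close>)
  qed (use i in auto)
  also have "\<dots> = 1 - (LINT u|mu n. exp (- (1 / R * u)))"
    using i prob_space by (subst Bochner_Integration.integral_diff) auto
  also have "\<dots> \<le> (1 / R) powr a" using one_minus_laplace_mu_le[of "1 / R" n] assms by simp
  also have "\<dots> = R powr (- a)" using assms by (simp add: powr_divide powr_minus_divide)
  finally show ?thesis .
qed

lemma tight_mu: "tight mu"
  unfolding tight_def
proof (intro conjI allI impI real_distribution_mu)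
  fix e :: real assume e: "e > 0"
  have k: "(1 - exp (- 1) :: real) > 0" by simp
  \<comment> \<open>Makes the tail bound \<open>R powr (- a) / (1 - exp (- 1))\<close> of
    \<open>mu_tail\<close> equal to \<open>e / 2\<close>.\<close>
  define R where "R = ((1 - exp (- 1)) * e / 2) powr (- 1 / a)"
  have R: "R > 0" using e k by (simp add: R_def)
  have Ra: "R powr (- a) = (1 - exp (- 1)) * e / 2" using e k a by (simp add: R_def powr_powr)
  have "1 - e < measure (mu n) {- 1<..R}" for n
  proof -
    interpret real_distribution "mu n" by (rule real_distribution_mu)
    have "(1 - exp (- 1)) * measure (mu n) {R<..} \<le> (1 - exp (- 1)) * (e / 2)" using mu_tail[OF R, of n] Ra by simp
    then have 1: "measure (mu n) {R<..} \<le> e / 2" using k by (simp only: mult_le_cancel_left_pos)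
    have "measure (mu n) {- 1<..R} + measure (mu n) {R<..} = measure (mu n) {- 1<..}"
      using R by (subst finite_measure_Union[symmetric]) (auto intro: arg_cong[where f="measure (mu n)"] simp: ivl_disj_un)
    moreover have "measure (mu n) {- 1<..} = 1"
      by (subst prob_eq_1) (use mu_nonneg[of n] in \<open>auto elim!: eventually_mono\<close>)
    ultimately show ?thesis using 1 e by simp
  qed
  then show "\<exists>x y. x < y \<and> (\<forall>n. 1 - e < measure (mu n) {x<..y})" using R by (intro exI[of _ "- 1"] exI[of _ R]) auto
qed

text \<open>Tightness yields a weak limit along a subsequence, and its Laplace transform is
  identified by \<open>laplace_mu_tendsto\<close>. Letting \<open>l\<close> tend to infinity in the
  transform excludes an atom at 0.\<close>

lemma stable_subordinator:
  "\<exists>N. real_distribution N \<and> (AE u in N. 0 < u) \<and> (\<forall>l>0. (LINT u|N. exp (- (l * u))) = exp (- (l powr a)))"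
proof -
  obtain r N where r: "strict_mono (r :: nat \<Rightarrow> nat)" and N: "real_distribution N" and w: "weak_conv_m (mu \<circ> id \<circ> r) N"
    using tight_imp_convergent_subsubsequence[OF tight_mu, of id] by (auto simp: strict_mono_def)
  interpret N: real_distribution N by fact
  have conv: "(\<lambda>n. LINT u|mu (r n). f u) \<longlonglongrightarrow> (LINT u|N. f u)" if "\<And>x. isCont f x" "\<And>x. norm (f x) \<le> B" for f :: "real \<Rightarrow> real" and B
    using weak_conv_imp_integral_bdd_continuous_conv[of "mu \<circ> id \<circ> r" N f B] real_distribution_mu N w that by (simp add: comp_def)
  have AE0: "AE u in N. 0 \<le> u"
  proof -
    \<comment> \<open>A bounded continuous function that is positive exactly on the negative
      half-line.\<close>
    let ?f = "\<lambda>u::real. min 1 (max 0 (- u))"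
    have "(LINT u|mu (r n). ?f u) = 0" for n
      by (rule integral_eq_zero_AE) (use mu_nonneg[of "r n"] in \<open>auto elim!: eventually_mono\<close>)
    then have "(LINT u|N. ?f u) = 0" using conv[of ?f 1] by (simp add: LIMSEQ_const_iff continuous_intros)
    moreover have "integrable N ?f" by (rule N.integrable_const_bound[where B=1]) auto
    ultimately have "AE u in N. ?f u = 0" by (subst (asm) integral_nonneg_eq_0_iff_AE) auto
    then show ?thesis by eventually_elim (auto simp: min_def max_def split: if_splits)
  qed
  have lap: "(LINT u|N. exp (- (l * u))) = exp (- (l powr a))" if l: "l > 0" for l
  proof -
    \<comment> \<open>\<open>exp (- (l * u))\<close> is unbounded for negative \<open>u\<close>.
      Truncating the argument gives a bounded continuous function that agrees with it almost
      everywhere.\<close>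
    let ?f = "\<lambda>u::real. exp (- (l * max 0 u))"
    have "(LINT u|mu (r n). ?f u) = (LINT u|mu (r n). exp (- (l * u)))" for n
    proof (rule integral_cong_AE)
      interpret real_distribution "mu (r n)" by (rule real_distribution_mu)
      show "?f \<in> borel_measurable (mu (r n))" "(\<lambda>u. exp (- (l * u))) \<in> borel_measurable (mu (r n))" by measurable
      show "AE u in mu (r n). ?f u = exp (- (l * u))" using mu_nonneg[of "r n"] by eventually_elim simp
    qed
    moreover have "(\<lambda>n. LINT u|mu (r n). ?f u) \<longlonglongrightarrow> (LINT u|N. ?f u)"
      by (rule conv[of _ 1]) (use l in \<open>auto intro!: continuous_intros\<close>)
    moreover have "(\<lambda>n. LINT u|mu (r n). exp (- (l * u))) \<longlonglongrightarrow> exp (- (l powr a))"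
      using LIMSEQ_subseq_LIMSEQ[OF laplace_mu_tendsto[OF l] r] by (simp add: comp_def)
    ultimately have "(LINT u|N. ?f u) = exp (- (l powr a))" by (simp add: LIMSEQ_unique)
    moreover have "(LINT u|N. ?f u) = (LINT u|N. exp (- (l * u)))"
    proof (rule integral_cong_AE)
      show "AE u in N. ?f u = exp (- (l * u))" using AE0 by eventually_elim simp
    qed measurable
    ultimately show ?thesis by simp
  qed
  have "measure N {0} = 0"
  proof -
    have le: "measure N {0} \<le> exp (- (l powr a))" if l: "l > 0" for l
    proof -
      have "measure N {0} = (LINT u|N. indicator {0} u)" by simp
      also have "\<dots> \<le> (LINT u|N. exp (- (l * u)))"
      proof (rule integral_mono_AE)
        show "integrable N (indicator {0} :: real \<Rightarrow> real)"
          by (rule N.integrable_const_bound[where B=1]) (auto simp: indicator_def)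
        show "integrable N (\<lambda>u. exp (- (l * u)))"
          by (rule N.integrable_const_bound[where B=1]) (use AE0 l in \<open>auto elim!: eventually_mono\<close>)
      qed (auto simp: indicator_def)
      finally show ?thesis using lap[OF l] by simp
    qed
    have "((\<lambda>l::real. exp (- (l powr a))) \<longlongrightarrow> 0) at_top"
      using a by real_asymp
    moreover have "\<forall>\<^sub>F l in at_top. measure N {0} \<le> exp (- (l powr a))"
      using eventually_gt_at_top[of 0] by eventually_elim (rule le)
    ultimately have "measure N {0} \<le> 0" by (rule tendsto_lowerbound) simp
    then show ?thesis using measure_nonneg[of N "{0}"] by linarith
  qed
  then have "AE u in N. u \<noteq> 0"
    by (intro AE_I[of _ _ "{0}"]) (auto simp: N.emeasure_eq_measure)
  with AE0 have "AE u in N. 0 < u" by eventually_elim auto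
  then show ?thesis using N lap by blast
qed

end

section \<open>The isotropic stable density\<close>

lemma exp_ge_powr:
  fixes y q :: real
  assumes "y > 0" "q > 0"
  shows "(y / q) powr q \<le> exp y"
proof -
  have "y / q \<le> exp (y / q)" using exp_ge_add_one_self[of "y / q"] by linarith
  then have "(y / q) powr q \<le> exp (y / q) powr q" using assms by (intro powr_mono2) auto
  also have "\<dots> = exp y" using assms by (simp add: powr_def)
  finally show ?thesis .
qed

lemma nn_integral_Gamma_scaled:
  fixes s u :: real
  assumes s: "s > 0" and u: "u > 0"
  shows "(\<integral>\<^sup>+l. ennreal (indicator {0..} l * (l powr (s - 1) * exp (- (u * l)))) \<partial>lborel) = ennreal (Gamma s * u powr (- s))"
proof -
  have "ennreal (Gamma s) = (\<integral>\<^sup>+t. ennreal (indicator {0..} t * t powr (s - 1) / exp t) \<partial>lborel)"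
    by (rule Gamma_conv_nn_integral_real[OF s])
  also have "\<dots> = ennreal u * (\<integral>\<^sup>+t. ennreal (indicator {0..} (u * t) * (u * t) powr (s - 1) / exp (u * t)) \<partial>lborel)"
    using u by (subst nn_integral_real_affine[where c=u and t=0]) auto
  also have "\<dots> = ennreal u * (\<integral>\<^sup>+t. ennreal (u powr (s - 1)) * ennreal (indicator {0..} t * (t powr (s - 1) * exp (- (u * t)))) \<partial>lborel)"
    using u by (intro arg_cong2[where f="(*)"] refl nn_integral_cong, subst ennreal_mult[symmetric])
      (auto simp: indicator_def powr_mult exp_minus field_simps zero_le_mult_iff intro!: arg_cong[where f=ennreal])
  also have "\<dots> = ennreal (u powr s) * (\<integral>\<^sup>+t. ennreal (indicator {0..} t * (t powr (s - 1) * exp (- (u * t)))) \<partial>lborel)"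
    using u by (subst nn_integral_cmult) (auto simp: powr_diff mult.assoc[symmetric] simp flip: ennreal_mult)
  finally have eq: "ennreal (Gamma s) = ennreal (u powr s) * (\<integral>\<^sup>+t. ennreal (indicator {0..} t * (t powr (s - 1) * exp (- (u * t)))) \<partial>lborel)" .
  have "ennreal (Gamma s * u powr (- s)) = ennreal (u powr (- s)) * ennreal (Gamma s)"
    using s by (simp add: ennreal_mult' mult.commute)
  also have "\<dots> = ennreal (u powr (- s) * u powr s) * (\<integral>\<^sup>+t. ennreal (indicator {0..} t * (t powr (s - 1) * exp (- (u * t)))) \<partial>lborel)"
    unfolding eq by (simp add: ennreal_mult mult.assoc)
  also have "u powr (- s) * u powr s = 1" using u by (simp add: powr_minus field_simps)
  finally show ?thesis by simp
qed

text \<open>Comparison profile of the stable density. The origin is a separate case because division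
  by zero returns 0 and would annihilate the minimum.\<close>

definition sbound :: "real \<Rightarrow> real \<Rightarrow> 'a::euclidean_space \<Rightarrow> real" where
  "sbound \<alpha> t x = (if x = 0 then t powr (- real DIM('a) / \<alpha>)
     else min (t powr (- real DIM('a) / \<alpha>)) (t / norm x powr (real DIM('a) + \<alpha>)))"

lemma sbound_scale:
  fixes x :: "'a::euclidean_space"
  assumes "t > 0" "\<alpha> > 0"
  shows "sbound \<alpha> t x = t powr (- real DIM('a) / \<alpha>) * sbound \<alpha> 1 ((1 / t powr (1 / \<alpha>)) *\<^sub>R x)"
proof (cases "x = 0")
  case False
  let ?d = "real DIM('a)"
  have "norm ((1 / t powr (1 / \<alpha>)) *\<^sub>R x) powr (?d + \<alpha>) = norm x powr (?d + \<alpha>) / t powr (1 / \<alpha> * (?d + \<alpha>))"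
    using assms by (simp add: powr_divide powr_powr)
  also have "1 / \<alpha> * (?d + \<alpha>) = ?d / \<alpha> + 1" using assms by (simp add: field_simps)
  also have "t powr (?d / \<alpha> + 1) = t powr (?d / \<alpha>) * t" using assms by (simp add: powr_add)
  finally have "t powr (- ?d / \<alpha>) * (1 / norm ((1 / t powr (1 / \<alpha>)) *\<^sub>R x) powr (?d + \<alpha>)) = t / norm x powr (?d + \<alpha>)"
    using assms False by (simp add: powr_minus field_simps)
  moreover have "sbound \<alpha> 1 ((1 / t powr (1 / \<alpha>)) *\<^sub>R x) = min 1 (1 / norm ((1 / t powr (1 / \<alpha>)) *\<^sub>R x) powr (?d + \<alpha>))"
    using assms False by (simp add: sbound_def)
  ultimately have "t powr (- ?d / \<alpha>) * sbound \<alpha> 1 ((1 / t powr (1 / \<alpha>)) *\<^sub>R x) = min (t powr (- ?d / \<alpha>)) (t / norm x powr (?d + \<alpha>))"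
    by (simp only: min_mult_distrib_left powr_ge_zero if_True mult_1_right)
  then show ?thesis using False by (simp add: sbound_def)
qed (use assms in \<open>simp add: sbound_def\<close>)

section \<open>The subordinated Gaussian density and its two-sided bound\<close>

locale subordinator =
  fixes \<alpha> :: real and N :: "real measure"
  assumes alpha: "0 < \<alpha>" "\<alpha> < 2"
    and N: "real_distribution N" and N_pos: "AE u in N. 0 < u"
    and laplace: "\<And>l. l > 0 \<Longrightarrow> (LINT u|N. exp (- (l * u))) = exp (- (l powr (\<alpha> / 2)))"
begin

sublocale real_distribution N by (rule N)

abbreviation "a \<equiv> \<alpha> / 2"

lemma integrable_exp_N: "l > 0 \<Longrightarrow> integrable N (\<lambda>u. exp (- (l * u)))"
  by (rule integrable_const_bound[where B=1]) (use N_pos in \<open>auto elim!: eventually_mono\<close>)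

lemma integral_one_minus_exp: "l > 0 \<Longrightarrow> (LINT u|N. 1 - exp (- (l * u))) = 1 - exp (- (l powr a))"
  using integrable_exp_N prob_space by (subst Bochner_Integration.integral_diff) (auto simp: laplace)

lemma integral_one_minus_exp_le: "l > 0 \<Longrightarrow> (LINT u|N. 1 - exp (- (l * u))) \<le> l powr a"
  using exp_ge_add_one_self[of "- (l powr a)"] by (simp add: integral_one_minus_exp)

text \<open>Write \<open>u powr (- s)\<close> as a Gamma integral of \<open>exp (- (u * l))\<close>
  and exchange the integrals. The Laplace transform \<open>exp (- (l powr a))\<close> decays faster
  than any power, so the integral over \<open>l\<close> converges at both ends.\<close>

lemma integrable_neg_moment:
  assumes s: "s > 0"
  shows "integrable N (\<lambda>u. u powr (- s))"
proof (rule integrableI_nonneg)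
  interpret P: pair_sigma_finite N "lborel :: real measure" ..
  \<comment> \<open>Chosen so that \<open>a * q = s + 1\<close>: then \<open>exp_ge_powr\<close>
    yields \<open>l powr (s - 1) * exp (- (l powr a)) \<le> q powr q * l powr (- 2)\<close>.\<close>
  define q where "q = (s + 1) / a"
  have q: "q > 0" using s alpha by (simp add: q_def)
  have aq: "a * q = s + 1" using alpha by (simp add: q_def)
  have G: "Gamma s > 0" using s by simp
  have "ennreal (Gamma s) * (\<integral>\<^sup>+u. ennreal (u powr (- s)) \<partial>N) = (\<integral>\<^sup>+u. ennreal (Gamma s * u powr (- s)) \<partial>N)"
    using s by (subst nn_integral_cmult[symmetric]) (auto simp: ennreal_mult)
  also have "\<dots> = (\<integral>\<^sup>+u. (\<integral>\<^sup>+l. ennreal (indicator {0..} l * (l powr (s - 1) * exp (- (u * l)))) \<partial>lborel) \<partial>N)"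
    by (rule nn_integral_cong_AE) (use N_pos in \<open>eventually_elim, simp add: nn_integral_Gamma_scaled[OF s]\<close>)
  also have "\<dots> = (\<integral>\<^sup>+l. (\<integral>\<^sup>+u. ennreal (indicator {0..} l * (l powr (s - 1) * exp (- (u * l)))) \<partial>N) \<partial>lborel)"
    by (rule P.Fubini'[symmetric]) measurable
  also have "\<dots> \<le> (\<integral>\<^sup>+l. ennreal (indicator {0..1} l * l powr (s - 1)) + ennreal (q powr q) * ennreal (indicator {1..} l * l powr (- 1 - 1)) \<partial>lborel)"
  proof (rule nn_integral_mono)
    fix l :: real
    consider "l \<le> 0" | "0 < l" "l \<le> 1" | "l > 1" by linarith
    then show "(\<integral>\<^sup>+u. ennreal (indicator {0..} l * (l powr (s - 1) * exp (- (u * l)))) \<partial>N)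
       \<le> ennreal (indicator {0..1} l * l powr (s - 1)) + ennreal (q powr q) * ennreal (indicator {1..} l * l powr (- 1 - 1))"
    proof cases
      case 1
      then show ?thesis by (cases "l = 0") (auto simp: indicator_def)
    next
      case 2
      have "(\<integral>\<^sup>+u. ennreal (indicator {0..} l * (l powr (s - 1) * exp (- (u * l)))) \<partial>N) \<le> (\<integral>\<^sup>+u. ennreal (l powr (s - 1)) \<partial>N)"
        by (rule nn_integral_mono_AE) (use N_pos 2 in \<open>auto elim!: eventually_mono intro!: ennreal_leI mult_left_le\<close>)
      also have "\<dots> = ennreal (indicator {0..1} l * l powr (s - 1))" using 2 emeasure_space_1 by simp
      finally show ?thesis by (rule add_increasing2[rotated]) simp
    next
      case 3
      have "(\<integral>\<^sup>+u. ennreal (indicator {0..} l * (l powr (s - 1) * exp (- (u * l)))) \<partial>N) = ennreal (LINT u|N. l powr (s - 1) * exp (- (l * u)))"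
        using 3 integrable_exp_N[of l] by (subst nn_integral_eq_integral) (auto simp: mult.commute)
      also have "\<dots> = ennreal (l powr (s - 1) * exp (- (l powr a)))" using 3 by (simp add: laplace)
      also have "\<dots> \<le> ennreal (q powr q * (l powr (- 2)))"
      proof (rule ennreal_leI)
        have "(l powr a / q) powr q \<le> exp (l powr a)" using 3 q by (intro exp_ge_powr) auto
        moreover have "(l powr a / q) powr q = l powr (s + 1) / q powr q"
        proof -
          have "(l powr b / q) powr q = l powr (s + 1) / q powr q" if "b * q = s + 1" for b
            using that 3 q by (simp add: powr_divide powr_powr)
          then show ?thesis using aq by blast
        qed
        ultimately have "l powr (s + 1) \<le> q powr q * exp (l powr a)" using q by (simp add: field_simps)
        then have "l powr (s - 1) * l powr 2 \<le> q powr q * exp (l powr a)" using 3 by (subst powr_add[symmetric]) (simp add: add.commute)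
        then show "l powr (s - 1) * exp (- (l powr a)) \<le> q powr q * (l powr (- 2))"
          using 3 by (simp add: exp_minus powr_minus field_simps)
      qed
      also have "\<dots> = ennreal (q powr q) * ennreal (indicator {1..} l * l powr (- 1 - 1))"
        using 3 by (simp add: ennreal_mult)
      finally show ?thesis by (rule add_increasing[rotated]) simp
    qed
  qed
  also have "\<dots> < \<infinity>"
    using s nn_integral_powr_from_0[of s 1] nn_integral_powr_to_inf[of 1 1]
    by (subst nn_integral_add) (auto simp: nn_integral_cmult ennreal_mult_less_top)
  finally have fin: "ennreal (Gamma s) * (\<integral>\<^sup>+u. ennreal (u powr (- s)) \<partial>N) < \<infinity>" .
  show "(\<integral>\<^sup>+u. ennreal (u powr (- s)) \<partial>N) < \<infinity>"
  proof (rule ccontr)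
    assume "\<not> ?thesis"
    then have "(\<integral>\<^sup>+u. ennreal (u powr (- s)) \<partial>N) = \<top>" by (simp add: less_top[symmetric])
    then show False using fin G by (simp add: ennreal_mult_top)
  qed
qed auto

text \<open>The Laplace defect at \<open>1 / r\<close> is at least \<open>k * r powr (- a)\<close>.
  Values of \<open>u\<close> below \<open>e * r\<close> and above \<open>A * r\<close> are compared
  with the defects at other scales and contribute at most a quarter of that amount each; the shell
  must carry the rest.\<close>

lemma measure_shell_ge:
  obtains e A c where "e > 0" "A > 0" "c > 0" "\<And>r. r \<ge> 1 \<Longrightarrow> c * r powr (- a) \<le> measure N {e * r..A * r}"
proof -
  define k :: real where "k = 1 - exp (- 1)"
  have k: "k > 0" "k < 1" by (auto simp: k_def)
  \<comment> \<open>Both \<open>e powr (1 - a)\<close> and \<open>A powr (- a)\<close> are made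
    equal to \<open>k^2 / 4\<close>, which turns each unwanted part into \<open>k / 4\<close> times
    \<open>r powr (- a)\<close>.\<close>
  define e where "e = (k\<^sup>2 / 4) powr (1 / (1 - a))"
  define A where "A = (k\<^sup>2 / 4) powr (- 1 / a)"
  have e: "e > 0" and A: "A > 0" using k by (auto simp: e_def A_def)
  have ep: "e powr (1 - a) = k\<^sup>2 / 4" using alpha k by (simp add: e_def powr_powr)
  have Ap: "A powr (- a) = k\<^sup>2 / 4" using alpha k by (simp add: A_def powr_powr)
  have "(k / 2) * r powr (- a) \<le> measure N {e * r..A * r}" if r: "r \<ge> 1" for r
  proof -
    let ?l = "1 / r"
    have l: "?l > 0" using r by simp
    have i1: "integrable N (\<lambda>u. 1 - exp (- (m * u)))" if "m > 0" for m using integrable_exp_N[OF that] by simp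
    have i2: "integrable N (indicator {e * r..A * r} :: real \<Rightarrow> real)"
      by (rule integrable_const_bound[where B=1]) (auto simp: indicator_def)
    have la: "?l powr a \<le> 1" using r alpha by (intro powr_le1) auto
    have "k * ?l powr a \<le> 1 - exp (- (?l powr a))" unfolding k_def
      by (rule one_minus_exp_ge) (use la in auto)
    also have "\<dots> = (LINT u|N. 1 - exp (- (?l * u)))" using integral_one_minus_exp[OF l] by simp
    also have "\<dots> \<le> (LINT u|N. (e / k) * (1 - exp (- (?l / e * u))) + indicator {e * r..A * r} u + (1 / k) * (1 - exp (- (?l / A * u))))"
    proof (rule integral_mono_AE)
      show "AE u in N. 1 - exp (- (?l * u)) \<le> (e / k) * (1 - exp (- (?l / e * u))) + indicator {e * r..A * r} u + (1 / k) * (1 - exp (- (?l / A * u)))"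
        using N_pos
      proof eventually_elim
        case (elim u)
        have p1: "0 \<le> (e / k) * (1 - exp (- (?l / e * u)))" using elim r e k by simp
        have p2: "0 \<le> (1 / k) * (1 - exp (- (?l / A * u)))" using elim r A k by simp
        consider "u < e * r" | "u \<in> {e * r..A * r}" | "u > A * r" by fastforce
        then show ?case
        proof cases
          case 1
          have "k * (?l / e * u) \<le> 1 - exp (- (?l / e * u))" unfolding k_def
            by (rule one_minus_exp_ge) (use elim 1 r e in \<open>auto simp: field_simps\<close>)
          then have "(e / k) * (k * (?l / e * u)) \<le> (e / k) * (1 - exp (- (?l / e * u)))"
            using e k by (intro mult_left_mono) auto
          moreover have "(e / k) * (k * (?l / e * u)) = ?l * u" using e k by simp
          moreover have "1 - exp (- (?l * u)) \<le> ?l * u" using exp_ge_add_one_self[of "- (?l * u)"] by linarith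
          ultimately show ?thesis using p2 by (simp add: indicator_def)
        next
          case 2
          have "1 - exp (- (?l * u)) \<le> 1" by simp
          moreover have "(indicator {e * r..A * r} u :: real) = 1" using 2 by simp
          ultimately show ?thesis using p1 p2 by linarith
        next
          case 3
          have "exp (- (?l / A * u)) \<le> exp (- 1)" using 3 r A by (simp add: field_simps)
          then have "1 \<le> (1 / k) * (1 - exp (- (?l / A * u)))" using k by (simp add: k_def field_simps)
          moreover have "1 - exp (- (?l * u)) \<le> 1" by simp
          moreover have "0 \<le> (indicator {e * r..A * r} u :: real)" by simp
          ultimately show ?thesis using p1 by linarith
        qed
      qed
    qed (use i1[OF l] i1[of "?l / e"] i1[of "?l / A"] i2 r e A in auto)
    also have "\<dots> = (e / k) * (LINT u|N. 1 - exp (- (?l / e * u))) + measure N {e * r..A * r} + (1 / k) * (LINT u|N. 1 - exp (- (?l / A * u)))"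
      using i1[of "?l / e"] i1[of "?l / A"] i2 r e A by (subst Bochner_Integration.integral_add) (auto simp del: Bochner_Integration.integral_diff)
    also have "\<dots> \<le> (e / k) * (?l / e) powr a + measure N {e * r..A * r} + (1 / k) * (?l / A) powr a"
      using integral_one_minus_exp_le[of "?l / e"] integral_one_minus_exp_le[of "?l / A"] r e A k
      by (intro add_mono mult_left_mono) auto
    also have "(e / k) * (?l / e) powr a = ?l powr a * (e powr (1 - a)) / k"
      using e r by (simp add: powr_divide powr_diff powr_mult)
    also have "(1 / k) * (?l / A) powr a = ?l powr a * (A powr (- a)) / k"
      using A r by (simp add: powr_divide powr_minus powr_mult divide_simps)
    finally have "k * ?l powr a \<le> ?l powr a * (k / 4) + measure N {e * r..A * r} + ?l powr a * (k / 4)"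
      using k by (simp add: ep Ap power2_eq_square)
    moreover have "?l powr a = r powr (- a)" using r by (simp add: powr_divide powr_minus_divide)
    ultimately show ?thesis by (simp add: field_simps)
  qed
  with e A k that[of e A "k / 2"] show ?thesis by auto
qed

text \<open>By scaling, the subordinator at time \<open>t\<close> is distributed as
  \<open>t powr (2 / \<alpha>)\<close> times a variable with law \<open>N\<close>; a single law thus
  serves all times.\<close>

definition pd :: "real \<Rightarrow> 'b::euclidean_space \<Rightarrow> real" where
  "pd t x = (LINT u|N. gauss (t powr (2 / \<alpha>) * u) x)"

lemma gauss_le: "u > 0 \<Longrightarrow> gauss u (x::'b::euclidean_space) \<le> (4 * pi) powr (- real DIM('b) / 2) * u powr (- (real DIM('b) / 2))"
  by (simp add: gauss_def powr_mult)

lemma gauss_meas2 [measurable]: "(\<lambda>(u, x::'b::euclidean_space). gauss u x) \<in> borel_measurable (borel \<Otimes>\<^sub>M borel)"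
  unfolding gauss_def by measurable

lemma integrable_gauss_N: "integrable N (\<lambda>u. gauss u (x::'b::euclidean_space))"
proof (rule Bochner_Integration.integrable_bound)
  show "integrable N (\<lambda>u. (4 * pi) powr (- real DIM('b) / 2) * u powr (- (real DIM('b) / 2)))"
    by (intro integrable_mult_right integrable_neg_moment) simp
  show "AE u in N. norm (gauss u x) \<le> norm ((4 * pi) powr (- real DIM('b) / 2) * u powr (- (real DIM('b) / 2)))"
    using N_pos by eventually_elim (use gauss_le[where 'b='b] in auto)
qed measurable

lemma pd_1: "pd 1 x = (LINT u|N. gauss u x)" by (simp add: pd_def)

lemma pd_scale:
  fixes x :: "'b::euclidean_space"
  assumes t: "t > 0"
  shows "pd t x = t powr (- real DIM('b) / \<alpha>) * pd 1 ((1 / t powr (1 / \<alpha>)) *\<^sub>R x)"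
proof -
  let ?c = "t powr (1 / \<alpha>)"
  have c: "?c > 0" using t by simp
  have "AE u in N. gauss (t powr (2 / \<alpha>) * u) x = t powr (- real DIM('b) / \<alpha>) * gauss u ((1 / ?c) *\<^sub>R x)"
    using N_pos
  proof eventually_elim
    case (elim u)
    have "t powr (2 / \<alpha>) = ?c\<^sup>2" using t by (simp add: powr_powr flip: powr_numeral)
    moreover have "?c ^ DIM('b) = t powr (real DIM('b) / \<alpha>)" using t by (simp add: powr_powr flip: powr_realpow)
    ultimately show ?case using gauss_scale[OF c elim, of "(1 / ?c) *\<^sub>R x"] c by (simp add: powr_minus_divide)
  qed
  then have "pd t x = (LINT u|N. t powr (- real DIM('b) / \<alpha>) * gauss u ((1 / ?c) *\<^sub>R x))"
    unfolding pd_def by (intro integral_cong_AE) auto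
  then show ?thesis by (simp add: pd_1)
qed

text \<open>Near the origin a negative moment of \<open>N\<close> bounds the density. Far away, the
  Gaussian profile \<open>v powr (- m) * exp (- 1 / (4 * v))\<close> with
  \<open>v = u / |x|^2\<close> is dominated by a multiple of \<open>1 - exp (- v)\<close>, whose
  mean is at most \<open>|x| powr (- \<alpha>)\<close>.\<close>

lemma pd_1_upper:
  obtains C where "C > 0" "\<And>x::'b::euclidean_space. pd 1 x \<le> C * sbound \<alpha> 1 x"
proof -
  let ?d = "real DIM('b)"
  define m where "m = ?d / 2"
  have m: "m > 0" by (simp add: m_def)
  define B where "B = (4 * pi) powr (- m)"
  have B: "B > 0" by (simp add: B_def)
  define C1 where "C1 = B * (LINT u|N. u powr (- m))"
  define k :: real where "k = 1 - exp (- 1)"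
  have k: "k > 0" by (simp add: k_def)
  define D where "D = max 1 ((4 * (m + 1)) powr (m + 1)) / k"
  have D: "D > 0" using k by (auto simp: D_def)
  have elem: "v powr (- m) * exp (- 1 / (4 * v)) \<le> D * (1 - exp (- v))" if v: "v > 0" for v
  proof (cases "v \<le> 1")
    case True
    have "(1 / (4 * v) / (m + 1)) powr (m + 1) \<le> exp (1 / (4 * v))" using v m by (intro exp_ge_powr) auto
    moreover have "(1 / (4 * v) / (m + 1)) powr (m + 1) = 1 / ((4 * (m + 1)) powr (m + 1) * v powr (m + 1))"
    proof -
      have "1 / (4 * v) / (m + 1) = 1 / ((4 * (m + 1)) * v)" by simp
      then show ?thesis using v m by (simp only: powr_divide powr_mult powr_one_eq_one)
    qed
    ultimately have "1 / ((4 * (m + 1)) powr (m + 1) * v powr (m + 1)) \<le> exp (1 / (4 * v))" by simp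
    moreover have "(4 * (m + 1)) powr (m + 1) * v powr (m + 1) > 0" using v m by simp
    ultimately have "1 \<le> exp (1 / (4 * v)) * ((4 * (m + 1)) powr (m + 1) * v powr (m + 1))" by (simp only: pos_divide_le_eq)
    then have "exp (- 1 / (4 * v)) \<le> (4 * (m + 1)) powr (m + 1) * v powr (m + 1)"
      by (simp add: exp_minus inverse_eq_divide pos_divide_le_eq mult.commute)
    then have "v powr (- m) * exp (- 1 / (4 * v)) \<le> v powr (- m) * ((4 * (m + 1)) powr (m + 1) * v powr (m + 1))"
      by (intro mult_left_mono) auto
    also have "\<dots> = (4 * (m + 1)) powr (m + 1) * v" using v by (simp add: powr_minus powr_add)
    also have "\<dots> \<le> (D * k) * v" using v k by (intro mult_right_mono) (auto simp: D_def)
    also have "\<dots> \<le> D * (1 - exp (- v))" using one_minus_exp_ge[of v] v True D by (simp add: k_def mult.assoc)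
    finally show ?thesis .
  next
    case False
    have "v powr (- m) \<le> v powr 0" using False m by (intro powr_mono) auto
    then have "v powr (- m) * exp (- 1 / (4 * v)) \<le> 1 * 1"
      using False by (intro mult_mono) auto
    also have "\<dots> \<le> D * k" using k by (simp add: D_def)
    also have "\<dots> \<le> D * (1 - exp (- v))" using False D by (intro mult_left_mono) (auto simp: k_def)
    finally show ?thesis .
  qed
  have u1: "pd 1 x \<le> C1" for x :: 'b
  proof -
    have "pd 1 x \<le> (LINT u|N. B * u powr (- m))" unfolding pd_1
      by (rule integral_mono_AE) (use N_pos gauss_le[where 'b='b] integrable_gauss_N integrable_neg_moment[OF m] in \<open>auto elim!: eventually_mono simp: B_def m_def\<close>)
    then show ?thesis by (simp add: C1_def)
  qed
  have u2: "pd 1 x \<le> B * D / norm x powr (?d + \<alpha>)" if x: "x \<noteq> 0" for x :: 'b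
  proof -
    let ?r = "(norm x)\<^sup>2"
    have r: "?r > 0" using x by simp
    have "pd 1 x \<le> (LINT u|N. (B * D * ?r powr (- m)) * (1 - exp (- (1 / ?r * u))))" unfolding pd_1
    proof (rule integral_mono_AE[OF integrable_gauss_N])
      show "AE u in N. gauss u x \<le> (B * D * ?r powr (- m)) * (1 - exp (- (1 / ?r * u)))"
        using N_pos
      proof eventually_elim
        case (elim u)
        have "gauss u x = B * ?r powr (- m) * ((u / ?r) powr (- m) * exp (- 1 / (4 * (u / ?r))))"
          using elim x r by (simp add: gauss_def B_def m_def powr_mult powr_divide)
        also have "\<dots> \<le> B * ?r powr (- m) * (D * (1 - exp (- (u / ?r))))"
          using elem[of "u / ?r"] elim r B by (intro mult_left_mono) auto
        finally show ?case by (simp add: mult_ac)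
      qed
    qed (use integrable_exp_N[of "1 / ?r"] r in auto)
    also have "\<dots> = (B * D * ?r powr (- m)) * (LINT u|N. (1 - exp (- (1 / ?r * u))))" by simp
    also have "\<dots> \<le> (B * D * ?r powr (- m)) * (1 / ?r) powr a"
      using integral_one_minus_exp_le[of "1 / ?r"] r B D by (intro mult_left_mono) auto
    also have "?r powr (- m) = norm x powr (- ?d)" using x by (simp add: powr_powr m_def flip: powr_numeral)
    also have "(1 / ?r) powr a = norm x powr (- \<alpha>)" using x by (simp add: powr_divide powr_powr powr_minus_divide flip: powr_numeral)
    finally show ?thesis using x by (simp add: powr_add powr_minus_divide)
  qed
  show ?thesis
  proof (rule that[of "max 1 (max C1 (B * D))"])
    fix x :: 'b
    let ?C = "max 1 (max C1 (B * D))"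
    show "pd 1 x \<le> ?C * sbound \<alpha> 1 x"
    proof (cases "x = 0")
      case True
      then show ?thesis using u1[of x] by (simp add: sbound_def)
    next
      case False
      have "pd 1 x \<le> ?C * 1" using u1[of x] by simp
      moreover have "B * D / norm x powr (?d + \<alpha>) \<le> ?C * (1 / norm x powr (?d + \<alpha>))" by (simp add: divide_right_mono)
      ultimately show ?thesis using u2[OF False] False by (auto simp: sbound_def min_def)
    qed
  qed simp
qed

text \<open>For \<open>|x| \<ge> 1\<close> the shell of \<open>u\<close> comparable to
  \<open>|x|^2\<close> has mass at least of order \<open>|x| powr (- \<alpha>)\<close>, and on it
  the Gaussian is of order \<open>|x| powr (- d)\<close>. For smaller \<open>|x|\<close> the density
  exceeds its value at a unit vector, since Gaussians decrease radially.\<close>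

lemma pd_1_lower:
  obtains c where "c > 0" "\<And>x::'b::euclidean_space. c * sbound \<alpha> 1 x \<le> pd 1 x"
proof -
  let ?d = "real DIM('b)"
  obtain e A c where eAc: "e > 0" "A > 0" "c > 0" "\<And>r. r \<ge> 1 \<Longrightarrow> c * r powr (- a) \<le> measure N {e * r..A * r}"
    using measure_shell_ge by metis
  define c1 where "c1 = (4 * pi * A) powr (- ?d / 2) * exp (- 1 / (4 * e)) * c"
  have c1: "c1 > 0" using eAc by (simp add: c1_def)
  have far: "c1 / norm x powr (?d + \<alpha>) \<le> pd 1 x" if x: "norm x \<ge> 1" for x :: 'b
  proof -
    let ?r = "(norm x)\<^sup>2"
    have r: "?r \<ge> 1" using x by simp
    have x0: "norm x > 0" using x by linarith
    let ?g = "(4 * pi * A * ?r) powr (- ?d / 2) * exp (- 1 / (4 * e))"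
    have "?g * measure N {e * ?r..A * ?r} = (LINT u|N. ?g * indicator {e * ?r..A * ?r} u)" by simp
    also have "\<dots> \<le> pd 1 x" unfolding pd_1
    proof (rule integral_mono_AE[OF _ integrable_gauss_N])
      have "integrable N (indicator {e * ?r..A * ?r} :: real \<Rightarrow> real)"
        by (rule integrable_const_bound[where B=1]) (auto simp: indicator_def)
      then show "integrable N (\<lambda>u. ?g * indicator {e * ?r..A * ?r} u)" by (rule integrable_mult_right)
      show "AE u in N. ?g * indicator {e * ?r..A * ?r} u \<le> gauss u x"
        using N_pos
      proof eventually_elim
        case (elim u)
        show ?case
        proof (cases "u \<in> {e * ?r..A * ?r}")
          case True
          have "(4 * pi * A * ?r) powr (- ?d / 2) \<le> (4 * pi * u) powr (- ?d / 2)"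
            using True elim by (intro powr_mono2') auto
          moreover have "exp (- 1 / (4 * e)) \<le> exp (- ?r / (4 * u))" using True elim eAc(1) by (simp add: field_simps)
          ultimately have "?g \<le> gauss u x" unfolding gauss_def by (intro mult_mono) auto
          then show ?thesis using True by simp
        qed simp
      qed
    qed
    finally have "?g * measure N {e * ?r..A * ?r} \<le> pd 1 x" .
    moreover have "?g * (c * ?r powr (- a)) \<le> ?g * measure N {e * ?r..A * ?r}"
      using eAc(4)[OF r] by (intro mult_left_mono) auto
    moreover have "?g * (c * ?r powr (- a)) = c1 / norm x powr (?d + \<alpha>)"
    proof -
      have "?r powr (- ?d / 2) = norm x powr (- ?d)" "?r powr (- a) = norm x powr (- \<alpha>)"
        using x0 by (simp_all add: powr_powr flip: powr_numeral)
      then show ?thesis using eAc(2) x0 by (simp add: c1_def powr_mult[of "4 * pi * A" ?r] powr_add powr_minus_divide)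
    qed
    ultimately show ?thesis by linarith
  qed
  show ?thesis
  proof (rule that[OF c1])
    fix x :: 'b
    show "c1 * sbound \<alpha> 1 x \<le> pd 1 x"
    proof (cases "norm x \<ge> 1")
      case True
      then have x0: "x \<noteq> 0" by auto
      have "sbound \<alpha> 1 x \<le> 1 / norm x powr (?d + \<alpha>)" using x0 by (simp add: sbound_def)
      then have "c1 * sbound \<alpha> 1 x \<le> c1 * (1 / norm x powr (?d + \<alpha>))" using c1 by (intro mult_left_mono) auto
      then show ?thesis using far[OF True] by simp
    next
      case False
      obtain b :: 'b where b: "norm b = 1" using vector_choose_size[of 1] by auto
      have "sbound \<alpha> 1 x \<le> 1" by (simp add: sbound_def)
      then have "c1 * sbound \<alpha> 1 x \<le> c1" using c1 by (simp add: mult_left_le)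
      also have "\<dots> \<le> pd 1 b" using far[of b] b by simp
      also have "\<dots> \<le> pd 1 x" unfolding pd_1
      proof (rule integral_mono_AE[OF integrable_gauss_N integrable_gauss_N])
        show "AE u in N. gauss u b \<le> gauss u x" using N_pos
        proof eventually_elim
          case (elim u)
          have "(norm x)\<^sup>2 \<le> (norm b)\<^sup>2" using False b by (intro power_mono) auto
          then show ?case unfolding gauss_def using elim by (intro mult_left_mono) (auto simp: divide_right_mono)
        qed
      qed
      finally show ?thesis .
    qed
  qed
qed

lemma continuous_pd_1: "continuous_on UNIV (pd 1 :: 'b::euclidean_space \<Rightarrow> real)"
  unfolding continuous_on_sequentially pd_1 comp_def
proof safe
  fix X :: "nat \<Rightarrow> 'b" and x assume X: "X \<longlonglongrightarrow> x"
  show "(\<lambda>n. LINT u|N. gauss u (X n)) \<longlonglongrightarrow> (LINT u|N. gauss u x)"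
  proof (rule integral_dominated_convergence)
    show "integrable N (\<lambda>u. (4 * pi) powr (- real DIM('b) / 2) * u powr (- (real DIM('b) / 2)))"
      by (intro integrable_mult_right integrable_neg_moment) simp
    show "AE u in N. norm (gauss u (X n)) \<le> (4 * pi) powr (- real DIM('b) / 2) * u powr (- (real DIM('b) / 2))" for n
      using N_pos by eventually_elim (use gauss_le[where 'b='b] in auto)
    show "AE u in N. (\<lambda>n. gauss u (X n)) \<longlonglongrightarrow> gauss u x"
      using N_pos by eventually_elim (use X in \<open>auto simp: gauss_def intro!: tendsto_intros\<close>)
  qed measurable
qed

lemma continuous_pd: "continuous_on ({0<..} \<times> UNIV) (\<lambda>(t, x::'b::euclidean_space). pd t x)"
proof -
  have "continuous_on ({0<..} \<times> UNIV) (\<lambda>(t, x::'b). t powr (- real DIM('b) / \<alpha>) * pd 1 ((1 / t powr (1 / \<alpha>)) *\<^sub>R x))"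
    unfolding case_prod_beta
    by (intro continuous_intros continuous_on_compose2[OF continuous_pd_1]) auto
  then show ?thesis by (rule continuous_on_eq) (clarsimp, rule pd_scale[symmetric, simplified minus_divide_left[symmetric]], simp)
qed

lemma char_pd:
  fixes xi :: "'b::euclidean_space"
  assumes t: "t > 0"
  shows "(LINT y|lborel. complex_of_real (pd t y) * cis (xi \<bullet> y)) = exp (- t * norm xi powr \<alpha>)"
proof -
  interpret P: pair_sigma_finite N "lborel :: 'b measure" ..
  let ?c = "t powr (2 / \<alpha>)"
  let ?F = "\<lambda>u y. complex_of_real (gauss (?c * u) y) * cis (xi \<bullet> y)"
  have m: "(\<lambda>(u, y). ?F u y) \<in> borel_measurable (N \<Otimes>\<^sub>M lborel)"
    unfolding cis_conv_exp by measurable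
  have int: "integrable (N \<Otimes>\<^sub>M lborel) (\<lambda>(u, y). ?F u y)"
  proof (rule P.Fubini_integrable[OF m])
    have "AE u in N. 1 = (LINT y|lborel. cmod (case (u, y) of (u, y) \<Rightarrow> ?F u y))"
      using N_pos by eventually_elim (use t in \<open>simp add: norm_mult integral_gauss\<close>)
    then show "integrable N (\<lambda>u. LINT y|lborel. cmod (case (u, y) of (u, y) \<Rightarrow> ?F u y))"
    proof (rule integrable_cong_AE_imp[rotated 2])
      show "(\<lambda>u. LINT y|lborel. cmod (case (u, y) of (u, y) \<Rightarrow> ?F u y)) \<in> borel_measurable N"
        using m by measurable
    qed simp
    show "AE u in N. integrable lborel (\<lambda>y. case (u, y) of (u, y) \<Rightarrow> ?F u y)"
      using N_pos by eventually_elim (use t in \<open>simp add: integrable_gauss_cis\<close>)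
  qed
  have "(LINT y|lborel. complex_of_real (pd t y) * cis (xi \<bullet> y)) = (LINT y|lborel. LINT u|N. ?F u y)"
    by (rule Bochner_Integration.integral_cong[OF refl]) (simp add: pd_def)
  also have "\<dots> = (LINT u|N. LINT y|lborel. ?F u y)" by (rule P.Fubini_integral[OF int])
  also have "\<dots> = (LINT u|N. complex_of_real (exp (- (?c * (norm xi)\<^sup>2 * u))))"
  proof (rule integral_cong_AE)
    show "AE u in N. (LINT y|lborel. ?F u y) = complex_of_real (exp (- (?c * (norm xi)\<^sup>2 * u)))"
      using N_pos
    proof eventually_elim
      case (elim u)
      then have "?c * u > 0" using t by simp
      from char_gauss[OF this, of xi] show ?case by (simp add: mult_ac)
    qed
  qed (use m in measurable)
  also have "\<dots> = of_real (LINT u|N. exp (- (?c * (norm xi)\<^sup>2 * u)))" by simp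
  also have "(LINT u|N. exp (- (?c * (norm xi)\<^sup>2 * u))) = exp (- t * norm xi powr \<alpha>)"
  proof (cases "xi = 0")
    case True
    then show ?thesis using prob_space alpha by simp
  next
    case False
    have "(?c * (norm xi)\<^sup>2) powr a = t * norm xi powr \<alpha>"
      using t False alpha by (simp add: powr_mult powr_powr flip: powr_numeral)
    then show ?thesis using laplace[of "?c * (norm xi)\<^sup>2"] t False by simp
  qed
  finally show ?thesis .
qed

end

theorem stable_density_exists:
  assumes "0 < \<alpha>" "\<alpha> < 2"
  shows "\<exists>(p :: real \<Rightarrow> 'b::euclidean_space \<Rightarrow> real) C. C \<ge> 1 \<and>
     (\<forall>t>0. \<forall>x. sbound \<alpha> t x / C \<le> p t x \<and> p t x \<le> C * sbound \<alpha> t x) \<and>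
     continuous_on ({0<..} \<times> UNIV) (\<lambda>(t, x). p t x) \<and>
     (\<forall>t x. p t (- x) = p t x) \<and>
     (\<forall>t>0. \<forall>xi. (LINT y|lborel. complex_of_real (p t y) * cis (xi \<bullet> y)) = exp (- t * norm xi powr \<alpha>))"
proof -
  interpret pareto "\<alpha> / 2" using assms by unfold_locales auto
  obtain N where N: "real_distribution N" "AE u in N. 0 < u" "\<And>l. l > 0 \<Longrightarrow> (LINT u|N. exp (- (l * u))) = exp (- (l powr (\<alpha> / 2)))"
    using stable_subordinator by auto
  interpret subordinator \<alpha> N by (rule subordinator.intro[OF assms N])
  obtain C1 where C1: "C1 > 0" "\<And>x::'b. pd 1 x \<le> C1 * sbound \<alpha> 1 x" using pd_1_upper by metis
  obtain c2 where c2: "c2 > 0" "\<And>x::'b. c2 * sbound \<alpha> 1 x \<le> pd 1 x" using pd_1_lower by metis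
  define C where "C = max 1 (max C1 (1 / c2))"
  have s0: "0 \<le> sbound \<alpha> t x" if "t > 0" for t and x :: 'b using that by (simp add: sbound_def)
  have b: "sbound \<alpha> t x / C \<le> pd t x \<and> pd t x \<le> C * sbound \<alpha> t x" if t: "t > 0" for t and x :: 'b
  proof -
    let ?y = "(1 / t powr (1 / \<alpha>)) *\<^sub>R x"
    have "1 / c2 \<le> C" by (simp add: C_def)
    then have "1 / C \<le> c2" using c2(1) by (simp add: C_def field_simps)
    then have "sbound \<alpha> 1 ?y * (1 / C) \<le> sbound \<alpha> 1 ?y * c2" using s0[of 1 ?y] by (intro mult_left_mono) auto
    then have 1: "sbound \<alpha> 1 ?y / C \<le> pd 1 ?y" using c2(2)[of ?y] by (simp add: mult.commute)
    have "C1 * sbound \<alpha> 1 ?y \<le> C * sbound \<alpha> 1 ?y" using s0[of 1 ?y] by (intro mult_right_mono) (auto simp: C_def)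
    then have 2: "pd 1 ?y \<le> C * sbound \<alpha> 1 ?y" using C1(2)[of ?y] by simp
    have "t powr (- real DIM('b) / \<alpha>) * (sbound \<alpha> 1 ?y / C) \<le> t powr (- real DIM('b) / \<alpha>) * pd 1 ?y"
      "t powr (- real DIM('b) / \<alpha>) * pd 1 ?y \<le> t powr (- real DIM('b) / \<alpha>) * (C * sbound \<alpha> 1 ?y)"
      by (rule mult_left_mono[OF 1], simp, rule mult_left_mono[OF 2], simp)
    then show ?thesis unfolding sbound_scale[OF t alpha(1), of x] pd_scale[OF t, of x]
      by (simp only: times_divide_eq_right mult.left_commute[of C] simp_thms)
  qed
  show ?thesis
    by (rule exI[of _ pd], rule exI[of _ C])
       (use b continuous_pd char_pd in \<open>auto simp: C_def pd_def\<close>)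
qed

section \<open>Radial power integrals by layer cakes\<close>

lemma norm_powr_layer_cake:
  fixes x :: "'a::euclidean_space"
  assumes "s > 0" "x \<noteq> 0"
  shows "ennreal (norm x powr (- s)) = (\<integral>\<^sup>+v. ennreal s * ennreal (indicator {norm x..} v * v powr (- s - 1)) \<partial>lborel)"
  using assms by (subst nn_integral_cmult) (auto simp: nn_integral_powr_to_inf simp flip: ennreal_mult)

text \<open>Integrating over the superlevel sets of \<open>|x| powr (- s)\<close> replaces polar
  coordinates: only volumes of balls remain.\<close>

lemma nn_integral_norm_powr_layer_cake:
  fixes A :: "'a::euclidean_space set"
  assumes s: "s > 0" and [measurable]: "A \<in> sets borel"
  shows "(\<integral>\<^sup>+x. indicator A x * ennreal (norm x powr (- s)) \<partial>lborel)
     = (\<integral>\<^sup>+v. ennreal (s * v powr (- s - 1)) * (indicator {0<..} v * emeasure lborel (A \<inter> cball 0 v)) \<partial>lborel)"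
proof -
  have ae: "AE x in lborel. x \<noteq> (0::'a)" by (rule AE_lborel_singleton)
  have "(\<integral>\<^sup>+x. indicator A x * ennreal (norm x powr (- s)) \<partial>lborel)
     = (\<integral>\<^sup>+x. (\<integral>\<^sup>+v. indicator A x * (ennreal s * ennreal (indicator {norm x..} v * v powr (- s - 1))) \<partial>lborel) \<partial>lborel)"
  proof (rule nn_integral_cong_AE)
    show "AE x in lborel. indicator A x * ennreal (norm x powr (- s)) = (\<integral>\<^sup>+v. indicator A x * (ennreal s * ennreal (indicator {norm x..} v * v powr (- s - 1))) \<partial>lborel)"
      using ae by eventually_elim (subst nn_integral_cmult, auto simp: norm_powr_layer_cake[OF s])
  qed
  also have "\<dots> = (\<integral>\<^sup>+x. (\<integral>\<^sup>+v. ennreal (s * v powr (- s - 1)) * (indicator {0<..} v * indicator (A \<inter> cball 0 v) x) \<partial>lborel) \<partial>lborel)"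
  proof (rule nn_integral_cong_AE)
    show "AE x in lborel. (\<integral>\<^sup>+v. indicator A x * (ennreal s * ennreal (indicator {norm x..} v * v powr (- s - 1))) \<partial>lborel) = (\<integral>\<^sup>+v. ennreal (s * v powr (- s - 1)) * (indicator {0<..} v * indicator (A \<inter> cball 0 v) x) \<partial>lborel)"
      using ae
    proof eventually_elim
      case (elim x)
      then have "norm x > 0" by simp
      show ?case
        by (rule nn_integral_cong) (use s order.strict_trans2[OF \<open>norm x > 0\<close>] in \<open>auto simp: indicator_def ennreal_mult\<close>)
    qed
  qed
  also have "\<dots> = (\<integral>\<^sup>+v. (\<integral>\<^sup>+x. ennreal (s * v powr (- s - 1)) * (indicator {0<..} v * indicator (A \<inter> cball 0 v) x) \<partial>lborel) \<partial>lborel)"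
  proof (rule lborel_pair.Fubini'[symmetric])
    have "(\<lambda>(x::'a, v::real). ennreal (s * v powr (- s - 1)) * (indicator {0<..} v * (indicator A x * indicator {(x, v). norm x \<le> v} (x, v)))) \<in> borel_measurable (lborel \<Otimes>\<^sub>M lborel)"
      by measurable
    then show "(\<lambda>(x::'a, v::real). ennreal (s * v powr (- s - 1)) * (indicator {0<..} v * indicator (A \<inter> cball 0 v) x)) \<in> borel_measurable (lborel \<Otimes>\<^sub>M lborel)"
      by (rule measurable_cong[THEN iffD1, rotated]) (auto simp: indicator_def)
  qed
  also have "\<dots> = (\<integral>\<^sup>+v. ennreal (s * v powr (- s - 1)) * (indicator {0<..} v * emeasure lborel (A \<inter> cball 0 v)) \<partial>lborel)"
  proof (rule nn_integral_cong)
    fix v :: real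
    have [measurable]: "A \<inter> cball 0 v \<in> sets borel" by auto
    show "(\<integral>\<^sup>+x. ennreal (s * v powr (- s - 1)) * (indicator {0<..} v * indicator (A \<inter> cball 0 v) x) \<partial>lborel)
       = ennreal (s * v powr (- s - 1)) * (indicator {0<..} v * emeasure lborel (A \<inter> cball 0 v))"
      by (subst nn_integral_cmult, measurable, subst nn_integral_cmult) auto
  qed
  finally show ?thesis .
qed

lemma nn_integral_norm_powr_ball:
  fixes s :: real
  assumes s: "0 < s" "s < real DIM('a::euclidean_space)"
  obtains K where "K > 0" "\<And>R. R \<ge> 0 \<Longrightarrow> (\<integral>\<^sup>+x. indicator (cball (0::'a) R) x * ennreal (norm x powr (- s)) \<partial>lborel) \<le> ennreal (K * R powr (real DIM('a) - s))"
proof -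
  let ?d = "real DIM('a)"
  define w where "w = unit_ball_vol ?d"
  have w: "w > 0" by (simp add: w_def)
  define K where "K = w * s * (1 / (?d - s) + 1 / s)"
  have K: "K > 0" using w s by (simp add: K_def add_pos_pos)
  have "(\<integral>\<^sup>+x. indicator (cball (0::'a) R) x * ennreal (norm x powr (- s)) \<partial>lborel) \<le> ennreal (K * R powr (?d - s))" if R: "R > 0" for R
  proof -
    have "(\<integral>\<^sup>+x. indicator (cball (0::'a) R) x * ennreal (norm x powr (- s)) \<partial>lborel)
      = (\<integral>\<^sup>+v. ennreal (s * v powr (- s - 1)) * (indicator {0<..} v * emeasure lborel (cball (0::'a) R \<inter> cball 0 v)) \<partial>lborel)"
      by (rule nn_integral_norm_powr_layer_cake) (use s in auto)
    also have "\<dots> \<le> (\<integral>\<^sup>+v. ennreal (w * s) * ennreal (indicator {0..R} v * v powr ((?d - s) - 1)) + ennreal (w * s * R powr ?d) * ennreal (indicator {R..} v * v powr (- s - 1)) \<partial>lborel)"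
    proof (rule nn_integral_mono)
      fix v :: real
      show "ennreal (s * v powr (- s - 1)) * (indicator {0<..} v * emeasure lborel (cball (0::'a) R \<inter> cball 0 v))
        \<le> ennreal (w * s) * ennreal (indicator {0..R} v * v powr ((?d - s) - 1)) + ennreal (w * s * R powr ?d) * ennreal (indicator {R..} v * v powr (- s - 1))"
      proof (cases "v > 0")
        case v: True
        show ?thesis
        proof (cases "v \<le> R")
          case True
          have "ennreal (s * v powr (- s - 1)) * (indicator {0<..} v * emeasure lborel (cball (0::'a) R \<inter> cball 0 v))
            \<le> ennreal (s * v powr (- s - 1)) * emeasure lborel (cball (0::'a) v)"
            using v by (intro mult_left_mono) (auto intro: emeasure_mono)
          also have "\<dots> = ennreal (s * v powr (- s - 1)) * ennreal (w * v ^ DIM('a))" using v by (simp add: emeasure_cball w_def)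
          also have "\<dots> = ennreal (w * s) * ennreal (indicator {0..R} v * v powr ((?d - s) - 1))"
            using v True s w by (simp add: powr_diff powr_minus powr_realpow powr_add field_simps flip: ennreal_mult)
          finally show ?thesis by (rule add_increasing2[rotated]) simp
        next
          case False
          have "ennreal (s * v powr (- s - 1)) * (indicator {0<..} v * emeasure lborel (cball (0::'a) R \<inter> cball 0 v))
            \<le> ennreal (s * v powr (- s - 1)) * emeasure lborel (cball (0::'a) R)"
            using v by (intro mult_left_mono) (auto intro: emeasure_mono)
          also have "\<dots> = ennreal (s * v powr (- s - 1)) * ennreal (w * R ^ DIM('a))" using R by (simp add: emeasure_cball w_def)
          also have "\<dots> = ennreal (w * s * R powr ?d) * ennreal (indicator {R..} v * v powr (- s - 1))"
            using False R s w by (simp add: powr_realpow mult_ac flip: ennreal_mult)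
          finally show ?thesis by (rule add_increasing[rotated]) simp
        qed
      qed simp
    qed
    also have "\<dots> = ennreal (w * s) * ennreal (R powr (?d - s) / (?d - s)) + ennreal (w * s * R powr ?d) * ennreal (R powr (- s) / s)"
      using s R nn_integral_powr_from_0[of "?d - s" R] nn_integral_powr_to_inf[of s R]
      by (subst nn_integral_add) (auto simp: nn_integral_cmult)
    also have "\<dots> = ennreal (w * s * (R powr (?d - s) / (?d - s)) + (w * s * R powr ?d) * (R powr (- s) / s))"
      using w s by (simp flip: ennreal_mult ennreal_plus)
    also have "(w * s * (R powr (?d - s) / (?d - s)) + (w * s * R powr ?d) * (R powr (- s) / s)) = K * R powr (?d - s)"
    proof -
      have e: "R powr ?d * R powr (- s) = R powr (?d - s)" by (simp flip: powr_add)
      have "(w * s * (R powr (?d - s) / (?d - s)) + (w * s * R powr ?d) * (R powr (- s) / s)) = w * s * (R powr (?d - s) / (?d - s) + (R powr ?d * R powr (- s)) / s)"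
        by (simp add: algebra_simps)
      then show ?thesis unfolding e K_def by (simp add: algebra_simps)
    qed
    finally show ?thesis .
  qed
  moreover have "(\<integral>\<^sup>+x. indicator (cball (0::'a) 0) x * ennreal (norm x powr (- s)) \<partial>lborel) = 0"
    by (subst nn_integral_0_iff_AE) (auto simp: indicator_def)
  ultimately show ?thesis using that[OF K] by (metis less_eq_real_def zero_le)
qed

lemma nn_integral_norm_powr_outside:
  fixes s :: real
  assumes s: "real DIM('a::euclidean_space) < s"
  obtains K where "K > 0" "\<And>R. R > 0 \<Longrightarrow> (\<integral>\<^sup>+x. indicator {x::'a. R \<le> norm x} x * ennreal (norm x powr (- s)) \<partial>lborel) \<le> ennreal (K * R powr (real DIM('a) - s))"
proof -
  let ?d = "real DIM('a)"
  have s0: "s > 0" using s of_nat_0_le_iff[of "DIM('a)"] by linarith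
  define w where "w = unit_ball_vol ?d"
  have w: "w > 0" by (simp add: w_def)
  define K where "K = w * s / (s - ?d)"
  have K: "K > 0" using w s s0 by (simp add: K_def)
  have "(\<integral>\<^sup>+x. indicator {x::'a. R \<le> norm x} x * ennreal (norm x powr (- s)) \<partial>lborel) \<le> ennreal (K * R powr (?d - s))" if R: "R > 0" for R
  proof -
    have "(\<integral>\<^sup>+x. indicator {x::'a. R \<le> norm x} x * ennreal (norm x powr (- s)) \<partial>lborel)
      = (\<integral>\<^sup>+v. ennreal (s * v powr (- s - 1)) * (indicator {0<..} v * emeasure lborel ({x::'a. R \<le> norm x} \<inter> cball 0 v)) \<partial>lborel)"
      by (rule nn_integral_norm_powr_layer_cake[OF s0]) measurable
    also have "\<dots> \<le> (\<integral>\<^sup>+v. ennreal (w * s) * ennreal (indicator {R..} v * v powr (- (s - ?d) - 1)) \<partial>lborel)"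
    proof (rule nn_integral_mono)
      fix v :: real
      show "ennreal (s * v powr (- s - 1)) * (indicator {0<..} v * emeasure lborel ({x::'a. R \<le> norm x} \<inter> cball 0 v))
        \<le> ennreal (w * s) * ennreal (indicator {R..} v * v powr (- (s - ?d) - 1))"
      proof (cases "v \<ge> R")
        case True
        then have v: "v > 0" using R by simp
        have "ennreal (s * v powr (- s - 1)) * (indicator {0<..} v * emeasure lborel ({x::'a. R \<le> norm x} \<inter> cball 0 v))
            \<le> ennreal (s * v powr (- s - 1)) * emeasure lborel (cball (0::'a) v)"
          using v by (intro mult_left_mono) (auto intro: emeasure_mono)
        also have "\<dots> = ennreal (s * v powr (- s - 1)) * ennreal (w * v ^ DIM('a))" using v by (simp add: emeasure_cball w_def)
        also have "\<dots> = ennreal (w * s) * ennreal (indicator {R..} v * v powr (- (s - ?d) - 1))"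
          using v True s0 w by (simp add: powr_diff powr_minus powr_realpow powr_add field_simps flip: ennreal_mult)
        finally show ?thesis .
      next
        case False
        then have "{x::'a. R \<le> norm x} \<inter> cball 0 v = {}" by auto
        then show ?thesis by simp
      qed
    qed
    also have "\<dots> = ennreal (w * s) * ennreal (R powr (- (s - ?d)) / (s - ?d))"
      using s R nn_integral_powr_to_inf[of "s - ?d" R] by (subst nn_integral_cmult) auto
    also have "\<dots> = ennreal (K * R powr (?d - s))" using s s0 w by (simp add: K_def flip: ennreal_mult)
    finally show ?thesis .
  qed
  with that[OF K] show ?thesis by blast
qed

section \<open>Inequalities for the profile \<open>sbound\<close>\<close>

lemma sbound_pos: "t > 0 \<Longrightarrow> 0 < sbound \<alpha> t x"
  by (simp add: sbound_def)

lemma sbound_minus [simp]: "sbound \<alpha> t (- x) = sbound \<alpha> t x"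
  by (simp add: sbound_def)

lemma sbound_minus_commute: "sbound \<alpha> t (x - y) = sbound \<alpha> t (y - x)"
  by (metis minus_diff_eq sbound_minus)

lemma sbound_le1: "sbound \<alpha> t (x::'a::euclidean_space) \<le> t powr (- real DIM('a) / \<alpha>)"
  by (simp add: sbound_def)

lemma sbound_le2: "x \<noteq> 0 \<Longrightarrow> sbound \<alpha> t (x::'a::euclidean_space) \<le> t / norm x powr (real DIM('a) + \<alpha>)"
  by (simp add: sbound_def)

lemma sbound_geI:
  fixes x :: "'a::euclidean_space"
  assumes "c \<le> t powr (- real DIM('a) / \<alpha>)" "x \<noteq> 0 \<Longrightarrow> c \<le> t / norm x powr (real DIM('a) + \<alpha>)"
  shows "c \<le> sbound \<alpha> t x"
  using assms by (simp add: sbound_def)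

text \<open>At fixed \<open>x\<close> the profile is largest when
  \<open>t powr (1 / \<alpha>)\<close> is comparable to \<open>|x|\<close>. The resulting bound is
  uniform in time, which the negative moments below rely on.\<close>

lemma sbound_le3:
  fixes x :: "'a::euclidean_space"
  assumes "x \<noteq> 0" "t > 0" "\<alpha> > 0"
  shows "sbound \<alpha> t x \<le> norm x powr (- real DIM('a))"
proof (cases "norm x \<le> t powr (1 / \<alpha>)")
  case True
  have "sbound \<alpha> t x \<le> (t powr (1 / \<alpha>)) powr (- real DIM('a))" using sbound_le1[of \<alpha> t x] by (simp add: powr_powr)
  also have "\<dots> \<le> norm x powr (- real DIM('a))" using True assms by (intro powr_mono2') auto
  finally show ?thesis .
next
  case False
  have "t = (t powr (1 / \<alpha>)) powr \<alpha>" using assms by (simp add: powr_powr)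
  also have "\<dots> \<le> norm x powr \<alpha>" using False assms by (intro powr_mono2) auto
  finally have "t / norm x powr (real DIM('a) + \<alpha>) \<le> norm x powr \<alpha> / norm x powr (real DIM('a) + \<alpha>)"
    by (intro divide_right_mono) auto
  also have "\<dots> = norm x powr (- real DIM('a))" using assms by (simp add: powr_diff[symmetric])
  finally show ?thesis using sbound_le2[OF assms(1), of \<alpha> t] by simp
qed

text \<open>\<open>m\<close> bounds the ratio of the times in both directions. The profile decreases
  in the norm, so for the space variables one inequality, \<open>|y| \<le> k * |x|\<close>, is the
  right hypothesis.\<close>

lemma sbound_compare:
  fixes x y :: "'a::euclidean_space"
  assumes "\<alpha> > 0" "s > 0" "t > 0" "m \<ge> 1" "k \<ge> 1" "s \<le> m * t" "t \<le> m * s" "norm y \<le> k * norm x"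
  shows "sbound \<alpha> s x \<le> (m powr (1 + real DIM('a) / \<alpha>) * k powr (real DIM('a) + \<alpha>)) * sbound \<alpha> t y"
proof -
  let ?d = "real DIM('a)"
  let ?K = "m powr (1 + ?d / \<alpha>) * k powr (?d + \<alpha>)"
  have m1: "m powr (1 + ?d / \<alpha>) = m * m powr (?d / \<alpha>)" using assms by (simp add: powr_add)
  have mg: "1 \<le> m powr (?d / \<alpha>)" using assms by (intro ge_one_powr_ge_zero) auto
  have kg: "1 \<le> k powr (?d + \<alpha>)" using assms by (intro ge_one_powr_ge_zero) auto
  have K1: "m powr (?d / \<alpha>) \<le> ?K"
  proof -
    have "1 * m powr (?d / \<alpha>) * 1 \<le> m * m powr (?d / \<alpha>) * k powr (?d + \<alpha>)"
      using assms kg by (intro mult_mono) auto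
    then show ?thesis by (simp add: m1)
  qed
  have K2: "m * k powr (?d + \<alpha>) \<le> ?K"
  proof -
    have "m * 1 * k powr (?d + \<alpha>) \<le> m * m powr (?d / \<alpha>) * k powr (?d + \<alpha>)"
      using assms mg by (intro mult_mono) auto
    then show ?thesis by (simp add: m1)
  qed
  have K: "?K > 0" using assms by simp
  have "sbound \<alpha> s x / ?K \<le> sbound \<alpha> t y"
  proof (rule sbound_geI)
    have "sbound \<alpha> s x \<le> s powr (- ?d / \<alpha>)" by (rule sbound_le1)
    also have "\<dots> \<le> (t / m) powr (- ?d / \<alpha>)"
      using assms by (intro powr_mono2') (auto simp: field_simps)
    also have "\<dots> = m powr (?d / \<alpha>) * t powr (- ?d / \<alpha>)" using assms by (simp add: powr_divide powr_minus field_simps)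
    also have "\<dots> \<le> ?K * t powr (- ?d / \<alpha>)" using K1 by (intro mult_right_mono) auto
    finally show "sbound \<alpha> s x / ?K \<le> t powr (- ?d / \<alpha>)" using K by (simp add: field_simps)
  next
    assume y: "y \<noteq> 0"
    then have x: "x \<noteq> 0" using assms by auto
    have "sbound \<alpha> s x \<le> s / norm x powr (?d + \<alpha>)" by (rule sbound_le2[OF x])
    also have "\<dots> \<le> (m * t) / (norm y / k) powr (?d + \<alpha>)"
      using assms y by (intro frac_le powr_mono2) (auto simp: field_simps)
    also have "\<dots> = (m * k powr (?d + \<alpha>)) * (t / norm y powr (?d + \<alpha>))"
      using assms by (simp add: powr_divide)
    also have "\<dots> \<le> ?K * (t / norm y powr (?d + \<alpha>))" using K2 assms by (intro mult_right_mono) auto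
    finally show "sbound \<alpha> s x / ?K \<le> t / norm y powr (?d + \<alpha>)" using K by (simp add: divide_le_eq mult.commute)
  qed
  then show ?thesis using K by (simp add: divide_le_eq mult.commute)
qed

text \<open>Of two times one is at least half the sum, and of two increments one is at least half as
  long as their sum. The corresponding factor of the minimum is already bounded by the profile at
  \<open>(s + t, x + y)\<close>.\<close>

lemma sbound_3P_min:
  fixes x y :: "'a::euclidean_space"
  assumes "\<alpha> > 0" "s > 0" "t > 0"
  shows "min (sbound \<alpha> s x) (sbound \<alpha> t y) \<le> 2 powr (real DIM('a) / \<alpha> + real DIM('a) + \<alpha>) * sbound \<alpha> (s + t) (x + y)"
proof -
  let ?d = "real DIM('a)"
  let ?K = "2 powr (?d / \<alpha> + ?d + \<alpha>) :: real"
  let ?m = "min (sbound \<alpha> s x) (sbound \<alpha> t y)"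
  have K: "?K > 0" by simp
  have K1: "2 powr (?d / \<alpha>) \<le> ?K" and K2: "2 powr (?d + \<alpha>) \<le> ?K" using assms by (auto intro!: powr_mono)
  have "?m / ?K \<le> sbound \<alpha> (s + t) (x + y)"
  proof (rule sbound_geI)
    have "?m \<le> max s t powr (- ?d / \<alpha>)"
      using sbound_le1[of \<alpha> s x] sbound_le1[of \<alpha> t y] by (auto simp: max_def min_def)
    also have "\<dots> \<le> ((s + t) / 2) powr (- ?d / \<alpha>)" using assms by (intro powr_mono2') (auto simp: max_def)
    also have "\<dots> = 2 powr (?d / \<alpha>) * (s + t) powr (- ?d / \<alpha>)" using assms by (simp add: powr_divide powr_minus field_simps)
    also have "\<dots> \<le> ?K * (s + t) powr (- ?d / \<alpha>)" using K1 by (intro mult_right_mono) auto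
    finally show "?m / ?K \<le> (s + t) powr (- ?d / \<alpha>)" using K by (simp add: divide_le_eq mult.commute)
  next
    assume xy: "x + y \<noteq> 0"
    have tri: "norm (x + y) \<le> norm x + norm y" by (rule norm_triangle_ineq)
    have "?m \<le> (s + t) / (norm (x + y) / 2) powr (?d + \<alpha>)"
    proof (cases "norm (x + y) / 2 \<le> norm x")
      case True
      then have x: "x \<noteq> 0" using xy by auto
      have "?m \<le> s / norm x powr (?d + \<alpha>)" using sbound_le2[OF x, of \<alpha> s] by simp
      also have "\<dots> \<le> (s + t) / (norm (x + y) / 2) powr (?d + \<alpha>)"
        using assms True xy by (intro frac_le powr_mono2) auto
      finally show ?thesis .
    next
      case False
      then have F: "norm (x + y) / 2 \<le> norm y" using tri by linarith
      then have y: "y \<noteq> 0" using xy by auto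
      have "?m \<le> t / norm y powr (?d + \<alpha>)" using sbound_le2[OF y, of \<alpha> t] by simp
      also have "\<dots> \<le> (s + t) / (norm (x + y) / 2) powr (?d + \<alpha>)"
        using assms F xy by (intro frac_le powr_mono2) auto
      finally show ?thesis .
    qed
    also have "\<dots> = 2 powr (?d + \<alpha>) * ((s + t) / norm (x + y) powr (?d + \<alpha>))" by (simp add: powr_divide)
    also have "\<dots> \<le> ?K * ((s + t) / norm (x + y) powr (?d + \<alpha>))" using K2 assms by (intro mult_right_mono) auto
    finally show "?m / ?K \<le> (s + t) / norm (x + y) powr (?d + \<alpha>)" using K by (simp add: divide_le_eq mult.commute)
  qed
  then show ?thesis using K by (simp add: divide_le_eq mult.commute)
qed

text \<open>The product is the minimum times the maximum, and the maximum is at most the sum. This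
  takes the place of bridge estimates: after it, one of the two kernels can be integrated
  out.\<close>

lemma sbound_3P:
  fixes x y :: "'a::euclidean_space"
  assumes "\<alpha> > 0" "s > 0" "t > 0"
  shows "sbound \<alpha> s x * sbound \<alpha> t y \<le>
    2 powr (real DIM('a) / \<alpha> + real DIM('a) + \<alpha>) * sbound \<alpha> (s + t) (x + y) * (sbound \<alpha> s x + sbound \<alpha> t y)"
proof -
  have p: "sbound \<alpha> s x > 0" "sbound \<alpha> t y > 0" using assms by (auto simp: sbound_pos)
  have "sbound \<alpha> s x * sbound \<alpha> t y \<le> min (sbound \<alpha> s x) (sbound \<alpha> t y) * (sbound \<alpha> s x + sbound \<alpha> t y)"
    using p by (auto simp: min_def algebra_simps)
  also have "\<dots> \<le> 2 powr (real DIM('a) / \<alpha> + real DIM('a) + \<alpha>) * sbound \<alpha> (s + t) (x + y) * (sbound \<alpha> s x + sbound \<alpha> t y)"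
    using sbound_3P_min[OF assms, of x y] p by (intro mult_right_mono) auto
  finally show ?thesis .
qed

lemma nn_integral_lincomb:
  assumes [measurable]: "f \<in> borel_measurable M" "g \<in> borel_measurable M"
  shows "(\<integral>\<^sup>+z. a * f z + b * g z \<partial>M) = a * (\<integral>\<^sup>+z. f z \<partial>M) + b * (\<integral>\<^sup>+z. g z \<partial>M)"
  by (simp add: nn_integral_add nn_integral_cmult)

section \<open>Moments of a density comparable to \<open>sbound\<close>\<close>

locale stable_kernel =
  fixes \<alpha> C0 :: real and p :: "real \<Rightarrow> 'a::euclidean_space \<Rightarrow> real"
  assumes alpha: "0 < \<alpha>" "\<alpha> < 2" "\<alpha> < real DIM('a)"
    and C0: "C0 \<ge> 1"
    and p_lower: "\<And>t x. t > 0 \<Longrightarrow> sbound \<alpha> t x / C0 \<le> p t x"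
    and p_upper: "\<And>t x. t > 0 \<Longrightarrow> p t x \<le> C0 * sbound \<alpha> t x"
    and p_cont: "continuous_on ({0<..} \<times> UNIV) (\<lambda>(t, x). p t x)"
    and p_minus: "\<And>t x. p t (- x) = p t x"
    and p_char: "\<And>t xi. t > 0 \<Longrightarrow> (LINT y|lborel. complex_of_real (p t y) * cis (xi \<bullet> y)) = exp (- t * norm xi powr \<alpha>)"
begin

abbreviation S :: "real \<Rightarrow> 'a \<Rightarrow> real" where "S \<equiv> sbound \<alpha>"

lemma d_ge1: "real DIM('a) \<ge> 1" using DIM_positive[where 'a='a] by linarith

lemma p_pos: "t > 0 \<Longrightarrow> p t x > 0"
  using p_lower[of t x] sbound_pos[of t \<alpha> x] C0 by (smt (verit) divide_pos_pos)

lemma S_le_p: "t > 0 \<Longrightarrow> S t x \<le> C0 * p t x"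
  using p_lower[of t x] C0 by (simp add: divide_le_eq mult.commute)

lemma p_commute: "p t (x - y) = p t (y - x)"
  by (metis minus_diff_eq p_minus)

lemma continuous_p: "t > 0 \<Longrightarrow> continuous_on UNIV (p t)"
  using continuous_on_compose2[OF p_cont, of UNIV "\<lambda>x. (t, x)"] continuous_on_Pair[OF continuous_on_const continuous_on_id]
  by auto

lemma p_meas: "t > 0 \<Longrightarrow> p t \<in> borel_measurable borel"
  using continuous_p by (rule borel_measurable_continuous_onI)

text \<open>The Bochner integral of a non-integrable function is 0 by convention, whereas
  \<open>p_char\<close> at \<open>xi = 0\<close> gives the value 1.\<close>

lemma integrable_p: "t > 0 \<Longrightarrow> integrable lborel (p t)"
proof (rule ccontr)
  assume t: "t > 0" and n: "\<not> integrable lborel (p t)"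
  then have "\<not> integrable lborel (\<lambda>y. complex_of_real (p t y))" by (simp add: complex_of_real_integrable_eq)
  then have "(LINT y|lborel. complex_of_real (p t y)) = 0" by (rule not_integrable_integral_eq)
  then show False using p_char[OF t, of 0] alpha by simp
qed

lemma integral_p: "t > 0 \<Longrightarrow> (LINT y|lborel. p t y) = 1"
  using p_char[of t 0] alpha by simp

lemma nn_integral_p: "t > 0 \<Longrightarrow> (\<integral>\<^sup>+y. ennreal (p t y) \<partial>lborel) = 1"
  using integrable_p integral_p p_pos by (subst nn_integral_eq_integral) (auto intro!: AE_I2 less_imp_le)

lemma nn_integral_translate:
  fixes f :: "'a \<Rightarrow> ennreal"
  assumes [measurable]: "f \<in> borel_measurable borel"
  shows "(\<integral>\<^sup>+z. f z \<partial>lborel) = (\<integral>\<^sup>+z. f (x + z) \<partial>lborel)"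
  using nn_integral_lborel_affine[of f 1 x] by simp

lemma nn_integral_p_translate: "t > 0 \<Longrightarrow> (\<integral>\<^sup>+y. ennreal (p t (y - x)) \<partial>lborel) = 1"
  using nn_integral_translate[of "\<lambda>y. ennreal (p t (y - x))" x] nn_integral_p p_meas[of t, measurable] by simp

lemma p_le2: "t > 0 \<Longrightarrow> x \<noteq> 0 \<Longrightarrow> p t x \<le> C0 * (t / norm x powr (real DIM('a) + \<alpha>))"
  using p_upper[of t x] mult_left_mono[OF sbound_le2[of x \<alpha> t], of C0] C0 by linarith

lemma p_le3: "t > 0 \<Longrightarrow> x \<noteq> 0 \<Longrightarrow> p t x \<le> C0 * norm x powr (- real DIM('a))"
  by (rule order_trans[OF p_upper mult_left_mono[OF sbound_le3]]) (use alpha C0 in auto)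

text \<open>Inside the radius \<open>t powr (1 / \<alpha>)\<close> the total mass 1 suffices;
  outside, the tail \<open>t / |z| powr (d + \<alpha>)\<close> is integrable against
  \<open>|z| powr \<delta>\<close> exactly because \<open>\<delta> < \<alpha>\<close>.\<close>

lemma p_moment:
  assumes del: "0 < \<delta>" "\<delta> < \<alpha>"
  obtains K where "K > 0" "\<And>t. t > 0 \<Longrightarrow> (\<integral>\<^sup>+z. ennreal (p t z * norm z powr \<delta>) \<partial>lborel) \<le> ennreal (K * t powr (\<delta> / \<alpha>))"
proof -
  have *: "real DIM('a) < real DIM('a) + \<alpha> - \<delta>" using del by simp
  obtain K1 where K1: "K1 > 0" "\<And>R. R > 0 \<Longrightarrow> (\<integral>\<^sup>+x. indicator {x::'a. R \<le> norm x} x * ennreal (norm x powr (- (real DIM('a) + \<alpha> - \<delta>))) \<partial>lborel) \<le> ennreal (K1 * R powr (real DIM('a) - (real DIM('a) + \<alpha> - \<delta>)))"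
    by (rule nn_integral_norm_powr_outside[OF *]) (rule that)
  have "(\<integral>\<^sup>+z. ennreal (p t z * norm z powr \<delta>) \<partial>lborel) \<le> ennreal ((1 + C0 * K1) * t powr (\<delta> / \<alpha>))" if t: "t > 0" for t
  proof -
    note [measurable] = p_meas[OF t]
    let ?R = "t powr (1 / \<alpha>)"
    have R: "?R > 0" using t by simp
    have R\<delta>: "?R powr \<delta> = t powr (\<delta> / \<alpha>)" by (simp add: powr_powr)
    have "(\<integral>\<^sup>+z. ennreal (p t z * norm z powr \<delta>) \<partial>lborel) \<le> (\<integral>\<^sup>+z. ennreal (t powr (\<delta> / \<alpha>)) * ennreal (p t z) + ennreal (C0 * t) * (indicator {x::'a. ?R \<le> norm x} z * ennreal (norm z powr (- (real DIM('a) + \<alpha> - \<delta>)))) \<partial>lborel)"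
    proof (rule nn_integral_mono)
      fix z :: 'a
      show "ennreal (p t z * norm z powr \<delta>) \<le> ennreal (t powr (\<delta> / \<alpha>)) * ennreal (p t z) + ennreal (C0 * t) * (indicator {x::'a. ?R \<le> norm x} z * ennreal (norm z powr (- (real DIM('a) + \<alpha> - \<delta>))))"
      proof (cases "norm z \<le> ?R")
        case True
        have "norm z powr \<delta> \<le> ?R powr \<delta>" using True del by (intro powr_mono2) auto
        then have "p t z * norm z powr \<delta> \<le> t powr (\<delta> / \<alpha>) * p t z" using p_pos[OF t, of z] R\<delta> by (simp add: mult.commute)
        then have "ennreal (p t z * norm z powr \<delta>) \<le> ennreal (t powr (\<delta> / \<alpha>)) * ennreal (p t z)"
          using p_pos[OF t, of z] by (simp flip: ennreal_mult)
        then show ?thesis by (rule add_increasing2[rotated]) simp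
      next
        case False
        then have z: "z \<noteq> 0" using R by auto
        have "p t z * norm z powr \<delta> \<le> (C0 * (t / norm z powr (real DIM('a) + \<alpha>))) * norm z powr \<delta>"
          by (intro mult_right_mono p_le2[OF t z]) simp
        also have "\<dots> = (C0 * t) * norm z powr (- (real DIM('a) + \<alpha> - \<delta>))" using z by (simp add: powr_diff powr_minus powr_add field_simps)
        finally have "ennreal (p t z * norm z powr \<delta>) \<le> ennreal (C0 * t) * (indicator {x::'a. ?R \<le> norm x} z * ennreal (norm z powr (- (real DIM('a) + \<alpha> - \<delta>))))"
          using False C0 t by (simp add: ennreal_leI flip: ennreal_mult)
        then show ?thesis by (rule add_increasing[rotated]) simp
      qed
    qed
    also have "\<dots> = ennreal (t powr (\<delta> / \<alpha>)) + ennreal (C0 * t) * (\<integral>\<^sup>+z. (indicator {x::'a. ?R \<le> norm x} z * ennreal (norm z powr (- (real DIM('a) + \<alpha> - \<delta>)))) \<partial>lborel)"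
      by (subst nn_integral_lincomb) (simp_all add: nn_integral_p[OF t])
    also have "\<dots> \<le> ennreal (t powr (\<delta> / \<alpha>)) + ennreal (C0 * t) * ennreal (K1 * ?R powr (real DIM('a) - (real DIM('a) + \<alpha> - \<delta>)))"
      by (intro add_left_mono mult_left_mono K1 R) simp
    also have "\<dots> = ennreal ((1 + C0 * K1) * t powr (\<delta> / \<alpha>))"
    proof -
      have "?R powr (real DIM('a) - (real DIM('a) + \<alpha> - \<delta>)) = t powr (\<delta> / \<alpha> - 1)" using alpha by (simp add: powr_powr diff_divide_distrib)
      also have "\<dots> = t powr (\<delta> / \<alpha>) / t" using t by (simp add: powr_diff)
      finally show ?thesis using t C0 K1(1) by (simp add: algebra_simps flip: ennreal_mult ennreal_plus)
    qed
    finally show ?thesis .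
  qed
  with that[of "1 + C0 * K1"] K1(1) C0 show ?thesis by (simp add: add_pos_nonneg)
qed

text \<open>Split at \<open>|z| = |x| / 2\<close>. Outside, the singular factor is bounded; inside,
  \<open>|z - x| \<ge> |x| / 2\<close>, and the time-uniform bound \<open>p_le3\<close> makes the
  constant independent of \<open>t\<close>.\<close>

lemma p_neg_moment:
  assumes b: "0 < \<beta>" "\<beta> < real DIM('a)"
  obtains K where "K > 0" "\<And>t x. t > 0 \<Longrightarrow> x \<noteq> 0 \<Longrightarrow> (\<integral>\<^sup>+z. ennreal (p t (z - x) * norm z powr (- \<beta>)) \<partial>lborel) \<le> ennreal (K * norm x powr (- \<beta>))"
proof -
  obtain K1 where K1: "K1 > 0" "\<And>R. R \<ge> 0 \<Longrightarrow> (\<integral>\<^sup>+x. indicator (cball (0::'a) R) x * ennreal (norm x powr (- \<beta>)) \<partial>lborel) \<le> ennreal (K1 * R powr (real DIM('a) - \<beta>))"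
    by (rule nn_integral_norm_powr_ball[OF b]) (rule that)
  have "(\<integral>\<^sup>+z. ennreal (p t (z - x) * norm z powr (- \<beta>)) \<partial>lborel) \<le> ennreal ((2 powr \<beta> + C0 * 2 powr \<beta> * K1) * norm x powr (- \<beta>))"
    if t: "t > 0" and x: "x \<noteq> 0" for t x
  proof -
    note [measurable] = p_meas[OF t]
    let ?R = "norm x / 2"
    have [measurable]: "cball (0::'a) ?R \<in> sets borel" by (simp add: borel_closed)
    have R: "?R > 0" using x by simp
    have "(\<integral>\<^sup>+z. ennreal (p t (z - x) * norm z powr (- \<beta>)) \<partial>lborel) \<le>
      (\<integral>\<^sup>+z. ennreal (?R powr (- \<beta>)) * ennreal (p t (z - x)) + ennreal (C0 * ?R powr (- real DIM('a))) * (indicator (cball (0::'a) ?R) z * ennreal (norm z powr (- \<beta>))) \<partial>lborel)"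
    proof (rule nn_integral_mono)
      fix z :: 'a
      show "ennreal (p t (z - x) * norm z powr (- \<beta>)) \<le> ennreal (?R powr (- \<beta>)) * ennreal (p t (z - x)) + ennreal (C0 * ?R powr (- real DIM('a))) * (indicator (cball (0::'a) ?R) z * ennreal (norm z powr (- \<beta>)))"
      proof (cases "norm z \<le> ?R")
        case False
        have "norm z powr (- \<beta>) \<le> ?R powr (- \<beta>)" using False b R by (intro powr_mono2') auto
        then have "p t (z - x) * norm z powr (- \<beta>) \<le> ?R powr (- \<beta>) * p t (z - x)" using p_pos[OF t, of "z - x"] by (simp add: mult.commute)
        then have "ennreal (p t (z - x) * norm z powr (- \<beta>)) \<le> ennreal (?R powr (- \<beta>)) * ennreal (p t (z - x))"
          using p_pos[OF t, of "z - x"] by (simp flip: ennreal_mult)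
        then show ?thesis by (rule add_increasing2[rotated]) simp
      next
        case True
        have zx: "norm (z - x) \<ge> ?R" using True norm_triangle_ineq2[of x z] by (simp add: norm_minus_commute)
        then have "z - x \<noteq> 0" using R by auto
        then have "p t (z - x) \<le> C0 * norm (z - x) powr (- real DIM('a))" using p_le3[OF t] by blast
        also have "\<dots> \<le> C0 * ?R powr (- real DIM('a))" using zx R C0 by (intro mult_left_mono powr_mono2') auto
        finally have "p t (z - x) * norm z powr (- \<beta>) \<le> (C0 * ?R powr (- real DIM('a))) * norm z powr (- \<beta>)" by (intro mult_right_mono) auto
        then have "ennreal (p t (z - x) * norm z powr (- \<beta>)) \<le> ennreal (C0 * ?R powr (- real DIM('a))) * (indicator (cball (0::'a) ?R) z * ennreal (norm z powr (- \<beta>)))"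
          using True C0 by (simp add: ennreal_leI flip: ennreal_mult)
        then show ?thesis by (rule add_increasing[rotated]) simp
      qed
    qed
    also have "\<dots> = ennreal (?R powr (- \<beta>)) + ennreal (C0 * ?R powr (- real DIM('a))) * (\<integral>\<^sup>+z. (indicator (cball (0::'a) ?R) z * ennreal (norm z powr (- \<beta>))) \<partial>lborel)"
      by (subst nn_integral_lincomb) (simp_all add: nn_integral_p_translate[OF t, of x])
    also have "\<dots> \<le> ennreal (?R powr (- \<beta>)) + ennreal (C0 * ?R powr (- real DIM('a))) * ennreal (K1 * ?R powr (real DIM('a) - \<beta>))"
      using R by (intro add_left_mono mult_left_mono K1) auto
    also have "\<dots> = ennreal (?R powr (- \<beta>) + C0 * K1 * (?R powr (- real DIM('a)) * ?R powr (real DIM('a) - \<beta>)))"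
      using C0 K1(1) by (simp add: mult_ac flip: ennreal_mult ennreal_plus)
    also have "?R powr (- real DIM('a)) * ?R powr (real DIM('a) - \<beta>) = ?R powr (- \<beta>)" by (simp flip: powr_add)
    also have "?R powr (- \<beta>) = 2 powr \<beta> * norm x powr (- \<beta>)" by (simp add: powr_divide powr_minus field_simps)
    finally show ?thesis by (simp add: algebra_simps)
  qed
  with that[of "2 powr \<beta> + C0 * 2 powr \<beta> * K1"] K1(1) C0 show ?thesis by (simp add: add_pos_nonneg)
qed

end

section \<open>The action of the stable semigroup on powers of the norm\<close>

lemma Gamma_neg_frac:
  fixes g :: real
  assumes "0 < g" "g < 1"
  shows "Gamma (1 - g) = - g * Gamma (- g)" "Gamma (- g) < 0"
proof -
  have "- g \<noteq> 0" using assms by simp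
  moreover have "- g \<notin> \<int>\<^sub>\<le>\<^sub>0"
  proof
    assume "- g \<in> \<int>\<^sub>\<le>\<^sub>0"
    then obtain n :: int where "- g = of_int n" by (auto elim!: nonpos_Ints_cases)
    then have "real_of_int n < 0" "real_of_int n > - 1" using assms by linarith+
    then have "n < 0" "n > - 1" by linarith+
    then show False by simp
  qed
  ultimately show 1: "Gamma (1 - g) = - g * Gamma (- g)" using Gamma_plus1[of "- g"] by simp
  have "Gamma (1 - g) > 0" using assms by simp
  then show "Gamma (- g) < 0" using 1 assms by (simp add: mult_less_0_iff)
qed

text \<open>At the negative argument \<open>- g\<close> the Gamma integral converges only after
  subtracting 1. It reduces to the convergent case at \<open>1 - g\<close> by writing
  \<open>1 - exp (- (r * v))\<close> as the integral of \<open>r * exp (- (u * r))\<close> over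
  \<open>u\<close> in \<open>[0, v]\<close>.\<close>

lemma nn_integral_Gamma_neg:
  fixes g v :: real
  assumes g: "0 < g" "g < 1" and v: "v \<ge> 0"
  shows "(\<integral>\<^sup>+r. ennreal (indicator {0..} r * (r powr (- g - 1) * (1 - exp (- (r * v))))) \<partial>lborel) = ennreal (- Gamma (- g) * v powr g)"
proof -
  have 1: "ennreal (indicator {0..} r * (r powr (- g - 1) * (1 - exp (- (r * v)))))
     = (\<integral>\<^sup>+u. ennreal (indicator {0..v} u * (indicator {0..} r * (r powr ((1 - g) - 1) * exp (- (u * r))))) \<partial>lborel)" for r
  proof (cases "r > 0")
    case r: True
    have "((\<lambda>u. r powr ((1 - g) - 1) * exp (- (u * r))) has_integral
       (- (r powr ((1 - g) - 1) * exp (- (v * r)) / r)) - (- (r powr ((1 - g) - 1) * exp (- (0 * r)) / r))) {0..v}"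
      by (rule fundamental_theorem_of_calculus[OF v])
         (use r in \<open>auto intro!: derivative_eq_intros simp flip: has_real_derivative_iff_has_vector_derivative\<close>)
    also have "(- (r powr ((1 - g) - 1) * exp (- (v * r)) / r)) - (- (r powr ((1 - g) - 1) * exp (- (0 * r)) / r)) = r powr (- g - 1) * (1 - exp (- (r * v)))"
      using r by (simp add: powr_diff powr_minus field_simps)
    finally have "((\<lambda>u. indicator {0..v} u * (r powr ((1 - g) - 1) * exp (- (u * r)))) has_integral (r powr (- g - 1) * (1 - exp (- (r * v))))) UNIV"
      by (subst (asm) has_integral_restrict_UNIV[symmetric], elim has_integral_eq[rotated]) (auto simp: indicator_def)
    then have "(\<integral>\<^sup>+u. ennreal (indicator {0..v} u * (r powr ((1 - g) - 1) * exp (- (u * r)))) \<partial>lborel) = ennreal (r powr (- g - 1) * (1 - exp (- (r * v))))"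
      by (intro nn_integral_has_integral_lborel) auto
    then show ?thesis using r by (simp add: indicator_def)
  next
    case False
    then show ?thesis by (cases "r = 0") auto
  qed
  have "(\<integral>\<^sup>+r. ennreal (indicator {0..} r * (r powr (- g - 1) * (1 - exp (- (r * v))))) \<partial>lborel)
    = (\<integral>\<^sup>+r. (\<integral>\<^sup>+u. ennreal (indicator {0..v} u * (indicator {0..} r * (r powr ((1 - g) - 1) * exp (- (u * r))))) \<partial>lborel) \<partial>lborel)"
    unfolding 1 ..
  also have "\<dots> = (\<integral>\<^sup>+u. (\<integral>\<^sup>+r. ennreal (indicator {0..v} u * (indicator {0..} r * (r powr ((1 - g) - 1) * exp (- (u * r))))) \<partial>lborel) \<partial>lborel)"
    by (rule lborel_pair.Fubini'[symmetric]) measurable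
  also have "\<dots> = (\<integral>\<^sup>+u. ennreal (Gamma (1 - g)) * ennreal (indicator {0..v} u * u powr (g - 1)) \<partial>lborel)"
  proof (rule nn_integral_cong_AE)
    have "AE u in lborel. u \<noteq> (0::real)" by (rule AE_lborel_singleton)
    then show "AE u in lborel. (\<integral>\<^sup>+r. ennreal (indicator {0..v} u * (indicator {0..} r * (r powr ((1 - g) - 1) * exp (- (u * r))))) \<partial>lborel) = ennreal (Gamma (1 - g)) * ennreal (indicator {0..v} u * u powr (g - 1))"
    proof eventually_elim
      case (elim u)
      show ?case
      proof (cases "u \<in> {0..v}")
        case True
        then have "u > 0" using elim by auto
        then show ?thesis using True nn_integral_Gamma_scaled[of "1 - g" u] g by (simp add: ennreal_mult')
      qed simp
    qed
  qed
  also have "\<dots> = ennreal (Gamma (1 - g)) * ennreal (v powr g / g)"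
    using nn_integral_powr_from_0[of g v] g v by (simp add: nn_integral_cmult)
  also have "\<dots> = ennreal (- Gamma (- g) * v powr g)"
    using g Gamma_neg_frac[OF g] by (subst ennreal_mult[symmetric]) (auto simp: mult_le_0_iff)
  finally show ?thesis .
qed

lemma nn_integral_inversion:
  fixes F :: "real \<Rightarrow> real"
  assumes [measurable]: "F \<in> borel_measurable borel" and F: "\<And>r. r > 0 \<Longrightarrow> 0 \<le> F r"
    and I: "(\<integral>\<^sup>+r. ennreal (indicator {0<..} r * F r) \<partial>lborel) = ennreal b" and b: "b \<ge> 0"
  shows "(\<integral>\<^sup>+r. ennreal (indicator {0<..} r * (F (1 / r) / r\<^sup>2)) \<partial>lborel) = ennreal b"
proof -
  let ?S = "{0<..} :: real set"
  have hb: "has_bochner_integral lborel (\<lambda>r. indicator ?S r * F r) b"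
    by (rule has_bochner_integral_nn_integral) (use I b F in \<open>auto simp: indicator_def\<close>)
  then have 1: "integrable lborel (\<lambda>r. indicator ?S r * F r)" and 2: "(LINT r|lborel. indicator ?S r * F r) = b"
    by (auto simp: has_bochner_integral_iff)
  have si: "set_integrable lborel ?S F" using 1 by (simp add: set_integrable_def)
  have ai: "F absolutely_integrable_on ?S" using 1 by (simp add: set_integrable_def integrable_completion)
  have ib: "integral ?S F = b"
    using set_borel_integral_eq_integral(2)[OF si] 2 by (simp add: set_lebesgue_integral_def)
  have img: "(\<lambda>r. 1 / r) ` ?S = ?S"
  proof safe
    fix x :: real assume "0 < x"
    then show "x \<in> (\<lambda>r. 1 / r) ` ?S" by (intro image_eqI[of _ _ "1 / x"]) auto
  qed auto
  have inj: "inj_on (\<lambda>r. 1 / r :: real) ?S" by (auto simp: inj_on_def)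
  have der: "((\<lambda>r. 1 / r) has_real_derivative - 1 / x\<^sup>2) (at x within ?S)" if "x \<in> ?S" for x
    using that by (auto intro!: derivative_eq_intros simp: power2_eq_square)
  have "(\<lambda>x. \<bar>- 1 / x\<^sup>2\<bar> * F (1 / x)) absolutely_integrable_on ?S \<and> integral ?S (\<lambda>x. \<bar>- 1 / x\<^sup>2\<bar> * F (1 / x)) = b"
    by (rule has_absolute_integral_change_of_variables_1'[OF _ der inj, THEN iffD2]) (use ai ib img in auto)
  then have "((\<lambda>x. \<bar>- 1 / x\<^sup>2\<bar> * F (1 / x)) has_integral b) ?S"
    using absolutely_integrable_on_def has_integral_integral set_lebesgue_integral_eq_integral(1) by blast
  then have "((\<lambda>r. indicator ?S r * (F (1 / r) / r\<^sup>2)) has_integral b) UNIV"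
    by (subst (asm) has_integral_restrict_UNIV[symmetric], elim has_integral_eq[rotated]) (auto simp: indicator_def)
  then show ?thesis by (intro nn_integral_has_integral_lborel) (use F in \<open>auto simp: indicator_def\<close>)
qed

text \<open>The substitution \<open>r -> 1 / r\<close> turns this into a Gamma integral: a Gaussian
  integrated over its time parameter is a Riesz kernel. Negative \<open>b\<close> is included
  because positive powers of the norm come from it.\<close>

lemma nn_integral_gauss_powr:
  fixes xi :: "'a::euclidean_space"
  assumes b: "b < real DIM('a) / 2" and xi: "xi \<noteq> 0"
  shows "(\<integral>\<^sup>+r. ennreal (indicator {0<..} r * (r powr (b - 1) * gauss r xi)) \<partial>lborel)
    = ennreal ((4 * pi) powr (- real DIM('a) / 2) * Gamma (real DIM('a) / 2 - b) * 2 powr (real DIM('a) - 2 * b) * norm xi powr (2 * b - real DIM('a)))"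
proof -
  let ?d = "real DIM('a)"
  let ?m = "?d / 2 - b"
  let ?w = "(norm xi)\<^sup>2 / 4"
  have m: "?m > 0" using b by simp
  have w: "?w > 0" using xi by simp
  let ?F = "\<lambda>r. r powr (?m - 1) * exp (- (?w * r))"
  let ?c = "(4 * pi) powr (- ?d / 2)"
  have G: "Gamma ?m > 0" using m by simp
  have "(\<integral>\<^sup>+r. ennreal (indicator {0<..} r * ?F r) \<partial>lborel) = (\<integral>\<^sup>+r. ennreal (indicator {0..} r * ?F r) \<partial>lborel)"
    by (rule nn_integral_cong) (auto simp: indicator_def)
  also have "\<dots> = ennreal (Gamma ?m * ?w powr (- ?m))" by (rule nn_integral_Gamma_scaled[OF m w])
  finally have inv: "(\<integral>\<^sup>+r. ennreal (indicator {0<..} r * (?F (1 / r) / r\<^sup>2)) \<partial>lborel) = ennreal (Gamma ?m * ?w powr (- ?m))"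
    using G by (intro nn_integral_inversion) auto
  have "(\<integral>\<^sup>+r. ennreal (indicator {0<..} r * (r powr (b - 1) * gauss r xi)) \<partial>lborel)
     = (\<integral>\<^sup>+r. ennreal ?c * ennreal (indicator {0<..} r * (?F (1 / r) / r\<^sup>2)) \<partial>lborel)"
  proof (rule nn_integral_cong)
    fix r :: real
    show "ennreal (indicator {0<..} r * (r powr (b - 1) * gauss r xi)) = ennreal ?c * ennreal (indicator {0<..} r * (?F (1 / r) / r\<^sup>2))"
    proof (cases "r > 0")
      case r: True
      have "(1 / r) powr (?m - 1) = r powr (1 - ?m)" using r by (simp add: powr_divide powr_minus_divide[symmetric])
      moreover have "(4 * pi * r) powr (- ?d / 2) = ?c * r powr (- ?d / 2)"
        using r by (simp add: powr_mult)
      moreover have "r powr (1 - ?m) / r\<^sup>2 = r powr (b - 1) * r powr (- ?d / 2)"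
      proof -
        have "r powr (1 - ?m) = r powr ((b - 1) + - ?d / 2 + 2)" by (rule arg_cong[where f="\<lambda>e. r powr e"]) simp
        also have "\<dots> = r powr (b - 1) * r powr (- ?d / 2) * r powr 2" using r by (simp only: powr_add)
        finally show ?thesis using r by simp
      qed
      moreover have "- (norm xi)\<^sup>2 / (4 * r) = - (?w * (1 / r))" using r by simp
      ultimately have "r powr (b - 1) * gauss r xi = ?c * (?F (1 / r) / r\<^sup>2)"
        unfolding gauss_def by (simp add: times_divide_eq_left[symmetric] del: times_divide_eq_left)
      then show ?thesis using r by (subst ennreal_mult[symmetric]) auto
    qed simp
  qed
  also have "\<dots> = ennreal ?c * ennreal (Gamma ?m * ?w powr (- ?m))"
    by (subst nn_integral_cmult, measurable) (simp only: inv)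
  also have "\<dots> = ennreal (?c * (Gamma ?m * ?w powr (- ?m)))"
    using G by (subst ennreal_mult[symmetric]) (auto intro!: mult_nonneg_nonneg)
  also have "?w powr (- ?m) = 2 powr (?d - 2 * b) * norm xi powr (2 * b - ?d)"
  proof -
    have "?w powr (- ?m) = ((norm xi / 2) powr 2) powr (- ?m)" using xi by (simp add: power_divide)
    also have "\<dots> = (norm xi / 2) powr (2 * b - ?d)" unfolding powr_powr by (simp add: algebra_simps)
    also have "\<dots> = norm xi powr (2 * b - ?d) / 2 powr (2 * b - ?d)" by (simp add: powr_divide)
    also have "\<dots> = 2 powr (?d - 2 * b) * norm xi powr (2 * b - ?d)" by (simp add: powr_diff mult_ac)
    finally show ?thesis .
  qed
  finally show ?thesis by (simp add: mult.assoc)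
qed


text \<open>Transfers a Fourier identity known for each Gaussian parameter \<open>r\<close> to
  powers of the norm: the weight \<open>r powr (b - 1)\<close> with
  \<open>b = (\<alpha> - \<delta>) / 2\<close> will produce
  \<open>|z| powr (\<delta> - \<alpha>)\<close>, and with \<open>b = - \<delta> / 2\<close> it will
  produce \<open>|z| powr \<delta>\<close>.\<close>

lemma gauss_mixture:
  fixes k :: "'a::euclidean_space \<Rightarrow> real"
  assumes b: "b < real DIM('a) / 2" and [measurable]: "k \<in> borel_measurable borel"
    and int: "integrable lborel (\<lambda>xi. k xi * norm xi powr (2 * b - real DIM('a)))"
  shows "(LINT r|lborel. indicator {0<..} r * (r powr (b - 1) * (LINT xi|lborel. gauss r xi * k xi)))
    = (4 * pi) powr (- real DIM('a) / 2) * Gamma (real DIM('a) / 2 - b) * 2 powr (real DIM('a) - 2 * b)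
        * (LINT xi|lborel. k xi * norm xi powr (2 * b - real DIM('a)))"
proof -
  let ?d = "real DIM('a)"
  let ?c = "(4 * pi) powr (- ?d / 2) * Gamma (?d / 2 - b) * 2 powr (?d - 2 * b)"
  have c: "?c > 0" using b by simp
  let ?w = "\<lambda>xi r. indicator {0<..} r * (r powr (b - 1) * gauss r (xi::'a))"
  have [measurable]: "(\<lambda>(xi, r). ?w xi r) \<in> borel_measurable (borel \<Otimes>\<^sub>M borel)"
    unfolding gauss_def by measurable
  have ae: "AE xi in lborel. xi \<noteq> (0::'a)" by (rule AE_lborel_singleton)
  have w: "has_bochner_integral lborel (?w xi) (?c * norm xi powr (2 * b - ?d))" if "xi \<noteq> 0" for xi
  proof (rule has_bochner_integral_nn_integral)
    show "(\<integral>\<^sup>+r. ennreal (?w xi r) \<partial>lborel) = ennreal (?c * norm xi powr (2 * b - ?d))"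
      using nn_integral_gauss_powr[OF b that] by simp
    show "?w xi \<in> borel_measurable lborel" unfolding gauss_def by measurable
  qed (use c in \<open>auto simp: indicator_def\<close>)
  let ?F = "\<lambda>(xi, r). k xi * ?w xi r"
  have F: "integrable (lborel \<Otimes>\<^sub>M lborel) ?F"
  proof (rule lborel_pair.Fubini_integrable)
    have "AE xi in lborel. ?c * \<bar>k xi * norm xi powr (2 * b - ?d)\<bar> = (LINT r|lborel. norm (?F (xi, r)))"
      using ae
    proof eventually_elim
      case (elim xi)
      have "(LINT r|lborel. norm (?F (xi, r))) = (LINT r|lborel. \<bar>k xi\<bar> * ?w xi r)"
        by (rule Bochner_Integration.integral_cong) (auto simp: abs_mult indicator_def)
      also have "\<dots> = \<bar>k xi\<bar> * (?c * norm xi powr (2 * b - ?d))"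
        using has_bochner_integral_integral_eq[OF w[OF elim]] by simp
      finally have "(LINT r|lborel. norm (?F (xi, r))) = \<bar>k xi\<bar> * (?c * norm xi powr (2 * b - ?d))" .
      moreover have "?c * \<bar>k xi * norm xi powr (2 * b - ?d)\<bar> = \<bar>k xi\<bar> * (?c * norm xi powr (2 * b - ?d))"
        by (simp add: abs_mult)
      ultimately show ?case by simp
    qed
    then show "integrable lborel (\<lambda>xi. LINT r|lborel. norm (?F (xi, r)))"
      by (intro integrable_cong_AE_imp[OF integrable_mult_right[OF integrable_abs[OF int], of ?c]]) auto
    show "AE xi in lborel. integrable lborel (\<lambda>r. ?F (xi, r))"
      using ae by eventually_elim (use w in \<open>auto simp: has_bochner_integral_iff\<close>)
  qed measurable
  have "(LINT r|lborel. indicator {0<..} r * (r powr (b - 1) * (LINT xi|lborel. gauss r xi * k xi))) = (LINT r|lborel. LINT xi|lborel. ?F (xi, r))"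
  proof (rule Bochner_Integration.integral_cong[OF refl])
    fix r :: real
    have "?F (xi, r) = (indicator {0<..} r * r powr (b - 1)) * (gauss r xi * k xi)" for xi by simp
    then show "indicator {0<..} r * (r powr (b - 1) * (LINT xi|lborel. gauss r xi * k xi)) = (LINT xi|lborel. ?F (xi, r))"
      by (simp only: integral_mult_right_zero mult.assoc)
  qed
  also have "\<dots> = (LINT xi|lborel. LINT r|lborel. ?F (xi, r))"
    using lborel_pair.Fubini_integral[OF F] by simp
  also have "\<dots> = (LINT xi|lborel. ?c * (k xi * norm xi powr (2 * b - ?d)))"
  proof (rule integral_cong_AE)
    show "AE xi in lborel. (LINT r|lborel. ?F (xi, r)) = ?c * (k xi * norm xi powr (2 * b - ?d))"
      using ae
    proof eventually_elim
      case (elim xi)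
      show ?case using has_bochner_integral_integral_eq[OF w[OF elim]] by simp
    qed
  qed measurable
  finally show ?thesis by simp
qed

section \<open>Fourier formulas for moments of the stable density\<close>

context stable_kernel
begin

text \<open>Parseval's identity: \<open>exp (- r * |z|^2)\<close> is the characteristic function of
  \<open>gauss r\<close>, and that of the shifted density is known from \<open>p_char\<close>.
  Taking real parts leaves the cosine.\<close>

lemma p_gauss_transform:
  assumes t: "t > 0" and r: "r > 0"
  shows "(LINT z|lborel. p t (z - x) * exp (- r * (norm z)\<^sup>2)) = (LINT xi|lborel. gauss r xi * (cos (x \<bullet> xi) * exp (- t * norm xi powr \<alpha>)))"
proof -
  note [measurable] = p_meas[OF t]
  let ?F = "\<lambda>(z, xi). complex_of_real (p t (z - x) * gauss r xi) * cis (z \<bullet> xi)"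
  have ip: "integrable lborel (\<lambda>z. p t (z - x))"
    using integrable_lborel_affine_iff[of "p t" 1 "- x"] integrable_p[OF t] by simp
  have m: "?F \<in> borel_measurable (lborel \<Otimes>\<^sub>M lborel)"
    unfolding cis_conv_exp by measurable
  have F: "integrable (lborel \<Otimes>\<^sub>M lborel) ?F"
  proof (rule lborel_pair.Fubini_integrable[OF m])
    have "(LINT xi|lborel. norm (?F (z, xi))) = p t (z - x)" for z
      using integral_gauss[OF r, where 'a='a] p_pos[OF t, of "z - x"] by (simp add: norm_mult)
    then show "integrable lborel (\<lambda>z. LINT xi|lborel. norm (?F (z, xi)))" using ip by simp
    have "integrable lborel (\<lambda>xi. ?F (z, xi))" for z
      using integrable_mult_right[OF integrable_gauss_cis[OF r, of z], of "complex_of_real (p t (z - x))"] by (simp add: mult.assoc)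
    then show "AE z in lborel. integrable lborel (\<lambda>xi. ?F (z, xi))" by simp
  qed
  have 1: "(LINT xi|lborel. ?F (z, xi)) = of_real (p t (z - x) * exp (- r * (norm z)\<^sup>2))" for z
  proof -
    have "(LINT xi|lborel. ?F (z, xi)) = (LINT xi|lborel. of_real (p t (z - x)) * (of_real (gauss r xi) * cis (z \<bullet> xi)))"
      by (simp add: mult.assoc)
    also have "\<dots> = of_real (p t (z - x)) * of_real (exp (- r * (norm z)\<^sup>2))"
      by (simp only: integral_mult_right_zero char_gauss[OF r, of z])
    finally show ?thesis by simp
  qed
  have 2: "(LINT z|lborel. ?F (z, xi)) = of_real (gauss r xi) * cis (x \<bullet> xi) * of_real (exp (- t * norm xi powr \<alpha>))" for xi
  proof -
    have "(LINT z|lborel. ?F (z, xi)) = (LINT z|lborel. ?F (x + 1 *\<^sub>R z, xi))"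
      using integral_lborel_affine[of "\<lambda>z. ?F (z, xi)" 1 x] m by simp
    also have "\<dots> = (LINT z|lborel. of_real (gauss r xi) * cis (x \<bullet> xi) * (of_real (p t z) * cis (xi \<bullet> z)))"
    proof (rule Bochner_Integration.integral_cong[OF refl])
      fix z
      have "cis ((x + z) \<bullet> xi) = cis (x \<bullet> xi) * cis (xi \<bullet> z)" by (simp add: inner_add_left cis_mult inner_commute[of xi])
      then show "?F (x + 1 *\<^sub>R z, xi) = of_real (gauss r xi) * cis (x \<bullet> xi) * (of_real (p t z) * cis (xi \<bullet> z))"
        by (simp add: mult_ac)
    qed
    also have "\<dots> = of_real (gauss r xi) * cis (x \<bullet> xi) * of_real (exp (- t * norm xi powr \<alpha>))"
      by (simp only: integral_mult_right_zero p_char[OF t, of xi])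
    finally show ?thesis .
  qed
  have "complex_of_real (LINT z|lborel. p t (z - x) * exp (- r * (norm z)\<^sup>2)) = (LINT z|lborel. LINT xi|lborel. ?F (z, xi))"
    unfolding 1 integral_complex_of_real ..
  also have "\<dots> = (LINT xi|lborel. LINT z|lborel. ?F (z, xi))"
    using lborel_pair.Fubini_integral[OF F] by simp
  finally have eq: "complex_of_real (LINT z|lborel. p t (z - x) * exp (- r * (norm z)\<^sup>2)) = (LINT xi|lborel. of_real (gauss r xi) * cis (x \<bullet> xi) * of_real (exp (- t * norm xi powr \<alpha>)))"
    unfolding 2 .
  have "integrable lborel (\<lambda>xi. LINT z|lborel. ?F (z, xi))"
    using lborel_pair.integrable_snd[OF F] by simp
  then have i: "integrable lborel (\<lambda>xi. complex_of_real (gauss r xi) * cis (x \<bullet> xi) * of_real (exp (- t * norm xi powr \<alpha>)))"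
    unfolding 2 .
  have "(LINT z|lborel. p t (z - x) * exp (- r * (norm z)\<^sup>2)) = Re (complex_of_real (LINT z|lborel. p t (z - x) * exp (- r * (norm z)\<^sup>2)))" by simp
  also have "\<dots> = (LINT xi|lborel. Re (complex_of_real (gauss r xi) * cis (x \<bullet> xi) * of_real (exp (- t * norm xi powr \<alpha>))))"
    unfolding eq by (rule integral_Re[OF i, symmetric])
  finally show ?thesis by (simp add: mult.assoc)
qed

lemma p_nonneg: "t > 0 \<Longrightarrow> 0 \<le> p t x"
  using p_pos by (rule less_imp_le)

lemma integrable_norm_powr_split:
  assumes b: "0 < b" "b < real DIM('a)" and c: "real DIM('a) < c"
    and [measurable]: "f \<in> borel_measurable borel"
    and f1: "\<And>x::'a. x \<noteq> 0 \<Longrightarrow> norm x \<le> 1 \<Longrightarrow> \<bar>f x\<bar> \<le> A * norm x powr (- b)"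
    and f2: "\<And>x::'a. norm x \<ge> 1 \<Longrightarrow> \<bar>f x\<bar> \<le> A * norm x powr (- c)"
    and A: "A \<ge> 0"
  shows "integrable lborel f"
proof (rule integrableI_bounded)
  obtain K1 where K1: "K1 > 0" "\<And>R. R \<ge> 0 \<Longrightarrow> (\<integral>\<^sup>+x. indicator (cball (0::'a) R) x * ennreal (norm x powr (- b)) \<partial>lborel) \<le> ennreal (K1 * R powr (real DIM('a) - b))"
    by (rule nn_integral_norm_powr_ball[OF b]) (rule that)
  obtain K2 where K2: "K2 > 0" "\<And>R. R > 0 \<Longrightarrow> (\<integral>\<^sup>+x. indicator {x::'a. R \<le> norm x} x * ennreal (norm x powr (- c)) \<partial>lborel) \<le> ennreal (K2 * R powr (real DIM('a) - c))"
    by (rule nn_integral_norm_powr_outside[OF c]) (rule that)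
  have [measurable]: "cball (0::'a) 1 \<in> sets borel" by (simp add: borel_closed)
  have "(\<integral>\<^sup>+x. ennreal (norm (f x)) \<partial>lborel) \<le> (\<integral>\<^sup>+x. ennreal A * (indicator (cball (0::'a) 1) x * ennreal (norm x powr (- b))) + ennreal A * (indicator {x::'a. 1 \<le> norm x} x * ennreal (norm x powr (- c))) \<partial>lborel)"
  proof (rule nn_integral_mono_AE)
    have "AE x in lborel. x \<noteq> (0::'a)" by (rule AE_lborel_singleton)
    then show "AE x in lborel. ennreal (norm (f x)) \<le> ennreal A * (indicator (cball (0::'a) 1) x * ennreal (norm x powr (- b))) + ennreal A * (indicator {x::'a. 1 \<le> norm x} x * ennreal (norm x powr (- c)))"
    proof eventually_elim
      case (elim x)
      show ?case
      proof (cases "norm x \<le> 1")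
        case True
        then have "ennreal (norm (f x)) \<le> ennreal A * (indicator (cball (0::'a) 1) x * ennreal (norm x powr (- b)))"
          using f1[OF elim True] A by (simp add: ennreal_leI flip: ennreal_mult)
        then show ?thesis by (rule add_increasing2[rotated]) simp
      next
        case False
        then have "ennreal (norm (f x)) \<le> ennreal A * (indicator {x::'a. 1 \<le> norm x} x * ennreal (norm x powr (- c)))"
          using f2[of x] A by (simp add: ennreal_leI flip: ennreal_mult)
        then show ?thesis by (rule add_increasing[rotated]) simp
      qed
    qed
  qed
  also have "\<dots> = ennreal A * (\<integral>\<^sup>+x. indicator (cball (0::'a) 1) x * ennreal (norm x powr (- b)) \<partial>lborel) + ennreal A * (\<integral>\<^sup>+x. indicator {x::'a. 1 \<le> norm x} x * ennreal (norm x powr (- c)) \<partial>lborel)"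
    by (rule nn_integral_lincomb) measurable
  also have "\<dots> < \<infinity>"
    using K1(2)[of 1] K2(2)[of 1] by (auto simp: ennreal_mult_less_top intro: le_less_trans)
  finally show "(\<integral>\<^sup>+x. ennreal (norm (f x)) \<partial>lborel) < \<infinity>" .
qed measurable

context
  fixes \<delta> :: real
  assumes del: "0 < \<delta>" "\<delta> < \<alpha>"
begin

text \<open>Near the origin the defect is at most \<open>t * |xi| powr \<alpha>\<close>, which
  suffices since \<open>\<delta> < \<alpha>\<close>; at infinity it is at most 1, and
  \<open>\<delta> > 0\<close> gives the decay.\<close>

lemma integrable_char_defect:
  assumes t: "t > 0" and [measurable]: "f \<in> borel_measurable borel" and f: "\<And>xi. \<bar>f xi\<bar> \<le> 1 - exp (- t * norm xi powr \<alpha>)"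
  shows "integrable lborel (\<lambda>xi::'a. f xi * norm xi powr (- \<delta> - real DIM('a)))"
proof (rule integrable_norm_powr_split[where b="real DIM('a) + \<delta> - \<alpha>" and c="real DIM('a) + \<delta>" and A="max 1 t"])
  fix xi :: 'a assume xi: "xi \<noteq> 0"
  have "\<bar>f xi\<bar> \<le> t * norm xi powr \<alpha>" using f[of xi] exp_ge_add_one_self[of "- t * norm xi powr \<alpha>"] by simp
  also have "\<dots> \<le> max 1 t * norm xi powr \<alpha>" by (intro mult_right_mono) auto
  finally have "\<bar>f xi\<bar> * norm xi powr (- \<delta> - real DIM('a)) \<le> max 1 t * norm xi powr \<alpha> * norm xi powr (- \<delta> - real DIM('a))"
    by (intro mult_right_mono) auto
  also have "\<dots> = max 1 t * norm xi powr (- (real DIM('a) + \<delta> - \<alpha>))"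
    using xi by (simp add: powr_add[symmetric] mult.assoc) (simp add: algebra_simps)
  finally show "\<bar>f xi * norm xi powr (- \<delta> - real DIM('a))\<bar> \<le> max 1 t * norm xi powr (- (real DIM('a) + \<delta> - \<alpha>))"
    by (simp add: abs_mult)
next
  fix xi :: 'a
  have "\<bar>f xi\<bar> \<le> 1" using f[of xi] by (meson diff_le_self exp_ge_zero order_trans diff_left_mono le_diff_eq add_increasing2 order_refl diff_ge_0_iff_ge diff_diff_eq2 diff_add_cancel)
  then have "\<bar>f xi\<bar> * norm xi powr (- \<delta> - real DIM('a)) \<le> max 1 t * norm xi powr (- \<delta> - real DIM('a))"
    by (intro mult_right_mono) auto
  then show "\<bar>f xi * norm xi powr (- \<delta> - real DIM('a))\<bar> \<le> max 1 t * norm xi powr (- (real DIM('a) + \<delta>))"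
    by (simp add: abs_mult algebra_simps)
qed (use del alpha d_ge1 in auto)

text \<open>The inequality \<open>exp (- u) \<le> 1 / u\<close> is enough decay: it leaves the
  exponent \<open>- \<delta> - d\<close> at infinity, while \<open>\<alpha> - \<delta> > 0\<close>
  handles the origin.\<close>

lemma integrable_char_norm_powr:
  assumes s: "s > 0" and [measurable]: "f \<in> borel_measurable borel" and f: "\<And>xi. \<bar>f xi\<bar> \<le> exp (- s * norm xi powr \<alpha>)"
  shows "integrable lborel (\<lambda>xi::'a. f xi * norm xi powr ((\<alpha> - \<delta>) - real DIM('a)))"
proof (rule integrable_norm_powr_split[where b="real DIM('a) + \<delta> - \<alpha>" and c="real DIM('a) + \<delta>" and A="max 1 (1 / s)"])
  fix xi :: 'a
  have "exp (- s * norm xi powr \<alpha>) \<le> 1" using s by simp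
  then have "\<bar>f xi\<bar> \<le> max 1 (1 / s)" using f[of xi] by linarith
  then have "\<bar>f xi\<bar> * norm xi powr ((\<alpha> - \<delta>) - real DIM('a)) \<le> max 1 (1 / s) * norm xi powr ((\<alpha> - \<delta>) - real DIM('a))"
    by (intro mult_right_mono) auto
  then show "\<bar>f xi * norm xi powr ((\<alpha> - \<delta>) - real DIM('a))\<bar> \<le> max 1 (1 / s) * norm xi powr (- (real DIM('a) + \<delta> - \<alpha>))"
    by (simp add: abs_mult algebra_simps)
next
  fix xi :: 'a assume "1 \<le> norm xi"
  then have xi: "norm xi > 0" by linarith
  let ?u = "s * norm xi powr \<alpha>"
  have u: "?u > 0" using s xi by simp
  have "\<bar>f xi\<bar> \<le> exp (- ?u)" using f[of xi] by simp
  also have "\<dots> \<le> 1 / ?u" unfolding exp_minus inverse_eq_divide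
    using u exp_ge_add_one_self[of ?u] by (intro divide_left_mono) (linarith, auto)
  also have "\<dots> = (1 / s) * norm xi powr (- \<alpha>)" by (simp add: powr_minus_divide)
  also have "\<dots> \<le> max 1 (1 / s) * norm xi powr (- \<alpha>)" by (intro mult_right_mono) auto
  finally have "\<bar>f xi\<bar> * norm xi powr ((\<alpha> - \<delta>) - real DIM('a)) \<le> max 1 (1 / s) * norm xi powr (- \<alpha>) * norm xi powr ((\<alpha> - \<delta>) - real DIM('a))"
    by (intro mult_right_mono) auto
  also have "\<dots> = max 1 (1 / s) * norm xi powr (- (real DIM('a) + \<delta>))"
  proof -
    have "norm xi powr (- \<alpha>) * norm xi powr ((\<alpha> - \<delta>) - real DIM('a)) = norm xi powr (- (real DIM('a) + \<delta>))"
      unfolding powr_add[symmetric] by (rule arg_cong[where f="\<lambda>e. norm xi powr e"]) simp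
    then show ?thesis by (simp only: mult.assoc)
  qed
  finally show "\<bar>f xi * norm xi powr ((\<alpha> - \<delta>) - real DIM('a))\<bar> \<le> max 1 (1 / s) * norm xi powr (- (real DIM('a) + \<delta>))"
    by (simp add: abs_mult)
qed (use del alpha d_ge1 in auto)

lemma has_integral_p_neg_moment:
  assumes s: "s > 0" and x: "x \<noteq> 0"
  shows "integrable lborel (\<lambda>z. p s (z - x) * norm z powr (\<delta> - \<alpha>))"
proof -
  note [measurable] = p_meas[OF s]
  obtain K where K: "K > 0" "\<And>t x. t > 0 \<Longrightarrow> x \<noteq> 0 \<Longrightarrow> (\<integral>\<^sup>+z. ennreal (p t (z - x) * norm z powr (- (\<alpha> - \<delta>))) \<partial>lborel) \<le> ennreal (K * norm x powr (- (\<alpha> - \<delta>)))"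
    by (rule p_neg_moment[of "\<alpha> - \<delta>"]) (use del alpha in \<open>auto intro: that\<close>)
  show ?thesis
  proof (rule integrableI_nonneg)
    show "(\<integral>\<^sup>+z. ennreal (p s (z - x) * norm z powr (\<delta> - \<alpha>)) \<partial>lborel) < \<infinity>"
      using K(2)[OF s x] by (auto intro: le_less_trans)
  qed (use p_nonneg[OF s] in \<open>auto intro!: AE_I2 mult_nonneg_nonneg\<close>)
qed

lemma integrable_p_moment:
  assumes t: "t > 0"
  shows "integrable lborel (\<lambda>z. p t (z - x) * norm z powr \<delta>)"
proof -
  note [measurable] = p_meas[OF t]
  obtain K where K: "K > 0" "\<And>t. t > 0 \<Longrightarrow> (\<integral>\<^sup>+z. ennreal (p t z * norm z powr \<delta>) \<partial>lborel) \<le> ennreal (K * t powr (\<delta> / \<alpha>))"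
    by (rule p_moment[OF del]) (rule that)
  have i1: "integrable lborel (\<lambda>z. p t z * norm z powr \<delta>)"
  proof (rule integrableI_nonneg)
    show "(\<integral>\<^sup>+z. ennreal (p t z * norm z powr \<delta>) \<partial>lborel) < \<infinity>"
      using K(2)[OF t] by (auto intro: le_less_trans)
  qed (use p_nonneg[OF t] in \<open>auto intro!: AE_I2 mult_nonneg_nonneg\<close>)
  have i2: "integrable lborel (\<lambda>z. 2 powr \<delta> * (p t z * norm z powr \<delta>) + 2 powr \<delta> * norm x powr \<delta> * p t z)"
    using i1 integrable_p[OF t] by auto
  have "integrable lborel (\<lambda>z. p t z * norm (x + z) powr \<delta>)"
  proof (rule Bochner_Integration.integrable_bound[OF i2])
    show "AE z in lborel. norm (p t z * norm (x + z) powr \<delta>) \<le> norm (2 powr \<delta> * (p t z * norm z powr \<delta>) + 2 powr \<delta> * norm x powr \<delta> * p t z)"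
    proof (rule AE_I2)
      fix z
      have "norm (x + z) \<le> 2 * max (norm x) (norm z)" using norm_triangle_ineq[of x z] by (auto simp: max_def)
      then have "norm (x + z) powr \<delta> \<le> (2 * max (norm x) (norm z)) powr \<delta>" using del by (intro powr_mono2) auto
      also have "\<dots> = 2 powr \<delta> * max (norm x) (norm z) powr \<delta>" by (simp add: powr_mult)
      also have "\<dots> \<le> 2 powr \<delta> * (norm x powr \<delta> + norm z powr \<delta>)" by (intro mult_left_mono) (auto simp: max_def)
      finally have "p t z * norm (x + z) powr \<delta> \<le> p t z * (2 powr \<delta> * (norm x powr \<delta> + norm z powr \<delta>))"
        using p_pos[OF t, of z] by (intro mult_left_mono) auto
      then show "norm (p t z * norm (x + z) powr \<delta>) \<le> norm (2 powr \<delta> * (p t z * norm z powr \<delta>) + 2 powr \<delta> * norm x powr \<delta> * p t z)"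
        using p_pos[OF t, of z] by (simp add: abs_mult algebra_simps)
    qed
  qed measurable
  then show ?thesis
    using integrable_lborel_affine_iff[of "\<lambda>z. p t (z - x) * norm z powr \<delta>" 1 x] by simp
qed

lemma integrable_p_exp:
  assumes t: "t > 0" and r: "r \<ge> 0"
  shows "integrable lborel (\<lambda>z. p t (z - x) * exp (- r * (norm z)\<^sup>2))"
proof -
  note [measurable] = p_meas[OF t]
  have ip: "integrable lborel (\<lambda>z. p t (z - x))"
    using integrable_lborel_affine_iff[of "p t" 1 "- x"] integrable_p[OF t] by simp
  show ?thesis
    by (rule Bochner_Integration.integrable_bound[OF ip]) (use p_nonneg[OF t] r in \<open>auto simp: abs_mult intro!: AE_I2 mult_left_le\<close>)
qed

text \<open>\<open>Gamma ((\<alpha> - \<delta>) / 2) * |z| powr (\<delta> - \<alpha>)\<close> is a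
  mixture of the functions \<open>exp (- r * |z|^2)\<close>. Each is transformed by
  \<open>p_gauss_transform\<close>, and the mixture over \<open>r\<close> is evaluated by
  \<open>gauss_mixture\<close>.\<close>

lemma p_neg_moment_fourier:
  assumes s: "s > 0" and x: "x \<noteq> 0"
  shows "Gamma ((\<alpha> - \<delta>) / 2) * (LINT z|lborel. p s (z - x) * norm z powr (\<delta> - \<alpha>)) =
    (4 * pi) powr (- real DIM('a) / 2) * Gamma ((real DIM('a) + \<delta> - \<alpha>) / 2) * 2 powr (real DIM('a) + \<delta> - \<alpha>) *
      (LINT xi|lborel. cos (x \<bullet> xi) * exp (- s * norm xi powr \<alpha>) * norm xi powr ((\<alpha> - \<delta>) - real DIM('a)))"
proof -
  note [measurable] = p_meas[OF s]
  let ?b = "(\<alpha> - \<delta>) / 2"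
  let ?B = "\<lambda>r. LINT z|lborel. p s (z - x) * exp (- r * (norm z)\<^sup>2)"
  have b: "?b > 0" using del by simp
  have G: "Gamma ?b > 0" using b by simp
  let ?E = "LINT z|lborel. p s (z - x) * norm z powr (\<delta> - \<alpha>)"
  have E0: "?E \<ge> 0" by (rule integral_nonneg_AE) (use p_nonneg[OF s] in \<open>auto intro!: AE_I2 mult_nonneg_nonneg\<close>)
  have B0: "?B r \<ge> 0" for r by (rule integral_nonneg_AE) (use p_nonneg[OF s] in \<open>auto intro!: AE_I2 mult_nonneg_nonneg\<close>)
  have ae: "AE z in lborel. z \<noteq> (0::'a)" by (rule AE_lborel_singleton)
  have "ennreal (Gamma ?b * ?E) = ennreal (Gamma ?b) * (\<integral>\<^sup>+z. ennreal (p s (z - x) * norm z powr (\<delta> - \<alpha>)) \<partial>lborel)"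
    using G E0 by (subst nn_integral_eq_integral[OF has_integral_p_neg_moment[OF s x]])
      (use p_nonneg[OF s] in \<open>auto intro!: AE_I2 mult_nonneg_nonneg simp: ennreal_mult\<close>)
  also have "\<dots> = (\<integral>\<^sup>+z. (\<integral>\<^sup>+r. ennreal (p s (z - x)) * ennreal (indicator {0..} r * (r powr (?b - 1) * exp (- ((norm z)\<^sup>2 * r)))) \<partial>lborel) \<partial>lborel)"
  proof (subst nn_integral_cmult[symmetric], measurable, rule nn_integral_cong_AE)
    show "AE z in lborel. ennreal (Gamma ?b) * ennreal (p s (z - x) * norm z powr (\<delta> - \<alpha>)) = (\<integral>\<^sup>+r. ennreal (p s (z - x)) * ennreal (indicator {0..} r * (r powr (?b - 1) * exp (- ((norm z)\<^sup>2 * r)))) \<partial>lborel)"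
      using ae
    proof eventually_elim
      case (elim z)
      have "((norm z)\<^sup>2) powr (- ?b) = norm z powr (\<delta> - \<alpha>)"
        using elim by (simp add: powr_powr diff_divide_distrib flip: powr_numeral)
      then have "(\<integral>\<^sup>+r. ennreal (indicator {0..} r * (r powr (?b - 1) * exp (- ((norm z)\<^sup>2 * r)))) \<partial>lborel) = ennreal (Gamma ?b * norm z powr (\<delta> - \<alpha>))"
        using nn_integral_Gamma_scaled[OF b, of "(norm z)\<^sup>2"] elim by simp
      then have "(\<integral>\<^sup>+r. ennreal (p s (z - x)) * ennreal (indicator {0..} r * (r powr (?b - 1) * exp (- ((norm z)\<^sup>2 * r)))) \<partial>lborel) = ennreal (p s (z - x)) * ennreal (Gamma ?b * norm z powr (\<delta> - \<alpha>))"
        by (subst nn_integral_cmult) auto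
      then show ?case using G p_pos[OF s, of "z - x"] by (simp add: mult_ac flip: ennreal_mult)
    qed
  qed
  also have "\<dots> = (\<integral>\<^sup>+r. (\<integral>\<^sup>+z. ennreal (p s (z - x)) * ennreal (indicator {0..} r * (r powr (?b - 1) * exp (- ((norm z)\<^sup>2 * r)))) \<partial>lborel) \<partial>lborel)"
    by (rule lborel_pair.Fubini'[symmetric]) measurable
  also have "\<dots> = (\<integral>\<^sup>+r. ennreal (indicator {0<..} r * (r powr (?b - 1) * ?B r)) \<partial>lborel)"
  proof (rule nn_integral_cong)
    fix r :: real
    show "(\<integral>\<^sup>+z. ennreal (p s (z - x)) * ennreal (indicator {0..} r * (r powr (?b - 1) * exp (- ((norm z)\<^sup>2 * r)))) \<partial>lborel) = ennreal (indicator {0<..} r * (r powr (?b - 1) * ?B r))"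
    proof (cases "r > 0")
      case True
      have "(\<integral>\<^sup>+z. ennreal (p s (z - x)) * ennreal (indicator {0..} r * (r powr (?b - 1) * exp (- ((norm z)\<^sup>2 * r)))) \<partial>lborel)
        = (\<integral>\<^sup>+z. ennreal (r powr (?b - 1)) * ennreal (p s (z - x) * exp (- r * (norm z)\<^sup>2)) \<partial>lborel)"
        by (rule nn_integral_cong) (use True p_nonneg[OF s] in \<open>simp add: mult_ac flip: ennreal_mult\<close>)
      also have "\<dots> = ennreal (r powr (?b - 1)) * ennreal (?B r)"
        by (subst nn_integral_cmult, measurable, subst nn_integral_eq_integral[OF integrable_p_exp[OF s]])
           (use True p_nonneg[OF s] in \<open>auto intro!: AE_I2 mult_nonneg_nonneg\<close>)
      finally show ?thesis using True B0[of r] by (simp add: ennreal_mult)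
    next
      case False
      then show ?thesis by (cases "r = 0") auto
    qed
  qed
  finally have nn: "(\<integral>\<^sup>+r. ennreal (indicator {0<..} r * (r powr (?b - 1) * ?B r)) \<partial>lborel) = ennreal (Gamma ?b * ?E)" ..
  have "Gamma ?b * ?E = (LINT r|lborel. indicator {0<..} r * (r powr (?b - 1) * ?B r))"
    by (subst integral_eq_nn_integral) (use nn B0 G E0 in \<open>auto intro!: AE_I2 mult_nonneg_nonneg\<close>)
  also have "\<dots> = (LINT r|lborel. indicator {0<..} r * (r powr (?b - 1) * (LINT xi|lborel. gauss r xi * (cos (x \<bullet> xi) * exp (- s * norm xi powr \<alpha>)))))"
  proof (rule Bochner_Integration.integral_cong[OF refl])
    fix r :: real
    show "indicator {0<..} r * (r powr (?b - 1) * ?B r) = indicator {0<..} r * (r powr (?b - 1) * (LINT xi|lborel. gauss r xi * (cos (x \<bullet> xi) * exp (- s * norm xi powr \<alpha>))))"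
      using p_gauss_transform[OF s, of r x] by (cases "r > 0") auto
  qed
  also have "\<dots> = (4 * pi) powr (- real DIM('a) / 2) * Gamma (real DIM('a) / 2 - ?b) * 2 powr (real DIM('a) - 2 * ?b)
        * (LINT xi|lborel. (cos (x \<bullet> xi) * exp (- s * norm xi powr \<alpha>)) * norm xi powr (2 * ?b - real DIM('a)))"
  proof (rule gauss_mixture)
    show "?b < real DIM('a) / 2" using del alpha by simp
    have "\<bar>cos (x \<bullet> xi) * exp (- s * norm xi powr \<alpha>)\<bar> \<le> exp (- s * norm xi powr \<alpha>)" for xi
      by (simp add: abs_mult mult_left_le_one_le)
    then show "integrable lborel (\<lambda>xi. (cos (x \<bullet> xi) * exp (- s * norm xi powr \<alpha>)) * norm xi powr (2 * ?b - real DIM('a)))"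
      using integrable_char_norm_powr[OF s, of "\<lambda>xi. cos (x \<bullet> xi) * exp (- s * norm xi powr \<alpha>)"] by (simp add: diff_divide_distrib)
  qed measurable
  also have "real DIM('a) / 2 - ?b = (real DIM('a) + \<delta> - \<alpha>) / 2" by (simp add: diff_divide_distrib add_divide_distrib)
  also have "real DIM('a) - 2 * ?b = real DIM('a) + \<delta> - \<alpha>" by (simp add: diff_divide_distrib)
  also have "2 * ?b - real DIM('a) = (\<alpha> - \<delta>) - real DIM('a)" by (simp add: diff_divide_distrib)
  finally show ?thesis .
qed

text \<open>A positive power is a mixture of \<open>1 - exp (- r * |z|^2)\<close>, and the constant
  1 has no Fourier density. Subtracting \<open>|x| powr \<delta>\<close> cancels it for every
  \<open>r\<close> and leaves an integral against \<open>1 - exp (- t * |xi| powr \<alpha>)\<close>,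
  which vanishes fast enough at the origin.\<close>

lemma p_moment_fourier:
  assumes t: "t > 0"
  shows "- Gamma (- \<delta> / 2) * ((LINT z|lborel. p t (z - x) * norm z powr \<delta>) - norm x powr \<delta>) =
    (4 * pi) powr (- real DIM('a) / 2) * Gamma ((real DIM('a) + \<delta>) / 2) * 2 powr (real DIM('a) + \<delta>) *
      (LINT xi|lborel. cos (x \<bullet> xi) * (1 - exp (- t * norm xi powr \<alpha>)) * norm xi powr (- \<delta> - real DIM('a)))"
proof -
  note [measurable] = p_meas[OF t]
  let ?g = "\<delta> / 2"
  have g: "0 < ?g" "?g < 1" using del alpha by auto
  define G where "G = - Gamma (- ?g)"
  have G: "G > 0" using Gamma_neg_frac(2)[OF g] by (simp add: G_def)
  let ?B = "\<lambda>r. LINT z|lborel. p t (z - x) * exp (- r * (norm z)\<^sup>2)"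
  let ?P = "LINT z|lborel. p t (z - x) * norm z powr \<delta>"
  have P0: "?P \<ge> 0" by (rule integral_nonneg_AE) (use p_nonneg[OF t] in \<open>auto intro!: AE_I2 mult_nonneg_nonneg\<close>)
  have vg: "((norm z)\<^sup>2) powr ?g = norm z powr \<delta>" for z :: 'a
    by (cases "z = 0") (simp_all add: powr_powr flip: powr_numeral)
  have ip: "integrable lborel (\<lambda>z. p t (z - x))"
    using integrable_lborel_affine_iff[of "p t" 1 "- x"] integrable_p[OF t] by simp
  have Pp: "(LINT z|lborel. p t (z - x)) = 1"
    using integral_lborel_affine[of "p t" 1 "- x"] integral_p[OF t] by simp
  have B1: "(LINT z|lborel. p t (z - x) * (1 - exp (- r * (norm z)\<^sup>2))) = 1 - ?B r"
    and iB: "integrable lborel (\<lambda>z. p t (z - x) * (1 - exp (- r * (norm z)\<^sup>2)))" if "r \<ge> 0" for r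
    using Bochner_Integration.integral_diff[OF ip integrable_p_exp[OF t that, of x]] Bochner_Integration.integrable_diff[OF ip integrable_p_exp[OF t that, of x]] Pp
    by (simp_all add: algebra_simps)
  have B10: "1 - ?B r \<ge> 0" if "r \<ge> 0" for r
    unfolding B1[OF that, symmetric] by (rule integral_nonneg_AE) (use p_nonneg[OF t] that in \<open>auto intro!: AE_I2 mult_nonneg_nonneg\<close>)
  have "ennreal (G * ?P) = ennreal G * (\<integral>\<^sup>+z. ennreal (p t (z - x) * norm z powr \<delta>) \<partial>lborel)"
    using G P0 by (subst nn_integral_eq_integral[OF integrable_p_moment[OF t]])
      (use p_nonneg[OF t] in \<open>auto intro!: AE_I2 mult_nonneg_nonneg simp: ennreal_mult\<close>)
  also have "\<dots> = (\<integral>\<^sup>+z. (\<integral>\<^sup>+r. ennreal (p t (z - x)) * ennreal (indicator {0..} r * (r powr (- ?g - 1) * (1 - exp (- (r * (norm z)\<^sup>2))))) \<partial>lborel) \<partial>lborel)"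
  proof (subst nn_integral_cmult[symmetric], measurable, rule nn_integral_cong)
    fix z :: 'a
    have "(\<integral>\<^sup>+r. ennreal (p t (z - x)) * ennreal (indicator {0..} r * (r powr (- ?g - 1) * (1 - exp (- (r * (norm z)\<^sup>2))))) \<partial>lborel) = ennreal (p t (z - x)) * ennreal (G * norm z powr \<delta>)"
      using nn_integral_Gamma_neg[OF g, of "(norm z)\<^sup>2"] unfolding vg G_def[symmetric] by (subst nn_integral_cmult) auto
    then show "ennreal G * ennreal (p t (z - x) * norm z powr \<delta>) = (\<integral>\<^sup>+r. ennreal (p t (z - x)) * ennreal (indicator {0..} r * (r powr (- ?g - 1) * (1 - exp (- (r * (norm z)\<^sup>2))))) \<partial>lborel)"
      using less_imp_le[OF G] less_imp_le[OF p_pos[OF t, of "z - x"]] by (simp only: ennreal_mult[symmetric] mult_nonneg_nonneg powr_ge_zero mult.left_commute)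
  qed
  also have "\<dots> = (\<integral>\<^sup>+r. (\<integral>\<^sup>+z. ennreal (p t (z - x)) * ennreal (indicator {0..} r * (r powr (- ?g - 1) * (1 - exp (- (r * (norm z)\<^sup>2))))) \<partial>lborel) \<partial>lborel)"
    by (rule lborel_pair.Fubini'[symmetric]) measurable
  also have "\<dots> = (\<integral>\<^sup>+r. ennreal (indicator {0..} r * (r powr (- ?g - 1) * (1 - ?B r))) \<partial>lborel)"
  proof (rule nn_integral_cong)
    fix r :: real
    show "(\<integral>\<^sup>+z. ennreal (p t (z - x)) * ennreal (indicator {0..} r * (r powr (- ?g - 1) * (1 - exp (- (r * (norm z)\<^sup>2))))) \<partial>lborel) = ennreal (indicator {0..} r * (r powr (- ?g - 1) * (1 - ?B r)))"
    proof (cases "r \<ge> 0")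
      case True
      have "(\<integral>\<^sup>+z. ennreal (p t (z - x)) * ennreal (indicator {0..} r * (r powr (- ?g - 1) * (1 - exp (- (r * (norm z)\<^sup>2))))) \<partial>lborel)
        = (\<integral>\<^sup>+z. ennreal (r powr (- ?g - 1)) * ennreal (p t (z - x) * (1 - exp (- r * (norm z)\<^sup>2))) \<partial>lborel)"
        by (rule nn_integral_cong) (use True p_nonneg[OF t] in \<open>simp add: mult_ac flip: ennreal_mult\<close>)
      also have "\<dots> = ennreal (r powr (- ?g - 1)) * ennreal (1 - ?B r)"
        by (subst nn_integral_cmult, measurable, subst nn_integral_eq_integral[OF iB[OF True]])
           (use True p_nonneg[OF t] B1[OF True] in \<open>auto intro!: AE_I2 mult_nonneg_nonneg\<close>)
      finally show ?thesis using True B10[OF True] by (simp add: ennreal_mult)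
    qed auto
  qed
  finally have nn1: "(\<integral>\<^sup>+r. ennreal (indicator {0..} r * (r powr (- ?g - 1) * (1 - ?B r))) \<partial>lborel) = ennreal (G * ?P)" ..
  have nn2: "(\<integral>\<^sup>+r. ennreal (indicator {0..} r * (r powr (- ?g - 1) * (1 - exp (- (r * (norm x)\<^sup>2))))) \<partial>lborel) = ennreal (G * norm x powr \<delta>)"
    using nn_integral_Gamma_neg[OF g, of "(norm x)\<^sup>2"] unfolding vg G_def[symmetric] by simp
  have h1: "has_bochner_integral lborel (\<lambda>r. indicator {0..} r * (r powr (- ?g - 1) * (1 - ?B r))) (G * ?P)"
    by (rule has_bochner_integral_nn_integral[OF _ _ _ nn1]) (use B10 mult_nonneg_nonneg[OF less_imp_le[OF G] P0] in \<open>auto intro!: AE_I2 simp: indicator_def\<close>)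
  have h2: "has_bochner_integral lborel (\<lambda>r. indicator {0..} r * (r powr (- ?g - 1) * (1 - exp (- (r * (norm x)\<^sup>2))))) (G * norm x powr \<delta>)"
    by (rule has_bochner_integral_nn_integral[OF _ _ _ nn2]) (use mult_nonneg_nonneg[OF less_imp_le[OF G] powr_ge_zero[of "norm x" \<delta>]] in \<open>auto intro!: AE_I2 simp: indicator_def\<close>)
  have "G * (?P - norm x powr \<delta>) = G * ?P - G * norm x powr \<delta>" by (rule right_diff_distrib)
  also have "\<dots> = (LINT r|lborel. indicator {0..} r * (r powr (- ?g - 1) * (1 - ?B r)) - indicator {0..} r * (r powr (- ?g - 1) * (1 - exp (- (r * (norm x)\<^sup>2)))))"
    by (rule has_bochner_integral_integral_eq[OF has_bochner_integral_diff[OF h1 h2], symmetric])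
  also have "\<dots> = (LINT r|lborel. indicator {0<..} r * (r powr (- ?g - 1) * (LINT xi|lborel. gauss r xi * (cos (x \<bullet> xi) * (1 - exp (- t * norm xi powr \<alpha>))))))"
  proof (rule Bochner_Integration.integral_cong[OF refl])
    fix r :: real
    show "indicator {0..} r * (r powr (- ?g - 1) * (1 - ?B r)) - indicator {0..} r * (r powr (- ?g - 1) * (1 - exp (- (r * (norm x)\<^sup>2)))) = indicator {0<..} r * (r powr (- ?g - 1) * (LINT xi|lborel. gauss r xi * (cos (x \<bullet> xi) * (1 - exp (- t * norm xi powr \<alpha>)))))"
    proof (cases "r > 0")
      case r: True
      have ig: "integrable lborel (\<lambda>xi::'a. gauss r xi * k xi)" if [measurable]: "k \<in> borel_measurable borel" and "\<And>xi. \<bar>k xi\<bar> \<le> 1" for k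
        by (rule Bochner_Integration.integrable_bound[OF integrable_gauss[OF r]]) (use that in \<open>auto simp: abs_mult intro!: AE_I2 mult_left_le\<close>)
      have c1: "integrable lborel (\<lambda>xi. gauss r xi * cos (x \<bullet> xi))" by (rule ig) auto
      have c2: "integrable lborel (\<lambda>xi. gauss r xi * (cos (x \<bullet> xi) * exp (- t * norm xi powr \<alpha>)))"
      proof (rule ig)
        fix xi
        have "\<bar>cos (x \<bullet> xi)\<bar> * exp (- t * norm xi powr \<alpha>) \<le> 1 * 1" using t by (intro mult_mono) auto
        then show "\<bar>cos (x \<bullet> xi) * exp (- t * norm xi powr \<alpha>)\<bar> \<le> 1" by (simp add: abs_mult)
      qed measurable
      have "exp (- r * (norm x)\<^sup>2) = Re (LINT xi|lborel. complex_of_real (gauss r xi) * cis (x \<bullet> xi))"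
        by (simp add: char_gauss[OF r])
      also have "\<dots> = (LINT xi|lborel. Re (complex_of_real (gauss r xi) * cis (x \<bullet> xi)))"
        by (rule integral_Re[OF integrable_gauss_cis[OF r], symmetric])
      finally have "exp (- r * (norm x)\<^sup>2) = (LINT xi|lborel. gauss r xi * cos (x \<bullet> xi))" by simp
      then have "exp (- r * (norm x)\<^sup>2) - ?B r = (LINT xi|lborel. gauss r xi * cos (x \<bullet> xi)) - (LINT xi|lborel. gauss r xi * (cos (x \<bullet> xi) * exp (- t * norm xi powr \<alpha>)))"
        using p_gauss_transform[OF t r, of x] by simp
      also have "\<dots> = (LINT xi|lborel. gauss r xi * cos (x \<bullet> xi) - gauss r xi * (cos (x \<bullet> xi) * exp (- t * norm xi powr \<alpha>)))"
        by (rule Bochner_Integration.integral_diff[OF c1 c2, symmetric])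
      also have "\<dots> = (LINT xi|lborel. gauss r xi * (cos (x \<bullet> xi) * (1 - exp (- t * norm xi powr \<alpha>))))"
        by (rule Bochner_Integration.integral_cong[OF refl]) (simp only: right_diff_distrib mult_1_right)
      finally have "exp (- r * (norm x)\<^sup>2) - ?B r = (LINT xi|lborel. gauss r xi * (cos (x \<bullet> xi) * (1 - exp (- t * norm xi powr \<alpha>))))" .
      moreover have "indicator {0..} r * (r powr (- ?g - 1) * (1 - ?B r)) - indicator {0..} r * (r powr (- ?g - 1) * (1 - exp (- (r * (norm x)\<^sup>2)))) = r powr (- ?g - 1) * (exp (- r * (norm x)\<^sup>2) - ?B r)"
        using r by (simp add: right_diff_distrib)
      ultimately show ?thesis using r by simp
    next
      case False
      then show ?thesis by (cases "r = 0") auto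
    qed
  qed
  also have "\<dots> = (4 * pi) powr (- real DIM('a) / 2) * Gamma (real DIM('a) / 2 - (- ?g)) * 2 powr (real DIM('a) - 2 * (- ?g))
        * (LINT xi|lborel. (cos (x \<bullet> xi) * (1 - exp (- t * norm xi powr \<alpha>))) * norm xi powr (2 * (- ?g) - real DIM('a)))"
  proof (rule gauss_mixture)
    show "- ?g < real DIM('a) / 2" using g d_ge1 by simp
    have "\<bar>cos (x \<bullet> xi) * (1 - exp (- t * norm xi powr \<alpha>))\<bar> \<le> 1 - exp (- t * norm xi powr \<alpha>)" for xi
      using t by (simp add: abs_mult mult_left_le_one_le)
    then show "integrable lborel (\<lambda>xi. (cos (x \<bullet> xi) * (1 - exp (- t * norm xi powr \<alpha>))) * norm xi powr (2 * (- ?g) - real DIM('a)))"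
      using integrable_char_defect[OF t, of "\<lambda>xi. cos (x \<bullet> xi) * (1 - exp (- t * norm xi powr \<alpha>))"] by simp
  qed measurable
  also have "real DIM('a) / 2 - (- ?g) = (real DIM('a) + \<delta>) / 2" by (simp add: add_divide_distrib)
  also have "real DIM('a) - 2 * (- ?g) = real DIM('a) + \<delta>" by simp
  also have "2 * (- ?g) - real DIM('a) = - \<delta> - real DIM('a)" by simp
  finally show ?thesis by (simp add: G_def)
qed

end

end

lemma has_bochner_integral_exp_Ioo:
  fixes v t :: real
  assumes "v > 0" "t > 0"
  shows "has_bochner_integral lborel (\<lambda>s. indicator {0<..<t} s * exp (- s * v)) ((1 - exp (- t * v)) / v)"
proof (rule has_bochner_integral_nn_integral)
  have "((\<lambda>s. exp (- s * v)) has_integral (- (exp (- t * v) / v) - - (exp (- 0 * v) / v))) {0..t}"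
    by (rule fundamental_theorem_of_calculus)
       (use assms in \<open>auto intro!: derivative_eq_intros simp flip: has_real_derivative_iff_has_vector_derivative\<close>)
  then have "((\<lambda>s. exp (- s * v)) has_integral ((1 - exp (- t * v)) / v)) {0<..<t}"
    by (simp add: has_integral_Icc_iff_Ioo diff_divide_distrib)
  then have "((\<lambda>s. indicator {0<..<t} s * exp (- s * v)) has_integral ((1 - exp (- t * v)) / v)) UNIV"
    by (subst (asm) has_integral_restrict_UNIV[symmetric], elim has_integral_eq[rotated]) (auto simp: indicator_def)
  then show "(\<integral>\<^sup>+s. ennreal (indicator {0<..<t} s * exp (- s * v)) \<partial>lborel) = ennreal ((1 - exp (- t * v)) / v)"
    by (intro nn_integral_has_integral_lborel) auto
qed (use assms in auto)

context stable_kernel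
begin

text \<open>On the Fourier side, integrating \<open>exp (- s * |xi| powr \<alpha>)\<close> over
  \<open>s\<close> in \<open>(0, t)\<close> converts the formula for the negative power into the one
  for \<open>|z| powr \<delta>\<close>. The constants in front combine to
  \<open>- kappa\<close>.\<close>

lemma heat_norm_powr_identity:
  assumes del: "0 < \<delta>" "\<delta> < \<alpha>" and t: "t > 0" and x: "x \<noteq> 0"
  defines "E \<equiv> \<lambda>s. LINT z|lborel. p s (z - x) * norm z powr (\<delta> - \<alpha>)"
  shows "integrable lborel (\<lambda>s. indicator {0<..<t} s * E s)"
    and "(LINT z|lborel. p t (z - x) * norm z powr \<delta>) = norm x powr \<delta> + (- kappa DIM('a) \<alpha> \<delta>) * (LINT s|lborel. indicator {0<..<t} s * E s)"
proof -
  let ?e = "(\<alpha> - \<delta>) - real DIM('a)"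
  let ?F = "\<lambda>(xi, s). indicator {0<..<t} s * (cos (x \<bullet> xi) * exp (- s * norm xi powr \<alpha>) * norm xi powr ?e)"
  define Gb where "Gb = Gamma ((\<alpha> - \<delta>) / 2)"
  define Cb where "Cb = (4 * pi) powr (- real DIM('a) / 2) * Gamma ((real DIM('a) + \<delta> - \<alpha>) / 2) * 2 powr (real DIM('a) + \<delta> - \<alpha>)"
  have Gb: "Gb > 0" using del by (simp add: Gb_def)
  define J where "J = (LINT xi|lborel. cos (x \<bullet> xi) * (1 - exp (- t * norm xi powr \<alpha>)) * norm xi powr (- \<delta> - real DIM('a)))"
  have ae: "AE xi in lborel. xi \<noteq> (0::'a)" by (rule AE_lborel_singleton)
  have m: "?F \<in> borel_measurable (lborel \<Otimes>\<^sub>M lborel)" by measurable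
  have pw: "norm xi powr ?e * ((1 - exp (- t * norm xi powr \<alpha>)) / norm xi powr \<alpha>) = (1 - exp (- t * norm xi powr \<alpha>)) * norm xi powr (- \<delta> - real DIM('a))" if "xi \<noteq> 0" for xi :: 'a
  proof -
    have "norm xi powr ?e = norm xi powr (- \<delta> - real DIM('a)) * norm xi powr \<alpha>"
      unfolding powr_add[symmetric] by (rule arg_cong[where f="\<lambda>e. norm xi powr e"]) simp
    then show ?thesis using that by simp
  qed
  have int: "integrable (lborel \<Otimes>\<^sub>M lborel) ?F"
  proof (rule lborel_pair.Fubini_integrable[OF m])
    have "AE xi in lborel. \<bar>cos (x \<bullet> xi)\<bar> * (1 - exp (- t * norm xi powr \<alpha>)) * norm xi powr (- \<delta> - real DIM('a)) = (LINT s|lborel. norm (?F (xi, s)))"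
      using ae
    proof eventually_elim
      case (elim xi)
      have "(LINT s|lborel. norm (?F (xi, s))) = (LINT s|lborel. (\<bar>cos (x \<bullet> xi)\<bar> * norm xi powr ?e) * (indicator {0<..<t} s * exp (- s * norm xi powr \<alpha>)))"
        by (rule Bochner_Integration.integral_cong) (auto simp: abs_mult indicator_def)
      also have "\<dots> = (\<bar>cos (x \<bullet> xi)\<bar> * norm xi powr ?e) * ((1 - exp (- t * norm xi powr \<alpha>)) / norm xi powr \<alpha>)"
        using has_bochner_integral_integral_eq[OF has_bochner_integral_exp_Ioo[of "norm xi powr \<alpha>" t]] elim t by simp
      finally show ?case unfolding mult.assoc pw[OF elim] by simp
    qed
    then show "integrable lborel (\<lambda>xi. LINT s|lborel. norm (?F (xi, s)))"
    proof (rule integrable_cong_AE_imp[rotated 2])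
      show "integrable lborel (\<lambda>xi. \<bar>cos (x \<bullet> xi)\<bar> * (1 - exp (- t * norm xi powr \<alpha>)) * norm xi powr (- \<delta> - real DIM('a)))"
        by (rule integrable_char_defect[OF del t]) (use t in \<open>auto simp: abs_mult mult_left_le_one_le\<close>)
    qed (use m in measurable)
    show "AE xi in lborel. integrable lborel (\<lambda>s. ?F (xi, s))"
      using ae
    proof eventually_elim
      case (elim xi)
      have "integrable lborel (\<lambda>s. (cos (x \<bullet> xi) * norm xi powr ?e) * (indicator {0<..<t} s * exp (- s * norm xi powr \<alpha>)))"
        using has_bochner_integral_exp_Ioo[of "norm xi powr \<alpha>" t] elim t by (intro integrable_mult_right) (auto simp: has_bochner_integral_iff)
      then show ?case by (simp add: mult_ac)
    qed
  qed
  have EF: "Gb * (indicator {0<..<t} s * E s) = Cb * (LINT xi|lborel. ?F (xi, s))" for s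
    using p_neg_moment_fourier[OF del _ x, of s] by (cases "s \<in> {0<..<t}") (auto simp: E_def Gb_def Cb_def)
  then have EF': "indicator {0<..<t} s * E s = Cb / Gb * (LINT xi|lborel. ?F (xi, s))" for s
    using Gb by (simp add: field_simps)
  have i: "integrable lborel (\<lambda>s. LINT xi|lborel. ?F (xi, s))"
    using lborel_pair.integrable_snd[OF int] by simp
  show "integrable lborel (\<lambda>s. indicator {0<..<t} s * E s)" unfolding EF' using i by (rule integrable_mult_right)
  have "(LINT s|lborel. LINT xi|lborel. ?F (xi, s)) = (LINT xi|lborel. LINT s|lborel. ?F (xi, s))"
    using lborel_pair.Fubini_integral[OF int] by simp
  also have "\<dots> = J" unfolding J_def
  proof (rule integral_cong_AE)
    show "AE xi in lborel. (LINT s|lborel. ?F (xi, s)) = cos (x \<bullet> xi) * (1 - exp (- t * norm xi powr \<alpha>)) * norm xi powr (- \<delta> - real DIM('a))"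
      using ae
    proof eventually_elim
      case (elim xi)
      have "(LINT s|lborel. ?F (xi, s)) = (LINT s|lborel. (cos (x \<bullet> xi) * norm xi powr ?e) * (indicator {0<..<t} s * exp (- s * norm xi powr \<alpha>)))"
        by (rule Bochner_Integration.integral_cong) (auto simp: indicator_def)
      also have "\<dots> = (cos (x \<bullet> xi) * norm xi powr ?e) * ((1 - exp (- t * norm xi powr \<alpha>)) / norm xi powr \<alpha>)"
        using has_bochner_integral_integral_eq[OF has_bochner_integral_exp_Ioo[of "norm xi powr \<alpha>" t]] elim t by simp
      finally show ?case unfolding mult.assoc pw[OF elim] by simp
    qed
  qed (use m in measurable)
  finally have J: "(LINT s|lborel. indicator {0<..<t} s * E s) = Cb / Gb * J" unfolding EF' by simp
  define Gd where "Gd = Gamma (- \<delta> / 2)"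
  have Gd: "Gd < 0" using Gamma_neg_frac(2)[of "\<delta> / 2"] del alpha by (simp add: Gd_def)
  define C2 where "C2 = (4 * pi) powr (- real DIM('a) / 2) * Gamma ((real DIM('a) + \<delta>) / 2) * 2 powr (real DIM('a) + \<delta>)"
  have P: "- Gd * ((LINT z|lborel. p t (z - x) * norm z powr \<delta>) - norm x powr \<delta>) = C2 * J"
    using p_moment_fourier[OF del t, of x] by (simp add: Gd_def C2_def J_def)
  have G3: "Gamma ((real DIM('a) + \<delta> - \<alpha>) / 2) > 0" using del alpha by simp
  \<comment> \<open>The exact value of \<open>kappa\<close> enters here, as the quotient of the two
    Fourier constants including their Gamma factors.\<close>
  have "C2 = Gd * (kappa DIM('a) \<alpha> \<delta> * (Cb / Gb))"
    unfolding kappa_def Cb_def C2_def Gd_def[symmetric] Gb_def[symmetric] using Gd Gb G3 by (simp add: powr_diff)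
  then have "- Gd * ((LINT z|lborel. p t (z - x) * norm z powr \<delta>) - norm x powr \<delta>) = - Gd * (- kappa DIM('a) \<alpha> \<delta> * (Cb / Gb * J))"
    unfolding P by simp
  then have "(LINT z|lborel. p t (z - x) * norm z powr \<delta>) - norm x powr \<delta> = - kappa DIM('a) \<alpha> \<delta> * (Cb / Gb * J)"
    using Gd by (simp only: mult_cancel_left) auto
  then show "(LINT z|lborel. p t (z - x) * norm z powr \<delta>) = norm x powr \<delta> + (- kappa DIM('a) \<alpha> \<delta>) * (LINT s|lborel. indicator {0<..<t} s * E s)"
    unfolding J by simp
qed

lemma kappa_neg:
  assumes del: "0 < \<delta>" "\<delta> < \<alpha>"
  shows "kappa DIM('a) \<alpha> \<delta> < 0"
proof -
  have "Gamma (- \<delta> / 2) < 0" using Gamma_neg_frac(2)[of "\<delta> / 2"] del alpha by simp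
  moreover have "Gamma ((real DIM('a) + \<delta> - \<alpha>) / 2) > 0" using del alpha by simp
  moreover have "Gamma ((real DIM('a) + \<delta>) / 2) > 0" using del d_ge1 by simp
  moreover have "Gamma ((\<alpha> - \<delta>) / 2) > 0" using del by simp
  ultimately show ?thesis unfolding kappa_def by (intro divide_pos_neg mult_pos_pos mult_neg_pos) auto
qed

end

section \<open>The Feynman-Kac kernel away from the axes\<close>

text \<open>Each \<open>s\<close> is approximated strictly from the right by the next point of the
  grid of mesh \<open>1 / Suc n\<close>; the approximating processes involve only countably many
  random variables.\<close>

lemma right_continuous_process_measurable:
  fixes X :: "real \<Rightarrow> 'b \<Rightarrow> 'a::{metric_space, second_countable_topology}"
  assumes [measurable]: "\<And>t. X t \<in> borel_measurable M"
    and rc: "\<And>\<omega> s. \<omega> \<in> space M \<Longrightarrow> continuous (at_right s) (\<lambda>r. X r \<omega>)"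
  shows "(\<lambda>(s, \<omega>). X s \<omega>) \<in> borel_measurable (borel \<Otimes>\<^sub>M M)"
proof (rule borel_measurable_LIMSEQ_metric[where f="\<lambda>n (s, \<omega>). X ((real_of_int \<lfloor>s * real (Suc n)\<rfloor> + 1) / real (Suc n)) \<omega>"])
  let ?g = "\<lambda>n s. (real_of_int \<lfloor>s * real (Suc n)\<rfloor> + 1) / real (Suc n)"
  fix n :: nat
  have fl: "(\<lambda>x. \<lfloor>fst x * real (Suc n)\<rfloor>) \<in> borel \<Otimes>\<^sub>M M \<rightarrow>\<^sub>M count_space UNIV"
    by measurable
  have Xi: "(\<lambda>x. X ((real_of_int i + 1) / real (Suc n)) (snd x)) \<in> borel_measurable (borel \<Otimes>\<^sub>M M)" for i :: int
    by measurable
  show "(\<lambda>(s, \<omega>). X (?g n s) \<omega>) \<in> borel_measurable (borel \<Otimes>\<^sub>M M)"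
    using measurable_compose_countable[OF Xi fl] by (simp add: case_prod_beta)
next
  let ?g = "\<lambda>n s. (real_of_int \<lfloor>s * real (Suc n)\<rfloor> + 1) / real (Suc n)"
  fix x :: "real \<times> 'b" assume "x \<in> space (borel \<Otimes>\<^sub>M M)"
  then obtain s \<omega> where x: "x = (s, \<omega>)" and w: "\<omega> \<in> space M" by (auto simp: space_pair_measure)
  have gt: "?g n s > s" for n using floor_correct[of "s * real (Suc n)"] by (simp add: field_simps)
  have le: "?g n s \<le> s + 1 / real (Suc n)" for n
  proof -
    have "?g n s \<le> (s * real (Suc n) + 1) / real (Suc n)" by (intro divide_right_mono add_right_mono of_int_floor_le) simp
    then show ?thesis by (simp add: add_divide_distrib del: of_nat_Suc)
  qed
  have "(\<lambda>n. ?g n s) \<longlonglongrightarrow> s"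
  proof (rule tendsto_sandwich[of "\<lambda>_. s" _ _ "\<lambda>n. s + 1 / real (Suc n)"])
    have "(\<lambda>n. s + 1 / real (Suc n)) \<longlonglongrightarrow> s + 0"
      using LIMSEQ_inverse_real_of_nat by (intro tendsto_intros) (simp add: inverse_eq_divide)
    then show "(\<lambda>n. s + 1 / real (Suc n)) \<longlonglongrightarrow> s" by simp
  qed (use gt le in \<open>auto intro!: eventuallyI less_imp_le\<close>)
  then have "filterlim (\<lambda>n. ?g n s) (at_right s) sequentially"
    using gt by (intro tendsto_imp_filterlim_at_right) (auto intro!: eventuallyI)
  moreover have "((\<lambda>r. X r \<omega>) \<longlongrightarrow> X s \<omega>) (at_right s)" using rc[OF w, of s] by (simp add: continuous_within)
  ultimately show "(\<lambda>n. (case x of (s, \<omega>) \<Rightarrow> X (?g n s) \<omega>)) \<longlonglongrightarrow> (case x of (s, \<omega>) \<Rightarrow> X s \<omega>)"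
    unfolding x by (auto intro: filterlim_compose)
qed

section \<open>One-time and two-time laws of the process and the killing functional\<close>

locale stable_process = stable_kernel \<alpha> C0 p
  for \<alpha> C0 :: real and p :: "real \<Rightarrow> 'a::euclidean_space \<Rightarrow> real" +
  fixes M :: "'b measure" and X :: "real \<Rightarrow> 'b \<Rightarrow> 'a"
  assumes process: "is_stable_process M \<alpha> X"
begin

sublocale M: prob_space M using process by (simp add: is_stable_process_def)

lemma X_meas [measurable]: "X t \<in> borel_measurable M"
  using process by (simp add: is_stable_process_def)

lemma X_0: "\<omega> \<in> space M \<Longrightarrow> X 0 \<omega> = 0"
  using process by (simp add: is_stable_process_def)

lemma X_right_cont: "\<omega> \<in> space M \<Longrightarrow> continuous (at_right s) (\<lambda>r. X r \<omega>)"
  using process by (simp add: is_stable_process_def)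

lemma X_meas2 [measurable]: "(\<lambda>(s, \<omega>). X s \<omega>) \<in> borel_measurable (borel \<Otimes>\<^sub>M M)"
  by (rule right_continuous_process_measurable[OF X_meas X_right_cont])

lemma law_increment:
  assumes "0 \<le> s" "s < t"
  shows "distr M borel (\<lambda>\<omega>. X t \<omega> - X s \<omega>) = density lborel (\<lambda>y. ennreal (p (t - s) y))"
proof (rule finite_measure_eqI_char)
  have ts: "t - s > 0" using assms by simp
  note [measurable] = p_meas[OF ts]
  show "finite_measure (distr M borel (\<lambda>\<omega>. X t \<omega> - X s \<omega>))"
    by (intro prob_space.finite_measure M.prob_space_distr) measurable
  have "emeasure (density lborel (\<lambda>y. ennreal (p (t - s) y))) UNIV = 1"
    using nn_integral_p[OF ts] by (simp add: emeasure_density)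
  then show "finite_measure (density lborel (\<lambda>y. ennreal (p (t - s) y)))"
    by (intro finite_measureI) simp
  fix xi :: 'a
  have "(LINT y|distr M borel (\<lambda>\<omega>. X t \<omega> - X s \<omega>). cis (xi \<bullet> y)) = (LINT \<omega>|M. cis (xi \<bullet> (X t \<omega> - X s \<omega>)))"
    unfolding cis_conv_exp by (rule integral_distr) measurable
  also have "\<dots> = exp (- (t - s) * norm xi powr \<alpha>)"
    using process assms by (simp add: is_stable_process_def)
  also have "\<dots> = (LINT y|lborel. complex_of_real (p (t - s) y) * cis (xi \<bullet> y))" by (rule p_char[OF ts, symmetric])
  also have "\<dots> = (LINT y|density lborel (\<lambda>y. ennreal (p (t - s) y)). cis (xi \<bullet> y))"
    unfolding cis_conv_exp by (subst integral_density) (auto simp: p_nonneg[OF ts] scaleR_conv_of_real)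
  finally show "(LINT y|distr M borel (\<lambda>\<omega>. X t \<omega> - X s \<omega>). cis (xi \<bullet> y)) = (LINT y|density lborel (\<lambda>y. ennreal (p (t - s) y)). cis (xi \<bullet> y))" .
qed auto

lemma law_X:
  assumes t: "t > 0"
  shows "distr M borel (X t) = density lborel (\<lambda>y. ennreal (p t y))"
proof -
  have "distr M borel (X t) = distr M borel (\<lambda>\<omega>. X t \<omega> - X 0 \<omega>)"
    by (rule distr_cong) (auto simp: X_0)
  then show ?thesis using law_increment[of 0 t] t by simp
qed

lemma nn_integral_X:
  assumes t: "t > 0" and [measurable]: "f \<in> borel_measurable borel"
  shows "(\<integral>\<^sup>+\<omega>. f (x + X t \<omega>) \<partial>M) = (\<integral>\<^sup>+y. ennreal (p t (y - x)) * f y \<partial>lborel)"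
proof -
  note [measurable] = p_meas[OF t]
  have "(\<integral>\<^sup>+\<omega>. f (x + X t \<omega>) \<partial>M) = (\<integral>\<^sup>+y. f (x + y) \<partial>distr M borel (X t))"
    by (subst nn_integral_distr) auto
  also have "\<dots> = (\<integral>\<^sup>+y. ennreal (p t y) * f (x + y) \<partial>lborel)"
    unfolding law_X[OF t] by (subst nn_integral_density) auto
  also have "\<dots> = (\<integral>\<^sup>+y. ennreal (p t (y - x)) * f y \<partial>lborel)"
    using nn_integral_translate[of "\<lambda>y. ennreal (p t (y - x)) * f y" x] by simp
  finally show ?thesis .
qed

lemma nn_integral_X2:
  assumes s: "0 < s" "s < t" and f[measurable]: "(\<lambda>(z, w). f z w) \<in> borel_measurable (borel \<Otimes>\<^sub>M borel)"
  shows "(\<integral>\<^sup>+\<omega>. f (X s \<omega>) (X t \<omega> - X s \<omega>) \<partial>M) = (\<integral>\<^sup>+z. (\<integral>\<^sup>+w. ennreal (p s z) * (ennreal (p (t - s) w) * f z w) \<partial>lborel) \<partial>lborel)"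
proof -
  have ts: "t - s > 0" using s by simp
  note [measurable] = p_meas[OF ts] p_meas[OF s(1)]
  \<comment> \<open>The independence axiom speaks about sequences of times. The times
    \<open>0, s, t\<close> give two increments; the sequence is constant from index 2 on, which is
    allowed because strict growth is asked only for \<open>i < 2\<close>.\<close>
  define tau :: "nat \<Rightarrow> real" where "tau i = (if i = 0 then 0 else if i = 1 then s else t)" for i
  have "0 \<le> tau 0 \<longrightarrow> (\<forall>i<2. tau i < tau (Suc i)) \<longrightarrow> M.indep_vars (\<lambda>_. borel) (\<lambda>i \<omega>. X (tau (Suc i)) \<omega> - X (tau i) \<omega>) {..<2}"
    using process unfolding is_stable_process_def by blast
  moreover have "0 \<le> tau 0" "\<forall>i<2. tau i < tau (Suc i)" using s by (auto simp: tau_def less_2_cases_iff)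
  ultimately have "M.indep_vars (\<lambda>_. borel) (\<lambda>i \<omega>. X (tau (Suc i)) \<omega> - X (tau i) \<omega>) {..<2}" by blast
  from M.indep_var_restrict[OF this, of "{0}" "{1}"]
  have "M.indep_var (PiM {0} (\<lambda>_. borel)) (\<lambda>\<omega>. restrict (\<lambda>i. X (tau (Suc i)) \<omega> - X (tau i) \<omega>) {0})
     (PiM {1} (\<lambda>_. borel)) (\<lambda>\<omega>. restrict (\<lambda>i. X (tau (Suc i)) \<omega> - X (tau i) \<omega>) {1})" by auto
  then have "M.indep_var borel ((\<lambda>f. f 0) \<circ> (\<lambda>\<omega>. restrict (\<lambda>i. X (tau (Suc i)) \<omega> - X (tau i) \<omega>) {0}))
     borel ((\<lambda>f. f 1) \<circ> (\<lambda>\<omega>. restrict (\<lambda>i. X (tau (Suc i)) \<omega> - X (tau i) \<omega>) {1}))"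
    by (rule M.indep_var_compose) measurable
  then have ind: "M.indep_var borel (\<lambda>\<omega>. X s \<omega> - X 0 \<omega>) borel (\<lambda>\<omega>. X t \<omega> - X s \<omega>)"
    by (simp add: comp_def tau_def)
  let ?A = "\<lambda>\<omega>. X s \<omega> - X 0 \<omega>" and ?B = "\<lambda>\<omega>. X t \<omega> - X s \<omega>"
  have eq: "distr M borel ?A \<Otimes>\<^sub>M distr M borel ?B = distr M (borel \<Otimes>\<^sub>M borel) (\<lambda>\<omega>. (?A \<omega>, ?B \<omega>))"
    using ind unfolding M.indep_var_distribution_eq by blast
  have "(\<integral>\<^sup>+\<omega>. f (X s \<omega>) (X t \<omega> - X s \<omega>) \<partial>M) = (\<integral>\<^sup>+\<omega>. (\<lambda>(z, w). f z w) (?A \<omega>, ?B \<omega>) \<partial>M)"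
    by (rule nn_integral_cong) (simp add: X_0)
  also have "\<dots> = (\<integral>\<^sup>+v. (\<lambda>(z, w). f z w) v \<partial>(distr M borel ?A \<Otimes>\<^sub>M distr M borel ?B))"
    unfolding eq by (subst nn_integral_distr) auto
  also have "\<dots> = (\<integral>\<^sup>+v. (\<lambda>(z, w). f z w) v \<partial>(density lborel (\<lambda>y. ennreal (p s y)) \<Otimes>\<^sub>M density lborel (\<lambda>y. ennreal (p (t - s) y))))"
    using law_increment[of 0 s] law_increment[of s t] s by simp
  also have "\<dots> = (\<integral>\<^sup>+z. (\<integral>\<^sup>+w. f z w \<partial>density lborel (\<lambda>y. ennreal (p (t - s) y))) \<partial>density lborel (\<lambda>y. ennreal (p s y)))"
  proof -
    interpret D: sigma_finite_measure "density lborel (\<lambda>y. ennreal (p (t - s) y))"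
      by (rule finite_measure.sigma_finite_measure, rule finite_measureI) (use nn_integral_p[OF ts] in \<open>simp add: emeasure_density\<close>)
    show ?thesis by (subst D.nn_integral_fst[symmetric]) auto
  qed
  also have "\<dots> = (\<integral>\<^sup>+z. ennreal (p s z) * (\<integral>\<^sup>+w. ennreal (p (t - s) w) * f z w \<partial>lborel) \<partial>lborel)"
    by (simp add: nn_integral_density)
  also have "\<dots> = (\<integral>\<^sup>+z. (\<integral>\<^sup>+w. ennreal (p s z) * (ennreal (p (t - s) w) * f z w) \<partial>lborel) \<partial>lborel)"
    by (subst nn_integral_cmult) auto
  finally show ?thesis .
qed

text \<open>The killing functional with \<open>c\<close> in the place of \<open>- kap\<close>, kept
  in \<open>ennreal\<close> so that Tonelli applies before finiteness is known.\<close>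

definition FKint :: "real \<Rightarrow> real \<Rightarrow> 'a \<Rightarrow> 'b \<Rightarrow> ennreal" where
  "FKint c t x \<omega> = (\<integral>\<^sup>+ s\<in>{0..t}. ennreal (c * norm (x + X s \<omega>) powr (- \<alpha>)) \<partial>lborel)"

lemma FKint_meas [measurable]: "FKint c t x \<in> borel_measurable M"
proof -
  have "(\<lambda>\<omega>. (\<integral>\<^sup>+s. (\<lambda>(s, \<omega>). ennreal (c * norm (x + (\<lambda>(s, \<omega>). X s \<omega>) (s, \<omega>)) powr (- \<alpha>)) * indicator {0..t} s) (s, \<omega>) \<partial>lborel)) \<in> borel_measurable M"
    by measurable
  then show ?thesis unfolding FKint_def[abs_def] by simp
qed

lemma FK_weight_eq: "FK_weight (- c) \<alpha> X t x \<omega> = (if FKint c t x \<omega> = \<infinity> then 0 else exp (- enn2real (FKint c t x \<omega>)))"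
  by (simp add: FK_weight_def FKint_def Let_def)

lemma FK_weight_meas [measurable]: "FK_weight (- c) \<alpha> X t x \<in> borel_measurable M"
  unfolding FK_weight_eq[abs_def] by measurable

lemma FK_weight_bounds: "0 \<le> FK_weight (- c) \<alpha> X t x \<omega>" "FK_weight (- c) \<alpha> X t x \<omega> \<le> 1"
  by (auto simp: FK_weight_eq)

text \<open>Tangent line of the convex function \<open>exp (- I)\<close> at \<open>I = a\<close>,
  arranged as a sum to avoid subtraction in \<open>ennreal\<close>. At \<open>a = 0\<close> it
  bounds one minus the weight by \<open>FKint\<close>; with \<open>a\<close> a bound on a
  conditional mean it serves as Jensen's inequality.\<close>

lemma FK_weight_tangent:
  assumes a: "a \<ge> 0"
  shows "ennreal (exp (- a) * (1 + a)) \<le> ennreal (FK_weight (- c) \<alpha> X t x \<omega>) + ennreal (exp (- a)) * FKint c t x \<omega>"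
proof (cases "FKint c t x \<omega> = \<infinity>")
  case True
  then show ?thesis by (simp add: ennreal_mult_top)
next
  case False
  then obtain I where I: "FKint c t x \<omega> = ennreal I" "I \<ge> 0" by (cases "FKint c t x \<omega>") auto
  have "1 + a - I \<le> exp (a - I)" using exp_ge_add_one_self[of "a - I"] by linarith
  then have "exp (- a) * (1 + a - I) \<le> exp (- a) * exp (a - I)" by (intro mult_left_mono) auto
  also have "\<dots> = exp (- I)" by (simp flip: exp_add)
  finally have "exp (- a) * (1 + a) \<le> exp (- I) + exp (- a) * I" by (simp add: algebra_simps)
  then show ?thesis using I a by (simp add: FK_weight_eq flip: ennreal_mult ennreal_plus)
qed

text \<open>Tonelli followed by the joint law of \<open>X s\<close> and \<open>X t - X s\<close>.
  The endpoints \<open>s = 0\<close> and \<open>s = t\<close>, where one of the two densities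
  degenerates, form a null set.\<close>

lemma nn_integral_FKint:
  assumes t: "t > 0" and [measurable]: "f \<in> borel_measurable borel"
  shows "(\<integral>\<^sup>+\<omega>. f (x + X t \<omega>) * FKint c t x \<omega> \<partial>M) =
    (\<integral>\<^sup>+s. indicator {0<..<t} s * (\<integral>\<^sup>+z. (\<integral>\<^sup>+w. ennreal (p s z) * (ennreal (p (t - s) w) * (f (x + z + w) * ennreal (c * norm (x + z) powr (- \<alpha>)))) \<partial>lborel) \<partial>lborel) \<partial>lborel)"
proof -
  interpret P: pair_sigma_finite M "lborel :: real measure" ..
  have X2: "(\<lambda>(\<omega>, s). X s \<omega>) \<in> borel_measurable (M \<Otimes>\<^sub>M borel)"
    using measurable_pair_swap[OF X_meas2] by (simp add: case_prod_beta)
  have m: "(\<lambda>(\<omega>, s). f (x + X t \<omega>) * (ennreal (c * norm (x + X s \<omega>) powr (- \<alpha>)) * indicator {0..t} s)) \<in> borel_measurable (M \<Otimes>\<^sub>M lborel)"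
  proof -
    have "(\<lambda>(\<omega>, s). f (x + X t \<omega>) * (ennreal (c * norm (x + (\<lambda>(\<omega>, s). X s \<omega>) (\<omega>, s)) powr (- \<alpha>)) * indicator {0..t} s)) \<in> borel_measurable (M \<Otimes>\<^sub>M lborel)"
      using X2 by measurable
    then show ?thesis by simp
  qed
  have "(\<integral>\<^sup>+\<omega>. f (x + X t \<omega>) * FKint c t x \<omega> \<partial>M) = (\<integral>\<^sup>+\<omega>. (\<integral>\<^sup>+s. f (x + X t \<omega>) * (ennreal (c * norm (x + X s \<omega>) powr (- \<alpha>)) * indicator {0..t} s) \<partial>lborel) \<partial>M)"
  proof (rule nn_integral_cong)
    fix \<omega> assume w: "\<omega> \<in> space M"
    have "(\<lambda>s. X s \<omega>) \<in> borel_measurable borel" using measurable_Pair2[OF X2 w] by simp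
    then show "f (x + X t \<omega>) * FKint c t x \<omega> = (\<integral>\<^sup>+s. f (x + X t \<omega>) * (ennreal (c * norm (x + X s \<omega>) powr (- \<alpha>)) * indicator {0..t} s) \<partial>lborel)"
      unfolding FKint_def by (subst nn_integral_cmult) auto
  qed
  also have "\<dots> = (\<integral>\<^sup>+s. (\<integral>\<^sup>+\<omega>. f (x + X t \<omega>) * (ennreal (c * norm (x + X s \<omega>) powr (- \<alpha>)) * indicator {0..t} s) \<partial>M) \<partial>lborel)"
    by (rule P.Fubini'[symmetric]) (rule m)
  also have "\<dots> = (\<integral>\<^sup>+s. indicator {0<..<t} s * (\<integral>\<^sup>+z. (\<integral>\<^sup>+w. ennreal (p s z) * (ennreal (p (t - s) w) * (f (x + z + w) * ennreal (c * norm (x + z) powr (- \<alpha>)))) \<partial>lborel) \<partial>lborel) \<partial>lborel)"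
  proof (rule nn_integral_cong_AE)
    have "AE s in lborel. s \<noteq> (0::real)" "AE s in lborel. s \<noteq> t" by (rule AE_lborel_singleton)+
    then show "AE s in lborel. (\<integral>\<^sup>+\<omega>. f (x + X t \<omega>) * (ennreal (c * norm (x + X s \<omega>) powr (- \<alpha>)) * indicator {0..t} s) \<partial>M) = indicator {0<..<t} s * (\<integral>\<^sup>+z. (\<integral>\<^sup>+w. ennreal (p s z) * (ennreal (p (t - s) w) * (f (x + z + w) * ennreal (c * norm (x + z) powr (- \<alpha>)))) \<partial>lborel) \<partial>lborel)"
    proof eventually_elim
      case (elim s)
      show ?case
      proof (cases "s \<in> {0<..<t}")
        case True
        then have "(\<integral>\<^sup>+\<omega>. f (x + X t \<omega>) * (ennreal (c * norm (x + X s \<omega>) powr (- \<alpha>)) * indicator {0..t} s) \<partial>M)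
          = (\<integral>\<^sup>+\<omega>. f (x + X s \<omega> + (X t \<omega> - X s \<omega>)) * ennreal (c * norm (x + X s \<omega>) powr (- \<alpha>)) \<partial>M)"
          by (intro nn_integral_cong) (auto simp: algebra_simps)
        also have "\<dots> = (\<integral>\<^sup>+z. (\<integral>\<^sup>+w. ennreal (p s z) * (ennreal (p (t - s) w) * (f (x + z + w) * ennreal (c * norm (x + z) powr (- \<alpha>)))) \<partial>lborel) \<partial>lborel)"
          using True by (intro nn_integral_X2[where f="\<lambda>z w. f (x + z + w) * ennreal (c * norm (x + z) powr (- \<alpha>))"]) auto
        finally show ?thesis using True by simp
      next
        case False
        then have "s \<notin> {0..t}" using elim by auto
        then show ?thesis using False by simp
      qed
    qed
  qed
  finally show ?thesis .
qed

end

text \<open>A Dynkin argument for signed densities: when it is applied to the kernel, the sign of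
  \<open>G\<close> is still unknown, so \<open>G\<close> cannot yet be treated as the density of a
  measure.\<close>

lemma integral_eq_on_borel:
  fixes G :: "'a::metric_space \<Rightarrow> real" and g :: "'b \<Rightarrow> real" and Y :: "'b \<Rightarrow> 'a"
  assumes sets[measurable_cong]: "sets N = sets borel" and G[measurable]: "integrable N G" and g[measurable]: "integrable M g"
    and Y[measurable]: "Y \<in> borel_measurable M"
    and eq: "\<And>f :: 'a \<Rightarrow> real. continuous_on UNIV f \<Longrightarrow> (\<And>x. 0 \<le> f x) \<Longrightarrow> (\<And>x. f x \<le> 1) \<Longrightarrow>
                (LINT y|N. f y * G y) = (LINT \<omega>|M. f (Y \<omega>) * g \<omega>)"
    and A: "A \<in> sets borel"
  shows "(LINT y|N. indicator A y * G y) = (LINT \<omega>|M. indicator A (Y \<omega>) * g \<omega>)"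
proof -
  have lim: "(LINT y|N. h y * G y) = (LINT \<omega>|M. h (Y \<omega>) * g \<omega>)"
    if F: "\<And>n. (LINT y|N. F n y * G y) = (LINT \<omega>|M. F n (Y \<omega>) * g \<omega>)"
      and [measurable]: "\<And>n. F n \<in> borel_measurable borel" "h \<in> borel_measurable borel" and b: "\<And>n y. \<bar>F n y\<bar> \<le> 1"
      and lim: "\<And>y. (\<lambda>n. F n y) \<longlonglongrightarrow> h y" for F :: "nat \<Rightarrow> 'a \<Rightarrow> real" and h
  proof -
    have 1: "(\<lambda>n. LINT y|N. F n y * G y) \<longlonglongrightarrow> (LINT y|N. h y * G y)"
      by (rule integral_dominated_convergence[where w="\<lambda>y. \<bar>G y\<bar>"])
         (use G lim b in \<open>auto simp: abs_mult intro!: AE_I2 tendsto_mult mult_left_le_one_le\<close>)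
    have 2: "(\<lambda>n. LINT \<omega>|M. F n (Y \<omega>) * g \<omega>) \<longlonglongrightarrow> (LINT \<omega>|M. h (Y \<omega>) * g \<omega>)"
      by (rule integral_dominated_convergence[where w="\<lambda>y. \<bar>g y\<bar>"])
         (use g lim b in \<open>auto simp: abs_mult intro!: AE_I2 tendsto_mult mult_left_le_one_le\<close>)
    show ?thesis using 1 2 unfolding F by (rule LIMSEQ_unique)
  qed
  have UNIV: "(LINT y|N. G y) = (LINT \<omega>|M. g \<omega>)" using eq[of "\<lambda>_. 1"] by simp
  have op: "(LINT y|N. indicator U y * G y) = (LINT \<omega>|M. indicator U (Y \<omega>) * g \<omega>)" if U: "open U" for U
  proof (cases "U = UNIV")
    case False
    have cont: "continuous_on UNIV (\<lambda>x. min 1 (real n * infdist x (- U)))" for n by (intro continuous_intros)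
    show ?thesis
    proof (rule lim[where F="\<lambda>n x. min 1 (real n * infdist x (- U))"])
      show "(LINT y|N. min 1 (real n * infdist y (- U)) * G y) = (LINT \<omega>|M. min 1 (real n * infdist (Y \<omega>) (- U)) * g \<omega>)" for n
        by (rule eq[OF cont]) (auto simp: infdist_nonneg)
    qed (use U cont open_indicator_tendsto[OF U False] in \<open>auto intro!: borel_measurable_continuous_onI borel_measurable_indicator simp: infdist_nonneg\<close>)
  qed (simp add: UNIV)
  have A': "A \<in> sigma_sets UNIV {U. open U}" using A by (simp add: borel_def)
  have "Int_stable {U::'a set. open U}" "{U::'a set. open U} \<subseteq> Pow UNIV" by (auto simp: Int_stable_def)
  then show ?thesis
    using A'
  proof (induct rule: sigma_sets_induct_disjoint)
    case (basic U)
    then show ?case by (simp add: op)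
  next
    case empty
    show ?case by simp
  next
    case (compl B)
    have [measurable]: "B \<in> sets borel" using compl(1) by (simp add: borel_def)
    have i1: "integrable N (\<lambda>y. indicator B y * G y)"
      by (rule Bochner_Integration.integrable_bound[OF G]) (auto simp: indicator_def)
    have i2: "integrable M (\<lambda>\<omega>. indicator B (Y \<omega>) * g \<omega>)"
      by (rule Bochner_Integration.integrable_bound[OF g]) (auto simp: indicator_def)
    have "(LINT y|N. indicator (UNIV - B) y * G y) = (LINT y|N. G y - indicator B y * G y)"
      by (rule Bochner_Integration.integral_cong) (auto simp: indicator_def)
    also have "\<dots> = (LINT \<omega>|M. g \<omega> - indicator B (Y \<omega>) * g \<omega>)"
      using G g i1 i2 compl UNIV by simp
    also have "\<dots> = (LINT \<omega>|M. indicator (UNIV - B) (Y \<omega>) * g \<omega>)"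
      by (rule Bochner_Integration.integral_cong) (auto simp: indicator_def)
    finally show ?case .
  next
    case (union B)
    have B[measurable]: "B i \<in> sets borel" for i using union(2) by (auto simp: borel_def)
    let ?F = "\<lambda>n y. \<Sum>i<n. indicator (B i) y :: real"
    have ind: "?F n y = indicator (\<Union>i<n. B i) y" for n y
      by (rule indicator_UN_disjoint[symmetric]) (use union(1) in \<open>auto simp: disjoint_family_on_def\<close>)
    show ?case
    proof (rule lim[where F="?F"])
      fix n
      have i1: "integrable N (\<lambda>y. indicator (B i) y * G y)" for i
        by (rule Bochner_Integration.integrable_bound[OF G]) (auto simp: indicator_def)
      have i2: "integrable M (\<lambda>\<omega>. indicator (B i) (Y \<omega>) * g \<omega>)" for i
        by (rule Bochner_Integration.integrable_bound[OF g]) (auto simp: indicator_def)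
      show "(LINT y|N. ?F n y * G y) = (LINT \<omega>|M. ?F n (Y \<omega>) * g \<omega>)"
        unfolding sum_distrib_right by (subst (1 2) Bochner_Integration.integral_sum) (use i1 i2 union(3) in auto)
      show "\<bar>?F n y\<bar> \<le> 1" for y unfolding ind by simp
      show "(\<lambda>n. ?F n y) \<longlonglongrightarrow> indicator (\<Union>i. B i) y" for y
        unfolding ind by (rule LIMSEQ_indicator_UN)
    qed auto
  qed
qed

lemma AE_le_if_integral_le:
  fixes f g :: "'a \<Rightarrow> real"
  assumes f[measurable]: "integrable M f" and g[measurable]: "integrable M g"
    and le: "\<And>A. A \<in> sets M \<Longrightarrow> (LINT x|M. indicator A x * f x) \<le> (LINT x|M. indicator A x * g x)"
  shows "AE x in M. f x \<le> g x"
proof -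
  let ?A = "{x \<in> space M. g x < f x}"
  have A: "?A \<in> sets M" by measurable
  have iF: "integrable M (\<lambda>x. indicator ?A x * f x)"
    by (rule Bochner_Integration.integrable_bound[OF f]) (auto simp: indicator_def)
  have ig: "integrable M (\<lambda>x. indicator ?A x * g x)"
    by (rule Bochner_Integration.integrable_bound[OF g]) (auto simp: indicator_def)
  have i: "integrable M (\<lambda>x. indicator ?A x * f x - indicator ?A x * g x)"
    using iF ig by simp
  have nn: "AE x in M. 0 \<le> indicator ?A x * f x - indicator ?A x * g x" by (auto simp: indicator_def)
  have "(LINT x|M. indicator ?A x * f x - indicator ?A x * g x) \<le> 0"
    using iF ig le[OF A] by simp
  then have "(LINT x|M. indicator ?A x * f x - indicator ?A x * g x) = 0"
    using integral_nonneg_AE[OF nn] by simp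
  then have "AE x in M. indicator ?A x * f x - indicator ?A x * g x = 0"
    using integral_nonneg_eq_0_iff_AE[OF i nn] by simp
  then show ?thesis using AE_space by eventually_elim (auto simp: indicator_def split: if_splits)
qed

locale fk_kernel = stable_process \<alpha> C0 p M X
  for \<alpha> C0 :: real and p :: "real \<Rightarrow> 'a::euclidean_space \<Rightarrow> real" and M :: "'b measure" and X :: "real \<Rightarrow> 'b \<Rightarrow> 'a" +
  fixes \<delta> :: real and pt :: "real \<Rightarrow> 'a \<Rightarrow> 'a \<Rightarrow> real"
  assumes del: "0 < \<delta>" "\<delta> < \<alpha>"
    and kernel: "is_FK_heat_kernel M (kappa DIM('a) \<alpha> \<delta>) \<alpha> X pt"
begin

definition c where "c = - kappa DIM('a) \<alpha> \<delta>"

lemma c_pos: "c > 0" using kappa_neg[OF del] by (simp add: c_def)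

lemma kappa_c: "kappa DIM('a) \<alpha> \<delta> = - c" by (simp add: c_def)

abbreviation W :: "real \<Rightarrow> 'a \<Rightarrow> 'b \<Rightarrow> real" where "W t x \<omega> \<equiv> FK_weight (- c) \<alpha> X t x \<omega>"

lemma pt_sym: "t > 0 \<Longrightarrow> pt t x y = pt t y x"
  and pt_0: "t > 0 \<Longrightarrow> pt t x 0 = 0" "t > 0 \<Longrightarrow> pt t 0 x = 0"
  and CK: "s > 0 \<Longrightarrow> t > 0 \<Longrightarrow> integrable lborel (\<lambda>z. pt s x z * pt t z y)"
    "s > 0 \<Longrightarrow> t > 0 \<Longrightarrow> pt (s + t) x y = (LINT z|lborel. pt s x z * pt t z y)"
  and FK: "f \<in> C_infty_punctured \<Longrightarrow> t > 0 \<Longrightarrow> x \<noteq> 0 \<Longrightarrow> integrable lborel (\<lambda>y. pt t x y * f y)"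
    "f \<in> C_infty_punctured \<Longrightarrow> t > 0 \<Longrightarrow> x \<noteq> 0 \<Longrightarrow> (LINT y|lborel. pt t x y * f y) = (LINT \<omega>|M. f (x + X t \<omega>) * W t x \<omega>)"
  using kernel unfolding is_FK_heat_kernel_def kappa_c by blast+

text \<open>Positive off the origin and vanishing at 0 and at infinity. Multiplication by it moves
  every continuous function with values in \<open>[0, 1]\<close> into
  \<open>C_infty_punctured\<close>; dividing by it afterwards recovers the full law.\<close>

definition f0 :: "'a \<Rightarrow> real" where "f0 y = norm y / (1 + (norm y)\<^sup>2)"

lemma f0_bounds: "0 \<le> f0 y" "f0 y \<le> 1" "y \<noteq> 0 \<Longrightarrow> 0 < f0 y" "f0 0 = 0"
proof -
  have "norm y \<le> 1 + (norm y)\<^sup>2" using sum_squares_bound[of "norm y" 1] by (smt (verit) power2_less_0 norm_ge_zero mult_2_right one_power2 mult_cancel_left1)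
  then show "f0 y \<le> 1" by (simp add: f0_def divide_le_eq_1 add_pos_nonneg)
qed (auto simp: f0_def add_pos_nonneg)

lemma continuous_f0: "continuous_on UNIV f0"
  unfolding f0_def by (intro continuous_intros) (metis add_pos_nonneg less_irrefl zero_le_power2 zero_less_one)

lemma f0_meas [measurable]: "f0 \<in> borel_measurable borel"
  using continuous_f0 by (rule borel_measurable_continuous_onI)

lemma f0_mult_in:
  assumes "continuous_on UNIV \<psi>" "\<And>y. 0 \<le> \<psi> y" "\<And>y. \<psi> y \<le> 1"
  shows "(\<lambda>y. \<psi> y * f0 y) \<in> C_infty_punctured"
proof -
  have cont: "continuous_on UNIV (\<lambda>y. \<psi> y * f0 y)" using assms(1) continuous_f0 by (intro continuous_intros)
  then have "continuous_on (UNIV - {0}) (\<lambda>y. \<psi> y * f0 y)" by (rule continuous_on_subset) simp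
  moreover have "((\<lambda>y. \<psi> y * f0 y) \<longlongrightarrow> 0) (at 0)"
    using cont by (simp add: continuous_on_def f0_bounds(4) tendsto_within_subset) (metis UNIV_I f0_bounds(4) mult_zero_right)
  moreover have "((\<lambda>y. \<psi> y * f0 y) \<longlongrightarrow> 0) at_infinity"
  proof (rule Lim_null_comparison)
    show "\<forall>\<^sub>F y in at_infinity. norm (\<psi> y * f0 y) \<le> 1 / norm y"
    proof (rule eventually_at_infinityI[of 1])
      fix y :: 'a assume y: "norm y \<ge> 1"
      then have n: "norm y > 0" by linarith
      have "norm (\<psi> y * f0 y) \<le> 1 * f0 y" using assms(2,3)[of y] f0_bounds(1)[of y] by (simp add: abs_mult mult_right_le_one_le mult_left_le_one_le)
      also have "1 * f0 y \<le> norm y / (norm y)\<^sup>2" using n unfolding f0_def mult_1 by (intro divide_left_mono mult_pos_pos add_pos_nonneg) auto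
      also have "\<dots> = 1 / norm y" using n by (simp add: power2_eq_square)
      finally show "norm (\<psi> y * f0 y) \<le> 1 / norm y" .
    qed
    show "((\<lambda>y::'a. 1 / norm y) \<longlongrightarrow> 0) at_infinity"
      by (rule tendsto_divide_0[OF tendsto_const filterlim_at_top_imp_at_infinity[OF filterlim_norm_at_top]])
  qed
  ultimately show ?thesis by (simp add: C_infty_punctured_def f0_bounds(4))
qed

lemma pt_meas [measurable]: "t > 0 \<Longrightarrow> pt t x \<in> borel_measurable borel"
proof (cases "x = 0")
  case True
  assume "t > 0"
  then have "pt t x = (\<lambda>_. 0)" using True pt_0 by auto
  then show ?thesis by simp
next
  case False
  assume t: "t > 0"
  have "integrable lborel (\<lambda>y. pt t x y * (1 * f0 y))" by (rule FK(1)[OF f0_mult_in t False]) auto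
  then have [measurable]: "(\<lambda>y. pt t x y * f0 y) \<in> borel_measurable borel" by simp
  have "pt t x = (\<lambda>y. (pt t x y * f0 y) / f0 y)"
  proof
    fix y show "pt t x y = (pt t x y * f0 y) / f0 y"
      using f0_bounds(3)[of y] pt_0[OF t] by (cases "y = 0") auto
  qed
  also have "\<dots> \<in> borel_measurable borel" by measurable
  finally show ?thesis .
qed

text \<open>Testing with \<open>\<psi> * f0\<close> identifies the integrals of
  \<open>pt t x * f0\<close> over Borel sets with expectations of a nonnegative variable, which
  gives the sign. The factor \<open>f0\<close> can then be divided out because
  \<open>x + X t\<close> almost surely avoids the origin.\<close>

lemma pt_AE_nonneg_and_law:
  assumes t: "t > 0" and x: "x \<noteq> 0"
  shows "AE y in lborel. 0 \<le> pt t x y"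
    and "\<And>f. f \<in> borel_measurable borel \<Longrightarrow> (\<integral>\<^sup>+y. ennreal (pt t x y) * f y \<partial>lborel) = (\<integral>\<^sup>+\<omega>. f (x + X t \<omega>) * ennreal (W t x \<omega>) \<partial>M)"
proof -
  note [measurable] = pt_meas[OF t] p_meas[OF t]
  define G where "G y = pt t x y * f0 y" for y
  define g where "g \<omega> = f0 (x + X t \<omega>) * W t x \<omega>" for \<omega>
  have [measurable]: "G \<in> borel_measurable borel" "g \<in> borel_measurable M" unfolding G_def g_def by measurable
  have iG: "integrable lborel G" using FK(1)[OF f0_mult_in[of "\<lambda>_. 1"] t x] by (simp add: G_def[abs_def])
  have g0: "0 \<le> g \<omega>" "g \<omega> \<le> 1" for \<omega>
    using f0_bounds(1,2)[of "x + X t \<omega>"] FK_weight_bounds[of c t x \<omega>] by (auto simp: g_def mult_le_one)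
  have ig: "integrable M g" by (rule M.integrable_const_bound[where B=1]) (use g0 in auto)
  have eqA: "(LINT y|lborel. indicator A y * G y) = (LINT \<omega>|M. indicator A (x + X t \<omega>) * g \<omega>)" if "A \<in> sets borel" for A
  proof (rule integral_eq_on_borel[OF _ iG ig _ _ that])
    fix f :: "'a \<Rightarrow> real" assume "continuous_on UNIV f" "\<And>x. 0 \<le> f x" "\<And>x. f x \<le> 1"
    from FK(2)[OF f0_mult_in[OF this] t x]
    show "(LINT y|lborel. f y * G y) = (LINT \<omega>|M. f (x + X t \<omega>) * g \<omega>)" by (simp add: G_def g_def mult_ac)
  qed auto
  have "AE y in lborel. 0 \<le> G y"
  proof (rule AE_le_if_integral_le[OF _ iG])
    fix A :: "'a set" assume "A \<in> sets lborel"
    then show "(LINT y|lborel. indicator A y * 0) \<le> (LINT y|lborel. indicator A y * G y)"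
      using eqA[of A] g0 by (auto intro!: integral_nonneg_AE)
  qed simp
  moreover have ae0: "AE y in lborel. y \<noteq> (0::'a)" by (rule AE_lborel_singleton)
  ultimately show nonneg: "AE y in lborel. 0 \<le> pt t x y"
  proof eventually_elim
    case (elim y)
    then show ?case using f0_bounds(3)[of y] by (auto simp: G_def zero_le_mult_iff)
  qed
  then have G0: "AE y in lborel. 0 \<le> G y" by eventually_elim (simp add: G_def f0_bounds)
  have meq: "density lborel (\<lambda>y. ennreal (G y)) = distr (density M (\<lambda>\<omega>. ennreal (g \<omega>))) borel (\<lambda>\<omega>. x + X t \<omega>)"
  proof (rule measure_eqI)
    fix A assume "A \<in> sets (density lborel (\<lambda>y. ennreal (G y)))"
    then have A[measurable]: "A \<in> sets borel" by simp
    have iA: "integrable lborel (\<lambda>y. indicator A y * G y)"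
      by (rule Bochner_Integration.integrable_bound[OF iG]) (auto simp: indicator_def)
    have igA: "integrable M (\<lambda>\<omega>. indicator A (x + X t \<omega>) * g \<omega>)"
      by (rule Bochner_Integration.integrable_bound[OF ig]) (auto simp: indicator_def)
    have "emeasure (density lborel (\<lambda>y. ennreal (G y))) A = (\<integral>\<^sup>+y. ennreal (indicator A y * G y) \<partial>lborel)"
      by (subst emeasure_density) (auto intro!: nn_integral_cong simp: indicator_def)
    also have "\<dots> = ennreal (LINT y|lborel. indicator A y * G y)"
      by (rule nn_integral_eq_integral[OF iA]) (use G0 in \<open>eventually_elim, auto simp: indicator_def\<close>)
    also have "\<dots> = ennreal (LINT \<omega>|M. indicator A (x + X t \<omega>) * g \<omega>)" by (simp add: eqA)
    also have "\<dots> = (\<integral>\<^sup>+\<omega>. ennreal (indicator A (x + X t \<omega>) * g \<omega>) \<partial>M)"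
      by (rule nn_integral_eq_integral[OF igA, symmetric]) (use g0 in auto)
    also have "\<dots> = (\<integral>\<^sup>+\<omega>. ennreal (g \<omega>) * indicator ((\<lambda>\<omega>. x + X t \<omega>) -` A \<inter> space M) \<omega> \<partial>M)"
      by (rule nn_integral_cong) (auto simp: indicator_def)
    also have "\<dots> = emeasure (density M (\<lambda>\<omega>. ennreal (g \<omega>))) ((\<lambda>\<omega>. x + X t \<omega>) -` A \<inter> space M)"
      by (subst emeasure_density) (auto intro: measurable_sets)
    also have "\<dots> = emeasure (distr (density M (\<lambda>\<omega>. ennreal (g \<omega>))) borel (\<lambda>\<omega>. x + X t \<omega>)) A"
      by (subst emeasure_distr) auto
    finally show "emeasure (density lborel (\<lambda>y. ennreal (G y))) A = emeasure (distr (density M (\<lambda>\<omega>. ennreal (g \<omega>))) borel (\<lambda>\<omega>. x + X t \<omega>)) A" .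
  qed simp
  fix f :: "'a \<Rightarrow> ennreal" assume [measurable]: "f \<in> borel_measurable borel"
  have fin: "ennreal (f0 y) * (f y * ennreal (1 / f0 y)) = f y" if "y \<noteq> 0" for y
    using f0_bounds(3)[OF that] by (simp add: mult.left_commute flip: ennreal_mult)
  have "(\<integral>\<^sup>+y. ennreal (pt t x y) * f y \<partial>lborel) = (\<integral>\<^sup>+y. ennreal (G y) * (f y * ennreal (1 / f0 y)) \<partial>lborel)"
  proof (rule nn_integral_cong_AE)
    show "AE y in lborel. ennreal (pt t x y) * f y = ennreal (G y) * (f y * ennreal (1 / f0 y))"
      using nonneg ae0 by eventually_elim (simp add: G_def ennreal_mult f0_bounds fin mult.assoc)
  qed
  also have "\<dots> = (\<integral>\<^sup>+y. f y * ennreal (1 / f0 y) \<partial>density lborel (\<lambda>y. ennreal (G y)))"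
    by (subst nn_integral_density) auto
  also have "\<dots> = (\<integral>\<^sup>+\<omega>. ennreal (g \<omega>) * (f (x + X t \<omega>) * ennreal (1 / f0 (x + X t \<omega>))) \<partial>M)"
    unfolding meq by (subst nn_integral_distr, measurable, subst nn_integral_density) auto
  also have "\<dots> = (\<integral>\<^sup>+\<omega>. f (x + X t \<omega>) * ennreal (W t x \<omega>) \<partial>M)"
  proof (rule nn_integral_cong_AE)
    have "AE y in distr M borel (X t). x + y \<noteq> 0"
      unfolding law_X[OF t] using AE_lborel_singleton[of "- x"]
      by (subst AE_density, measurable) (auto simp: add_eq_0_iff2 elim!: eventually_mono)
    then have "AE \<omega> in M. x + X t \<omega> \<noteq> 0" by (subst (asm) AE_distr_iff) auto
    then show "AE \<omega> in M. ennreal (g \<omega>) * (f (x + X t \<omega>) * ennreal (1 / f0 (x + X t \<omega>))) = f (x + X t \<omega>) * ennreal (W t x \<omega>)"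
    proof eventually_elim
      case (elim \<omega>)
      have "ennreal (g \<omega>) * (f (x + X t \<omega>) * ennreal (1 / f0 (x + X t \<omega>))) = ennreal (W t x \<omega>) * (ennreal (f0 (x + X t \<omega>)) * (f (x + X t \<omega>) * ennreal (1 / f0 (x + X t \<omega>))))"
        by (simp add: g_def ennreal_mult f0_bounds FK_weight_bounds mult_ac)
      then show ?case by (simp add: fin[OF elim] mult.commute)
    qed
  qed
  finally show "(\<integral>\<^sup>+y. ennreal (pt t x y) * f y \<partial>lborel) = (\<integral>\<^sup>+\<omega>. f (x + X t \<omega>) * ennreal (W t x \<omega>) \<partial>M)" .
qed

end

lemma AE_le_if_nn_integral_le:
  fixes f g :: "'a \<Rightarrow> real"
  assumes f: "integrable M f" "AE x in M. 0 \<le> f x" and g: "integrable M g" "AE x in M. 0 \<le> g x"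
    and le: "\<And>A. A \<in> sets M \<Longrightarrow> (\<integral>\<^sup>+x. ennreal (f x) * indicator A x \<partial>M) \<le> (\<integral>\<^sup>+x. ennreal (g x) * indicator A x \<partial>M)"
  shows "AE x in M. f x \<le> g x"
proof (rule AE_le_if_integral_le[OF f(1) g(1)])
  fix A assume A: "A \<in> sets M"
  have eq: "ennreal (LINT x|M. indicator A x * h x) = (\<integral>\<^sup>+x. ennreal (h x) * indicator A x \<partial>M)"
    if h: "integrable M h" "AE x in M. 0 \<le> h x" for h :: "'a \<Rightarrow> real"
  proof -
    have [measurable]: "A \<in> sets M" by fact
    have "integrable M (\<lambda>x. indicator A x * h x)"
      by (rule Bochner_Integration.integrable_bound[OF h(1)]) (use h in \<open>auto simp: indicator_def\<close>)
    then have "ennreal (LINT x|M. indicator A x * h x) = (\<integral>\<^sup>+x. ennreal (indicator A x * h x) \<partial>M)"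
      by (rule nn_integral_eq_integral[symmetric]) (use h(2) in \<open>eventually_elim, auto simp: indicator_def\<close>)
    also have "\<dots> = (\<integral>\<^sup>+x. ennreal (h x) * indicator A x \<partial>M)"
      by (rule nn_integral_cong) (auto simp: indicator_def)
    finally show ?thesis .
  qed
  have "0 \<le> (LINT x|M. indicator A x * g x)"
    by (rule integral_nonneg_AE) (use g(2) in \<open>eventually_elim, auto simp: indicator_def\<close>)
  moreover have "ennreal (LINT x|M. indicator A x * f x) \<le> ennreal (LINT x|M. indicator A x * g x)"
    unfolding eq[OF f] eq[OF g] by (rule le[OF A])
  ultimately show "(LINT x|M. indicator A x * f x) \<le> (LINT x|M. indicator A x * g x)" by simp
qed

text \<open>Scheffe's trick: since both densities have mass one, only the part of \<open>f n - f\<close> dominated by \<open>f\<close> matters.\<close>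

lemma density_L1_tendsto:
  fixes f :: "nat \<Rightarrow> 'a \<Rightarrow> real"
  assumes fn: "\<And>n. integrable M (f n)" "\<And>n. (LINT x|M. f n x) = 1" "\<And>n x. 0 \<le> f n x"
    and g: "integrable M g" "(LINT x|M. g x) = 1" "\<And>x. 0 \<le> g x"
    and lim: "\<And>x. (\<lambda>n. f n x) \<longlonglongrightarrow> g x"
  shows "(\<lambda>n. LINT x|M. \<bar>f n x - g x\<bar>) \<longlonglongrightarrow> 0"
proof -
  have [measurable]: "g \<in> borel_measurable M" "f n \<in> borel_measurable M" for n using fn g by auto
  have "(\<lambda>n. LINT x|M. max 0 (g x - f n x)) \<longlonglongrightarrow> (LINT x|M. 0)"
  proof (rule integral_dominated_convergence[OF _ _ g(1)])
    show "AE x in M. (\<lambda>n. max 0 (g x - f n x)) \<longlonglongrightarrow> 0"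
    proof (rule AE_I2)
      fix x
      have "(\<lambda>n. max 0 (g x - f n x)) \<longlonglongrightarrow> max 0 (g x - g x)" by (intro tendsto_intros lim)
      then show "(\<lambda>n. max 0 (g x - f n x)) \<longlonglongrightarrow> 0" by simp
    qed
    show "AE x in M. norm (max 0 (g x - f n x)) \<le> g x" for n
      using fn(3) g(3) by (auto intro!: AE_I2 simp: max_def)
  qed auto
  then have "(\<lambda>n. 2 * (LINT x|M. max 0 (g x - f n x))) \<longlonglongrightarrow> 2 * 0" by (intro tendsto_intros) simp
  moreover have "2 * (LINT x|M. max 0 (g x - f n x)) = (LINT x|M. \<bar>f n x - g x\<bar>)" for n
  proof -
    have i: "integrable M (\<lambda>x. max 0 (g x - f n x))" using fn(1) g(1) by auto
    have "(LINT x|M. \<bar>f n x - g x\<bar>) = (LINT x|M. 2 * max 0 (g x - f n x) - (g x - f n x))"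
      by (rule Bochner_Integration.integral_cong) (auto simp: max_def)
    also have "\<dots> = 2 * (LINT x|M. max 0 (g x - f n x))"
      using i fn g by simp
    finally show ?thesis by simp
  qed
  ultimately show ?thesis by simp
qed

context stable_kernel
begin

lemma integrable_p_translate: "t > 0 \<Longrightarrow> integrable lborel (\<lambda>z. p t (z - x))"
  using integrable_lborel_affine_iff[of "p t" 1 "- x"] integrable_p[of t] p_meas[of t] by simp

lemma integral_p_translate: "t > 0 \<Longrightarrow> (LINT z|lborel. p t (z - x)) = 1"
  using integral_lborel_affine[of "p t" 1 "- x"] integral_p[of t] p_meas[of t] by simp

lemma p_L1_tendsto:
  assumes s: "\<And>n. s n > 0" "s0 > 0" "s \<longlonglongrightarrow> s0" and y: "y \<longlonglongrightarrow> y0"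
  shows "(\<lambda>n. LINT w|lborel. \<bar>p (s n) (w - y n) - p s0 (w - y0)\<bar>) \<longlonglongrightarrow> 0"
proof (rule density_L1_tendsto)
  fix w
  have "((\<lambda>n. (\<lambda>(t, x). p t x) (s n, w - y n)) \<longlongrightarrow> (\<lambda>(t, x). p t x) (s0, w - y0)) sequentially"
    by (rule continuous_on_tendsto_compose[OF p_cont]) (use s y in \<open>auto intro!: tendsto_intros eventuallyI\<close>)
  then show "(\<lambda>n. p (s n) (w - y n)) \<longlonglongrightarrow> p s0 (w - y0)" by simp
qed (use s in \<open>auto simp: integrable_p_translate integral_p_translate p_nonneg\<close>)

end

section \<open>Pointwise bounds for the kernel and continuity off the axes\<close>

context fk_kernel
begin

lemma integrable_pt: "t > 0 \<Longrightarrow> integrable lborel (pt t x)"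
proof (cases "x = 0")
  case True
  assume "t > 0"
  then have "pt t x = (\<lambda>_. 0)" using True pt_0 by auto
  then show ?thesis by simp
next
  case False
  assume t: "t > 0"
  note [measurable] = pt_meas[OF t]
  have "(\<integral>\<^sup>+y. ennreal (pt t x y) \<partial>lborel) = (\<integral>\<^sup>+\<omega>. ennreal (W t x \<omega>) \<partial>M)"
    using pt_AE_nonneg_and_law(2)[OF t False, of "\<lambda>_. 1"] by simp
  also have "\<dots> \<le> (\<integral>\<^sup>+\<omega>. 1 \<partial>M)" by (rule nn_integral_mono) (use FK_weight_bounds(2)[of c t x] in \<open>simp add: ennreal_le_1\<close>)
  also have "\<dots> < \<infinity>" using M.emeasure_space_1 by simp
  finally show ?thesis using pt_AE_nonneg_and_law(1)[OF t False] by (intro integrableI_nonneg) auto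
qed

text \<open>The weight lies between 0 and 1, so dropping it compares the integrals over every Borel
  set with those of the stable density.\<close>

lemma pt_AE_bounds: "t > 0 \<Longrightarrow> AE y in lborel. 0 \<le> pt t x y \<and> pt t x y \<le> p t (y - x)"
proof (cases "x = 0")
  case True
  assume "t > 0"
  then show ?thesis using True pt_0 p_nonneg by auto
next
  case False
  assume t: "t > 0"
  note [measurable] = pt_meas[OF t] p_meas[OF t]
  have "AE y in lborel. pt t x y \<le> p t (y - x)"
  proof (rule AE_le_if_nn_integral_le[OF integrable_pt[OF t] pt_AE_nonneg_and_law(1)[OF t False] integrable_p_translate[OF t]])
    fix A :: "'a set" assume "A \<in> sets lborel"
    then have [measurable]: "A \<in> sets borel" by simp
    have "(\<integral>\<^sup>+y. ennreal (pt t x y) * indicator A y \<partial>lborel) = (\<integral>\<^sup>+\<omega>. indicator A (x + X t \<omega>) * ennreal (W t x \<omega>) \<partial>M)"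
      by (rule pt_AE_nonneg_and_law(2)[OF t False]) measurable
    also have "\<dots> \<le> (\<integral>\<^sup>+\<omega>. indicator A (x + X t \<omega>) \<partial>M)"
      by (rule nn_integral_mono) (use FK_weight_bounds(2)[of c t x] in \<open>auto simp: indicator_def ennreal_le_1\<close>)
    also have "\<dots> = (\<integral>\<^sup>+y. ennreal (p t (y - x)) * indicator A y \<partial>lborel)"
      by (rule nn_integral_X[OF t]) measurable
    finally show "(\<integral>\<^sup>+y. ennreal (pt t x y) * indicator A y \<partial>lborel) \<le> (\<integral>\<^sup>+y. ennreal (p t (y - x)) * indicator A y \<partial>lborel)" .
  qed (use p_nonneg[OF t] in auto)
  with pt_AE_nonneg_and_law(1)[OF t False] show ?thesis by eventually_elim simp
qed

definition c3 :: real where "c3 = 2 powr (real DIM('a) / \<alpha> + real DIM('a) + \<alpha>)"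

lemma c3_pos: "c3 > 0" by (simp add: c3_def)

lemma p_3P:
  assumes "s > 0" "t > 0"
  shows "p s x * p t y \<le> (C0 ^ 3 * c3) * S (s + t) (x + y) * (p s x + p t y)"
proof -
  have "p s x * p t y \<le> (C0 * S s x) * (C0 * S t y)"
    using p_upper[of s x] p_upper[of t y] assms p_nonneg C0 sbound_pos[of s \<alpha> x] by (intro mult_mono) auto
  also have "\<dots> = C0\<^sup>2 * (S s x * S t y)" by (simp add: power2_eq_square)
  also have "\<dots> \<le> C0\<^sup>2 * (c3 * S (s + t) (x + y) * (S s x + S t y))"
    unfolding c3_def by (intro mult_left_mono sbound_3P) (use assms alpha in auto)
  also have "\<dots> \<le> C0\<^sup>2 * (c3 * S (s + t) (x + y) * (C0 * p s x + C0 * p t y))"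
    using S_le_p[of s x] S_le_p[of t y] assms sbound_pos[of "s + t" \<alpha> "x + y"]
    by (intro mult_left_mono add_mono mult_nonneg_nonneg) (auto simp: c3_def)
  also have "\<dots> = (C0 ^ 3 * c3) * S (s + t) (x + y) * (p s x + p t y)"
    by (simp add: power2_eq_square power3_eq_cube algebra_simps)
  finally show ?thesis .
qed

definition KU where "KU = 2 * C0 ^ 3 * c3"

lemma KU_pos: "KU > 0" using C0 c3_pos by (simp add: KU_def)

text \<open>Chapman-Kolmogorov at \<open>t / 2\<close> expresses each value by an integral, for
  which almost everywhere bounds suffice. Then \<open>p_3P\<close> extracts
  \<open>S t (x - y)\<close> and leaves two densities of mass one.\<close>

lemma pt_bounds:
  assumes t: "t > 0"
  shows "0 \<le> pt t x y" "pt t x y \<le> KU * S t (x - y)"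
proof -
  define s where "s = t / 2"
  have s: "s > 0" and ss: "s + s = t" using t by (auto simp: s_def)
  have eq: "pt t x y = (LINT z|lborel. pt s x z * pt s z y)" using CK(2)[OF s s, of x y] by (simp add: ss)
  have ae: "AE z in lborel. 0 \<le> pt s x z * pt s z y \<and> pt s x z * pt s z y \<le> (C0 ^ 3 * c3) * S t (x - y) * (p s (z - x) + p s (z - y))"
    using pt_AE_bounds[OF s, of x] pt_AE_bounds[OF s, of y]
  proof eventually_elim
    case (elim z)
    then have e: "0 \<le> pt s x z" "pt s x z \<le> p s (z - x)" "0 \<le> pt s z y" "pt s z y \<le> p s (y - z)"
      by (auto simp: pt_sym[OF s, of z y] p_commute[of s y z])
    have "pt s x z * pt s z y \<le> p s (z - x) * p s (y - z)" using e p_nonneg[OF s] by (intro mult_mono) auto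
    also have "\<dots> \<le> (C0 ^ 3 * c3) * S (s + s) ((z - x) + (y - z)) * (p s (z - x) + p s (y - z))" by (rule p_3P[OF s s])
    also have "(z - x) + (y - z) = y - x" by simp
    finally show ?case using e by (simp add: ss sbound_minus_commute[of \<alpha> t x y] p_commute[of s y z])
  qed
  show "0 \<le> pt t x y" unfolding eq by (rule integral_nonneg_AE) (use ae in \<open>eventually_elim, simp\<close>)
  have "pt t x y \<le> (LINT z|lborel. (C0 ^ 3 * c3) * S t (x - y) * (p s (z - x) + p s (z - y)))" unfolding eq
    by (rule integral_mono_AE[OF CK(1)[OF s s]]) (use ae integrable_p_translate[OF s] in \<open>auto elim!: eventually_mono\<close>)
  also have "\<dots> = (C0 ^ 3 * c3) * S t (x - y) * 2"
    using integrable_p_translate[OF s] integral_p_translate[OF s] by simp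
  finally show "pt t x y \<le> KU * S t (x - y)" by (simp add: KU_def mult_ac)
qed

lemma pt_le_sup: "t > 0 \<Longrightarrow> pt t x y \<le> KU * t powr (- real DIM('a) / \<alpha>)"
  using pt_bounds(2)[of t x y] mult_left_mono[OF sbound_le1[of \<alpha> t "x - y"], of KU] KU_pos by linarith

lemma nn_integral_FKint_1_le:
  obtains K where "K > 0" "\<And>t x. t > 0 \<Longrightarrow> x \<noteq> 0 \<Longrightarrow> (\<integral>\<^sup>+\<omega>. FKint c t x \<omega> \<partial>M) \<le> ennreal (K * t * norm x powr (- \<alpha>))"
proof -
  obtain K where K: "K > 0" "\<And>t x. t > 0 \<Longrightarrow> x \<noteq> 0 \<Longrightarrow> (\<integral>\<^sup>+z. ennreal (p t (z - x) * norm z powr (- \<alpha>)) \<partial>lborel) \<le> ennreal (K * norm x powr (- \<alpha>))"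
    by (rule p_neg_moment[OF alpha(1,3)]) (rule that)
  have "(\<integral>\<^sup>+\<omega>. FKint c t x \<omega> \<partial>M) \<le> ennreal (c * K * t * norm x powr (- \<alpha>))" if t: "t > 0" and x: "x \<noteq> 0" for t x
  proof -
    have "(\<integral>\<^sup>+\<omega>. FKint c t x \<omega> \<partial>M) = (\<integral>\<^sup>+s. indicator {0<..<t} s * (\<integral>\<^sup>+z. (\<integral>\<^sup>+w. ennreal (p s z) * (ennreal (p (t - s) w) * ennreal (c * norm (x + z) powr (- \<alpha>))) \<partial>lborel) \<partial>lborel) \<partial>lborel)"
      using nn_integral_FKint[OF t, of "\<lambda>_. 1" x c] by simp
    also have "\<dots> \<le> (\<integral>\<^sup>+s. ennreal (c * K * norm x powr (- \<alpha>)) * indicator {0<..<t} s \<partial>lborel)"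
    proof (rule nn_integral_mono)
      fix s :: real
      show "indicator {0<..<t} s * (\<integral>\<^sup>+z. (\<integral>\<^sup>+w. ennreal (p s z) * (ennreal (p (t - s) w) * ennreal (c * norm (x + z) powr (- \<alpha>))) \<partial>lborel) \<partial>lborel) \<le> ennreal (c * K * norm x powr (- \<alpha>)) * indicator {0<..<t} s"
      proof (cases "s \<in> {0<..<t}")
        case True
        then have s: "s > 0" and ts: "t - s > 0" by auto
        note [measurable] = p_meas[OF s] p_meas[OF ts]
        have "(\<integral>\<^sup>+z. (\<integral>\<^sup>+w. ennreal (p s z) * (ennreal (p (t - s) w) * ennreal (c * norm (x + z) powr (- \<alpha>))) \<partial>lborel) \<partial>lborel)
          = (\<integral>\<^sup>+z. ennreal (p s z) * ennreal (c * norm (x + z) powr (- \<alpha>)) \<partial>lborel)"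
          using nn_integral_p[OF ts] by (simp add: nn_integral_cmult nn_integral_multc)
        also have "\<dots> = (\<integral>\<^sup>+z. ennreal (p s (z - x)) * ennreal (c * norm z powr (- \<alpha>)) \<partial>lborel)"
          using nn_integral_translate[of "\<lambda>z. ennreal (p s (z - x)) * ennreal (c * norm z powr (- \<alpha>))" x] by simp
        also have "\<dots> = (\<integral>\<^sup>+z. ennreal c * ennreal (p s (z - x) * norm z powr (- \<alpha>)) \<partial>lborel)"
          using c_pos p_nonneg[OF s] by (intro nn_integral_cong) (simp add: mult_ac flip: ennreal_mult)
        also have "\<dots> = ennreal c * (\<integral>\<^sup>+z. ennreal (p s (z - x) * norm z powr (- \<alpha>)) \<partial>lborel)"
          by (rule nn_integral_cmult) measurable
        also have "\<dots> \<le> ennreal c * ennreal (K * norm x powr (- \<alpha>))" by (intro mult_left_mono K(2) s x) simp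
        also have "\<dots> = ennreal (c * K * norm x powr (- \<alpha>))" using c_pos K(1) by (simp add: mult.assoc flip: ennreal_mult)
        finally show ?thesis using True by simp
      qed simp
    qed
    also have "\<dots> = ennreal (c * K * norm x powr (- \<alpha>)) * ennreal t" using t by (subst nn_integral_cmult_indicator) auto
    also have "\<dots> = ennreal (c * K * t * norm x powr (- \<alpha>))" using t c_pos K(1) by (simp add: mult_ac flip: ennreal_mult)
    finally show ?thesis .
  qed
  with that[of "c * K"] K(1) c_pos show ?thesis by simp
qed

text \<open>Since the kernel lies below the stable density, their distance is the lost mass. This is
  the mean of one minus the weight, hence at most the mean of \<open>FKint\<close>.\<close>

lemma pt_defect:
  obtains K where "K > 0" "\<And>t x. t > 0 \<Longrightarrow> x \<noteq> 0 \<Longrightarrow> (LINT z|lborel. \<bar>p t (z - x) - pt t x z\<bar>) \<le> K * t * norm x powr (- \<alpha>)"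
proof -
  obtain K where K: "K > 0" "\<And>t x. t > 0 \<Longrightarrow> x \<noteq> 0 \<Longrightarrow> (\<integral>\<^sup>+\<omega>. FKint c t x \<omega> \<partial>M) \<le> ennreal (K * t * norm x powr (- \<alpha>))"
    by (rule nn_integral_FKint_1_le) (rule that)
  have "(LINT z|lborel. \<bar>p t (z - x) - pt t x z\<bar>) \<le> K * t * norm x powr (- \<alpha>)" if t: "t > 0" and x: "x \<noteq> 0" for t x
  proof -
    note [measurable] = pt_meas[OF t] p_meas[OF t]
    have "(LINT z|lborel. \<bar>p t (z - x) - pt t x z\<bar>) = (LINT z|lborel. p t (z - x) - pt t x z)"
    proof (rule integral_cong_AE)
      show "AE z in lborel. \<bar>p t (z - x) - pt t x z\<bar> = p t (z - x) - pt t x z"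
        using pt_AE_bounds[OF t, of x] by eventually_elim simp
    qed measurable
    also have "\<dots> = 1 - (LINT z|lborel. pt t x z)"
      using integrable_p_translate[OF t] integrable_pt[OF t] integral_p_translate[OF t] by simp
    finally have 1: "(LINT z|lborel. \<bar>p t (z - x) - pt t x z\<bar>) = 1 - (LINT z|lborel. pt t x z)" .
    have nn: "ennreal (LINT z|lborel. pt t x z) = (\<integral>\<^sup>+\<omega>. ennreal (W t x \<omega>) \<partial>M)"
      using pt_AE_nonneg_and_law(2)[OF t x, of "\<lambda>_. 1"] nn_integral_eq_integral[OF integrable_pt[OF t] pt_AE_nonneg_and_law(1)[OF t x]] by simp
    have "1 = (\<integral>\<^sup>+\<omega>. 1 \<partial>M)" using M.emeasure_space_1 by simp
    also have "\<dots> \<le> (\<integral>\<^sup>+\<omega>. ennreal (W t x \<omega>) + FKint c t x \<omega> \<partial>M)"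
      by (rule nn_integral_mono) (use FK_weight_tangent[of 0 c t x] in simp)
    also have "\<dots> = ennreal (LINT z|lborel. pt t x z) + (\<integral>\<^sup>+\<omega>. FKint c t x \<omega> \<partial>M)"
      unfolding nn by (rule nn_integral_add) auto
    also have "\<dots> \<le> ennreal (LINT z|lborel. pt t x z) + ennreal (K * t * norm x powr (- \<alpha>))"
      by (intro add_left_mono K(2) t x)
    also have "\<dots> = ennreal ((LINT z|lborel. pt t x z) + K * t * norm x powr (- \<alpha>))"
      using K(1) t pt_bounds(1)[OF t] by (subst ennreal_plus) (auto intro!: integral_nonneg_AE)
    finally have "1 \<le> (LINT z|lborel. pt t x z) + K * t * norm x powr (- \<alpha>)"
      by (simp add: ennreal_1[symmetric] del: ennreal_1) (subst (asm) ennreal_le_iff2, auto)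
    then show ?thesis unfolding 1 by simp
  qed
  with that K(1) show ?thesis by blast
qed

text \<open>A short time \<open>s\<close> is split off at the second spatial argument. Over it the
  kernel is replaced in mean by the stable density, at a cost linear in \<open>s\<close> by
  \<open>pt_defect\<close>; the remaining factor at time \<open>\<tau>\<close> is bounded by its
  supremum.\<close>

lemma pt_modulus:
  obtains K where "K > 0" "\<And>\<tau> s s0 z y y0. \<tau> > 0 \<Longrightarrow> s > 0 \<Longrightarrow> s0 > 0 \<Longrightarrow> y \<noteq> 0 \<Longrightarrow> y0 \<noteq> 0 \<Longrightarrow>
    \<bar>pt (\<tau> + s) z y - pt (\<tau> + s0) z y0\<bar> \<le> KU * \<tau> powr (- real DIM('a) / \<alpha>) *
      (K * s * norm y powr (- \<alpha>) + K * s0 * norm y0 powr (- \<alpha>) + (LINT w|lborel. \<bar>p s (w - y) - p s0 (w - y0)\<bar>))"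
proof -
  obtain K where K: "K > 0" "\<And>t x. t > 0 \<Longrightarrow> x \<noteq> 0 \<Longrightarrow> (LINT z|lborel. \<bar>p t (z - x) - pt t x z\<bar>) \<le> K * t * norm x powr (- \<alpha>)"
    by (rule pt_defect) (rule that)
  have "\<bar>pt (\<tau> + s) z y - pt (\<tau> + s0) z y0\<bar> \<le> KU * \<tau> powr (- real DIM('a) / \<alpha>) *
      (K * s * norm y powr (- \<alpha>) + K * s0 * norm y0 powr (- \<alpha>) + (LINT w|lborel. \<bar>p s (w - y) - p s0 (w - y0)\<bar>))"
    if \<tau>: "\<tau> > 0" and s: "s > 0" and s0: "s0 > 0" and y: "y \<noteq> 0" and y0: "y0 \<noteq> 0" for \<tau> s s0 z y y0
  proof -
    define B where "B = KU * \<tau> powr (- real DIM('a) / \<alpha>)"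
    have B: "0 \<le> pt \<tau> z w" "pt \<tau> z w \<le> B" "B \<ge> 0" for w
      using pt_bounds(1)[OF \<tau>] pt_le_sup[OF \<tau>] KU_pos by (auto simp: B_def)
    note [measurable] = pt_meas[OF \<tau>] pt_meas[OF s] pt_meas[OF s0] p_meas[OF s] p_meas[OF s0]
    have b1: "integrable lborel (\<lambda>w. \<bar>p s (w - y) - pt s y w\<bar>)" using integrable_p_translate[OF s] integrable_pt[OF s] by auto
    have b2: "integrable lborel (\<lambda>w. \<bar>p s0 (w - y0) - pt s0 y0 w\<bar>)" using integrable_p_translate[OF s0] integrable_pt[OF s0] by auto
    have b3: "integrable lborel (\<lambda>w. \<bar>p s (w - y) - p s0 (w - y0)\<bar>)" using integrable_p_translate[OF s] integrable_p_translate[OF s0] by auto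
    have i1: "integrable lborel (\<lambda>w. pt \<tau> z w * pt s w y)" "integrable lborel (\<lambda>w. pt \<tau> z w * pt s0 w y0)" using CK(1)[OF \<tau>] s s0 by auto
    have "pt (\<tau> + s) z y - pt (\<tau> + s0) z y0 = (LINT w|lborel. pt \<tau> z w * pt s w y - pt \<tau> z w * pt s0 w y0)"
      using CK(2)[OF \<tau> s] CK(2)[OF \<tau> s0] i1 by simp
    also have "\<dots> = (LINT w|lborel. pt \<tau> z w * (pt s y w - pt s0 y0 w))"
      by (rule Bochner_Integration.integral_cong) (auto simp: pt_sym[OF s, of _ y] pt_sym[OF s0, of _ y0] algebra_simps)
    finally have "\<bar>pt (\<tau> + s) z y - pt (\<tau> + s0) z y0\<bar> = \<bar>LINT w|lborel. pt \<tau> z w * (pt s y w - pt s0 y0 w)\<bar>" by simp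
    also have "\<dots> \<le> (LINT w|lborel. \<bar>pt \<tau> z w * (pt s y w - pt s0 y0 w)\<bar>)" by (rule integral_abs_bound)
    also have "\<dots> \<le> (LINT w|lborel. B * (\<bar>p s (w - y) - pt s y w\<bar> + \<bar>p s0 (w - y0) - pt s0 y0 w\<bar> + \<bar>p s (w - y) - p s0 (w - y0)\<bar>))"
    proof (rule integral_mono_AE')
      show "AE w in lborel. \<bar>pt \<tau> z w * (pt s y w - pt s0 y0 w)\<bar> \<le> B * (\<bar>p s (w - y) - pt s y w\<bar> + \<bar>p s0 (w - y0) - pt s0 y0 w\<bar> + \<bar>p s (w - y) - p s0 (w - y0)\<bar>)"
      proof (rule AE_I2)
        fix w
        have "\<bar>pt \<tau> z w * (pt s y w - pt s0 y0 w)\<bar> \<le> B * \<bar>pt s y w - pt s0 y0 w\<bar>"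
          using B(1,2)[of w] by (simp add: abs_mult mult_right_mono)
        also have "\<dots> \<le> B * (\<bar>p s (w - y) - pt s y w\<bar> + \<bar>p s0 (w - y0) - pt s0 y0 w\<bar> + \<bar>p s (w - y) - p s0 (w - y0)\<bar>)"
          using B(3) by (intro mult_left_mono) linarith+
        finally show "\<bar>pt \<tau> z w * (pt s y w - pt s0 y0 w)\<bar> \<le> B * (\<bar>p s (w - y) - pt s y w\<bar> + \<bar>p s0 (w - y0) - pt s0 y0 w\<bar> + \<bar>p s (w - y) - p s0 (w - y0)\<bar>)" .
      qed
    qed (use b1 b2 b3 B(3) in auto)
    also have "\<dots> = B * ((LINT w|lborel. \<bar>p s (w - y) - pt s y w\<bar>) + (LINT w|lborel. \<bar>p s0 (w - y0) - pt s0 y0 w\<bar>) + (LINT w|lborel. \<bar>p s (w - y) - p s0 (w - y0)\<bar>))"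
      using b1 b2 b3 by simp
    also have "\<dots> \<le> B * (K * s * norm y powr (- \<alpha>) + K * s0 * norm y0 powr (- \<alpha>) + (LINT w|lborel. \<bar>p s (w - y) - p s0 (w - y0)\<bar>))"
      using B(3) K(2)[OF s y] K(2)[OF s0 y0] by (intro mult_left_mono add_mono) auto
    finally show ?thesis by (simp add: B_def)
  qed
  with that K(1) show ?thesis by blast
qed

lemma continuous_pt_off_axes:
  "continuous_on ({0<..} \<times> (UNIV - {0}) \<times> (UNIV - {0})) (\<lambda>(t, x, y). pt t x y)"
  unfolding continuous_on_sequentially
proof (intro allI impI ballI)
  fix U :: "nat \<Rightarrow> real \<times> 'a \<times> 'a" and u0
  assume u0: "u0 \<in> {0<..} \<times> (UNIV - {0}) \<times> (UNIV - {0})"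
    and "(\<forall>n. U n \<in> {0<..} \<times> (UNIV - {0}) \<times> (UNIV - {0})) \<and> U \<longlonglongrightarrow> u0"
  then have U: "\<And>n. U n \<in> {0<..} \<times> (UNIV - {0}) \<times> (UNIV - {0})" and lim: "U \<longlonglongrightarrow> u0" by auto
  define T where "T n = fst (U n)" for n
  define X where "X n = fst (snd (U n))" for n
  define Y where "Y n = snd (snd (U n))" for n
  obtain t0 x0 y0 where u0e: "u0 = (t0, x0, y0)" by (cases u0)
  have Un: "U n = (T n, X n, Y n)" for n by (simp add: T_def X_def Y_def)
  have nz: "T n > 0" "X n \<noteq> 0" "Y n \<noteq> 0" for n using U[of n] by (auto simp: Un)
  have nz0: "t0 > 0" "x0 \<noteq> 0" "y0 \<noteq> 0" using u0 by (auto simp: u0e)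
  have limT: "T \<longlonglongrightarrow> t0" and limX: "X \<longlonglongrightarrow> x0" and limY: "Y \<longlonglongrightarrow> y0"
    using tendsto_fst[OF lim] tendsto_fst[OF tendsto_snd[OF lim]] tendsto_snd[OF tendsto_snd[OF lim]]
    by (simp_all add: T_def[abs_def] X_def[abs_def] Y_def[abs_def] u0e)
  obtain K where K: "K > 0" "\<And>\<tau> s s0 z y y0. \<tau> > 0 \<Longrightarrow> s > 0 \<Longrightarrow> s0 > 0 \<Longrightarrow> y \<noteq> 0 \<Longrightarrow> y0 \<noteq> 0 \<Longrightarrow>
    \<bar>pt (\<tau> + s) z y - pt (\<tau> + s0) z y0\<bar> \<le> KU * \<tau> powr (- real DIM('a) / \<alpha>) *
      (K * s * norm y powr (- \<alpha>) + K * s0 * norm y0 powr (- \<alpha>) + (LINT w|lborel. \<bar>p s (w - y) - p s0 (w - y0)\<bar>))"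
    by (rule pt_modulus) (rule that)
  define B where "B = KU * (t0 / 2) powr (- real DIM('a) / \<alpha>)"
  have B: "B > 0" using KU_pos nz0 by (simp add: B_def)
  define Q where "Q = B * (2 * K * norm y0 powr (- \<alpha>) + 2 * K * norm x0 powr (- \<alpha>))"
  have Q: "Q > 0" using B K(1) nz0 by (simp add: Q_def add_pos_pos)
  have "(\<lambda>n. pt (T n) (X n) (Y n)) \<longlonglongrightarrow> pt t0 x0 y0"
  proof (rule LIMSEQ_I)
    fix e :: real assume e: "e > 0"
    \<comment> \<open>Replacing the kernel by the stable density at both spatial arguments costs
      \<open>s0 * Q\<close> in the limit; this choice keeps the cost at or below
      \<open>e / 2\<close>.\<close>
    define s0 where "s0 = min (t0 / 2) (e / (2 * Q))"
    have s0: "s0 > 0" "s0 \<le> t0 / 2" using nz0 e Q by (auto simp: s0_def)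
    have s0Q: "s0 * Q \<le> e / 2"
    proof -
      have "s0 * Q \<le> (e / (2 * Q)) * Q" using Q by (intro mult_right_mono) (auto simp: s0_def)
      then show ?thesis using Q by simp
    qed
    define \<tau> where "\<tau> = t0 - s0"
    have \<tau>: "\<tau> \<ge> t0 / 2" "\<tau> > 0" using s0 nz0 by (auto simp: \<tau>_def)
    have B\<tau>: "KU * \<tau> powr (- real DIM('a) / \<alpha>) \<le> B"
      unfolding B_def using \<tau> nz0 KU_pos alpha by (intro mult_left_mono powr_mono2') auto
    \<comment> \<open>Eventually equal to \<open>T n - \<tau>\<close>; the floor
      \<open>s0 / 2\<close> keeps it positive for every \<open>n\<close>, as
      \<open>p_L1_tendsto\<close> requires.\<close>
    define s where "s n = max (T n - \<tau>) (s0 / 2)" for n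
    have spos: "s n > 0" for n using s0 by (simp add: s_def less_max_iff_disj)
    have "(\<lambda>n. max (T n - \<tau>) (s0 / 2)) \<longlonglongrightarrow> max (t0 - \<tau>) (s0 / 2)" by (intro tendsto_intros limT)
    then have lims: "s \<longlonglongrightarrow> s0" using s0 by (simp add: s_def[abs_def] \<tau>_def max_def)
    define D1 where "D1 n = (LINT w|lborel. \<bar>p (s n) (w - Y n) - p s0 (w - y0)\<bar>)" for n
    define D2 where "D2 n = (LINT w|lborel. \<bar>p s0 (w - X n) - p s0 (w - x0)\<bar>)" for n
    have D1: "D1 \<longlonglongrightarrow> 0" unfolding D1_def by (rule p_L1_tendsto[OF spos s0(1) lims limY])
    have D2: "D2 \<longlonglongrightarrow> 0" unfolding D2_def by (rule p_L1_tendsto[OF _ s0(1) _ limX]) (use s0 in auto)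
    let ?bd = "\<lambda>n. B * (K * s n * norm (Y n) powr (- \<alpha>) + K * s0 * norm y0 powr (- \<alpha>) + D1 n)
        + B * (K * s0 * norm (X n) powr (- \<alpha>) + K * s0 * norm x0 powr (- \<alpha>) + D2 n)"
    have "?bd \<longlonglongrightarrow> B * (K * s0 * norm y0 powr (- \<alpha>) + K * s0 * norm y0 powr (- \<alpha>) + 0)
        + B * (K * s0 * norm x0 powr (- \<alpha>) + K * s0 * norm x0 powr (- \<alpha>) + 0)"
      using nz0 by (intro tendsto_intros lims limX limY D1 D2) auto
    also have "B * (K * s0 * norm y0 powr (- \<alpha>) + K * s0 * norm y0 powr (- \<alpha>) + 0)
        + B * (K * s0 * norm x0 powr (- \<alpha>) + K * s0 * norm x0 powr (- \<alpha>) + 0) = s0 * Q"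
      by (simp add: Q_def algebra_simps)
    finally have "?bd \<longlonglongrightarrow> s0 * Q" .
    moreover have "s0 * Q < e" using s0Q e by simp
    ultimately have ev1: "eventually (\<lambda>n. ?bd n < e) sequentially" by (rule order_tendstoD)
    have "eventually (\<lambda>n. T n > \<tau> + s0 / 2) sequentially"
      by (rule order_tendstoD[OF limT]) (use s0 in \<open>simp add: \<tau>_def\<close>)
    with ev1 have "eventually (\<lambda>n. norm (pt (T n) (X n) (Y n) - pt t0 x0 y0) < e) sequentially"
    proof eventually_elim
      case (elim n)
      have Tn: "T n = \<tau> + s n" using elim(2) by (simp add: s_def max_def)
      have t0e: "t0 = \<tau> + s0" by (simp add: \<tau>_def)
      have mono: "KU * \<tau> powr (- real DIM('a) / \<alpha>) * r \<le> B * r" if "r \<ge> 0" for r using B\<tau> that by (rule mult_right_mono)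
      have D0: "D1 n \<ge> 0" "D2 n \<ge> 0" unfolding D1_def D2_def by (auto intro!: integral_nonneg_AE)
      have "\<bar>pt (\<tau> + s n) (X n) (Y n) - pt (\<tau> + s0) (X n) y0\<bar> \<le> KU * \<tau> powr (- real DIM('a) / \<alpha>) * (K * s n * norm (Y n) powr (- \<alpha>) + K * s0 * norm y0 powr (- \<alpha>) + D1 n)"
        unfolding D1_def by (rule K(2)) (use \<tau> spos s0 nz nz0 in auto)
      also have "\<dots> \<le> B * (K * s n * norm (Y n) powr (- \<alpha>) + K * s0 * norm y0 powr (- \<alpha>) + D1 n)"
        using K(1) spos[of n] s0 D0 by (intro mono) simp
      finally have a1: "\<bar>pt (\<tau> + s n) (X n) (Y n) - pt (\<tau> + s0) (X n) y0\<bar> \<le> B * (K * s n * norm (Y n) powr (- \<alpha>) + K * s0 * norm y0 powr (- \<alpha>) + D1 n)" .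
      have "\<bar>pt (\<tau> + s0) y0 (X n) - pt (\<tau> + s0) y0 x0\<bar> \<le> KU * \<tau> powr (- real DIM('a) / \<alpha>) * (K * s0 * norm (X n) powr (- \<alpha>) + K * s0 * norm x0 powr (- \<alpha>) + D2 n)"
        unfolding D2_def by (rule K(2)) (use \<tau> spos s0 nz nz0 in auto)
      also have "\<dots> \<le> B * (K * s0 * norm (X n) powr (- \<alpha>) + K * s0 * norm x0 powr (- \<alpha>) + D2 n)"
        using K(1) s0 D0 by (intro mono) simp
      finally have a2: "\<bar>pt (\<tau> + s0) (X n) y0 - pt (\<tau> + s0) x0 y0\<bar> \<le> B * (K * s0 * norm (X n) powr (- \<alpha>) + K * s0 * norm x0 powr (- \<alpha>) + D2 n)"
        using \<tau> s0 by (simp add: pt_sym[of "\<tau> + s0" y0])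
      have "norm (pt (T n) (X n) (Y n) - pt t0 x0 y0) \<le> ?bd n"
        unfolding Tn t0e real_norm_def using a1 a2 by linarith
      then show ?case using elim(1) by linarith
    qed
    then show "\<exists>no. \<forall>n\<ge>no. norm (pt (T n) (X n) (Y n) - pt t0 x0 y0) < e" by (simp add: eventually_sequentially)
  qed
  then show "((\<lambda>(t, x, y). pt t x y) \<circ> U) \<longlonglongrightarrow> (\<lambda>(t, x, y). pt t x y) u0"
    by (simp add: comp_def Un u0e)
qed

text \<open>The kernel is continuous off the axes and 0 on them.\<close>

lemma pt_meas2: "t > 0 \<Longrightarrow> (\<lambda>(x, y). pt t x y) \<in> borel_measurable (borel \<Otimes>\<^sub>M borel)"
proof -
  assume t: "t > 0"
  let ?S = "(UNIV - {0::'a}) \<times> (UNIV - {0::'a})"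
  have "continuous_on ?S (\<lambda>u. (\<lambda>(t, x, y). pt t x y) (t, u))"
    by (rule continuous_on_compose2[OF continuous_pt_off_axes]) (use t in \<open>auto intro!: continuous_intros\<close>)
  then have "(\<lambda>u. indicator ?S u *\<^sub>R (case u of (x, y) \<Rightarrow> pt t x y)) \<in> borel_measurable borel"
    by (intro borel_measurable_continuous_on_indicator borel_open open_Times) (auto simp: case_prod_beta)
  then show ?thesis unfolding borel_prod[symmetric]
    by (rule measurable_cong[THEN iffD1, rotated]) (use pt_0[OF t] in \<open>auto simp: indicator_def\<close>)
qed

text \<open>\<open>p_3P\<close> replaces \<open>p s z * p (t - s) w\<close> by
  \<open>p t (z + w)\<close> times a sum, and each summand leaves a negative moment centred at
  \<open>x\<close> or at \<open>y\<close>, bounded uniformly in \<open>s\<close>. In effect this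
  estimates the mean of \<open>FKint\<close> given the endpoint, with the test function
  \<open>f\<close> in the place of a bridge.\<close>

lemma nn_integral_FKint_le:
  obtains K where "K > 0" "\<And>t x f. t > 0 \<Longrightarrow> x \<noteq> 0 \<Longrightarrow> f \<in> borel_measurable borel \<Longrightarrow>
    (\<integral>\<^sup>+\<omega>. f (x + X t \<omega>) * FKint c t x \<omega> \<partial>M) \<le>
      (\<integral>\<^sup>+y. ennreal (K * t * (norm x powr (- \<alpha>) + norm y powr (- \<alpha>))) * (ennreal (p t (y - x)) * f y) \<partial>lborel)"
proof -
  obtain K where K: "K > 0" "\<And>t x. t > 0 \<Longrightarrow> x \<noteq> 0 \<Longrightarrow> (\<integral>\<^sup>+z. ennreal (p t (z - x) * norm z powr (- \<alpha>)) \<partial>lborel) \<le> ennreal (K * norm x powr (- \<alpha>))"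
    by (rule p_neg_moment[OF alpha(1,3)]) (rule that)
  define Q where "Q = C0 ^ 4 * c3 * c"
  have Q: "Q > 0" using C0 c3_pos c_pos by (simp add: Q_def)
  have "(\<integral>\<^sup>+\<omega>. f (x + X t \<omega>) * FKint c t x \<omega> \<partial>M) \<le>
      (\<integral>\<^sup>+y. ennreal ((Q * K) * t * (norm x powr (- \<alpha>) + norm y powr (- \<alpha>))) * (ennreal (p t (y - x)) * f y) \<partial>lborel)"
    if t: "t > 0" and x: "x \<noteq> 0" and [measurable]: "f \<in> borel_measurable borel" for t x f
  proof -
    note [measurable] = p_meas[OF t]
    let ?R = "\<integral>\<^sup>+y. ennreal ((Q * K) * (norm x powr (- \<alpha>) + norm y powr (- \<alpha>))) * (ennreal (p t (y - x)) * f y) \<partial>lborel"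
    have inner: "(\<integral>\<^sup>+z. (\<integral>\<^sup>+w. ennreal (p s z) * (ennreal (p (t - s) w) * (f (x + z + w) * ennreal (c * norm (x + z) powr (- \<alpha>)))) \<partial>lborel) \<partial>lborel) \<le> ?R"
      if st: "s \<in> {0<..<t}" for s
    proof -
      have s: "s > 0" and ts: "t - s > 0" using st by auto
      note [measurable] = p_meas[OF s] p_meas[OF ts]
      let ?F = "\<integral>\<^sup>+y. ennreal (p t (y - x)) * f y \<partial>lborel"
      have "(\<integral>\<^sup>+z. (\<integral>\<^sup>+w. ennreal (p s z) * (ennreal (p (t - s) w) * (f (x + z + w) * ennreal (c * norm (x + z) powr (- \<alpha>)))) \<partial>lborel) \<partial>lborel)
        \<le> (\<integral>\<^sup>+z. (\<integral>\<^sup>+w. ennreal (Q * norm (x + z) powr (- \<alpha>) * p s z) * (ennreal (p t (z + w)) * f (x + z + w))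
             + ennreal (Q * norm (x + z) powr (- \<alpha>)) * (ennreal (p (t - s) w) * (ennreal (p t (z + w)) * f (x + z + w))) \<partial>lborel) \<partial>lborel)"
      proof (intro nn_integral_mono)
        fix z w :: 'a
        have "p s z * p (t - s) w \<le> (C0 ^ 3 * c3) * S (s + (t - s)) (z + w) * (p s z + p (t - s) w)" by (rule p_3P[OF s ts])
        also have "\<dots> \<le> (C0 ^ 3 * c3) * (C0 * p t (z + w)) * (p s z + p (t - s) w)"
          using S_le_p[OF t, of "z + w"] C0 c3_pos p_nonneg[OF s] p_nonneg[OF ts]
          by (intro mult_right_mono mult_left_mono add_nonneg_nonneg) auto
        finally have "c * norm (x + z) powr (- \<alpha>) * (p s z * p (t - s) w) \<le> c * norm (x + z) powr (- \<alpha>) * ((C0 ^ 3 * c3) * (C0 * p t (z + w)) * (p s z + p (t - s) w))"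
          using c_pos by (intro mult_left_mono) auto
        also have "\<dots> = Q * norm (x + z) powr (- \<alpha>) * p s z * p t (z + w) + Q * norm (x + z) powr (- \<alpha>) * (p (t - s) w * p t (z + w))"
          by (simp add: Q_def algebra_simps power4_eq_xxxx power3_eq_cube)
        finally have "ennreal (c * norm (x + z) powr (- \<alpha>) * (p s z * p (t - s) w)) * f (x + z + w) \<le> ennreal (Q * norm (x + z) powr (- \<alpha>) * p s z * p t (z + w) + Q * norm (x + z) powr (- \<alpha>) * (p (t - s) w * p t (z + w))) * f (x + z + w)"
          by (intro mult_right_mono ennreal_leI) auto
        moreover have "ennreal (p s z) * (ennreal (p (t - s) w) * (f (x + z + w) * ennreal (c * norm (x + z) powr (- \<alpha>)))) = ennreal (c * norm (x + z) powr (- \<alpha>) * (p s z * p (t - s) w)) * f (x + z + w)"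
          using p_nonneg[OF s] p_nonneg[OF ts] c_pos by (simp add: ennreal_mult mult_ac)
        moreover have "ennreal (Q * norm (x + z) powr (- \<alpha>) * p s z * p t (z + w) + Q * norm (x + z) powr (- \<alpha>) * (p (t - s) w * p t (z + w))) * f (x + z + w) =
           ennreal (Q * norm (x + z) powr (- \<alpha>) * p s z) * (ennreal (p t (z + w)) * f (x + z + w)) + ennreal (Q * norm (x + z) powr (- \<alpha>)) * (ennreal (p (t - s) w) * (ennreal (p t (z + w)) * f (x + z + w)))"
          using p_nonneg[OF s] p_nonneg[OF ts] p_nonneg[OF t] Q by (simp add: ennreal_mult distrib_right mult.assoc)
        ultimately show "ennreal (p s z) * (ennreal (p (t - s) w) * (f (x + z + w) * ennreal (c * norm (x + z) powr (- \<alpha>)))) \<le>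
           ennreal (Q * norm (x + z) powr (- \<alpha>) * p s z) * (ennreal (p t (z + w)) * f (x + z + w)) + ennreal (Q * norm (x + z) powr (- \<alpha>)) * (ennreal (p (t - s) w) * (ennreal (p t (z + w)) * f (x + z + w)))"
          by simp
      qed
      also have "\<dots> = (\<integral>\<^sup>+z. ennreal (Q * norm (x + z) powr (- \<alpha>) * p s z) * ?F \<partial>lborel)
         + (\<integral>\<^sup>+z. ennreal (Q * norm (x + z) powr (- \<alpha>)) * (\<integral>\<^sup>+y. ennreal (p (t - s) (y - (x + z))) * (ennreal (p t (y - x)) * f y) \<partial>lborel) \<partial>lborel)"
      proof -
        have 1: "(\<integral>\<^sup>+w. ennreal (p t (z + w)) * f (x + z + w) \<partial>lborel) = ?F" for z
          using nn_integral_translate[of "\<lambda>y. ennreal (p t (y - x)) * f y" "x + z"] by (simp add: algebra_simps)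
        have 2: "(\<integral>\<^sup>+w. ennreal (p (t - s) w) * (ennreal (p t (z + w)) * f (x + z + w)) \<partial>lborel) = (\<integral>\<^sup>+y. ennreal (p (t - s) (y - (x + z))) * (ennreal (p t (y - x)) * f y) \<partial>lborel)" for z
          using nn_integral_translate[of "\<lambda>y. ennreal (p (t - s) (y - (x + z))) * (ennreal (p t (y - x)) * f y)" "x + z"] by (simp add: algebra_simps)
        have "(\<integral>\<^sup>+w. ennreal (Q * norm (x + z) powr (- \<alpha>) * p s z) * (ennreal (p t (z + w)) * f (x + z + w))
             + ennreal (Q * norm (x + z) powr (- \<alpha>)) * (ennreal (p (t - s) w) * (ennreal (p t (z + w)) * f (x + z + w))) \<partial>lborel)
          = ennreal (Q * norm (x + z) powr (- \<alpha>) * p s z) * ?F + ennreal (Q * norm (x + z) powr (- \<alpha>)) * (\<integral>\<^sup>+y. ennreal (p (t - s) (y - (x + z))) * (ennreal (p t (y - x)) * f y) \<partial>lborel)" for z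
          by (subst nn_integral_lincomb, measurable) (simp only: 1 2)
        then show ?thesis by (subst nn_integral_add[symmetric]) auto
      qed
      also have "(\<integral>\<^sup>+z. ennreal (Q * norm (x + z) powr (- \<alpha>) * p s z) * ?F \<partial>lborel) = (\<integral>\<^sup>+z. ennreal Q * ennreal (p s (z - x) * norm z powr (- \<alpha>)) \<partial>lborel) * ?F"
      proof -
        have "(\<integral>\<^sup>+z. ennreal (Q * norm (x + z) powr (- \<alpha>) * p s z) * ?F \<partial>lborel) = (\<integral>\<^sup>+z. ennreal (Q * norm (x + z) powr (- \<alpha>) * p s z) \<partial>lborel) * ?F"
          by (rule nn_integral_multc) measurable
        also have "(\<integral>\<^sup>+z. ennreal (Q * norm (x + z) powr (- \<alpha>) * p s z) \<partial>lborel) = (\<integral>\<^sup>+z. ennreal (Q * norm z powr (- \<alpha>) * p s (z - x)) \<partial>lborel)"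
          using nn_integral_translate[of "\<lambda>z. ennreal (Q * norm z powr (- \<alpha>) * p s (z - x))" x] by simp
        also have "\<dots> = (\<integral>\<^sup>+z. ennreal Q * ennreal (p s (z - x) * norm z powr (- \<alpha>)) \<partial>lborel)"
          using Q p_nonneg[OF s] by (intro nn_integral_cong) (simp add: mult_ac flip: ennreal_mult)
        finally show ?thesis .
      qed
      also have "(\<integral>\<^sup>+z. ennreal (Q * norm (x + z) powr (- \<alpha>)) * (\<integral>\<^sup>+y. ennreal (p (t - s) (y - (x + z))) * (ennreal (p t (y - x)) * f y) \<partial>lborel) \<partial>lborel)
         = (\<integral>\<^sup>+y. (\<integral>\<^sup>+z. ennreal Q * ennreal (p (t - s) (z - y) * norm z powr (- \<alpha>)) \<partial>lborel) * (ennreal (p t (y - x)) * f y) \<partial>lborel)"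
      proof -
        have "(\<integral>\<^sup>+z. ennreal (Q * norm (x + z) powr (- \<alpha>)) * (\<integral>\<^sup>+y. ennreal (p (t - s) (y - (x + z))) * (ennreal (p t (y - x)) * f y) \<partial>lborel) \<partial>lborel)
          = (\<integral>\<^sup>+z. ennreal (Q * norm z powr (- \<alpha>)) * (\<integral>\<^sup>+y. ennreal (p (t - s) (y - z)) * (ennreal (p t (y - x)) * f y) \<partial>lborel) \<partial>lborel)"
          using nn_integral_translate[of "\<lambda>z. ennreal (Q * norm z powr (- \<alpha>)) * (\<integral>\<^sup>+y. ennreal (p (t - s) (y - z)) * (ennreal (p t (y - x)) * f y) \<partial>lborel)" x] by simp
        also have "\<dots> = (\<integral>\<^sup>+z. (\<integral>\<^sup>+y. ennreal Q * ennreal (p (t - s) (z - y) * norm z powr (- \<alpha>)) * (ennreal (p t (y - x)) * f y) \<partial>lborel) \<partial>lborel)"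
          using Q p_nonneg[OF ts] by (subst nn_integral_cmult[symmetric], measurable)
            (auto intro!: nn_integral_cong simp: ennreal_mult p_commute[of "t - s" _ "_ :: 'a"] mult_ac)
        also have "\<dots> = (\<integral>\<^sup>+y. (\<integral>\<^sup>+z. ennreal Q * ennreal (p (t - s) (z - y) * norm z powr (- \<alpha>)) * (ennreal (p t (y - x)) * f y) \<partial>lborel) \<partial>lborel)"
          by (rule lborel_pair.Fubini'[symmetric]) measurable
        also have "\<dots> = (\<integral>\<^sup>+y. (\<integral>\<^sup>+z. ennreal Q * ennreal (p (t - s) (z - y) * norm z powr (- \<alpha>)) \<partial>lborel) * (ennreal (p t (y - x)) * f y) \<partial>lborel)"
          by (subst nn_integral_multc) auto
        finally show ?thesis .
      qed
      also have "(\<integral>\<^sup>+z. ennreal Q * ennreal (p s (z - x) * norm z powr (- \<alpha>)) \<partial>lborel) * ?F + (\<integral>\<^sup>+y. (\<integral>\<^sup>+z. ennreal Q * ennreal (p (t - s) (z - y) * norm z powr (- \<alpha>)) \<partial>lborel) * (ennreal (p t (y - x)) * f y) \<partial>lborel)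
        \<le> ennreal (Q * K * norm x powr (- \<alpha>)) * ?F + (\<integral>\<^sup>+y. ennreal (Q * K * norm y powr (- \<alpha>)) * (ennreal (p t (y - x)) * f y) \<partial>lborel)"
      proof (intro add_mono mult_right_mono nn_integral_mono_AE)
        have QK: "(\<integral>\<^sup>+z. ennreal Q * ennreal (p r (z - y) * norm z powr (- \<alpha>)) \<partial>lborel) \<le> ennreal (Q * K * norm y powr (- \<alpha>))" if r: "r > 0" and y: "y \<noteq> 0" for r y
        proof -
          note [measurable] = p_meas[OF r]
          have "(\<integral>\<^sup>+z. ennreal Q * ennreal (p r (z - y) * norm z powr (- \<alpha>)) \<partial>lborel) = ennreal Q * (\<integral>\<^sup>+z. ennreal (p r (z - y) * norm z powr (- \<alpha>)) \<partial>lborel)"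
            by (rule nn_integral_cmult) measurable
          also have "\<dots> \<le> ennreal Q * ennreal (K * norm y powr (- \<alpha>))" by (intro mult_left_mono K(2) r y) simp
          finally show ?thesis using Q K(1) by (simp add: mult.assoc flip: ennreal_mult)
        qed
        show "(\<integral>\<^sup>+z. ennreal Q * ennreal (p s (z - x) * norm z powr (- \<alpha>)) \<partial>lborel) \<le> ennreal (Q * K * norm x powr (- \<alpha>))" by (rule QK[OF s x])
        have "AE y in lborel. y \<noteq> (0::'a)" by (rule AE_lborel_singleton)
        then show "AE y in lborel. (\<integral>\<^sup>+z. ennreal Q * ennreal (p (t - s) (z - y) * norm z powr (- \<alpha>)) \<partial>lborel) * (ennreal (p t (y - x)) * f y) \<le> ennreal (Q * K * norm y powr (- \<alpha>)) * (ennreal (p t (y - x)) * f y)"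
          by eventually_elim (intro mult_right_mono QK[OF ts], auto)
      qed simp
      also have "\<dots> = (\<integral>\<^sup>+y. ennreal (Q * K * norm x powr (- \<alpha>)) * (ennreal (p t (y - x)) * f y) + ennreal (Q * K * norm y powr (- \<alpha>)) * (ennreal (p t (y - x)) * f y) \<partial>lborel)"
        by (subst nn_integral_add, measurable, subst nn_integral_cmult) auto
      also have "\<dots> = ?R"
        using Q K(1) by (intro nn_integral_cong) (simp add: distrib_right[symmetric] distrib_left flip: ennreal_plus)
      finally show ?thesis .
    qed
    have "(\<integral>\<^sup>+\<omega>. f (x + X t \<omega>) * FKint c t x \<omega> \<partial>M) \<le> (\<integral>\<^sup>+s. ?R * indicator {0<..<t} s \<partial>lborel)"
      unfolding nn_integral_FKint[OF t \<open>f \<in> borel_measurable borel\<close>]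
      by (rule nn_integral_mono) (use inner in \<open>auto simp: indicator_def\<close>)
    also have "\<dots> = ennreal t * ?R" using t by (subst nn_integral_cmult_indicator) (auto simp: mult.commute)
    also have "\<dots> = (\<integral>\<^sup>+y. ennreal ((Q * K) * t * (norm x powr (- \<alpha>) + norm y powr (- \<alpha>))) * (ennreal (p t (y - x)) * f y) \<partial>lborel)"
    proof -
      have "ennreal t * ennreal ((Q * K) * u) = ennreal ((Q * K) * t * u)" if "u \<ge> 0" for u
        using t Q K(1) that by (simp add: mult_ac flip: ennreal_mult)
      then show ?thesis
        by (subst nn_integral_cmult[symmetric], measurable) (simp only: mult.assoc[of "ennreal t", symmetric] add_nonneg_nonneg powr_ge_zero)
    qed
    finally show ?thesis .
  qed
  with that[of "Q * K"] Q K(1) show ?thesis by simp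
qed

end

section \<open>Lower bound away from the origin and the invariant function\<close>

text \<open>A violation at one point persists on a ball, which has positive measure.\<close>

lemma AE_le_imp_le_on_open:
  fixes f g :: "'a::euclidean_space \<Rightarrow> real"
  assumes "open U" "continuous_on U f" "continuous_on U g"
    and ae: "AE y in lborel. y \<in> U \<longrightarrow> f y \<le> g y" and y: "y \<in> U"
  shows "f y \<le> g y"
proof (rule ccontr)
  assume n: "\<not> f y \<le> g y"
  let ?N = "U \<inter> (\<lambda>y. f y - g y) -` {0<..}"
  have "open ?N" using assms(1-3) by (intro continuous_open_preimage continuous_intros) auto
  moreover have "y \<in> ?N" using n y by simp
  ultimately obtain e where e: "e > 0" "ball y e \<subseteq> ?N" by (meson open_contains_ball_eq)
  have "AE y in lborel. y \<notin> ?N" using ae by eventually_elim auto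
  then have "emeasure lborel ?N = 0" using \<open>open ?N\<close> by (subst (asm) AE_iff_measurable[of ?N]) auto
  then have "emeasure lborel (ball y e) = 0" using e(2) \<open>open ?N\<close> emeasure_mono[of "ball y e" ?N lborel] by simp
  then show False using e(1) unit_ball_vol_pos[of "real DIM('a)"] by (simp add: emeasure_ball)
qed

lemma integrable_indicator_Ioo: "integrable lborel (indicator {a<..<b::real} :: real \<Rightarrow> real)"
  by (cases "a \<le> b") (auto intro!: integrable_real_indicator)

context fk_kernel
begin

text \<open>Jensen's inequality in tangent form, with \<open>a\<close> a bound on the conditional
  mean of \<open>FKint\<close> when both ends are outside the ball. For the masses \<open>F\<close>
  and \<open>Y\<close> of a set under the stable density and the kernel it reads
  \<open>exp (- a) * (1 + a) * F \<le> Y + exp (- a) * a * F\<close>, and the terms with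
  \<open>a\<close> cancel.\<close>

lemma pt_lower_AE:
  assumes K: "K > 0" "\<And>t x f. t > 0 \<Longrightarrow> x \<noteq> 0 \<Longrightarrow> f \<in> borel_measurable borel \<Longrightarrow>
    (\<integral>\<^sup>+\<omega>. f (x + X t \<omega>) * FKint c t x \<omega> \<partial>M) \<le>
      (\<integral>\<^sup>+y. ennreal (K * t * (norm x powr (- \<alpha>) + norm y powr (- \<alpha>))) * (ennreal (p t (y - x)) * f y) \<partial>lborel)"
    and r: "r > 0" and t: "t > 0" and x: "norm x \<ge> r * t powr (1 / \<alpha>)"
  shows "AE y in lborel. r * t powr (1 / \<alpha>) \<le> norm y \<longrightarrow> exp (- (2 * K * r powr (- \<alpha>))) * p t (y - x) \<le> pt t x y"
proof -
  note [measurable] = p_meas[OF t] pt_meas[OF t]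
  define R where "R = r * t powr (1 / \<alpha>)"
  have R: "R > 0" using r t by (simp add: R_def)
  have x0: "x \<noteq> 0" using x R by (auto simp: R_def)
  define a where "a = 2 * K * r powr (- \<alpha>)"
  have a: "a \<ge> 0" using K(1) by (simp add: a_def)
  have tR: "t * norm y powr (- \<alpha>) \<le> r powr (- \<alpha>)" if "norm y \<ge> R" for y :: 'a
  proof -
    have "norm y powr (- \<alpha>) \<le> R powr (- \<alpha>)" using that R alpha by (intro powr_mono2') auto
    also have "\<dots> = r powr (- \<alpha>) * t powr (- 1)" using r t alpha by (simp add: R_def powr_mult powr_powr)
    finally have "t * norm y powr (- \<alpha>) \<le> t * (r powr (- \<alpha>) * t powr (- 1))" using t by (intro mult_left_mono) auto
    then show ?thesis using t by (simp add: powr_minus_divide)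
  qed
  let ?S = "{y::'a. R \<le> norm y}"
  let ?f = "\<lambda>y. exp (- a) * p t (y - x) * indicator ?S y"
  have [measurable]: "?S \<in> sets borel" by measurable
  have "AE y in lborel. ?f y \<le> pt t x y"
  proof (rule AE_le_if_nn_integral_le)
    have "integrable lborel (\<lambda>y. exp (- a) * p t (y - x))" using integrable_p_translate[OF t] by simp
    then show "integrable lborel ?f" by (rule Bochner_Integration.integrable_bound) (auto simp: indicator_def)
    show "AE y in lborel. 0 \<le> ?f y" using p_nonneg[OF t] by simp
    show "integrable lborel (pt t x)" by (rule integrable_pt[OF t])
    show "AE y in lborel. 0 \<le> pt t x y" using pt_bounds(1)[OF t] by simp
    fix A :: "'a set" assume "A \<in> sets lborel"
    then have [measurable]: "A \<in> sets borel" by simp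
    let ?B = "A \<inter> ?S"
    let ?F = "\<integral>\<^sup>+y. ennreal (p t (y - x)) * indicator ?B y \<partial>lborel"
    let ?Y = "\<integral>\<^sup>+y. ennreal (pt t x y) * indicator ?B y \<partial>lborel"
    have "?F \<le> (\<integral>\<^sup>+y. ennreal (p t (y - x)) \<partial>lborel)" by (rule nn_integral_mono) (auto simp: indicator_def)
    then have Ffin: "?F \<le> 1" using nn_integral_p_translate[OF t, of x] by simp
    have "?Y \<le> ?F"
    proof (rule nn_integral_mono_AE)
      show "AE y in lborel. ennreal (pt t x y) * indicator ?B y \<le> ennreal (p t (y - x)) * indicator ?B y"
        using pt_AE_bounds[OF t, of x] by eventually_elim (auto simp: indicator_def intro: ennreal_leI)
    qed
    with Ffin have Yfin: "?Y \<le> 1" by simp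
    \<comment> \<open>Both masses are finite, so the common term may later be cancelled among the
      reals.\<close>
    obtain F where F: "?F = ennreal F" "F \<ge> 0" using Ffin by (cases ?F) (auto simp: top_unique)
    obtain Y where Y: "?Y = ennreal Y" "Y \<ge> 0" using Yfin by (cases ?Y) (auto simp: top_unique)
    have "ennreal (exp (- a) * (1 + a)) * ?F = ennreal (exp (- a) * (1 + a)) * (\<integral>\<^sup>+\<omega>. indicator ?B (x + X t \<omega>) \<partial>M)"
      by (subst nn_integral_X[OF t]) auto
    also have "\<dots> = (\<integral>\<^sup>+\<omega>. indicator ?B (x + X t \<omega>) * ennreal (exp (- a) * (1 + a)) \<partial>M)"
      by (subst nn_integral_multc) (auto simp: mult.commute)
    also have "\<dots> \<le> (\<integral>\<^sup>+\<omega>. indicator ?B (x + X t \<omega>) * ennreal (W t x \<omega>) + ennreal (exp (- a)) * (indicator ?B (x + X t \<omega>) * FKint c t x \<omega>) \<partial>M)"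
    proof (rule nn_integral_mono)
      fix \<omega>
      show "indicator ?B (x + X t \<omega>) * ennreal (exp (- a) * (1 + a)) \<le> indicator ?B (x + X t \<omega>) * ennreal (W t x \<omega>) + ennreal (exp (- a)) * (indicator ?B (x + X t \<omega>) * FKint c t x \<omega>)"
        using FK_weight_tangent[OF a, of c t x \<omega>] by (cases "x + X t \<omega> \<in> ?B") (auto simp del: Int_iff)
    qed
    also have "\<dots> = ?Y + ennreal (exp (- a)) * (\<integral>\<^sup>+\<omega>. indicator ?B (x + X t \<omega>) * FKint c t x \<omega> \<partial>M)"
      by (subst nn_integral_add, measurable, subst nn_integral_cmult, measurable, subst pt_AE_nonneg_and_law(2)[OF t x0]) auto
    also have "\<dots> \<le> ?Y + ennreal (exp (- a)) * (ennreal a * ?F)"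
    proof (intro add_left_mono mult_left_mono)
      have "(\<integral>\<^sup>+\<omega>. indicator ?B (x + X t \<omega>) * FKint c t x \<omega> \<partial>M) \<le> (\<integral>\<^sup>+y. ennreal (K * t * (norm x powr (- \<alpha>) + norm y powr (- \<alpha>))) * (ennreal (p t (y - x)) * indicator ?B y) \<partial>lborel)"
        by (rule K(2)[OF t x0]) measurable
      also have "\<dots> \<le> (\<integral>\<^sup>+y. ennreal a * (ennreal (p t (y - x)) * indicator ?B y) \<partial>lborel)"
      proof (rule nn_integral_mono)
        fix y :: 'a
        show "ennreal (K * t * (norm x powr (- \<alpha>) + norm y powr (- \<alpha>))) * (ennreal (p t (y - x)) * indicator ?B y) \<le> ennreal a * (ennreal (p t (y - x)) * indicator ?B y)"
        proof (cases "y \<in> ?B")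
          case True
          then have "t * norm x powr (- \<alpha>) + t * norm y powr (- \<alpha>) \<le> r powr (- \<alpha>) + r powr (- \<alpha>)"
            using x by (intro add_mono tR) (auto simp: R_def)
          then have "K * (t * norm x powr (- \<alpha>) + t * norm y powr (- \<alpha>)) \<le> K * (r powr (- \<alpha>) + r powr (- \<alpha>))" using K(1) by (intro mult_left_mono) auto
          then have "K * t * (norm x powr (- \<alpha>) + norm y powr (- \<alpha>)) \<le> a" by (simp add: a_def algebra_simps)
          then show ?thesis by (intro mult_right_mono ennreal_leI) auto
        qed simp
      qed
      also have "\<dots> = ennreal a * ?F" by (rule nn_integral_cmult) measurable
      finally show "(\<integral>\<^sup>+\<omega>. indicator ?B (x + X t \<omega>) * FKint c t x \<omega> \<partial>M) \<le> ennreal a * ?F" .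
    qed simp
    finally have "ennreal (exp (- a) * (1 + a) * F) \<le> ennreal (Y + exp (- a) * (a * F))"
      using F Y a by (simp flip: ennreal_mult ennreal_plus)
    then have "exp (- a) * (1 + a) * F \<le> Y + exp (- a) * (a * F)" using F Y a by (subst (asm) ennreal_le_iff) auto
    then have le: "exp (- a) * F \<le> Y" by (simp add: algebra_simps)
    have "(\<integral>\<^sup>+y. ennreal (?f y) * indicator A y \<partial>lborel) = (\<integral>\<^sup>+y. ennreal (exp (- a)) * (ennreal (p t (y - x)) * indicator ?B y) \<partial>lborel)"
      using p_nonneg[OF t] by (intro nn_integral_cong) (auto simp: indicator_def ennreal_mult)
    also have "\<dots> = ennreal (exp (- a) * F)" using F by (subst nn_integral_cmult) (auto simp: ennreal_mult)
    also have "\<dots> \<le> ?Y" using le Y by (simp add: ennreal_leI)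
    also have "\<dots> \<le> (\<integral>\<^sup>+y. ennreal (pt t x y) * indicator A y \<partial>lborel)" by (rule nn_integral_mono) (auto simp: indicator_def)
    finally show "(\<integral>\<^sup>+y. ennreal (?f y) * indicator A y \<partial>lborel) \<le> (\<integral>\<^sup>+y. ennreal (pt t x y) * indicator A y \<partial>lborel)" .
  qed
  then show ?thesis by eventually_elim (auto simp: R_def a_def indicator_def split: if_splits)
qed

text \<open>The almost everywhere bound is applied with radius \<open>r / 2\<close>, so that all
  points with \<open>|y| \<ge> r * t powr (1 / \<alpha>)\<close> are interior and continuity of both
  sides removes the exceptional set.\<close>

lemma pt_lower_away:
  assumes r: "r > 0"
  obtains b where "b > 0" "\<And>t x y. t > 0 \<Longrightarrow> norm x \<ge> r * t powr (1 / \<alpha>) \<Longrightarrow> norm y \<ge> r * t powr (1 / \<alpha>) \<Longrightarrow> b * S t (x - y) \<le> pt t x y"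
proof -
  obtain K where K: "K > 0" "\<And>t x f. t > 0 \<Longrightarrow> x \<noteq> 0 \<Longrightarrow> f \<in> borel_measurable borel \<Longrightarrow>
    (\<integral>\<^sup>+\<omega>. f (x + X t \<omega>) * FKint c t x \<omega> \<partial>M) \<le>
      (\<integral>\<^sup>+y. ennreal (K * t * (norm x powr (- \<alpha>) + norm y powr (- \<alpha>))) * (ennreal (p t (y - x)) * f y) \<partial>lborel)"
    by (rule nn_integral_FKint_le) (rule that)
  define b where "b = exp (- (2 * K * (r / 2) powr (- \<alpha>)))"
  have "b / C0 * S t (x - y) \<le> pt t x y" if t: "t > 0" and x: "norm x \<ge> r * t powr (1 / \<alpha>)" and y: "norm y \<ge> r * t powr (1 / \<alpha>)" for t x y
  proof -
    have tt: "t powr (1 / \<alpha>) > 0" using t by simp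
    let ?R = "(r / 2) * t powr (1 / \<alpha>)"
    have R: "?R > 0" "?R < r * t powr (1 / \<alpha>)" using r tt by auto
    have x0: "x \<noteq> 0" using x R by auto
    let ?U = "{y::'a. ?R < norm y}"
    have U: "open ?U" by (intro open_Collect_less continuous_intros)
    have cp: "continuous_on ?U (\<lambda>y. b * p t (y - x))"
      by (intro continuous_intros continuous_on_compose2[OF continuous_p[OF t]]) auto
    have "continuous_on ?U (\<lambda>y. (\<lambda>(t, x, y). pt t x y) (t, x, y))"
      by (rule continuous_on_compose2[OF continuous_pt_off_axes]) (use t x0 R in \<open>auto intro!: continuous_intros\<close>)
    then have cpt: "continuous_on ?U (\<lambda>y. pt t x y)" by simp
    have "AE y in lborel. ?R \<le> norm y \<longrightarrow> b * p t (y - x) \<le> pt t x y"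
    proof -
      have "r / 2 > 0" "?R \<le> norm x" using r x R by linarith+
      from pt_lower_AE[OF K this(1) t this(2)] show ?thesis unfolding b_def .
    qed
    then have ae: "AE y in lborel. y \<in> ?U \<longrightarrow> b * p t (y - x) \<le> pt t x y" by eventually_elim auto
    have "b * p t (y - x) \<le> pt t x y"
      by (rule AE_le_imp_le_on_open[OF U cp cpt ae]) (use y R in auto)
    moreover have "b * (S t (y - x) / C0) \<le> b * p t (y - x)" by (intro mult_left_mono p_lower[OF t]) (simp add: b_def)
    ultimately show ?thesis by (simp add: sbound_minus_commute[of \<alpha> t x y])
  qed
  with that[of "b / C0"] C0 show ?thesis by (simp add: b_def)
qed

lemma integrable_pt_moment: "t > 0 \<Longrightarrow> integrable lborel (\<lambda>z. pt t x z * norm z powr \<delta>)"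
proof -
  assume t: "t > 0"
  note [measurable] = pt_meas[OF t]
  show ?thesis
  proof (rule Bochner_Integration.integrable_bound[OF integrable_p_moment[OF del t, of x]])
    show "AE z in lborel. norm (pt t x z * norm z powr \<delta>) \<le> norm (p t (z - x) * norm z powr \<delta>)"
      using pt_AE_bounds[OF t, of x] by eventually_elim (auto simp: abs_mult intro!: mult_right_mono)
  qed measurable
qed

section \<open>Invariance of the power of the norm\<close>

definition E :: "'a \<Rightarrow> real \<Rightarrow> real" where
  "E x s = (LINT z|lborel. p s (z - x) * norm z powr (\<delta> - \<alpha>))"

definition A :: "real \<Rightarrow> 'a \<Rightarrow> real" where
  "A t x = (LINT z|lborel. p t (z - x) * norm z powr \<delta>) - norm x powr \<delta>"

text \<open>The defect whose vanishing is the invariance; \<open>A - g\<close> is the part lost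
  through the weight.\<close>

definition g :: "real \<Rightarrow> 'a \<Rightarrow> real" where
  "g t x = (LINT z|lborel. pt t x z * norm z powr \<delta>) - norm x powr \<delta>"

lemma integrable_E: "t > 0 \<Longrightarrow> x \<noteq> 0 \<Longrightarrow> integrable lborel (\<lambda>s. indicator {0<..<t} s * E x s)"
  unfolding E_def by (rule heat_norm_powr_identity(1)[OF del])

lemma A_eq: "t > 0 \<Longrightarrow> x \<noteq> 0 \<Longrightarrow> A t x = c * (LINT s|lborel. indicator {0<..<t} s * E x s)"
  unfolding A_def E_def c_def using heat_norm_powr_identity(2)[OF del, of t x] by simp

lemma E_nonneg: "s > 0 \<Longrightarrow> 0 \<le> E x s"
  unfolding E_def by (rule integral_nonneg_AE) (use p_nonneg in auto)

lemma integral_E_le: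
  assumes t: "t > 0" and x: "x \<noteq> 0" and le: "\<And>s. 0 < s \<Longrightarrow> s < t \<Longrightarrow> E x s \<le> B"
  shows "(LINT s|lborel. indicator {0<..<t} s * E x s) \<le> t * B"
proof -
  have "(LINT s|lborel. indicator {0<..<t} s * E x s) \<le> (LINT s|lborel. indicator {0<..<t} s * B)"
    by (rule integral_mono[OF integrable_E[OF t x]], rule integrable_mult_left[OF integrable_indicator_Ioo]) (use le in \<open>auto simp: indicator_def\<close>)
  then show ?thesis using t by simp
qed

lemma A_bounds:
  obtains K where "K > 0" "\<And>t x. t > 0 \<Longrightarrow> x \<noteq> 0 \<Longrightarrow> 0 \<le> A t x \<and> A t x \<le> K * t * norm x powr (\<delta> - \<alpha>)"
proof -
  obtain K where K: "K > 0" "\<And>t x. t > 0 \<Longrightarrow> x \<noteq> 0 \<Longrightarrow> (\<integral>\<^sup>+z. ennreal (p t (z - x) * norm z powr (- (\<alpha> - \<delta>))) \<partial>lborel) \<le> ennreal (K * norm x powr (- (\<alpha> - \<delta>)))"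
    by (rule p_neg_moment[of "\<alpha> - \<delta>"]) (use del alpha in \<open>auto intro: that\<close>)
  have E: "E x s \<le> K * norm x powr (\<delta> - \<alpha>)" if "s > 0" "x \<noteq> 0" for x s
  proof -
    have "ennreal (E x s) = (\<integral>\<^sup>+z. ennreal (p s (z - x) * norm z powr (\<delta> - \<alpha>)) \<partial>lborel)"
      unfolding E_def using p_nonneg[OF that(1)]
      by (intro nn_integral_eq_integral[symmetric] has_integral_p_neg_moment[OF del that]) auto
    also have "\<dots> \<le> ennreal (K * norm x powr (\<delta> - \<alpha>))" using K(2)[OF that] by simp
    finally show ?thesis using K(1) by (simp add: ennreal_le_iff)
  qed
  show ?thesis
  proof (rule that[of "c * K"])
    fix t x assume t: "t > (0::real)" and x: "x \<noteq> (0::'a)"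
    have "(LINT s|lborel. indicator {0<..<t} s * E x s) \<le> t * (K * norm x powr (\<delta> - \<alpha>))"
      by (rule integral_E_le[OF t x]) (use E x in auto)
    then have "c * (LINT s|lborel. indicator {0<..<t} s * E x s) \<le> c * (t * (K * norm x powr (\<delta> - \<alpha>)))"
      using c_pos by (intro mult_left_mono) auto
    moreover have "0 \<le> (LINT s|lborel. indicator {0<..<t} s * E x s)"
      by (rule integral_nonneg_AE) (use E_nonneg[of _ x] in \<open>auto simp: indicator_def\<close>)
    ultimately show "0 \<le> A t x \<and> A t x \<le> c * K * t * norm x powr (\<delta> - \<alpha>)"
      using A_eq[OF t x] c_pos by (simp add: mult_ac)
  qed (use c_pos K in simp)
qed

lemma g_le_A: "t > 0 \<Longrightarrow> g t x \<le> A t x"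
proof -
  assume t: "t > 0"
  have "(LINT z|lborel. pt t x z * norm z powr \<delta>) \<le> (LINT z|lborel. p t (z - x) * norm z powr \<delta>)"
  proof (rule integral_mono_AE[OF integrable_pt_moment[OF t] integrable_p_moment[OF del t]])
    show "AE z in lborel. pt t x z * norm z powr \<delta> \<le> p t (z - x) * norm z powr \<delta>"
      using pt_AE_bounds[OF t, of x] by eventually_elim (auto intro!: mult_right_mono)
  qed
  then show ?thesis by (simp add: g_def A_def)
qed

text \<open>\<open>\<delta>\<close> may exceed 1, and then no such bound with first factor exactly 1
  exists. A small \<open>\<theta>\<close> brings that factor arbitrarily close to 1, which the
  small-time limit of \<open>g\<close> requires.\<close>

lemma powr_add_le:
  fixes u v \<theta> :: real
  assumes "u \<ge> 0" "v \<ge> 0" "\<theta> > 0"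
  shows "(u + v) powr \<delta> \<le> (1 + \<theta>) powr \<delta> * u powr \<delta> + (1 + 1 / \<theta>) powr \<delta> * v powr \<delta>"
proof (cases "v \<le> \<theta> * u")
  case True
  have "(u + v) powr \<delta> \<le> ((1 + \<theta>) * u) powr \<delta>" using True assms del by (intro powr_mono2) (auto simp: algebra_simps)
  also have "\<dots> = (1 + \<theta>) powr \<delta> * u powr \<delta>" using assms by (simp add: powr_mult)
  finally show ?thesis by (rule order_trans) simp
next
  case False
  then have "u \<le> v / \<theta>" using assms by (simp add: field_simps)
  then have "(u + v) powr \<delta> \<le> ((1 + 1 / \<theta>) * v) powr \<delta>" using assms del by (intro powr_mono2) (auto simp: algebra_simps)
  also have "\<dots> = (1 + 1 / \<theta>) powr \<delta> * v powr \<delta>" using assms by (simp add: powr_mult)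
  finally show ?thesis by (rule order_trans) simp
qed

text \<open>\<open>A - g\<close> is the mean of \<open>|x + X t| powr \<delta>\<close> times one
  minus the weight, so at most the mean with \<open>FKint\<close> instead. Replacing
  \<open>X t\<close> by \<open>X s\<close> through \<open>powr_add_le\<close> turns the main part
  into \<open>A\<close> itself; the increment from \<open>s\<close> to \<open>t\<close> contributes
  the higher order \<open>t powr (1 + \<delta> / \<alpha>)\<close>.\<close>

lemma A_minus_g_le:
  obtains K where "\<And>\<theta>. \<theta> > 0 \<Longrightarrow> K \<theta> > 0" "\<And>t x \<theta>. t > 0 \<Longrightarrow> x \<noteq> 0 \<Longrightarrow> \<theta> > 0 \<Longrightarrow>
    A t x - g t x \<le> (1 + \<theta>) powr \<delta> * A t x + K \<theta> * t powr (1 + \<delta> / \<alpha>) * norm x powr (- \<alpha>)"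
proof -
  obtain K where K: "K > 0" "\<And>t x. t > 0 \<Longrightarrow> x \<noteq> 0 \<Longrightarrow> (\<integral>\<^sup>+z. ennreal (p t (z - x) * norm z powr (- \<alpha>)) \<partial>lborel) \<le> ennreal (K * norm x powr (- \<alpha>))"
    by (rule p_neg_moment[OF alpha(1,3)]) (rule that)
  obtain Km where Km: "Km > 0" "\<And>t. t > 0 \<Longrightarrow> (\<integral>\<^sup>+z. ennreal (p t z * norm z powr \<delta>) \<partial>lborel) \<le> ennreal (Km * t powr (\<delta> / \<alpha>))"
    by (rule p_moment[OF del]) (rule that)
  have main: "A t x - g t x \<le> (1 + \<theta>) powr \<delta> * A t x + ((1 + 1 / \<theta>) powr \<delta> * Km * c * K) * t powr (1 + \<delta> / \<alpha>) * norm x powr (- \<alpha>)"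
    if t: "t > 0" and x: "x \<noteq> 0" and \<theta>: "\<theta> > 0" for t x \<theta>
  proof -
    note [measurable] = p_meas[OF t] pt_meas[OF t]
    define T1 where "T1 = (1 + \<theta>) powr \<delta>"
    define T2 where "T2 = (1 + 1 / \<theta>) powr \<delta>"
    have "1 + 1 / \<theta> > 0" using \<theta> by (simp add: add_pos_pos)
    then have T: "T1 > 0" "T2 > 0" using \<theta> by (auto simp: T1_def T2_def)
    let ?h = "\<lambda>y. ennreal (norm y powr \<delta>)"
    define R where "R = T2 * Km * c * K * t powr (\<delta> / \<alpha>) * norm x powr (- \<alpha>)"
    have R: "R \<ge> 0" using T Km K c_pos by (simp add: R_def)
    have inner: "(\<integral>\<^sup>+z. (\<integral>\<^sup>+w. ennreal (p s z) * (ennreal (p (t - s) w) * (?h (x + z + w) * ennreal (c * norm (x + z) powr (- \<alpha>)))) \<partial>lborel) \<partial>lborel)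
       \<le> ennreal (T1 * c * E x s + R)" if st: "s \<in> {0<..<t}" for s
    proof -
      have s: "s > 0" and ts: "t - s > 0" using st by auto
      note [measurable] = p_meas[OF s] p_meas[OF ts]
      have "(\<integral>\<^sup>+w. ennreal (p s z) * (ennreal (p (t - s) w) * (?h (x + z + w) * ennreal (c * norm (x + z) powr (- \<alpha>)))) \<partial>lborel)
        \<le> ennreal (T1 * c) * ennreal (p s z * (norm (x + z) powr (- \<alpha>) * norm (x + z) powr \<delta>)) + ennreal (T2 * c * Km * t powr (\<delta> / \<alpha>)) * ennreal (p s z * norm (x + z) powr (- \<alpha>))" (is "?L \<le> _") for z
      proof -
        have "?L \<le> (\<integral>\<^sup>+w. ennreal (T1 * c * (p s z * (norm (x + z) powr (- \<alpha>) * norm (x + z) powr \<delta>))) * ennreal (p (t - s) w)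
           + ennreal (T2 * c * (p s z * norm (x + z) powr (- \<alpha>))) * ennreal (p (t - s) w * norm w powr \<delta>) \<partial>lborel)"
        proof (rule nn_integral_mono)
          fix w :: 'a
          have "norm (x + z + w) powr \<delta> \<le> (norm (x + z) + norm w) powr \<delta>" using del norm_triangle_ineq[of "x + z" w] by (intro powr_mono2) auto
          also have "\<dots> \<le> T1 * norm (x + z) powr \<delta> + T2 * norm w powr \<delta>" unfolding T1_def T2_def by (rule powr_add_le) (use \<theta> in auto)
          finally have "p s z * p (t - s) w * c * norm (x + z) powr (- \<alpha>) * norm (x + z + w) powr \<delta> \<le> p s z * p (t - s) w * c * norm (x + z) powr (- \<alpha>) * (T1 * norm (x + z) powr \<delta> + T2 * norm w powr \<delta>)"
            using p_nonneg[OF s] p_nonneg[OF ts] c_pos by (intro mult_left_mono) auto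
          then have "ennreal (p s z * p (t - s) w * c * norm (x + z) powr (- \<alpha>) * norm (x + z + w) powr \<delta>) \<le> ennreal (T1 * c * (p s z * (norm (x + z) powr (- \<alpha>) * norm (x + z) powr \<delta>)) * p (t - s) w + T2 * c * (p s z * norm (x + z) powr (- \<alpha>)) * (p (t - s) w * norm w powr \<delta>))"
            by (intro ennreal_leI) (simp add: algebra_simps)
          also have "\<dots> = ennreal (T1 * c * (p s z * (norm (x + z) powr (- \<alpha>) * norm (x + z) powr \<delta>))) * ennreal (p (t - s) w) + ennreal (T2 * c * (p s z * norm (x + z) powr (- \<alpha>))) * ennreal (p (t - s) w * norm w powr \<delta>)"
            using p_nonneg[OF s] p_nonneg[OF ts] c_pos T by (simp add: ennreal_mult)
          finally show "ennreal (p s z) * (ennreal (p (t - s) w) * (?h (x + z + w) * ennreal (c * norm (x + z) powr (- \<alpha>)))) \<le> \<dots>"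
            using p_nonneg[OF s] p_nonneg[OF ts] c_pos by (simp add: ennreal_mult mult_ac)
        qed
        also have "\<dots> = ennreal (T1 * c * (p s z * (norm (x + z) powr (- \<alpha>) * norm (x + z) powr \<delta>))) + ennreal (T2 * c * (p s z * norm (x + z) powr (- \<alpha>))) * (\<integral>\<^sup>+w. ennreal (p (t - s) w * norm w powr \<delta>) \<partial>lborel)"
          by (subst nn_integral_lincomb) (simp_all add: nn_integral_p[OF ts])
        also have "\<dots> \<le> ennreal (T1 * c * (p s z * (norm (x + z) powr (- \<alpha>) * norm (x + z) powr \<delta>))) + ennreal (T2 * c * (p s z * norm (x + z) powr (- \<alpha>))) * ennreal (Km * t powr (\<delta> / \<alpha>))"
        proof (intro add_left_mono mult_left_mono)
          have "(\<integral>\<^sup>+w. ennreal (p (t - s) w * norm w powr \<delta>) \<partial>lborel) \<le> ennreal (Km * (t - s) powr (\<delta> / \<alpha>))" by (rule Km(2)[OF ts])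
          also have "\<dots> \<le> ennreal (Km * t powr (\<delta> / \<alpha>))" using Km(1) s ts del alpha by (intro ennreal_leI mult_left_mono powr_mono2) auto
          finally show "(\<integral>\<^sup>+w. ennreal (p (t - s) w * norm w powr \<delta>) \<partial>lborel) \<le> ennreal (Km * t powr (\<delta> / \<alpha>))" .
        qed simp
        also have "\<dots> = ennreal (T1 * c) * ennreal (p s z * (norm (x + z) powr (- \<alpha>) * norm (x + z) powr \<delta>)) + ennreal (T2 * c * Km * t powr (\<delta> / \<alpha>)) * ennreal (p s z * norm (x + z) powr (- \<alpha>))"
          using p_nonneg[OF s] c_pos T Km(1) by (simp add: mult_ac flip: ennreal_mult)
        finally show ?thesis .
      qed
      then have "(\<integral>\<^sup>+z. (\<integral>\<^sup>+w. ennreal (p s z) * (ennreal (p (t - s) w) * (?h (x + z + w) * ennreal (c * norm (x + z) powr (- \<alpha>)))) \<partial>lborel) \<partial>lborel)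
        \<le> (\<integral>\<^sup>+z. ennreal (T1 * c) * ennreal (p s z * (norm (x + z) powr (- \<alpha>) * norm (x + z) powr \<delta>)) + ennreal (T2 * c * Km * t powr (\<delta> / \<alpha>)) * ennreal (p s z * norm (x + z) powr (- \<alpha>)) \<partial>lborel)"
        by (rule nn_integral_mono)
      also have "\<dots> = ennreal (T1 * c) * (\<integral>\<^sup>+z. ennreal (p s z * (norm (x + z) powr (- \<alpha>) * norm (x + z) powr \<delta>)) \<partial>lborel) + ennreal (T2 * c * Km * t powr (\<delta> / \<alpha>)) * (\<integral>\<^sup>+z. ennreal (p s z * norm (x + z) powr (- \<alpha>)) \<partial>lborel)"
        by (rule nn_integral_lincomb) measurable
      also have "(\<integral>\<^sup>+z. ennreal (p s z * (norm (x + z) powr (- \<alpha>) * norm (x + z) powr \<delta>)) \<partial>lborel) = (\<integral>\<^sup>+z. ennreal (p s (z - x) * norm z powr (\<delta> - \<alpha>)) \<partial>lborel)"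
        using nn_integral_translate[of "\<lambda>z. ennreal (p s (z - x) * norm z powr (\<delta> - \<alpha>))" x] by (simp add: powr_add[symmetric])
      also have "\<dots> = ennreal (E x s)" unfolding E_def using p_nonneg[OF s]
        by (intro nn_integral_eq_integral has_integral_p_neg_moment[OF del s x]) auto
      also have "(\<integral>\<^sup>+z. ennreal (p s z * norm (x + z) powr (- \<alpha>)) \<partial>lborel) = (\<integral>\<^sup>+z. ennreal (p s (z - x) * norm z powr (- \<alpha>)) \<partial>lborel)"
        using nn_integral_translate[of "\<lambda>z. ennreal (p s (z - x) * norm z powr (- \<alpha>))" x] by simp
      also have "ennreal (T1 * c) * ennreal (E x s) + ennreal (T2 * c * Km * t powr (\<delta> / \<alpha>)) * (\<integral>\<^sup>+z. ennreal (p s (z - x) * norm z powr (- \<alpha>)) \<partial>lborel)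
        \<le> ennreal (T1 * c) * ennreal (E x s) + ennreal (T2 * c * Km * t powr (\<delta> / \<alpha>)) * ennreal (K * norm x powr (- \<alpha>))"
        by (intro add_left_mono mult_left_mono K(2) s x) simp
      also have "\<dots> = ennreal (T1 * c * E x s + R)"
        using T c_pos E_nonneg[OF s] Km(1) K(1) by (simp add: R_def mult_ac flip: ennreal_mult ennreal_plus)
      finally show ?thesis .
    qed
    have iE: "integrable lborel (\<lambda>s. indicator {0<..<t} s * (T1 * c * E x s + R))"
    proof -
      have "integrable lborel (\<lambda>s. T1 * c * (indicator {0<..<t} s * E x s) + R * indicator {0<..<t} s)"
        by (intro Bochner_Integration.integrable_add integrable_mult_right integrable_E[OF t x] integrable_indicator_Ioo)
      then show ?thesis by (rule Bochner_Integration.integrable_cong[THEN iffD1, rotated 2]) (auto simp: indicator_def)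
    qed
    have "(\<integral>\<^sup>+\<omega>. ?h (x + X t \<omega>) * FKint c t x \<omega> \<partial>M) \<le> (\<integral>\<^sup>+s. ennreal (indicator {0<..<t} s * (T1 * c * E x s + R)) \<partial>lborel)"
    proof (subst nn_integral_FKint[OF t], measurable, rule nn_integral_mono)
      fix s :: real
      show "indicator {0<..<t} s * (\<integral>\<^sup>+z. (\<integral>\<^sup>+w. ennreal (p s z) * (ennreal (p (t - s) w) * (?h (x + z + w) * ennreal (c * norm (x + z) powr (- \<alpha>)))) \<partial>lborel) \<partial>lborel) \<le> ennreal (indicator {0<..<t} s * (T1 * c * E x s + R))"
        using inner[of s] by (cases "s \<in> {0<..<t}") auto
    qed
    also have "\<dots> = ennreal (LINT s|lborel. indicator {0<..<t} s * (T1 * c * E x s + R))"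
      by (rule nn_integral_eq_integral[OF iE]) (use T c_pos E_nonneg R in \<open>auto simp: indicator_def\<close>)
    also have "(LINT s|lborel. indicator {0<..<t} s * (T1 * c * E x s + R)) = (LINT s|lborel. T1 * c * (indicator {0<..<t} s * E x s) + R * indicator {0<..<t} s)"
      by (rule Bochner_Integration.integral_cong) (auto simp: indicator_def)
    also have "\<dots> = T1 * (c * (LINT s|lborel. indicator {0<..<t} s * E x s)) + R * t"
      using t by (subst Bochner_Integration.integral_add[OF integrable_mult_right[OF integrable_E[OF t x]] integrable_mult_right[OF integrable_indicator_Ioo]]) simp
    also have "\<dots> = T1 * A t x + R * t" using A_eq[OF t x] by simp
    finally have I: "(\<integral>\<^sup>+\<omega>. ?h (x + X t \<omega>) * FKint c t x \<omega> \<partial>M) \<le> ennreal (T1 * A t x + R * t)" .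
    let ?P = "LINT z|lborel. p t (z - x) * norm z powr \<delta>" and ?Q = "LINT z|lborel. pt t x z * norm z powr \<delta>"
    have A0: "A t x \<ge> 0"
    proof -
      have "0 \<le> (LINT s|lborel. indicator {0<..<t} s * E x s)"
        by (rule integral_nonneg_AE) (use E_nonneg[of _ x] in \<open>auto simp: indicator_def\<close>)
      then show ?thesis using A_eq[OF t x] c_pos by simp
    qed
    have Q0: "?Q \<ge> 0" by (rule integral_nonneg_AE) (use pt_bounds(1)[OF t] in auto)
    have "ennreal ?P = (\<integral>\<^sup>+z. ennreal (p t (z - x)) * ?h z \<partial>lborel)"
      using p_nonneg[OF t] by (subst nn_integral_eq_integral[OF integrable_p_moment[OF del t], symmetric]) (auto simp: ennreal_mult)
    also have "\<dots> = (\<integral>\<^sup>+\<omega>. ?h (x + X t \<omega>) \<partial>M)" by (rule nn_integral_X[OF t, symmetric]) measurable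
    also have "\<dots> \<le> (\<integral>\<^sup>+\<omega>. ?h (x + X t \<omega>) * ennreal (W t x \<omega>) + ?h (x + X t \<omega>) * FKint c t x \<omega> \<partial>M)"
    proof (rule nn_integral_mono)
      fix \<omega>
      have "?h (x + X t \<omega>) * 1 \<le> ?h (x + X t \<omega>) * (ennreal (W t x \<omega>) + FKint c t x \<omega>)"
        using FK_weight_tangent[of 0 c t x \<omega>] by (intro mult_left_mono) auto
      then show "?h (x + X t \<omega>) \<le> ?h (x + X t \<omega>) * ennreal (W t x \<omega>) + ?h (x + X t \<omega>) * FKint c t x \<omega>"
        by (simp add: distrib_left)
    qed
    also have "\<dots> = (\<integral>\<^sup>+\<omega>. ?h (x + X t \<omega>) * ennreal (W t x \<omega>) \<partial>M) + (\<integral>\<^sup>+\<omega>. ?h (x + X t \<omega>) * FKint c t x \<omega> \<partial>M)"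
      by (rule nn_integral_add) measurable
    also have "(\<integral>\<^sup>+\<omega>. ?h (x + X t \<omega>) * ennreal (W t x \<omega>) \<partial>M) = (\<integral>\<^sup>+z. ennreal (pt t x z) * ?h z \<partial>lborel)"
      by (rule pt_AE_nonneg_and_law(2)[OF t x, symmetric]) measurable
    also have "\<dots> = ennreal ?Q"
      using pt_bounds(1)[OF t] by (subst nn_integral_eq_integral[OF integrable_pt_moment[OF t], symmetric]) (auto simp: ennreal_mult)
    also have "ennreal ?Q + (\<integral>\<^sup>+\<omega>. ?h (x + X t \<omega>) * FKint c t x \<omega> \<partial>M) \<le> ennreal ?Q + ennreal (T1 * A t x + R * t)"
      by (intro add_left_mono I)
    also have "\<dots> = ennreal (?Q + (T1 * A t x + R * t))" using Q0 T A0 R t by (subst ennreal_plus) auto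
    finally have "?P \<le> ?Q + (T1 * A t x + R * t)" using Q0 T A0 R t by (subst (asm) ennreal_le_iff) auto
    moreover have "R * t = (T2 * Km * c * K) * t powr (1 + \<delta> / \<alpha>) * norm x powr (- \<alpha>)"
      using t by (simp add: R_def powr_add mult_ac)
    ultimately show ?thesis by (simp add: A_def g_def T1_def T2_def)
  qed
  show ?thesis
  proof (rule that[of "\<lambda>\<theta>. (1 + 1 / \<theta>) powr \<delta> * Km * c * K"])
    fix \<theta> :: real assume "\<theta> > 0"
    then have "1 + 1 / \<theta> > 0" by (simp add: add_pos_pos)
    then show "(1 + 1 / \<theta>) powr \<delta> * Km * c * K > 0" using K Km c_pos by simp
  qed (rule main)
qed

text \<open>The part of the integral near the origin is of order \<open>s\<close>, since there the
  density is at most a multiple of \<open>s\<close>. On the rest the integrand is bounded, and the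
  paths leave \<open>x\<close> right-continuously.\<close>

lemma E_upper_limit:
  assumes x: "x \<noteq> 0" and eta: "\<eta> > 0"
  shows "\<exists>b>0. \<forall>s. 0 < s \<longrightarrow> s < b \<longrightarrow> E x s \<le> norm x powr (\<delta> - \<alpha>) + \<eta>"
proof -
  let ?b = "\<alpha> - \<delta>"
  have b: "0 < ?b" "?b < real DIM('a)" using del alpha by auto
  define R where "R = norm x / 2"
  have R: "R > 0" using x by (simp add: R_def)
  obtain K1 where K1: "K1 > 0" "\<And>R. R \<ge> 0 \<Longrightarrow> (\<integral>\<^sup>+x. indicator (cball (0::'a) R) x * ennreal (norm x powr (- ?b)) \<partial>lborel) \<le> ennreal (K1 * R powr (real DIM('a) - ?b))"
    by (rule nn_integral_norm_powr_ball[OF b]) (rule that)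
  define f1 where "f1 z = indicator {z. R < norm z} z * norm z powr (\<delta> - \<alpha>)" for z :: 'a
  have [measurable]: "f1 \<in> borel_measurable borel" unfolding f1_def by measurable
  have f1b: "0 \<le> f1 z" "f1 z \<le> R powr (\<delta> - \<alpha>)" for z
    using R del by (auto simp: f1_def indicator_def intro!: powr_mono2')
  define F1 where "F1 s = (LINT \<omega>|M. f1 (x + X s \<omega>))" for s
  define C where "C = C0 * K1 * R powr (- (real DIM('a) + \<alpha>)) * R powr (real DIM('a) - ?b)"
  have C: "C \<ge> 0" using C0 K1(1) by (simp add: C_def)
  have EF: "E x s \<le> F1 s + C * s" if s: "s > 0" for s
  proof -
    note [measurable] = p_meas[OF s]
    have [measurable]: "cball (0::'a) R \<in> sets borel" by (simp add: borel_closed)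
    have F10: "F1 s \<ge> 0" unfolding F1_def by (rule integral_nonneg_AE) (use f1b in auto)
    have "ennreal (E x s) = (\<integral>\<^sup>+z. ennreal (p s (z - x) * norm z powr (\<delta> - \<alpha>)) \<partial>lborel)"
      unfolding E_def using p_nonneg[OF s]
      by (intro nn_integral_eq_integral[symmetric] has_integral_p_neg_moment[OF del s x]) auto
    also have "\<dots> \<le> (\<integral>\<^sup>+z. 1 * (ennreal (p s (z - x)) * ennreal (f1 z)) + ennreal (C0 * s * R powr (- (real DIM('a) + \<alpha>))) * (indicator (cball 0 R) z * ennreal (norm z powr (- ?b))) \<partial>lborel)"
    proof (rule nn_integral_mono)
      fix z :: 'a
      show "ennreal (p s (z - x) * norm z powr (\<delta> - \<alpha>)) \<le> 1 * (ennreal (p s (z - x)) * ennreal (f1 z)) + ennreal (C0 * s * R powr (- (real DIM('a) + \<alpha>))) * (indicator (cball 0 R) z * ennreal (norm z powr (- ?b)))"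
      proof (cases "R < norm z")
        case True
        then show ?thesis using p_nonneg[OF s] by (simp add: f1_def ennreal_mult)
      next
        case False
        have zx: "norm (z - x) \<ge> R" using False norm_triangle_ineq2[of x z] by (simp add: norm_minus_commute R_def)
        then have nz: "z - x \<noteq> 0" using R by auto
        have "p s (z - x) \<le> C0 * (s / norm (z - x) powr (real DIM('a) + \<alpha>))" by (rule p_le2[OF s nz])
        also have "\<dots> \<le> C0 * (s / R powr (real DIM('a) + \<alpha>))"
          using zx R C0 s alpha by (intro mult_left_mono divide_left_mono powr_mono2 mult_pos_pos) auto
        also have "\<dots> = C0 * s * R powr (- (real DIM('a) + \<alpha>))" by (simp only: powr_minus_divide) simp
        finally have "p s (z - x) * norm z powr (\<delta> - \<alpha>) \<le> C0 * s * R powr (- (real DIM('a) + \<alpha>)) * norm z powr (\<delta> - \<alpha>)"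
          by (intro mult_right_mono) auto
        then have "ennreal (p s (z - x) * norm z powr (\<delta> - \<alpha>)) \<le> ennreal (C0 * s * R powr (- (real DIM('a) + \<alpha>))) * (indicator (cball 0 R) z * ennreal (norm z powr (- ?b)))"
          using False C0 s by (simp add: ennreal_leI flip: ennreal_mult)
        then show ?thesis by (rule add_increasing[rotated]) simp
      qed
    qed
    also have "\<dots> = (\<integral>\<^sup>+z. ennreal (p s (z - x)) * ennreal (f1 z) \<partial>lborel) + ennreal (C0 * s * R powr (- (real DIM('a) + \<alpha>))) * (\<integral>\<^sup>+z. indicator (cball (0::'a) R) z * ennreal (norm z powr (- ?b)) \<partial>lborel)"
      by (subst nn_integral_lincomb) auto
    also have "\<dots> \<le> (\<integral>\<^sup>+z. ennreal (p s (z - x)) * ennreal (f1 z) \<partial>lborel) + ennreal (C0 * s * R powr (- (real DIM('a) + \<alpha>))) * ennreal (K1 * R powr (real DIM('a) - ?b))"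
      using R by (intro add_left_mono mult_left_mono K1) auto
    also have "(\<integral>\<^sup>+z. ennreal (p s (z - x)) * ennreal (f1 z) \<partial>lborel) = (\<integral>\<^sup>+\<omega>. ennreal (f1 (x + X s \<omega>)) \<partial>M)"
      by (rule nn_integral_X[OF s, symmetric]) measurable
    also have "\<dots> = ennreal (F1 s)" unfolding F1_def
      by (rule nn_integral_eq_integral) (use f1b in \<open>auto intro!: M.integrable_const_bound[where B="R powr (\<delta> - \<alpha>)"]\<close>)
    also have "ennreal (F1 s) + ennreal (C0 * s * R powr (- (real DIM('a) + \<alpha>))) * ennreal (K1 * R powr (real DIM('a) - ?b)) = ennreal (F1 s + C * s)"
      using C0 s K1(1) F10 by (simp add: C_def mult_ac flip: ennreal_mult ennreal_plus)
    finally show ?thesis using F10 C s by (subst (asm) ennreal_le_iff) auto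
  qed
  have lim: "(F1 \<longlongrightarrow> norm x powr (\<delta> - \<alpha>)) (at_right 0)"
    unfolding tendsto_at_iff_sequentially comp_def
  proof (intro allI impI)
    fix s :: "nat \<Rightarrow> real" assume s: "\<forall>i. s i \<in> {0<..} - {0}" "s \<longlonglongrightarrow> 0"
    have fl: "filterlim s (at_right 0) sequentially"
      using s by (intro tendsto_imp_filterlim_at_right) auto
    have "(\<lambda>n. F1 (s n)) \<longlonglongrightarrow> (LINT \<omega>|M. norm x powr (\<delta> - \<alpha>))" unfolding F1_def
    proof (rule integral_dominated_convergence[where w="\<lambda>_. R powr (\<delta> - \<alpha>)"])
      show "AE \<omega> in M. (\<lambda>n. f1 (x + X (s n) \<omega>)) \<longlonglongrightarrow> norm x powr (\<delta> - \<alpha>)"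
      proof (rule AE_I2)
        fix \<omega> assume w: "\<omega> \<in> space M"
        have "((\<lambda>r. X r \<omega>) \<longlongrightarrow> 0) (at_right 0)" using X_right_cont[OF w, of 0] X_0[OF w] by (simp add: continuous_within)
        then have Xs: "(\<lambda>n. x + X (s n) \<omega>) \<longlonglongrightarrow> x + 0" by (intro tendsto_add tendsto_const filterlim_compose[OF _ fl])
        then have "(\<lambda>n. norm (x + X (s n) \<omega>)) \<longlonglongrightarrow> norm x" using tendsto_norm by fastforce
        then have "eventually (\<lambda>n. R < norm (x + X (s n) \<omega>)) sequentially" by (rule order_tendstoD) (use x in \<open>simp add: R_def\<close>)
        then have "eventually (\<lambda>n. norm (x + X (s n) \<omega>) powr (\<delta> - \<alpha>) = f1 (x + X (s n) \<omega>)) sequentially"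
          by eventually_elim (simp add: f1_def)
        moreover have "(\<lambda>n. norm (x + X (s n) \<omega>) powr (\<delta> - \<alpha>)) \<longlonglongrightarrow> norm x powr (\<delta> - \<alpha>)"
          using Xs x by (intro tendsto_powr tendsto_const) (auto dest: tendsto_norm)
        ultimately show "(\<lambda>n. f1 (x + X (s n) \<omega>)) \<longlonglongrightarrow> norm x powr (\<delta> - \<alpha>)" by (rule Lim_transform_eventually[rotated])
      qed
    qed (use f1b in auto)
    then show "(\<lambda>n. F1 (s n)) \<longlonglongrightarrow> norm x powr (\<delta> - \<alpha>)" using M.prob_space by simp
  qed
  have "((\<lambda>s. F1 s + C * s) \<longlongrightarrow> norm x powr (\<delta> - \<alpha>) + C * 0) (at_right 0)"
    by (intro tendsto_intros lim)
  then have "eventually (\<lambda>s. F1 s + C * s < norm x powr (\<delta> - \<alpha>) + \<eta>) (at_right 0)"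
    by (rule order_tendstoD) (use eta in simp)
  then obtain b where "b > 0" "\<And>s. 0 < s \<Longrightarrow> s < b \<Longrightarrow> F1 s + C * s < norm x powr (\<delta> - \<alpha>) + \<eta>"
    unfolding eventually_at_right_field by blast
  then show ?thesis using EF by (meson less_imp_le order_trans)
qed

text \<open>By right continuity at time 0 the killing rate exceeds \<open>v\<close> along the path
  for a short while, so the weight is at most \<open>exp (- (v * t))\<close> then. This is the
  pathwise input for Fatou's lemma.\<close>

lemma FK_weight_path_limit:
  assumes x: "x \<noteq> 0" and v: "0 < v" "v < c * norm x powr (- \<alpha>)" and w: "\<omega> \<in> space M"
    and e: "\<And>n. e n > 0" "e \<longlonglongrightarrow> 0"
  shows "ennreal (norm x powr \<delta> * v) \<le> liminf (\<lambda>n. ennreal (norm (x + X (e n) \<omega>) powr \<delta> * ((1 - W (e n) x \<omega>) / e n)))"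
proof -
  have fl: "filterlim e (at_right 0) sequentially"
    using e by (intro tendsto_imp_filterlim_at_right) auto
  have X0: "((\<lambda>r. X r \<omega>) \<longlongrightarrow> 0) (at_right 0)" using X_right_cont[OF w, of 0] X_0[OF w] by (simp add: continuous_within)
  have "((\<lambda>r. c * norm (x + X r \<omega>) powr (- \<alpha>)) \<longlongrightarrow> c * norm (x + 0) powr (- \<alpha>)) (at_right 0)"
    using x by (intro tendsto_intros X0) auto
  then have "eventually (\<lambda>r. v < c * norm (x + X r \<omega>) powr (- \<alpha>)) (at_right 0)"
    by (rule order_tendstoD) (use v in simp)
  then obtain b where b: "b > 0" "\<And>s. 0 < s \<Longrightarrow> s < b \<Longrightarrow> v < c * norm (x + X s \<omega>) powr (- \<alpha>)"
    unfolding eventually_at_right_field by blast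
  have Wle: "W t x \<omega> \<le> exp (- (v * t))" if t: "0 < t" "t < b" for t
  proof -
    have "ennreal (v * t) = (\<integral>\<^sup>+s. ennreal v * indicator {0<..<t} s \<partial>lborel)"
      using t v by (subst nn_integral_cmult_indicator) (auto simp: ennreal_mult)
    also have "\<dots> \<le> FKint c t x \<omega>" unfolding FKint_def
      by (rule nn_integral_mono) (use t in \<open>auto simp: indicator_def intro!: ennreal_leI less_imp_le[OF b(2)]\<close>)
    finally have le: "ennreal (v * t) \<le> FKint c t x \<omega>" .
    show ?thesis
    proof (cases "FKint c t x \<omega> = \<infinity>")
      case False
      then obtain I where I: "FKint c t x \<omega> = ennreal I" "I \<ge> 0" by (cases "FKint c t x \<omega>") auto
      then have "v * t \<le> I" using le by (simp add: ennreal_le_iff)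
      then show ?thesis using I by (simp add: FK_weight_eq)
    qed (simp add: FK_weight_eq)
  qed
  let ?G = "\<lambda>n. norm (x + X (e n) \<omega>) powr \<delta> * ((1 - exp (- (v * e n))) / e n)"
  have "((\<lambda>t. (1 - exp (- (v * t))) / t) \<longlongrightarrow> v) (at_right 0)" by real_asymp
  then have "(\<lambda>n. (1 - exp (- (v * e n))) / e n) \<longlonglongrightarrow> v" by (rule filterlim_compose[OF _ fl])
  moreover have "(\<lambda>n. norm (x + X (e n) \<omega>) powr \<delta>) \<longlonglongrightarrow> norm (x + 0) powr \<delta>"
    using x by (intro tendsto_intros filterlim_compose[OF X0 fl]) auto
  ultimately have "?G \<longlonglongrightarrow> norm (x + 0) powr \<delta> * v" by (intro tendsto_mult)
  then have "(\<lambda>n. ennreal (?G n)) \<longlonglongrightarrow> ennreal (norm x powr \<delta> * v)" by (intro tendsto_ennrealI) simp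
  then have "ennreal (norm x powr \<delta> * v) = liminf (\<lambda>n. ennreal (?G n))" by (rule lim_imp_Liminf[OF sequentially_bot, symmetric])
  also have "\<dots> \<le> liminf (\<lambda>n. ennreal (norm (x + X (e n) \<omega>) powr \<delta> * ((1 - W (e n) x \<omega>) / e n)))"
  proof (rule Liminf_mono)
    have "eventually (\<lambda>n. e n < b) sequentially" using e(2) b(1) by (rule order_tendstoD)
    then show "\<forall>\<^sub>F n in sequentially. ennreal (?G n) \<le> ennreal (norm (x + X (e n) \<omega>) powr \<delta> * ((1 - W (e n) x \<omega>) / e n))"
    proof eventually_elim
      case (elim n)
      then show ?case using Wle[of "e n"] e(1)[of n] by (intro ennreal_leI mult_left_mono divide_right_mono) auto
    qed
  qed
  finally show ?thesis .
qed

text \<open>Fatou's lemma is to be applied to the right-hand side, hence the form in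
  \<open>ennreal\<close> and the division by \<open>t\<close> under the integral.\<close>

lemma A_minus_g_eq:
  assumes t: "t > 0" and x: "x \<noteq> 0"
  shows "ennreal ((A t x - g t x) / t) = (\<integral>\<^sup>+\<omega>. ennreal (norm (x + X t \<omega>) powr \<delta> * ((1 - W t x \<omega>) / t)) \<partial>M)"
proof -
  note [measurable] = p_meas[OF t] pt_meas[OF t]
  let ?h = "\<lambda>y. ennreal (norm y powr \<delta>)"
  let ?P = "LINT z|lborel. p t (z - x) * norm z powr \<delta>" and ?Q = "LINT z|lborel. pt t x z * norm z powr \<delta>"
  have PQ: "?P - ?Q = A t x - g t x" by (simp add: A_def g_def)
  have Q0: "?Q \<ge> 0" by (rule integral_nonneg_AE) (use pt_bounds(1)[OF t] in auto)
  have P: "ennreal ?P = (\<integral>\<^sup>+\<omega>. ?h (x + X t \<omega>) \<partial>M)"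
    using p_nonneg[OF t] by (subst nn_integral_eq_integral[OF integrable_p_moment[OF del t], symmetric], simp)
      (subst nn_integral_X[OF t], auto simp: ennreal_mult)
  have Q: "ennreal ?Q = (\<integral>\<^sup>+\<omega>. ?h (x + X t \<omega>) * ennreal (W t x \<omega>) \<partial>M)"
    using pt_bounds(1)[OF t] by (subst nn_integral_eq_integral[OF integrable_pt_moment[OF t], symmetric], simp)
      (subst pt_AE_nonneg_and_law(2)[OF t x, symmetric], auto simp: ennreal_mult)
  let ?J = "\<integral>\<^sup>+\<omega>. ennreal (norm (x + X t \<omega>) powr \<delta> * ((1 - W t x \<omega>) / t)) \<partial>M"
  have "ennreal ?P = (\<integral>\<^sup>+\<omega>. 1 * (?h (x + X t \<omega>) * ennreal (W t x \<omega>)) + ennreal t * ennreal (norm (x + X t \<omega>) powr \<delta> * ((1 - W t x \<omega>) / t)) \<partial>M)"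
    unfolding P
  proof (rule nn_integral_cong)
    fix \<omega>
    have "norm (x + X t \<omega>) powr \<delta> = norm (x + X t \<omega>) powr \<delta> * W t x \<omega> + t * (norm (x + X t \<omega>) powr \<delta> * ((1 - W t x \<omega>) / t))"
    proof -
      have "t * (norm (x + X t \<omega>) powr \<delta> * ((1 - W t x \<omega>) / t)) = norm (x + X t \<omega>) powr \<delta> * (1 - W t x \<omega>)" using t by simp
      then show ?thesis by (simp add: algebra_simps)
    qed
    moreover have "0 \<le> t * (norm (x + X t \<omega>) powr \<delta> * ((1 - W t x \<omega>) / t))" "0 \<le> norm (x + X t \<omega>) powr \<delta> * W t x \<omega>" "0 \<le> norm (x + X t \<omega>) powr \<delta> * ((1 - W t x \<omega>) / t)"
      using t FK_weight_bounds[of c t x \<omega>] by auto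
    ultimately have "?h (x + X t \<omega>) = ennreal (norm (x + X t \<omega>) powr \<delta> * W t x \<omega>) + ennreal (t * (norm (x + X t \<omega>) powr \<delta> * ((1 - W t x \<omega>) / t)))"
      by (subst ennreal_plus[symmetric]) auto
    moreover have "ennreal (norm (x + X t \<omega>) powr \<delta> * W t x \<omega>) = ?h (x + X t \<omega>) * ennreal (W t x \<omega>)"
      using FK_weight_bounds[of c t x \<omega>] by (intro ennreal_mult) auto
    moreover have "ennreal (t * (norm (x + X t \<omega>) powr \<delta> * ((1 - W t x \<omega>) / t))) = ennreal t * ennreal (norm (x + X t \<omega>) powr \<delta> * ((1 - W t x \<omega>) / t))"
      using t FK_weight_bounds[of c t x \<omega>] by (intro ennreal_mult) auto
    ultimately show "?h (x + X t \<omega>) = 1 * (?h (x + X t \<omega>) * ennreal (W t x \<omega>)) + ennreal t * ennreal (norm (x + X t \<omega>) powr \<delta> * ((1 - W t x \<omega>) / t))"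
      by (simp only: mult_1)
  qed
  also have "\<dots> = ennreal ?Q + ennreal t * ?J" unfolding Q by (subst nn_integral_lincomb) auto
  finally have eq: "ennreal ?P = ennreal ?Q + ennreal t * ?J" .
  then have "?J \<noteq> \<infinity>" using t by (auto simp: ennreal_mult_eq_top_iff)
  then obtain J where J: "?J = ennreal J" "J \<ge> 0" by (cases ?J) auto
  then have "ennreal ?P = ennreal (?Q + t * J)" using eq Q0 t by (simp flip: ennreal_mult ennreal_plus)
  moreover have "0 \<le> ?P" by (rule integral_nonneg_AE) (use p_nonneg[OF t] in auto)
  ultimately have "?P = ?Q + t * J" using Q0 J t by (subst (asm) ennreal_inj) auto
  then have "(?P - ?Q) / t = J" using t by simp
  then show ?thesis unfolding PQ using J by simp
qed

text \<open>For \<open>t powr (1 / \<alpha>) \<le> |x|\<close> the error term of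
  \<open>A_minus_g_le\<close> at \<open>\<theta> = 1\<close> is absorbed. For smaller
  \<open>|x|\<close> the trivial bound \<open>g t x \<ge> - |x| powr \<delta>\<close> is enough, as
  then \<open>|x| powr \<delta> \<le> t * |x| powr (\<delta> - \<alpha>)\<close>.\<close>

lemma g_bound:
  obtains K where "K > 0" "\<And>t x. t > 0 \<Longrightarrow> x \<noteq> 0 \<Longrightarrow> \<bar>g t x\<bar> \<le> K * t * norm x powr (\<delta> - \<alpha>)"
proof -
  obtain K where K: "K > 0" "\<And>t x. t > 0 \<Longrightarrow> x \<noteq> 0 \<Longrightarrow> 0 \<le> A t x \<and> A t x \<le> K * t * norm x powr (\<delta> - \<alpha>)"
    by (rule A_bounds) (rule that)
  obtain L where L: "\<And>\<theta>. \<theta> > 0 \<Longrightarrow> L \<theta> > 0" "\<And>t x \<theta>. t > 0 \<Longrightarrow> x \<noteq> 0 \<Longrightarrow> \<theta> > 0 \<Longrightarrow>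
    A t x - g t x \<le> (1 + \<theta>) powr \<delta> * A t x + L \<theta> * t powr (1 + \<delta> / \<alpha>) * norm x powr (- \<alpha>)"
    by (rule A_minus_g_le) (rule that)
  define K2 where "K2 = K + 2 powr \<delta> * K + L 1 + 1"
  have L1: "L 1 > 0" by (rule L) simp
  have "\<bar>g t x\<bar> \<le> K2 * t * norm x powr (\<delta> - \<alpha>)" if t: "t > 0" and x: "x \<noteq> 0" for t x
  proof -
    let ?u = "t * norm x powr (\<delta> - \<alpha>)"
    have u: "?u > 0" using t x by simp
    have A: "0 \<le> A t x" "A t x \<le> K * ?u" using K(2)[OF t x] by (auto simp: mult_ac)
    have up: "g t x \<le> K * ?u" using g_le_A[OF t, of x] A by simp
    have "- g t x \<le> (2 powr \<delta> * K + L 1 + 1) * ?u"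
    proof (cases "t powr (1 / \<alpha>) \<le> norm x")
      case True
      have "t powr (\<delta> / \<alpha>) = (t powr (1 / \<alpha>)) powr \<delta>" by (simp add: powr_powr)
      also have "\<dots> \<le> norm x powr \<delta>" using True del by (intro powr_mono2) auto
      finally have "t * t powr (\<delta> / \<alpha>) * norm x powr (- \<alpha>) \<le> t * norm x powr \<delta> * norm x powr (- \<alpha>)" using t by (intro mult_right_mono mult_left_mono) auto
      also have "\<dots> = ?u" by (simp add: powr_add[symmetric] mult.assoc)
      finally have "t powr (1 + \<delta> / \<alpha>) * norm x powr (- \<alpha>) \<le> ?u" using t by (simp add: powr_add)
      then have "L 1 * (t powr (1 + \<delta> / \<alpha>) * norm x powr (- \<alpha>)) \<le> L 1 * ?u" using L1 by (intro mult_left_mono) auto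
      moreover have "2 powr \<delta> * A t x \<le> 2 powr \<delta> * (K * ?u)" using A by (intro mult_left_mono) auto
      moreover have "A t x - g t x \<le> 2 powr \<delta> * A t x + L 1 * (t powr (1 + \<delta> / \<alpha>) * norm x powr (- \<alpha>))" using L(2)[OF t x, of 1] by (simp add: mult.assoc)
      ultimately have "- g t x \<le> 2 powr \<delta> * (K * ?u) + L 1 * ?u" using A by linarith
      also have "\<dots> \<le> (2 powr \<delta> * K + L 1 + 1) * ?u" using u by (simp add: algebra_simps)
      finally show ?thesis .
    next
      case False
      have "norm x powr \<alpha> \<le> (t powr (1 / \<alpha>)) powr \<alpha>" using False alpha by (intro powr_mono2) auto
      also have "\<dots> = t" using t alpha by (simp add: powr_powr)
      finally have "norm x powr \<alpha> * norm x powr (\<delta> - \<alpha>) \<le> ?u" by (intro mult_right_mono) auto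
      then have "norm x powr \<delta> \<le> ?u" using x by (simp add: powr_add[symmetric])
      moreover have "0 \<le> (LINT z|lborel. pt t x z * norm z powr \<delta>)" by (rule integral_nonneg_AE) (use pt_bounds(1)[OF t] in auto)
      then have "- g t x \<le> norm x powr \<delta>" by (simp add: g_def)
      moreover have "0 \<le> (2 powr \<delta> * K + L 1) * ?u" 
        by (rule mult_nonneg_nonneg[OF _ less_imp_le[OF u]]) (use K(1) L1 in simp)
      ultimately show ?thesis by (simp add: algebra_simps)
    qed
    then have "\<bar>g t x\<bar> \<le> (K + 2 powr \<delta> * K + L 1 + 1) * ?u"
    proof -
      have "0 \<le> 2 powr \<delta> * K + L 1 + 1" using K(1) L1 by simp
      then have "0 \<le> (2 powr \<delta> * K + L 1 + 1) * ?u" "0 \<le> K * ?u"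
        using mult_nonneg_nonneg[OF _ less_imp_le[OF u]] K(1) by (blast, simp only: less_imp_le mult_nonneg_nonneg[OF _ less_imp_le[OF u]])
      moreover have "(K + 2 powr \<delta> * K + L 1 + 1) * ?u = K * ?u + (2 powr \<delta> * K + L 1 + 1) * ?u" by (simp add: algebra_simps)
      ultimately show ?thesis using up \<open>- g t x \<le> (2 powr \<delta> * K + L 1 + 1) * ?u\<close> by linarith
    qed
    then show ?thesis by (simp add: K2_def mult_ac)
  qed
  moreover have "K2 > 0" using K(1) L1 by (simp add: K2_def add_pos_pos)
  ultimately show ?thesis using that by blast
qed

text \<open>The lower estimate is \<open>A_minus_g_le\<close> with small \<open>\<theta>\<close>.
  For the upper one, the quotients of \<open>A\<close> have upper limit at most
  \<open>c * |x| powr (\<delta> - \<alpha>)\<close>, while by Fatou those of \<open>A - g\<close>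
  have at least the same lower limit.\<close>

lemma g_limit:
  assumes x: "x \<noteq> 0" and e: "\<And>n. e n > 0" "e \<longlonglongrightarrow> 0"
  shows "(\<lambda>n. g (e n) x / e n) \<longlonglongrightarrow> 0"
proof (rule order_tendstoI)
  let ?L = "norm x powr (\<delta> - \<alpha>)"
  have Lp: "?L > 0" using x by simp
  {
    fix a :: real assume a: "a < 0"
    obtain K where K: "K > 0" "\<And>t x. t > 0 \<Longrightarrow> x \<noteq> 0 \<Longrightarrow> 0 \<le> A t x \<and> A t x \<le> K * t * norm x powr (\<delta> - \<alpha>)"
      by (rule A_bounds) (rule that)
    obtain L where L: "\<And>\<theta>. \<theta> > 0 \<Longrightarrow> L \<theta> > 0" "\<And>t x \<theta>. t > 0 \<Longrightarrow> x \<noteq> 0 \<Longrightarrow> \<theta> > 0 \<Longrightarrow>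
      A t x - g t x \<le> (1 + \<theta>) powr \<delta> * A t x + L \<theta> * t powr (1 + \<delta> / \<alpha>) * norm x powr (- \<alpha>)"
      by (rule A_minus_g_le) (rule that)
    have "((\<lambda>\<theta>. ((1 + \<theta>) powr \<delta> - 1) * (K * ?L)) \<longlongrightarrow> ((1 + 0) powr \<delta> - 1) * (K * ?L)) (at_right 0)"
      by (intro tendsto_intros) auto
    then have "eventually (\<lambda>\<theta>. ((1 + \<theta>) powr \<delta> - 1) * (K * ?L) < - a / 2) (at_right 0)"
      by (rule order_tendstoD) (use a in simp)
    then have "eventually (\<lambda>\<theta>. ((1 + \<theta>) powr \<delta> - 1) * (K * ?L) < - a / 2 \<and> \<theta> > 0) (at_right 0)"
      using eventually_at_right_less by eventually_elim auto
    then obtain \<theta> where \<theta>: "((1 + \<theta>) powr \<delta> - 1) * (K * ?L) < - a / 2" "\<theta> > 0"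
      using eventually_happens'[of "at_right (0::real)"] by force
    have "(\<lambda>n. L \<theta> * (e n powr (\<delta> / \<alpha>) * norm x powr (- \<alpha>))) \<longlonglongrightarrow> L \<theta> * (0 * norm x powr (- \<alpha>))"
      using e del alpha by (intro tendsto_mult tendsto_const tendsto_zero_powrI[OF e(2) tendsto_const]) (auto intro: less_imp_le eventuallyI)
    then have "(\<lambda>n. L \<theta> * (e n powr (\<delta> / \<alpha>) * norm x powr (- \<alpha>))) \<longlonglongrightarrow> 0" by simp
    then have "eventually (\<lambda>n. L \<theta> * (e n powr (\<delta> / \<alpha>) * norm x powr (- \<alpha>)) < - a / 2) sequentially"
      by (rule order_tendstoD) (use a in simp)
    then show "eventually (\<lambda>n. a < g (e n) x / e n) sequentially"
    proof eventually_elim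
      case (elim n)
      have T1: "(1 + \<theta>) powr \<delta> \<ge> 1" using \<theta>(2) del by (intro ge_one_powr_ge_zero) auto
      have "- g (e n) x \<le> ((1 + \<theta>) powr \<delta> - 1) * A (e n) x + L \<theta> * e n powr (1 + \<delta> / \<alpha>) * norm x powr (- \<alpha>)"
        using L(2)[OF e(1)[of n] x \<theta>(2)] by (simp add: algebra_simps)
      also have "\<dots> \<le> ((1 + \<theta>) powr \<delta> - 1) * (K * e n * ?L) + L \<theta> * e n powr (1 + \<delta> / \<alpha>) * norm x powr (- \<alpha>)"
        using K(2)[OF e(1)[of n] x] T1 by (intro add_right_mono mult_left_mono) auto
      also have "\<dots> = e n * (((1 + \<theta>) powr \<delta> - 1) * (K * ?L) + L \<theta> * (e n powr (\<delta> / \<alpha>) * norm x powr (- \<alpha>)))"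
        using e(1)[of n] by (simp add: powr_add algebra_simps)
      finally have "- g (e n) x / e n \<le> ((1 + \<theta>) powr \<delta> - 1) * (K * ?L) + L \<theta> * (e n powr (\<delta> / \<alpha>) * norm x powr (- \<alpha>))"
        using e(1)[of n] by (simp only: pos_divide_le_eq mult.commute)
      then show ?case using elim \<theta>(1) by simp
    qed
  }
  fix a :: real assume a: "0 < a"
  \<comment> \<open>A relative loss in the killing rate that costs at most \<open>a / 4\<close>
    after multiplication by \<open>c * ?L\<close>; it gives the strict inequality asked for by
    \<open>FK_weight_path_limit\<close>.\<close>
  define \<rho> where "\<rho> = min (1 / 2) (a / (4 * (c * ?L)))"
  have cL: "c * ?L > 0" using c_pos Lp by simp
  have \<rho>: "0 < \<rho>" "\<rho> < 1" "c * ?L * \<rho> \<le> a / 4"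
  proof -
    show "0 < \<rho>" "\<rho> < 1" using a cL by (auto simp: \<rho>_def)
    have "c * ?L * \<rho> \<le> c * ?L * (a / (4 * (c * ?L)))" using cL by (intro mult_left_mono) (auto simp: \<rho>_def)
    also have "\<dots> = a / 4"
    proof -
      have "q * (a / (4 * q)) = a / 4" if "q > 0" for q :: real using that by simp
      then show ?thesis using cL by blast
    qed
    finally show "c * ?L * \<rho> \<le> a / 4" .
  qed
  define v where "v = c * norm x powr (- \<alpha>) * (1 - \<rho>)"
  have V: "c * norm x powr (- \<alpha>) > 0" using c_pos x by simp
  have v: "0 < v" unfolding v_def by (rule mult_pos_pos[OF V]) (use \<rho> in simp)
  have v2: "v < c * norm x powr (- \<alpha>)" unfolding v_def using mult_strict_left_mono[OF _ V, of "1 - \<rho>" 1] \<rho> by simp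
  have hv: "norm x powr \<delta> * v = c * ?L - c * ?L * \<rho>"
  proof -
    have "norm x powr \<delta> * norm x powr (- \<alpha>) = ?L" by (simp add: powr_add[symmetric])
    then have "norm x powr \<delta> * v = c * ?L * (1 - \<rho>)" by (simp add: v_def mult_ac)
    then show ?thesis by (simp add: algebra_simps)
  qed
  have "ennreal (norm x powr \<delta> * v) = (\<integral>\<^sup>+\<omega>. ennreal (norm x powr \<delta> * v) \<partial>M)" using M.emeasure_space_1 by simp
  also have "\<dots> \<le> (\<integral>\<^sup>+\<omega>. liminf (\<lambda>n. ennreal (norm (x + X (e n) \<omega>) powr \<delta> * ((1 - W (e n) x \<omega>) / e n))) \<partial>M)"
    by (rule nn_integral_mono) (rule FK_weight_path_limit[OF x v v2 _ e])
  also have "\<dots> \<le> liminf (\<lambda>n. \<integral>\<^sup>+\<omega>. ennreal (norm (x + X (e n) \<omega>) powr \<delta> * ((1 - W (e n) x \<omega>) / e n)) \<partial>M)"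
    by (rule nn_integral_liminf) measurable
  also have "\<dots> = liminf (\<lambda>n. ennreal ((A (e n) x - g (e n) x) / e n))"
    using A_minus_g_eq[OF e(1) x] by simp
  finally have li: "ennreal (norm x powr \<delta> * v) \<le> liminf (\<lambda>n. ennreal ((A (e n) x - g (e n) x) / e n))" .
  have evB: "eventually (\<lambda>n. norm x powr \<delta> * v - a / 4 < (A (e n) x - g (e n) x) / e n) sequentially"
  proof (cases "norm x powr \<delta> * v - a / 4 < 0")
    case True
    have "0 \<le> (A (e n) x - g (e n) x) / e n" for n using g_le_A[OF e(1), of n x] e(1)[of n] by simp
    then show ?thesis using True by (intro eventuallyI) (meson less_le_trans)
  next
    case False
    then have "ennreal (norm x powr \<delta> * v - a / 4) < ennreal (norm x powr \<delta> * v)" using a by (intro ennreal_lessI) auto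
    also note li
    finally have "eventually (\<lambda>n. ennreal (norm x powr \<delta> * v - a / 4) < ennreal ((A (e n) x - g (e n) x) / e n)) sequentially"
      by (rule less_LiminfD)
    then show ?thesis
    proof eventually_elim
      case (elim n)
      then show ?case using False by (simp add: ennreal_less_iff)
    qed
  qed
  obtain b where b: "b > 0" "\<And>s. 0 < s \<Longrightarrow> s < b \<Longrightarrow> E x s \<le> ?L + a / (4 * c)"
    using E_upper_limit[OF x, of "a / (4 * c)"] a c_pos by auto
  have "eventually (\<lambda>n. e n < b) sequentially" using e(2) b(1) by (rule order_tendstoD)
  with evB show "eventually (\<lambda>n. g (e n) x / e n < a) sequentially"
  proof eventually_elim
    case (elim n)
    have "(LINT s|lborel. indicator {0<..<e n} s * E x s) \<le> e n * (?L + a / (4 * c))"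
      by (rule integral_E_le[OF e(1) x]) (use elim b in auto)
    then have "A (e n) x \<le> c * (e n * (?L + a / (4 * c)))" unfolding A_eq[OF e(1)[of n] x] using c_pos by (intro mult_left_mono) auto
    also have "\<dots> = (c * ?L + a / 4) * e n" using c_pos by (simp add: field_simps)
    finally have "A (e n) x / e n \<le> c * ?L + a / 4" using e(1)[of n] by (simp add: pos_divide_le_eq)
    then have "g (e n) x / e n < c * ?L + a / 4 - (norm x powr \<delta> * v - a / 4)" using elim(1) by (simp add: diff_divide_distrib)
    then show ?case using hv \<rho>(3) a by linarith
  qed
qed

lemma g_meas [measurable]: "t > 0 \<Longrightarrow> g t \<in> borel_measurable borel"
proof -
  assume t: "t > 0"
  note [measurable] = pt_meas2[OF t]
  have "(\<lambda>x. (LINT z|lborel. (\<lambda>(x, y). pt t x y) (x, z) * norm z powr \<delta>) - norm x powr \<delta>) \<in> borel_measurable borel"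
    by measurable
  then show ?thesis by (simp add: g_def[abs_def])
qed

lemma g_0: "t > 0 \<Longrightarrow> g t 0 = 0"
  using del by (simp add: g_def pt_0)

lemma integrable_p_g:
  assumes t: "t > 0" and e: "e > 0" and x: "x \<noteq> 0"
  shows "integrable lborel (\<lambda>z. p t (z - x) * \<bar>g e z\<bar>)"
proof -
  note [measurable] = p_meas[OF t] g_meas[OF e]
  obtain K where K: "K > 0" "\<And>t x. t > 0 \<Longrightarrow> x \<noteq> 0 \<Longrightarrow> \<bar>g t x\<bar> \<le> K * t * norm x powr (\<delta> - \<alpha>)"
    by (rule g_bound) (rule that)
  show ?thesis
  proof (rule Bochner_Integration.integrable_bound)
    show "integrable lborel (\<lambda>z. (K * e) * (p t (z - x) * norm z powr (\<delta> - \<alpha>)))"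
      by (intro integrable_mult_right has_integral_p_neg_moment[OF del t x])
    show "AE z in lborel. norm (p t (z - x) * \<bar>g e z\<bar>) \<le> norm ((K * e) * (p t (z - x) * norm z powr (\<delta> - \<alpha>)))"
    proof (rule AE_I2)
      fix z
      have "\<bar>g e z\<bar> \<le> K * e * norm z powr (\<delta> - \<alpha>)" using K(2)[OF e, of z] g_0[OF e] by (cases "z = 0") auto
      then have "p t (z - x) * \<bar>g e z\<bar> \<le> p t (z - x) * (K * e * norm z powr (\<delta> - \<alpha>))" using p_nonneg[OF t] by (intro mult_left_mono) auto
      then show "norm (p t (z - x) * \<bar>g e z\<bar>) \<le> norm ((K * e) * (p t (z - x) * norm z powr (\<delta> - \<alpha>)))"
        using p_nonneg[OF t, of "z - x"] K(1) e by (simp add: abs_mult mult_ac)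
    qed
  qed measurable
qed

text \<open>By Chapman-Kolmogorov and Fubini, one more short step changes the moment by the defect
  of that step, averaged under \<open>pt s x\<close>.\<close>

lemma moment_increment:
  assumes s: "s > 0" and e: "e > 0" and x: "x \<noteq> 0"
  shows "integrable lborel (\<lambda>z. pt s x z * g e z)"
    and "(LINT y|lborel. pt (s + e) x y * norm y powr \<delta>) - (LINT y|lborel. pt s x y * norm y powr \<delta>) = (LINT z|lborel. pt s x z * g e z)"
proof -
  note [measurable] = pt_meas2[OF e] pt_meas[OF s] g_meas[OF e]
  have m2: "(\<lambda>(z, y). pt s x z * (pt e z y * norm y powr \<delta>)) \<in> borel_measurable (lborel \<Otimes>\<^sub>M lborel)"
  proof -
    have "(\<lambda>(z, y). pt s x z * ((\<lambda>(x, y). pt e x y) (z, y) * norm y powr \<delta>)) \<in> borel_measurable (lborel \<Otimes>\<^sub>M lborel)" by measurable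
    then show ?thesis by simp
  qed
  show ig: "integrable lborel (\<lambda>z. pt s x z * g e z)"
  proof (rule Bochner_Integration.integrable_bound[OF integrable_p_g[OF s e x]])
    show "AE z in lborel. norm (pt s x z * g e z) \<le> norm (p s (z - x) * \<bar>g e z\<bar>)"
      using pt_AE_bounds[OF s, of x] by eventually_elim (auto simp: abs_mult intro!: mult_right_mono)
  qed measurable
  have ih: "integrable lborel (\<lambda>z. pt s x z * norm z powr \<delta>)" by (rule integrable_pt_moment[OF s])
  have inner: "(LINT y|lborel. pt e z y * norm y powr \<delta>) = g e z + norm z powr \<delta>" for z by (simp add: g_def)
  let ?F = "\<lambda>(z, y). pt s x z * (pt e z y * norm y powr \<delta>)"
  have F: "integrable (lborel \<Otimes>\<^sub>M lborel) ?F"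
  proof (rule lborel_pair.Fubini_integrable[OF m2])
    have "(LINT y|lborel. norm (?F (z, y))) = pt s x z * g e z + pt s x z * norm z powr \<delta>" for z
    proof -
      have "(LINT y|lborel. norm (?F (z, y))) = (LINT y|lborel. pt s x z * (pt e z y * norm y powr \<delta>))"
        by (rule Bochner_Integration.integral_cong) (auto simp: abs_mult pt_bounds(1)[OF s] pt_bounds(1)[OF e])
      then show ?thesis by (simp add: inner distrib_left)
    qed
    then show "integrable lborel (\<lambda>z. LINT y|lborel. norm (?F (z, y)))" using ig ih by simp
    show "AE z in lborel. integrable lborel (\<lambda>y. ?F (z, y))" using integrable_pt_moment[OF e] by simp
  qed
  have "(LINT y|lborel. pt (s + e) x y * norm y powr \<delta>) = (LINT y|lborel. LINT z|lborel. ?F (z, y))"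
    by (rule Bochner_Integration.integral_cong[OF refl]) (simp add: CK(2)[OF s e] mult.assoc flip: integral_mult_left_zero)
  also have "\<dots> = (LINT z|lborel. LINT y|lborel. ?F (z, y))"
    using lborel_pair.Fubini_integral[OF F] by simp
  also have "\<dots> = (LINT z|lborel. pt s x z * g e z + pt s x z * norm z powr \<delta>)"
    by (simp add: inner distrib_left)
  also have "\<dots> = (LINT z|lborel. pt s x z * g e z) + (LINT z|lborel. pt s x z * norm z powr \<delta>)"
    using ig ih by simp
  finally show "(LINT y|lborel. pt (s + e) x y * norm y powr \<delta>) - (LINT y|lborel. pt s x y * norm y powr \<delta>) = (LINT z|lborel. pt s x z * g e z)" by simp
qed

text \<open>Dominated convergence: \<open>g_limit\<close> gives the pointwise limit, and
  \<open>g_bound\<close> a majorant proportional to \<open>|z| powr (\<delta> - \<alpha>)\<close>,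
  integrable against the stable density.\<close>

lemma p_g_tendsto_0:
  assumes t: "t > 0" and x: "x \<noteq> 0" and e: "\<And>n. e n > 0" "e \<longlonglongrightarrow> 0"
  shows "(\<lambda>n. (LINT z|lborel. p t (z - x) * \<bar>g (e n) z\<bar>) / e n) \<longlonglongrightarrow> 0"
proof -
  note [measurable] = p_meas[OF t] g_meas[OF e(1)]
  obtain K where K: "K > 0" "\<And>t x. t > 0 \<Longrightarrow> x \<noteq> 0 \<Longrightarrow> \<bar>g t x\<bar> \<le> K * t * norm x powr (\<delta> - \<alpha>)"
    by (rule g_bound) (rule that)
  have "(\<lambda>n. (LINT z|lborel. p t (z - x) * \<bar>g (e n) z / e n\<bar>)) \<longlonglongrightarrow> (LINT z|(lborel :: 'a measure). 0)"
  proof (rule integral_dominated_convergence)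
    show "integrable lborel (\<lambda>z. K * (p t (z - x) * norm z powr (\<delta> - \<alpha>)))"
      by (intro integrable_mult_right has_integral_p_neg_moment[OF del t x])
    show "AE z in lborel. (\<lambda>n. p t (z - x) * \<bar>g (e n) z / e n\<bar>) \<longlonglongrightarrow> 0"
    proof (rule AE_I2)
      fix z
      have "(\<lambda>n. g (e n) z / e n) \<longlonglongrightarrow> 0" using g_limit[OF _ e, of z] g_0[OF e(1)] by (cases "z = 0") auto
      then have "(\<lambda>n. p t (z - x) * \<bar>g (e n) z / e n\<bar>) \<longlonglongrightarrow> p t (z - x) * \<bar>0\<bar>" by (intro tendsto_intros)
      then show "(\<lambda>n. p t (z - x) * \<bar>g (e n) z / e n\<bar>) \<longlonglongrightarrow> 0" by simp
    qed
    show "AE z in lborel. norm (p t (z - x) * \<bar>g (e n) z / e n\<bar>) \<le> K * (p t (z - x) * norm z powr (\<delta> - \<alpha>))" for n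
    proof (rule AE_I2)
      fix z
      have "\<bar>g (e n) z\<bar> \<le> K * e n * norm z powr (\<delta> - \<alpha>)" using K(2)[OF e(1), of z n] g_0[OF e(1)] by (cases "z = 0") auto
      then have "\<bar>g (e n) z / e n\<bar> \<le> K * norm z powr (\<delta> - \<alpha>)" using e(1)[of n] by (simp add: abs_divide pos_divide_le_eq mult_ac)
      then have "p t (z - x) * \<bar>g (e n) z / e n\<bar> \<le> p t (z - x) * (K * norm z powr (\<delta> - \<alpha>))" using p_nonneg[OF t] by (intro mult_left_mono) auto
      then show "norm (p t (z - x) * \<bar>g (e n) z / e n\<bar>) \<le> K * (p t (z - x) * norm z powr (\<delta> - \<alpha>))"
        using p_nonneg[OF t, of "z - x"] by (simp add: abs_mult mult_ac)
    qed
  qed measurable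
  moreover have "(LINT z|lborel. p t (z - x) * \<bar>g (e n) z / e n\<bar>) = (LINT z|lborel. p t (z - x) * \<bar>g (e n) z\<bar>) / e n" for n
    by (simp add: abs_divide abs_of_pos[OF e(1)])
  ultimately show ?thesis by (simp only: integral_zero)
qed

text \<open>For negative \<open>h\<close> the earlier time \<open>t + h\<close> is the base of the
  increment. It stays above \<open>t / 2\<close>, so its kernel is still at most a multiple of the
  stable density at time \<open>t\<close>, and increments of both signs get one common
  majorant.\<close>

lemma moment_increment_le:
  assumes t: "t > 0" and x: "x \<noteq> 0"
  obtains K where "K > 0" "\<And>h. h \<noteq> 0 \<Longrightarrow> \<bar>h\<bar> \<le> t / 2 \<Longrightarrow>
    \<bar>(LINT y|lborel. pt (t + h) x y * norm y powr \<delta>) - (LINT y|lborel. pt t x y * norm y powr \<delta>)\<bar> \<le> K * (LINT z|lborel. p t (z - x) * \<bar>g \<bar>h\<bar> z\<bar>)"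
proof -
  define m where "m = 2 powr (1 + real DIM('a) / \<alpha>) * 1 powr (real DIM('a) + \<alpha>)"
  define K where "K = KU * m * C0"
  have K: "K > 0" using KU_pos C0 by (simp add: K_def m_def)
  have comp: "pt s x z \<le> K * p t (z - x)" if s: "t / 2 \<le> s" "s \<le> t" for s z
  proof -
    have s0: "s > 0" using s t by simp
    have "pt s x z \<le> KU * S s (x - z)" by (rule pt_bounds(2)[OF s0])
    also have "\<dots> \<le> KU * (m * S t (x - z))"
      unfolding m_def using KU_pos s s0 t alpha by (intro mult_left_mono sbound_compare) auto
    also have "\<dots> \<le> KU * (m * (C0 * p t (x - z)))"
      using KU_pos S_le_p[OF t, of "x - z"] by (intro mult_left_mono) (auto simp: m_def)
    finally show ?thesis by (simp add: K_def p_commute[of t x z] mult_ac)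
  qed
  have est: "\<bar>LINT z|lborel. pt s x z * g e z\<bar> \<le> K * (LINT z|lborel. p t (z - x) * \<bar>g e z\<bar>)" if s: "t / 2 \<le> s" "s \<le> t" and e: "e > 0" for s e
  proof -
    have s0: "s > 0" using s t by simp
    note [measurable] = g_meas[OF e] p_meas[OF t] pt_meas[OF s0]
    have "\<bar>LINT z|lborel. pt s x z * g e z\<bar> \<le> (LINT z|lborel. \<bar>pt s x z * g e z\<bar>)" by (rule integral_abs_bound)
    also have "\<dots> \<le> (LINT z|lborel. K * (p t (z - x) * \<bar>g e z\<bar>))"
    proof (rule integral_mono)
      show "integrable lborel (\<lambda>z. \<bar>pt s x z * g e z\<bar>)" using moment_increment(1)[OF s0 e x] by (rule integrable_abs)
      show "integrable lborel (\<lambda>z. K * (p t (z - x) * \<bar>g e z\<bar>))" by (intro integrable_mult_right integrable_p_g[OF t e x])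
      fix z
      have "pt s x z * \<bar>g e z\<bar> \<le> K * p t (z - x) * \<bar>g e z\<bar>" using comp[OF s] by (intro mult_right_mono) auto
      then show "\<bar>pt s x z * g e z\<bar> \<le> K * (p t (z - x) * \<bar>g e z\<bar>)" using pt_bounds(1)[OF s0, of x z] by (simp add: abs_mult mult.assoc)
    qed
    finally show ?thesis by simp
  qed
  show ?thesis
  proof (rule that[OF K])
    fix h :: real assume h: "h \<noteq> 0" "\<bar>h\<bar> \<le> t / 2"
    show "\<bar>(LINT y|lborel. pt (t + h) x y * norm y powr \<delta>) - (LINT y|lborel. pt t x y * norm y powr \<delta>)\<bar> \<le> K * (LINT z|lborel. p t (z - x) * \<bar>g \<bar>h\<bar> z\<bar>)"
    proof (cases "h > 0")
      case True
      then show ?thesis using moment_increment(2)[OF t True x] est[of t h] t by simp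
    next
      case False
      define s where "s = t + h"
      have e: "- h > 0" and s: "t / 2 \<le> s" "s \<le> t" "s > 0" "t = s + - h" using False h t by (auto simp: s_def)
      have "(LINT y|lborel. pt t x y * norm y powr \<delta>) - (LINT y|lborel. pt s x y * norm y powr \<delta>) = (LINT z|lborel. pt s x z * g (- h) z)"
        using moment_increment(2)[OF s(3) e x] s(4) by simp
      then have "\<bar>(LINT y|lborel. pt s x y * norm y powr \<delta>) - (LINT y|lborel. pt t x y * norm y powr \<delta>)\<bar> = \<bar>LINT z|lborel. pt s x z * g (- h) z\<bar>"
        by (simp add: abs_minus_commute)
      then show ?thesis using est[OF s(1,2) e] False by (simp add: s_def)
    qed
  qed
qed

text \<open>The moment has derivative 0 at every positive time and is therefore constant in time;
  its value is found by letting the time tend to 0 in \<open>g_bound\<close>.\<close>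

theorem pt_norm_powr_invariant:
  assumes x: "x \<noteq> 0" and t: "t > 0"
  shows "(LINT z|lborel. pt t x z * norm z powr \<delta>) = norm x powr \<delta>"
proof -
  define U where "U s = (LINT z|lborel. pt s x z * norm z powr \<delta>)" for s
  have der: "(U has_field_derivative 0) (at s within {0<..})" if s: "s \<in> {0<..}" for s
  proof -
    have s: "s > 0" using s by simp
    obtain K where K: "K > 0" "\<And>h. h \<noteq> 0 \<Longrightarrow> \<bar>h\<bar> \<le> s / 2 \<Longrightarrow> \<bar>U (s + h) - U s\<bar> \<le> K * (LINT z|lborel. p s (z - x) * \<bar>g \<bar>h\<bar> z\<bar>)"
      by (rule moment_increment_le[OF s x, folded U_def]) (rule that)
    have "((\<lambda>h. (U (s + h) - U s) / h) \<longlongrightarrow> 0) (at 0)"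
      unfolding tendsto_at_iff_sequentially comp_def
    proof (intro allI impI)
      fix h :: "nat \<Rightarrow> real" assume "\<forall>i. h i \<in> UNIV - {0}" and h0: "h \<longlonglongrightarrow> 0"
      then have h: "h n \<noteq> 0" for n by simp
      have "(\<lambda>n. \<bar>h n\<bar>) \<longlonglongrightarrow> 0" using h0 by (rule tendsto_rabs_zero)
      then have "(\<lambda>n. (LINT z|lborel. p s (z - x) * \<bar>g \<bar>h n\<bar> z\<bar>) / \<bar>h n\<bar>) \<longlonglongrightarrow> 0"
        using h by (intro p_g_tendsto_0[OF s x]) auto
      then have "(\<lambda>n. K * ((LINT z|lborel. p s (z - x) * \<bar>g \<bar>h n\<bar> z\<bar>) / \<bar>h n\<bar>)) \<longlonglongrightarrow> K * 0" by (intro tendsto_intros)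
      then have lim: "(\<lambda>n. K * ((LINT z|lborel. p s (z - x) * \<bar>g \<bar>h n\<bar> z\<bar>) / \<bar>h n\<bar>)) \<longlonglongrightarrow> 0" by simp
      have "eventually (\<lambda>n. \<bar>h n\<bar> < s / 2) sequentially" using \<open>(\<lambda>n. \<bar>h n\<bar>) \<longlonglongrightarrow> 0\<close> by (rule order_tendstoD) (use s in simp)
      then have "eventually (\<lambda>n. norm ((U (s + h n) - U s) / h n) \<le> K * ((LINT z|lborel. p s (z - x) * \<bar>g \<bar>h n\<bar> z\<bar>) / \<bar>h n\<bar>)) sequentially"
      proof eventually_elim
        case (elim n)
        have "\<bar>U (s + h n) - U s\<bar> / \<bar>h n\<bar> \<le> (K * (LINT z|lborel. p s (z - x) * \<bar>g \<bar>h n\<bar> z\<bar>)) / \<bar>h n\<bar>"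
          using K(2)[OF h] elim by (intro divide_right_mono) auto
        then show ?case by (simp add: abs_divide)
      qed
      then show "(\<lambda>n. (U (s + h n) - U s) / h n) \<longlonglongrightarrow> 0" by (rule Lim_null_comparison[OF _ lim])
    qed
    then have "DERIV U s :> 0" by (simp add: DERIV_def)
    then show ?thesis by (rule has_field_derivative_at_within)
  qed
  obtain k where k: "\<And>s. s \<in> {0<..} \<Longrightarrow> U s = k"
    using has_field_derivative_zero_constant[of "{0<..}" U] der by auto
  obtain K where K: "K > 0" "\<And>t x. t > 0 \<Longrightarrow> x \<noteq> 0 \<Longrightarrow> \<bar>g t x\<bar> \<le> K * t * norm x powr (\<delta> - \<alpha>)"
    by (rule g_bound) (rule that)
  have "\<bar>k - norm x powr \<delta>\<bar> \<le> K * norm x powr (\<delta> - \<alpha>) * s" if "s > 0" for s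
    using K(2)[OF that x] k[of s] that by (simp add: g_def U_def mult_ac)
  moreover have "((\<lambda>s. K * norm x powr (\<delta> - \<alpha>) * s) \<longlongrightarrow> K * norm x powr (\<delta> - \<alpha>) * 0) (at_right 0)" by (intro tendsto_intros)
  ultimately have "\<bar>k - norm x powr \<delta>\<bar> \<le> K * norm x powr (\<delta> - \<alpha>) * 0"
    by (intro tendsto_lowerbound[of _ _ "at_right 0"]) (auto intro: eventually_mono[OF eventually_at_right_less])
  then have "k = norm x powr \<delta>" by simp
  then show ?thesis using k[of t] t by (simp add: U_def)
qed

section \<open>Sharp upper bound\<close>

abbreviation T :: "real \<Rightarrow> real" where "T t \<equiv> t powr (1 / \<alpha>)"

text \<open>The boundary factor of \<open>Fbound\<close> in one variable.\<close>

definition H :: "real \<Rightarrow> 'a \<Rightarrow> real" where "H t x = (min 1 (norm x / T t)) powr \<delta>"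

lemma T_powr: "t > 0 \<Longrightarrow> T t powr u = t powr (u / \<alpha>)"
  by (simp add: powr_powr)

lemma T_alpha: "t > 0 \<Longrightarrow> T t powr \<alpha> = t"
  using alpha by (simp add: powr_powr)

lemma H_bounds: "0 \<le> H t x" "t > 0 \<Longrightarrow> H t x \<le> 1" "H t 0 = 0"
  using del by (auto simp: H_def intro!: powr_le1)

lemma H_small: "t > 0 \<Longrightarrow> norm x \<le> T t \<Longrightarrow> H t x = norm x powr \<delta> * t powr (- \<delta> / \<alpha>)"
proof -
  assume t: "t > 0" and x: "norm x \<le> T t"
  have "norm x / T t \<le> 1" using t x by (simp add: divide_le_eq_1)
  then have "H t x = (norm x / T t) powr \<delta>" by (simp add: H_def)
  also have "\<dots> = norm x powr \<delta> / T t powr \<delta>" using t by (simp add: powr_divide)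
  also have "\<dots> = norm x powr \<delta> * t powr (- \<delta> / \<alpha>)" using t by (simp add: T_powr powr_minus_divide)
  finally show ?thesis .
qed

lemma H_le: "t > 0 \<Longrightarrow> H t x \<le> norm x powr \<delta> * t powr (- \<delta> / \<alpha>)"
proof -
  assume t: "t > 0"
  have "H t x \<le> (norm x / T t) powr \<delta>" using del t by (auto simp: H_def intro!: powr_mono2)
  also have "\<dots> = norm x powr \<delta> / T t powr \<delta>" using t by (simp add: powr_divide)
  also have "\<dots> = norm x powr \<delta> * t powr (- \<delta> / \<alpha>)" using t by (simp add: T_powr powr_minus_divide)
  finally show ?thesis .
qed

lemma H_large: "t > 0 \<Longrightarrow> T t \<le> norm x \<Longrightarrow> H t x = 1"
proof -
  assume t: "t > 0" and x: "T t \<le> norm x"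
  then have "1 \<le> norm x / T t" by (simp add: le_divide_eq_1)
  then show ?thesis by (simp add: H_def)
qed

lemma H_mono_time: "0 < s \<Longrightarrow> s \<le> t \<Longrightarrow> H t x \<le> H s x"
proof -
  assume s: "0 < s" "s \<le> t"
  have "T s \<le> T t" using s alpha by (intro powr_mono2) auto
  moreover have "T s > 0" using s by simp
  ultimately have "norm x / T t \<le> norm x / T s" by (intro divide_left_mono) (auto intro!: mult_pos_pos)
  then have "min 1 (norm x / T t) \<le> min 1 (norm x / T s)" by (auto simp: min_def)
  then show ?thesis unfolding H_def using del s by (intro powr_mono2) auto
qed

lemma H_time_compare:
  assumes "t > 0" "k \<ge> 1"
  shows "H (t / k) x \<le> k powr (\<delta> / \<alpha>) * H t x"
proof -
  have k: "k powr (1 / \<alpha>) \<ge> 1" using assms alpha by (intro ge_one_powr_ge_zero) auto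
  have "norm x / T (t / k) = k powr (1 / \<alpha>) * (norm x / T t)" using assms by (simp add: powr_divide)
  then have "min 1 (norm x / T (t / k)) \<le> k powr (1 / \<alpha>) * min 1 (norm x / T t)"
    using k mult_right_mono[OF k, of "norm x / T t"] by (auto simp: min_def mult_left_mono)
  then have "H (t / k) x \<le> (k powr (1 / \<alpha>) * min 1 (norm x / T t)) powr \<delta>"
    unfolding H_def using del assms by (intro powr_mono2) auto
  also have "\<dots> = k powr (\<delta> / \<alpha>) * H t x" using assms by (simp add: H_def powr_mult powr_powr)
  finally show ?thesis .
qed

text \<open>For \<open>x \<noteq> 0\<close> this is the mean of the weight, that is, the survival
  probability of the process killed at rate \<open>- q\<close>.\<close>

definition m :: "real \<Rightarrow> 'a \<Rightarrow> real" where "m t x = (LINT z|lborel. pt t x z)"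

lemma m_bounds: "t > 0 \<Longrightarrow> 0 \<le> m t x" "t > 0 \<Longrightarrow> m t x \<le> 1"
proof -
  assume t: "t > 0"
  show "0 \<le> m t x" unfolding m_def by (rule integral_nonneg_AE) (use pt_bounds(1)[OF t] in auto)
  have "m t x \<le> (LINT z|lborel. p t (z - x))" unfolding m_def
    by (rule integral_mono_AE[OF integrable_pt[OF t] integrable_p_translate[OF t]]) (use pt_AE_bounds[OF t, of x] in \<open>eventually_elim, simp\<close>)
  then show "m t x \<le> 1" by (simp add: integral_p_translate[OF t])
qed

lemma pt_le_m: "s > 0 \<Longrightarrow> t > 0 \<Longrightarrow> pt (s + t) x y \<le> KU * t powr (- real DIM('a) / \<alpha>) * m s x"
proof -
  assume s: "s > 0" and t: "t > 0"
  have "pt (s + t) x y \<le> (LINT z|lborel. KU * t powr (- real DIM('a) / \<alpha>) * pt s x z)"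
    unfolding CK(2)[OF s t]
    by (rule integral_mono[OF CK(1)[OF s t]])
       (use integrable_pt[OF s] mult_left_mono[OF pt_le_sup[OF t] pt_bounds(1)[OF s]] in \<open>auto simp: mult_ac\<close>)
  then show ?thesis by (simp add: m_def)
qed

text \<open>Outside the ball of radius \<open>\<epsilon> * T t\<close>, Markov's inequality with the
  invariant function bounds the mass. Inside, the kernel is at most a multiple of
  \<open>t powr (- d / \<alpha>) * m (t / 2) x\<close>, and the volume of the ball supplies the
  factor \<open>\<epsilon> powr d\<close>.\<close>

lemma m_recursion:
  obtains C where "C > 0" "\<And>t x \<epsilon>. t > 0 \<Longrightarrow> x \<noteq> 0 \<Longrightarrow> \<epsilon> > 0 \<Longrightarrow>
    m t x \<le> \<epsilon> powr (- \<delta>) * (norm x powr \<delta> * t powr (- \<delta> / \<alpha>)) + C * \<epsilon> powr (real DIM('a)) * m (t / 2) x"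
proof -
  let ?d = "real DIM('a)"
  define w where "w = unit_ball_vol ?d"
  have w: "w > 0" by (simp add: w_def)
  define C where "C = KU * w * 2 powr (?d / \<alpha>)"
  have C: "C > 0" using KU_pos w by (simp add: C_def)
  have "m t x \<le> \<epsilon> powr (- \<delta>) * (norm x powr \<delta> * t powr (- \<delta> / \<alpha>)) + C * \<epsilon> powr ?d * m (t / 2) x"
    if t: "t > 0" and x: "x \<noteq> 0" and e: "\<epsilon> > 0" for t x \<epsilon>
  proof -
    define R where "R = \<epsilon> * T t"
    have R: "R > 0" using t e by (simp add: R_def)
    define B where "B = KU * (t / 2) powr (- ?d / \<alpha>) * m (t / 2) x"
    have t2: "t / 2 > 0" using t by simp
    have B: "0 \<le> B" "pt t x y \<le> B" for y
      using KU_pos m_bounds(1)[OF t2, of x] pt_le_m[OF t2 t2, of x y] by (auto simp: B_def)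
    have [measurable]: "cball (0::'a) R \<in> sets borel" by (simp add: borel_closed)
    have ib: "integrable lborel (indicator (cball (0::'a) R) :: 'a \<Rightarrow> real)"
      by (rule integrable_real_indicator) (auto simp: emeasure_cball R less_imp_le)
    have "m t x \<le> (LINT z|lborel. R powr (- \<delta>) * (pt t x z * norm z powr \<delta>) + B * indicator (cball 0 R) z)"
      unfolding m_def
    proof (rule integral_mono[OF integrable_pt[OF t]])
      show "integrable lborel (\<lambda>z. R powr (- \<delta>) * (pt t x z * norm z powr \<delta>) + B * indicator (cball 0 R) z)"
        using integrable_pt_moment[OF t] ib by auto
      fix z
      have p0: "0 \<le> pt t x z" by (rule pt_bounds(1)[OF t])
      show "pt t x z \<le> R powr (- \<delta>) * (pt t x z * norm z powr \<delta>) + B * indicator (cball 0 R) z"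
      proof (cases "norm z \<le> R")
        case True
        then show ?thesis using B(2)[of z] p0 by (simp add: add_increasing)
      next
        case False
        have "1 = R powr (- \<delta>) * R powr \<delta>" using R by (simp add: powr_minus)
        also have "\<dots> \<le> R powr (- \<delta>) * norm z powr \<delta>" using False R del by (intro mult_left_mono powr_mono2) auto
        finally have "pt t x z * 1 \<le> pt t x z * (R powr (- \<delta>) * norm z powr \<delta>)" using p0 by (intro mult_left_mono) auto
        then show ?thesis using False by (simp add: mult_ac)
      qed
    qed
    also have "\<dots> = R powr (- \<delta>) * norm x powr \<delta> + B * measure lborel (cball (0::'a) R)"
      using integrable_pt_moment[OF t] ib pt_norm_powr_invariant[OF x t] by simp
    also have "measure lborel (cball (0::'a) R) = w * R powr ?d"
      using R by (simp add: measure_def emeasure_cball w_def powr_realpow)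
    also have "B * (w * R powr ?d) = C * \<epsilon> powr ?d * m (t / 2) x"
    proof -
      have "R powr ?d = \<epsilon> powr ?d * t powr (?d / \<alpha>)" using t e by (simp add: R_def powr_mult T_powr)
      moreover have "(t / 2) powr (- ?d / \<alpha>) = 2 powr (?d / \<alpha>) * t powr (- ?d / \<alpha>)"
        using t by (simp add: powr_divide powr_minus field_simps)
      moreover have "t powr (- ?d / \<alpha>) * t powr (?d / \<alpha>) = 1" using t by (simp add: powr_minus)
      ultimately show ?thesis by (simp add: B_def C_def mult_ac)
    qed
    also have "R powr (- \<delta>) = \<epsilon> powr (- \<delta>) * t powr (- \<delta> / \<alpha>)" using t e by (simp add: R_def powr_mult T_powr)
    finally show ?thesis by (simp add: mult_ac)
  qed
  with that[OF C] show ?thesis by blast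
qed

lemma m_upper:
  obtains C where "C \<ge> 1" "\<And>t x. t > 0 \<Longrightarrow> m t x \<le> C * H t x"
proof -
  let ?d = "real DIM('a)"
  obtain C where C: "C > 0" "\<And>t x \<epsilon>. t > 0 \<Longrightarrow> x \<noteq> 0 \<Longrightarrow> \<epsilon> > 0 \<Longrightarrow>
    m t x \<le> \<epsilon> powr (- \<delta>) * (norm x powr \<delta> * t powr (- \<delta> / \<alpha>)) + C * \<epsilon> powr ?d * m (t / 2) x"
    by (rule m_recursion) (rule that)
  \<comment> \<open>Halving the time inflates \<open>t powr (- \<delta> / \<alpha>)\<close> by
    \<open>2 powr (\<delta> / \<alpha>)\<close>; a weight \<open>q\<close> on the half-time mass
    undoes this and leaves the factor \<open>1 / 2\<close>.\<close>
  define q where "q = 1 / (2 * 2 powr (\<delta> / \<alpha>))"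
  have q: "q > 0" "q \<le> 1 / 2" "q * 2 powr (\<delta> / \<alpha>) = 1 / 2"
    using del alpha by (auto simp: q_def divide_simps ge_one_powr_ge_zero)
  \<comment> \<open>The radius at which the recursion coefficient
    \<open>C * \<epsilon> powr d\<close> equals \<open>q\<close>.\<close>
  define \<epsilon> where "\<epsilon> = (q / C) powr (1 / ?d)"
  have e: "\<epsilon> > 0" using q C by (simp add: \<epsilon>_def)
  have ed: "C * \<epsilon> powr ?d = q" using q C d_ge1 by (simp add: \<epsilon>_def powr_powr)
  define A where "A = \<epsilon> powr (- \<delta>)"
  have A: "A > 0" using e by (simp add: A_def)
  \<comment> \<open>The iteration starts from \<open>m t x \<le> 1\<close>, so the remainder after
    \<open>n\<close> halvings is \<open>(1 / 2) ^ n\<close>, and letting \<open>n\<close> tend to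
    infinity removes it.\<close>
  have rec: "m t x \<le> 2 * A * (norm x powr \<delta> * t powr (- \<delta> / \<alpha>)) + (1 / 2) ^ n" if x: "x \<noteq> 0" and t: "t > 0" for n t x
    using t
  proof (induction n arbitrary: t)
    case 0
    have "0 \<le> 2 * A * (norm x powr \<delta> * t powr (- \<delta> / \<alpha>))" using A by simp
    then show ?case using m_bounds(2)[OF 0, of x] by simp
  next
    case (Suc n)
    let ?a = "norm x powr \<delta> * t powr (- \<delta> / \<alpha>)"
    have "(t / 2) powr (- \<delta> / \<alpha>) = 2 powr (\<delta> / \<alpha>) * t powr (- \<delta> / \<alpha>)"
      using Suc.prems by (simp add: powr_divide powr_minus field_simps)
    then have IH: "m (t / 2) x \<le> 2 * A * (2 powr (\<delta> / \<alpha>) * ?a) + (1 / 2) ^ n"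
      using Suc.IH[of "t / 2"] Suc.prems by (simp add: mult_ac)
    have "m t x \<le> A * ?a + q * m (t / 2) x" using C(2)[OF Suc.prems x e] ed by (simp add: A_def)
    also have "\<dots> \<le> A * ?a + q * (2 * A * (2 powr (\<delta> / \<alpha>) * ?a) + (1 / 2) ^ n)"
      using IH q by (intro add_left_mono mult_left_mono) auto
    also have "\<dots> = A * ?a + (q * 2 powr (\<delta> / \<alpha>)) * (2 * A * ?a) + q * (1 / 2) ^ n" by (simp add: algebra_simps)
    also have "\<dots> \<le> A * ?a + (1 / 2) * (2 * A * ?a) + (1 / 2) * (1 / 2) ^ n"
      unfolding q(3) using q by (intro add_left_mono mult_right_mono) auto
    finally show ?case by simp
  qed
  have b1: "m t x \<le> 2 * A * (norm x powr \<delta> * t powr (- \<delta> / \<alpha>))" if t: "t > 0" for t x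
  proof (cases "x = 0")
    case True
    then have "m t x = 0" using t by (simp add: m_def pt_0)
    then show ?thesis using A by simp
  next
    case False
    have "(\<lambda>n. 2 * A * (norm x powr \<delta> * t powr (- \<delta> / \<alpha>)) + (1 / 2) ^ n) \<longlonglongrightarrow> 2 * A * (norm x powr \<delta> * t powr (- \<delta> / \<alpha>)) + 0"
      by (intro tendsto_intros LIMSEQ_power_zero) auto
    then show ?thesis using rec[OF False t] by (intro tendsto_lowerbound[of _ _ sequentially]) auto
  qed
  show ?thesis
  proof (rule that[of "max 1 (2 * A)"])
    fix t x assume t: "t > (0::real)"
    have b: "m t x \<le> max 1 (2 * A) * (norm x powr \<delta> * t powr (- \<delta> / \<alpha>))" for x :: 'a
      using b1[OF t, of x] mult_right_mono[of "2 * A" "max 1 (2 * A)" "norm x powr \<delta> * t powr (- \<delta> / \<alpha>)"] by auto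
    show "m t x \<le> max 1 (2 * A) * H t x" for x :: 'a
    proof (cases "norm x \<le> T t")
      case True
      then show ?thesis using b[of x] H_small[OF t True] by simp
    next
      case False
      then show ?thesis using m_bounds(2)[OF t, of x] H_large[OF t, of x] by simp
    qed
  qed simp
qed

text \<open>The time is cut into thirds: the two outer ones contribute the masses at
  \<open>x\<close> and at \<open>y\<close>, the middle one the supremum bound.\<close>

lemma pt_upper_near:
  obtains C where "C > 0" "\<And>t x y. t > 0 \<Longrightarrow> pt t x y \<le> C * t powr (- real DIM('a) / \<alpha>) * (H t x * H t y)"
proof -
  let ?d = "real DIM('a)"
  obtain C where C: "C \<ge> 1" "\<And>t x. t > 0 \<Longrightarrow> m t x \<le> C * H t x"
    by (rule m_upper) (rule that)
  define D where "D = C * 3 powr (\<delta> / \<alpha>)"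
  have D: "D > 0" using C by (simp add: D_def)
  have "pt t x y \<le> KU * 3 powr (?d / \<alpha>) * D * D * t powr (- ?d / \<alpha>) * (H t x * H t y)" if t: "t > 0" for t x y
  proof -
    let ?s = "t / 3"
    have s: "?s > 0" using t by simp
    have mD: "m ?s x \<le> D * H t x" for x
    proof -
      have "m ?s x \<le> C * H ?s x" by (rule C(2)[OF s])
      also have "\<dots> \<le> C * (3 powr (\<delta> / \<alpha>) * H t x)" using C(1) t by (intro mult_left_mono H_time_compare) auto
      finally show ?thesis by (simp add: D_def mult_ac)
    qed
    let ?K = "KU * ?s powr (- ?d / \<alpha>) * m ?s y"
    have "pt (?s + ?s) z y \<le> ?K" for z
      using pt_le_m[OF s s, of y z] pt_sym[of "?s + ?s" z y] s by simp
    then have le: "pt ?s x z * pt (?s + ?s) z y \<le> pt ?s x z * ?K" for z using pt_bounds(1)[OF s] by (intro mult_left_mono) auto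
    have ss: "?s + ?s > 0" using s by simp
    have "pt t x y = (LINT z|lborel. pt ?s x z * pt (?s + ?s) z y)" using CK(2)[OF s ss, of x y] by (simp add: field_simps)
    also have "\<dots> \<le> (LINT z|lborel. pt ?s x z * ?K)"
      by (rule integral_mono[OF CK(1)[OF s ss]]) (use le integrable_pt[OF s] in auto)
    also have "\<dots> = KU * ?s powr (- ?d / \<alpha>) * (m ?s x * m ?s y)" by (simp add: m_def mult_ac)
    also have "\<dots> \<le> KU * ?s powr (- ?d / \<alpha>) * ((D * H t x) * (D * H t y))"
      using mD[of x] mD[of y] m_bounds(1)[OF s] KU_pos D H_bounds(1) by (intro mult_left_mono mult_mono mult_nonneg_nonneg) auto
    also have "?s powr (- ?d / \<alpha>) = 3 powr (?d / \<alpha>) * t powr (- ?d / \<alpha>)" using t by (simp add: powr_divide powr_minus field_simps)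
    finally show ?thesis by (simp add: mult_ac)
  qed
  with that[of "KU * 3 powr (?d / \<alpha>) * D * D"] KU_pos D show ?thesis by simp
qed

text \<open>The mass that \<open>pt (t/2) x\<close> puts inside the ball of radius \<open>R/2 + lam * a\<close> is at distance \<open>(1 - lam) * a\<close> from \<open>y\<close>; what lies outside is treated at time \<open>t/2\<close> with the smaller margin \<open>lam * a\<close>. Since \<open>\<delta> < \<alpha>\<close>, a factor \<open>lam\<close> close to \<open>1\<close> makes the iteration contract.\<close>

lemma pt_upper_far:
  obtains B where "B > 0" "\<And>t x y. t > 0 \<Longrightarrow> 4 * norm x \<le> norm y \<Longrightarrow> y \<noteq> 0 \<Longrightarrow>
    pt t x y \<le> B * (norm x powr \<delta> * t powr (- \<delta> / \<alpha>)) * (t / norm y powr (real DIM('a) + \<alpha>))"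
proof -
  let ?e = "real DIM('a) + \<alpha>"
  have e: "?e > 0" using alpha d_ge1 by linarith
  define \<gamma> where "\<gamma> = 1 - \<delta> / \<alpha>"
  have g: "\<gamma> > 0" using del alpha by (simp add: \<gamma>_def)
  \<comment> \<open>Shrinking the margin by \<open>lam\<close> costs
    \<open>lam powr (- (d + \<alpha>)) = 2 powr (\<gamma> / 2)\<close>, while halving the time gains
    \<open>2 powr (- \<gamma>)\<close>; the net factor is the \<open>r < 1\<close> below.\<close>
  define lam where "lam = 2 powr (- \<gamma> / (2 * ?e))"
  have lam: "0 < lam" "lam < 1" using g e by (auto simp: lam_def powr_less_one intro!: powr_less_one)
  have "- \<gamma> / (2 * u) * (- u) = \<gamma> / 2" if "u > 0" for u :: real using that by simp
  from this[OF e] have lam_e: "lam powr (- ?e) = 2 powr (\<gamma> / 2)" by (simp only: lam_def powr_powr)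
  obtain Cm where Cm: "Cm \<ge> 1" "\<And>t x. t > 0 \<Longrightarrow> m t x \<le> Cm * H t x"
    by (rule m_upper) (rule that)
  have Cm2: "m t x \<le> Cm * (norm x powr \<delta> * t powr (- \<delta> / \<alpha>))" if "t > 0" for t x
    by (rule order_trans[OF Cm(2)[OF that] mult_left_mono[OF H_le[OF that]]]) (use Cm(1) in simp)
  define D where "D = KU * Cm * (1 - lam) powr (- ?e)"
  have D: "D > 0" using KU_pos Cm lam by (simp add: D_def)
  define r where "r = 2 powr (- \<gamma> / 2)"
  have r: "0 < r" "r < 1" using g by (auto simp: r_def powr_less_one intro!: powr_less_one)
  \<comment> \<open>The fixed point of \<open>B = D * 2 powr (- \<gamma>) + B * r\<close>, which is
    the recursion for the constant in the inductive step.\<close>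
  define B where "B = D * 2 powr (- \<gamma>) / (1 - r)"
  have B: "B > 0" using D r by (simp add: B_def)
  have Beq: "D * 2 powr (- \<gamma>) + B * r = B" using r by (simp add: B_def field_simps)
  \<comment> \<open>Time, margin and endpoint vary in the induction because each step changes them.
    The second summand stems from the bound \<open>KU * S\<close> used in the base case and halves
    with every step.\<close>
  have claim: "pt t x y \<le> B * (norm x powr \<delta> * t powr \<gamma>) * a powr (- ?e) + KU * (t / 2 ^ n) * (R / 4) powr (- ?e)"
    if R: "R > 0" "4 * norm x \<le> R" and t: "t > 0" and a: "a > 0" and y: "norm y \<ge> R / 2 + a" for n t a x y R
    using t a y
  proof (induction n arbitrary: t a y)
    case 0
    have xy: "R / 4 \<le> norm (x - y)" using R 0(2,3) norm_triangle_ineq2[of y x] by (simp add: norm_minus_commute)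
    then have nz: "x - y \<noteq> 0" using R by auto
    have "pt t x y \<le> KU * S t (x - y)" by (rule pt_bounds(2)[OF 0(1)])
    also have "\<dots> \<le> KU * (t / norm (x - y) powr ?e)" using KU_pos sbound_le2[OF nz] by (intro mult_left_mono) auto
    also have "\<dots> \<le> KU * (t / (R / 4) powr ?e)"
      using KU_pos 0(1) R xy e by (intro mult_left_mono divide_left_mono powr_mono2 mult_pos_pos) auto
    also have "\<dots> = KU * (t / 2 ^ 0) * (R / 4) powr (- ?e)" by (simp add: powr_minus_divide del: minus_add_distrib)
    finally show ?case using B by (simp add: add_increasing)
  next
    case (Suc n)
    let ?s = "t / 2"
    have t: "t > 0" and a: "a > 0" and y: "norm y \<ge> R / 2 + a" using Suc.prems by auto
    have s: "?s > 0" and ss: "?s + ?s = t" using t by auto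
    define G where "G = (1 - lam) * a"
    have G: "G > 0" using lam a by (simp add: G_def)
    define P1 where "P1 = KU * (?s / G powr ?e)"
    have P1: "P1 \<ge> 0" using KU_pos s by (simp add: P1_def)
    define P2 where "P2 = B * (norm x powr \<delta> * ?s powr \<gamma>) * (lam * a) powr (- ?e) + KU * (?s / 2 ^ n) * (R / 4) powr (- ?e)"
    have P2: "P2 \<ge> 0" using B KU_pos s by (simp add: P2_def)
    have pw: "pt ?s x z * pt ?s z y \<le> P1 * pt ?s x z + P2 * pt ?s y z" for z
    proof (cases "norm z \<ge> R / 2 + lam * a")
      case True
      have "pt ?s x z \<le> P2" unfolding P2_def by (rule Suc.IH[OF s _ True]) (use lam a in simp)
      then have "pt ?s x z * pt ?s z y \<le> P2 * pt ?s z y" using pt_bounds(1)[OF s] by (intro mult_right_mono) auto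
      then show ?thesis using P1 pt_bounds(1)[OF s, of x z] pt_sym[OF s, of z y] by (simp add: add_increasing)
    next
      case False
      have zy: "norm (z - y) \<ge> G" using False y norm_triangle_ineq2[of y z] by (simp add: G_def norm_minus_commute algebra_simps)
      then have nz: "z - y \<noteq> 0" using G by auto
      have "pt ?s z y \<le> KU * S ?s (z - y)" by (rule pt_bounds(2)[OF s])
      also have "\<dots> \<le> KU * (?s / norm (z - y) powr ?e)" using KU_pos sbound_le2[OF nz, of \<alpha> ?s] by (intro mult_left_mono) auto
      also have "\<dots> \<le> P1" unfolding P1_def
        using KU_pos s G zy e by (intro mult_left_mono divide_left_mono powr_mono2 mult_pos_pos) auto
      finally have "pt ?s x z * pt ?s z y \<le> pt ?s x z * P1" using pt_bounds(1)[OF s] by (intro mult_left_mono) auto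
      then show ?thesis using P2 pt_bounds(1)[OF s, of y z] by (simp add: mult.commute add_increasing2)
    qed
    have "pt t x y \<le> (LINT z|lborel. P1 * pt ?s x z + P2 * pt ?s y z)"
      using integral_mono[OF CK(1)[OF s s, of x y] _ pw] CK(2)[OF s s, of x y] integrable_pt[OF s] ss by simp
    also have "\<dots> = P1 * m ?s x + P2 * m ?s y" using integrable_pt[OF s] by (simp add: m_def)
    also have "\<dots> \<le> P1 * (Cm * (norm x powr \<delta> * ?s powr (- \<delta> / \<alpha>))) + P2 * 1"
      using P1 P2 Cm2[OF s, of x] m_bounds(2)[OF s, of y] by (intro add_mono mult_left_mono) auto
    also have "P1 * (Cm * (norm x powr \<delta> * ?s powr (- \<delta> / \<alpha>))) = D * 2 powr (- \<gamma>) * (norm x powr \<delta> * t powr \<gamma>) * a powr (- ?e)"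
    proof -
      have "?s * ?s powr (- \<delta> / \<alpha>) = ?s powr \<gamma>" using s by (simp add: \<gamma>_def powr_diff powr_minus field_simps)
      also have "\<dots> = 2 powr (- \<gamma>) * t powr \<gamma>" using t by (simp add: powr_divide powr_minus field_simps)
      finally have 1: "?s * ?s powr (- \<delta> / \<alpha>) = 2 powr (- \<gamma>) * t powr \<gamma>" .
      have "1 / G powr ?e = G powr (- ?e)" by (simp only: powr_minus_divide)
      also have "\<dots> = (1 - lam) powr (- ?e) * a powr (- ?e)" using lam a by (simp only: G_def powr_mult)
      finally have 2: "1 / G powr ?e = (1 - lam) powr (- ?e) * a powr (- ?e)" .
      have "P1 * (Cm * (norm x powr \<delta> * ?s powr (- \<delta> / \<alpha>))) = KU * Cm * norm x powr \<delta> * (1 / G powr ?e) * (?s * ?s powr (- \<delta> / \<alpha>))"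
        by (simp add: P1_def mult_ac)
      then show ?thesis unfolding 1 2 by (simp only: D_def mult_ac)
    qed
    also have "P2 * 1 = B * r * (norm x powr \<delta> * t powr \<gamma>) * a powr (- ?e) + KU * (t / 2 ^ Suc n) * (R / 4) powr (- ?e)"
    proof -
      have 1: "(lam * a) powr (- ?e) = 2 powr (\<gamma> / 2) * a powr (- ?e)" using lam a by (simp only: powr_mult lam_e)
      have 2: "?s powr \<gamma> = 2 powr (- \<gamma>) * t powr \<gamma>" using t by (simp add: powr_divide powr_minus field_simps)
      have 3: "2 powr (- \<gamma>) * 2 powr (\<gamma> / 2) = r" unfolding r_def powr_add[symmetric] by simp
      have "(norm x powr \<delta> * ?s powr \<gamma>) * (lam * a) powr (- ?e) = (2 powr (- \<gamma>) * 2 powr (\<gamma> / 2)) * (norm x powr \<delta> * t powr \<gamma>) * a powr (- ?e)"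
        unfolding 1 2 by (simp only: mult_ac)
      then show ?thesis unfolding 3 by (simp add: P2_def mult.assoc)
    qed
    finally have "pt t x y \<le> (D * 2 powr (- \<gamma>) + B * r) * (norm x powr \<delta> * t powr \<gamma>) * a powr (- ?e) + KU * (t / 2 ^ Suc n) * (R / 4) powr (- ?e)"
      by (simp only: distrib_right add.assoc)
    then show ?case unfolding Beq .
  qed
  have "pt t x y \<le> (B * 2 powr ?e) * (norm x powr \<delta> * t powr (- \<delta> / \<alpha>)) * (t / norm y powr ?e)"
    if t: "t > 0" and xy: "4 * norm x \<le> norm y" and y: "y \<noteq> 0" for t x y
  proof -
    let ?R = "norm y"
    let ?A = "B * (norm x powr \<delta> * t powr \<gamma>) * (?R / 2) powr (- ?e)"
    have R: "?R > 0" using y by simp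
    have "(\<lambda>n. ?A + KU * (t * (1 / 2) ^ n) * (?R / 4) powr (- ?e)) \<longlonglongrightarrow> ?A + KU * (t * 0) * (?R / 4) powr (- ?e)"
      by (intro tendsto_intros LIMSEQ_power_zero) auto
    moreover have "pt t x y \<le> ?A + KU * (t * (1 / 2) ^ n) * (?R / 4) powr (- ?e)" for n
      using claim[OF R xy t, of "?R / 2" y n] R by (simp add: power_one_over)
    ultimately have "pt t x y \<le> ?A + KU * (t * 0) * (?R / 4) powr (- ?e)"
      by (intro tendsto_lowerbound[of _ _ sequentially]) auto
    also have "\<dots> = ?A" by simp
    also have "\<dots> = (B * 2 powr ?e) * (norm x powr \<delta> * t powr (- \<delta> / \<alpha>)) * (t / norm y powr ?e)"
    proof -
      have "t powr \<gamma> = t powr (- \<delta> / \<alpha>) * t" using t by (simp add: \<gamma>_def powr_diff powr_minus field_simps)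
      moreover have "(?R / 2) powr (- ?e) = 2 powr ?e / ?R powr ?e"
        by (simp only: powr_minus_divide powr_divide) simp
      ultimately show ?thesis by (simp only: mult_ac times_divide_eq_left times_divide_eq_right)
    qed
    finally show ?thesis .
  qed
  with that[of "B * 2 powr ?e"] B show ?thesis by simp
qed

section \<open>Sharp lower bound and joint continuity\<close>

lemma T_pos: "t > 0 \<Longrightarrow> T t > 0"
  by simp

lemma S_at_scale:
  assumes "t > 0" "k > 0"
  shows "t / (k * T t) powr (real DIM('a) + \<alpha>) = k powr (- (real DIM('a) + \<alpha>)) * t powr (- real DIM('a) / \<alpha>)"
proof -
  have "T t powr (real DIM('a) + \<alpha>) = t powr (real DIM('a) / \<alpha>) * t"
    using assms alpha by (simp add: powr_powr powr_add add_divide_distrib)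
  then have "(k * T t) powr (real DIM('a) + \<alpha>) = k powr (real DIM('a) + \<alpha>) * (t powr (real DIM('a) / \<alpha>) * t)"
    using assms by (simp only: powr_mult)
  then have "t / (k * T t) powr (real DIM('a) + \<alpha>) = (1 / k powr (real DIM('a) + \<alpha>)) * (1 / t powr (real DIM('a) / \<alpha>))"
    using assms by simp
  then show ?thesis by (simp only: powr_minus_divide minus_divide_left[symmetric])
qed

lemma S_near:
  fixes w :: 'a
  assumes t: "t > 0" and k: "k \<ge> 1" and w: "norm w \<le> k * T t"
  shows "k powr (- (real DIM('a) + \<alpha>)) * t powr (- real DIM('a) / \<alpha>) \<le> S t w"
proof (rule sbound_geI)
  let ?e = "real DIM('a) + \<alpha>"
  have e: "?e > 0" using alpha by linarith
  have "k powr (- ?e) \<le> 1 powr (- ?e)" using k e by (intro powr_mono2') auto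
  then have "k powr (- ?e) * t powr (- real DIM('a) / \<alpha>) \<le> 1 * t powr (- real DIM('a) / \<alpha>)" by (intro mult_right_mono) auto
  then show "k powr (- ?e) * t powr (- real DIM('a) / \<alpha>) \<le> t powr (- real DIM('a) / \<alpha>)" by simp
  assume "w \<noteq> 0"
  then have "t / (k * T t) powr ?e \<le> t / norm w powr ?e"
    using t k w e T_pos[OF t] by (intro divide_left_mono powr_mono2 mult_pos_pos) auto
  moreover have "k > 0" using k by simp
  ultimately show "k powr (- ?e) * t powr (- real DIM('a) / \<alpha>) \<le> t / norm w powr ?e"
    using S_at_scale[OF t, of k] by simp
qed

lemma S_far:
  fixes w :: 'a
  assumes t: "t > 0" and w: "T t \<le> norm w"
  shows "t / norm w powr (real DIM('a) + \<alpha>) \<le> S t w"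
proof (rule sbound_geI)
  let ?e = "real DIM('a) + \<alpha>"
  have e: "?e > 0" using alpha by linarith
  have "norm w > 0" using T_pos[OF t] w by linarith
  then have "t / norm w powr ?e \<le> t / (1 * T t) powr ?e"
    using t w e T_pos[OF t] by (intro divide_left_mono powr_mono2 mult_pos_pos) auto
  also have "\<dots> = t powr (- real DIM('a) / \<alpha>)" using S_at_scale[OF t, of 1] by simp
  finally show "t / norm w powr ?e \<le> t powr (- real DIM('a) / \<alpha>)" .
qed simp

text \<open>Within distance \<open>T t\<close> of the origin the profile is comparable to its
  maximum, and beyond it a displacement by \<open>k * T t\<close> changes the norm at most
  proportionally.\<close>

lemma S_shift:
  fixes v w :: 'a
  assumes t: "t > 0" and k: "k \<ge> 0" and v: "norm v \<le> norm w + k * T t"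
  shows "S t w \<le> (k + 1) powr (real DIM('a) + \<alpha>) * S t v"
proof (cases "norm w \<le> T t")
  case True
  let ?e = "real DIM('a) + \<alpha>"
  have k1: "k + 1 \<ge> 1" "k + 1 > 0" using k by auto
  have "norm v \<le> (k + 1) * T t" using True v by (simp add: algebra_simps)
  then have "(k + 1) powr ?e * ((k + 1) powr (- ?e) * t powr (- real DIM('a) / \<alpha>)) \<le> (k + 1) powr ?e * S t v"
    using S_near[OF t k1(1), of v] by (intro mult_left_mono) auto
  moreover have "(k + 1) powr ?e * (k + 1) powr (- ?e) = 1" unfolding powr_add[symmetric] using k1 by simp
  ultimately have "t powr (- real DIM('a) / \<alpha>) \<le> (k + 1) powr ?e * S t v" by (simp only: mult.assoc[symmetric] mult_1)
  then show ?thesis using sbound_le1[of \<alpha> t w] by linarith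
next
  case False
  have "k * T t \<le> k * norm w" using False k by (intro mult_left_mono) auto
  then have "norm v \<le> (k + 1) * norm w" using v by (simp add: algebra_simps)
  then show ?thesis using sbound_compare[of \<alpha> t t 1 "k + 1" v w] alpha t k by simp
qed

text \<open>For points within \<open>8 * T t\<close> of each other the near bound applies, as the
  profile is of order \<open>t powr (- d / \<alpha>)\<close>. For points further apart with one of
  them within \<open>T t\<close> of the origin, \<open>pt_upper_far\<close> applies. When both lie
  beyond \<open>T t\<close>, both factors \<open>H\<close> are 1 and \<open>pt_bounds\<close>
  suffices.\<close>

lemma pt_upper:
  obtains C where "C > 0" "\<And>t x y. t > 0 \<Longrightarrow> pt t x y \<le> C * (H t x * H t y * S t (x - y))"
proof -
  let ?d = "real DIM('a)"
  let ?e = "real DIM('a) + \<alpha>"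
  have e: "?e > 0" using alpha by linarith
  obtain C1 where C1: "C1 > 0" "\<And>t x y. t > 0 \<Longrightarrow> pt t x y \<le> C1 * t powr (- ?d / \<alpha>) * (H t x * H t y)"
    by (rule pt_upper_near) (rule that)
  obtain B where B: "B > 0" "\<And>t x y. t > 0 \<Longrightarrow> 4 * norm x \<le> norm y \<Longrightarrow> y \<noteq> 0 \<Longrightarrow>
    pt t x y \<le> B * (norm x powr \<delta> * t powr (- \<delta> / \<alpha>)) * (t / norm y powr ?e)"
    by (rule pt_upper_far) (rule that)
  define K where "K = C1 * 8 powr ?e + B * 2 powr ?e + KU"
  have K: "K \<ge> C1 * 8 powr ?e" "K \<ge> B * 2 powr ?e" "K \<ge> KU" "K > 0"
    using mult_pos_pos[OF C1(1), of "8 powr ?e"] mult_pos_pos[OF B(1), of "2 powr ?e"] KU_pos by (auto simp: K_def)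
  have HS: "0 \<le> H t x * H t y * S t (x - y)" if "t > 0" for t x y
    using H_bounds(1) sbound_pos[OF that, of \<alpha> "x - y"] by (intro mult_nonneg_nonneg) auto
  have far: "pt t x y \<le> K * (H t x * H t y * S t (x - y))"
    if t: "t > 0" and x: "norm x \<le> T t" and xy: "8 * T t < norm (x - y)" for t x y
  proof -
    \<comment> \<open>The constant 8 leaves \<open>|y| > 7 * T t \<ge> 4 * |x|\<close>, as
      \<open>pt_upper_far\<close> asks, and gives \<open>|x - y| \<le> 2 * |y|\<close>.\<close>
    have y: "7 * T t < norm y" using x xy norm_triangle_ineq4[of x y] by linarith
    have T0: "T t > 0" using t by (rule T_pos)
    have y0: "y \<noteq> 0" and xy0: "x - y \<noteq> 0" using y T0 xy by auto
    have n2: "norm (x - y) \<le> 2 * norm y" using x y T0 norm_triangle_ineq4[of x y] by linarith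
    have "t / norm y powr ?e = 2 powr ?e * (t / (2 * norm y) powr ?e)" by (simp add: powr_mult)
    also have "\<dots> \<le> 2 powr ?e * (t / norm (x - y) powr ?e)"
      using t n2 e xy0 y0 by (intro mult_left_mono divide_left_mono powr_mono2 mult_pos_pos) auto
    also have "\<dots> \<le> 2 powr ?e * S t (x - y)" using S_far[OF t, of "x - y"] xy T0 by (intro mult_left_mono) auto
    finally have 1: "t / norm y powr ?e \<le> 2 powr ?e * S t (x - y)" .
    have "pt t x y \<le> B * (norm x powr \<delta> * t powr (- \<delta> / \<alpha>)) * (t / norm y powr ?e)" using x y T0 y0 by (intro B(2)[OF t]) linarith
    also have "\<dots> = B * H t x * (t / norm y powr ?e)" using H_small[OF t x] by simp
    also have "\<dots> \<le> B * H t x * (2 powr ?e * S t (x - y))" using 1 B(1) H_bounds(1) by (intro mult_left_mono mult_nonneg_nonneg) auto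
    also have "\<dots> = (B * 2 powr ?e) * (H t x * H t y * S t (x - y))" using H_large[OF t, of y] y T0 by simp
    also have "\<dots> \<le> K * (H t x * H t y * S t (x - y))" using K(2) HS[OF t] by (intro mult_right_mono) auto
    finally show ?thesis .
  qed
  have "pt t x y \<le> K * (H t x * H t y * S t (x - y))" if t: "t > 0" for t x y
  proof -
    consider "norm (x - y) \<le> 8 * T t" | "8 * T t < norm (x - y)" "norm x \<le> T t" | "8 * T t < norm (x - y)" "norm y \<le> T t" | "T t \<le> norm x" "T t \<le> norm y"
      by linarith
    then show ?thesis
    proof cases
      case 1
      have "8 powr ?e * (8 powr (- ?e) * t powr (- ?d / \<alpha>)) \<le> 8 powr ?e * S t (x - y)"
        using S_near[OF t _ 1] by (intro mult_left_mono) auto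
      moreover have "8 powr ?e * 8 powr (- ?e) = (1::real)" unfolding powr_add[symmetric] by simp
      ultimately have s: "t powr (- ?d / \<alpha>) \<le> 8 powr ?e * S t (x - y)" by (simp only: mult.assoc[symmetric] mult_1)
      have "pt t x y \<le> C1 * (H t x * H t y) * t powr (- ?d / \<alpha>)" using C1(2)[OF t, of x y] by (simp add: mult_ac)
      also have "\<dots> \<le> C1 * (H t x * H t y) * (8 powr ?e * S t (x - y))"
        using s C1(1) H_bounds(1) by (intro mult_left_mono mult_nonneg_nonneg) auto
      also have "\<dots> = (C1 * 8 powr ?e) * (H t x * H t y * S t (x - y))" by (simp only: mult_ac)
      also have "\<dots> \<le> K * (H t x * H t y * S t (x - y))" using K(1) HS[OF t] by (intro mult_right_mono) auto
      finally show ?thesis .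
    next
      case 2
      then show ?thesis by (intro far t)
    next
      case 3
      then have "pt t y x \<le> K * (H t y * H t x * S t (y - x))" by (intro far t) (auto simp: norm_minus_commute)
      then show ?thesis using pt_sym[OF t, of x y] sbound_minus_commute[of \<alpha> t x y] by (simp add: mult_ac)
    next
      case 4
      have "pt t x y \<le> KU * S t (x - y)" by (rule pt_bounds(2)[OF t])
      also have "\<dots> \<le> K * S t (x - y)" using K(3) sbound_pos[OF t, of \<alpha> "x - y"] by (intro mult_right_mono) auto
      finally show ?thesis using H_large[OF t 4(1)] H_large[OF t 4(2)] by simp
    qed
  qed
  with that[OF K(4)] show ?thesis by blast
qed

lemma integral_norm_powr_outside:
  assumes s: "real DIM('a) < s"
  obtains K where "K > 0"
    "\<And>R. R > 0 \<Longrightarrow> integrable lborel (\<lambda>z::'a. indicator {z. R \<le> norm z} z * norm z powr (- s))"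
    "\<And>R. R > 0 \<Longrightarrow> (LINT z|lborel. indicator {z::'a. R \<le> norm z} z * norm z powr (- s)) \<le> K * R powr (real DIM('a) - s)"
proof -
  obtain K where K: "K > 0" "\<And>R. R > 0 \<Longrightarrow> (\<integral>\<^sup>+x. indicator {x::'a. R \<le> norm x} x * ennreal (norm x powr (- s)) \<partial>lborel) \<le> ennreal (K * R powr (real DIM('a) - s))"
    by (rule nn_integral_norm_powr_outside[OF s]) (rule that)
  have n: "(\<integral>\<^sup>+z. ennreal (indicator {z::'a. R \<le> norm z} z * norm z powr (- s)) \<partial>lborel) \<le> ennreal (K * R powr (real DIM('a) - s))" if "R > 0" for R
    using K(2)[OF that] by (simp add: ennreal_mult' ennreal_indicator)
  show ?thesis
  proof (rule that[OF K(1)])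
    fix R :: real assume R: "R > 0"
    show "integrable lborel (\<lambda>z::'a. indicator {z. R \<le> norm z} z * norm z powr (- s))"
      by (rule integrableI_nonneg) (use le_less_trans[OF n[OF R]] in auto)
    show "(LINT z|lborel. indicator {z::'a. R \<le> norm z} z * norm z powr (- s)) \<le> K * R powr (real DIM('a) - s)"
      using n[OF R] K(1) by (intro integral_real_bounded) auto
  qed
qed

text \<open>The invariance of \<open>|z|\<^sup>\<delta>\<close> forces mass into the annulus: by the upper bound, the small ball and the complement of the large ball together carry at most half of \<open>\<integral> pt t x z |z|\<^sup>\<delta> dz = |x|\<^sup>\<delta>\<close>.\<close>

lemma annulus_mass:
  obtains r R q where "r > 0" "R > 0" "q > 0" "\<And>t x. t > 0 \<Longrightarrow> norm x \<le> T t \<Longrightarrow>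
    q * H t x \<le> (LINT z|lborel. indicator {z. r * T t \<le> norm z \<and> norm z \<le> R * T t} z * pt t x z)"
proof -
  let ?d = "real DIM('a)"
  let ?e = "real DIM('a) + \<alpha>"
  have e: "?e > 0" using alpha by linarith
  define s where "s = ?e - \<delta>"
  have s: "?d < s" using del by (simp add: s_def)
  obtain K where K: "K > 0"
    "\<And>R. R > 0 \<Longrightarrow> integrable lborel (\<lambda>z::'a. indicator {z. R \<le> norm z} z * norm z powr (- s))"
    "\<And>R. R > 0 \<Longrightarrow> (LINT z|lborel. indicator {z::'a. R \<le> norm z} z * norm z powr (- s)) \<le> K * R powr (?d - s)"
    by (rule integral_norm_powr_outside[OF s]) (rule that)
  obtain C where C: "C > 0" "\<And>t x y. t > 0 \<Longrightarrow> pt t x y \<le> C * (H t x * H t y * S t (x - y))"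
    by (rule pt_upper) (rule that)
  define w where "w = unit_ball_vol ?d"
  have w: "w > 0" by (simp add: w_def)
  \<comment> \<open>With this radius the small ball contributes at most a quarter of
    \<open>|x| powr \<delta>\<close>, because \<open>C * w * r powr (d + \<delta>) = 1 / 4\<close>;
    \<open>R\<close> below is the analogous choice for the outer region.\<close>
  define r where "r = (1 / (4 * C * w)) powr (1 / (?d + \<delta>))"
  have ds: "?d + \<delta> > 0" using del by linarith
  have r: "r > 0" using C w by (simp add: r_def)
  have r_eq: "C * w * r powr (?d + \<delta>) = 1 / 4" using C w ds by (simp add: r_def powr_powr)
  define R where "R = max 2 ((4 * C * 2 powr ?e * K) powr (1 / (\<alpha> - \<delta>)))"
  have R: "R \<ge> 2" by (simp add: R_def)
  have R_le: "C * 2 powr ?e * K * R powr (\<delta> - \<alpha>) \<le> 1 / 4"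
  proof -
    let ?Q = "4 * C * 2 powr ?e * K"
    have Q: "?Q > 0" using C K by simp
    have "?Q = (?Q powr (1 / (\<alpha> - \<delta>))) powr (\<alpha> - \<delta>)" using Q del by (simp add: powr_powr)
    also have "\<dots> \<le> R powr (\<alpha> - \<delta>)" using del by (intro powr_mono2) (auto simp: R_def)
    finally have "?Q * R powr (\<delta> - \<alpha>) \<le> R powr (\<alpha> - \<delta>) * R powr (\<delta> - \<alpha>)" by (intro mult_right_mono) auto
    also have "\<dots> = 1" unfolding powr_add[symmetric] using R by simp
    finally show ?thesis by simp
  qed
  \<comment> \<open>On the annulus \<open>|z| powr \<delta>\<close> is at most
    \<open>(R * T t) powr \<delta>\<close>. Half of
    \<open>|x| powr \<delta> = H t x * T t powr \<delta>\<close>, divided by this, is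
    \<open>q * H t x\<close>.\<close>
  define q where "q = R powr (- \<delta>) / 2"
  have q: "q > 0" using R by (simp add: q_def)
  have "q * H t x \<le> (LINT z|lborel. indicator {z. r * T t \<le> norm z \<and> norm z \<le> R * T t} z * pt t x z)"
    if t: "t > 0" and xT: "norm x \<le> T t" for t x
  proof (cases "x = 0")
    case True
    then show ?thesis using t by (simp add: H_bounds(3) pt_0)
  next
    case False
    let ?A = "{z::'a. r * T t \<le> norm z \<and> norm z \<le> R * T t}"
    have T0: "T t > 0" using t by (rule T_pos)
    note [measurable] = pt_meas[OF t]
    define r' where "r' = r * T t"
    define R' where "R' = R * T t"
    have r': "r' > 0" and R': "R' > 0" "2 * T t \<le> R'" using r R T0 by (auto simp: r'_def R'_def)
    have hx: "H t x * T t powr \<delta> = norm x powr \<delta>"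
      using H_small[OF t xT] t by (simp add: T_powr powr_minus)
    define A1 where "A1 = C * t powr (- ?d / \<alpha>) * H t x * r' powr \<delta>"
    define A2 where "A2 = C * H t x * 2 powr ?e * t"
    have A1: "A1 \<ge> 0" and A2: "A2 \<ge> 0" using C H_bounds(1)[of t x] t by (auto simp: A1_def A2_def)
    have [measurable]: "cball (0::'a) r' \<in> sets borel" by (simp add: borel_closed)
    have ib: "integrable lborel (indicator (cball (0::'a) r') :: 'a \<Rightarrow> real)"
      by (rule integrable_real_indicator) (auto simp: emeasure_cball r' less_imp_le)
    have iA: "integrable lborel (\<lambda>z. indicator ?A z * pt t x z)"
      by (rule Bochner_Integration.integrable_bound[OF integrable_pt[OF t, of x]]) (auto simp: indicator_def)
    let ?F = "\<lambda>z. A1 * indicator (cball 0 r') z + R' powr \<delta> * (indicator ?A z * pt t x z) + A2 * (indicator {z. R' \<le> norm z} z * norm z powr (- s))"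
    have pw: "pt t x z * norm z powr \<delta> \<le> ?F z" for z
    proof -
      have p0: "0 \<le> pt t x z" by (rule pt_bounds(1)[OF t])
      have n: "0 \<le> A1 * indicator (cball 0 r') z" "0 \<le> R' powr \<delta> * (indicator ?A z * pt t x z)" "0 \<le> A2 * (indicator {z. R' \<le> norm z} z * norm z powr (- s))"
        using A1 A2 p0 by (auto simp: indicator_def)
      consider "norm z \<le> r'" | "r' \<le> norm z" "norm z \<le> R'" | "R' \<le> norm z" by linarith
      then show ?thesis
      proof cases
        case 1
        have "pt t x z \<le> C * (H t x * H t z * S t (x - z))" by (rule C(2)[OF t])
        also have "\<dots> \<le> C * (H t x * 1 * t powr (- ?d / \<alpha>))"
          using C(1) H_bounds(1)[of t x] H_bounds(1)[of t z] H_bounds(2)[OF t, of z] sbound_le1[of \<alpha> t "x - z"] sbound_pos[OF t, of \<alpha> "x - z"]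
          by (intro mult_left_mono mult_mono) auto
        finally have "pt t x z * norm z powr \<delta> \<le> (C * (H t x * 1 * t powr (- ?d / \<alpha>))) * r' powr \<delta>"
          using 1 del p0 C(1) H_bounds(1)[of t x] by (intro mult_mono powr_mono2) auto
        then have "pt t x z * norm z powr \<delta> \<le> A1 * indicator (cball 0 r') z" using 1 by (simp add: A1_def mult_ac)
        then show ?thesis using n by linarith
      next
        case 2
        have "pt t x z * norm z powr \<delta> \<le> pt t x z * R' powr \<delta>" using p0 2 del by (intro mult_left_mono powr_mono2) auto
        also have "\<dots> = R' powr \<delta> * (indicator ?A z * pt t x z)" using 2 by (simp add: r'_def R'_def)
        finally show ?thesis using n by linarith
      next
        case 3
        have z: "norm z / 2 \<le> norm (x - z)" using 3 R' xT norm_triangle_ineq2[of z x] by (simp add: norm_minus_commute)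
        have z0: "norm z > 0" using 3 R' by linarith
        have xz: "x - z \<noteq> 0" using z z0 by auto
        have "S t (x - z) \<le> t / norm (x - z) powr ?e" by (rule sbound_le2[OF xz])
        also have "\<dots> \<le> t / (norm z / 2) powr ?e" using t z z0 e xz by (intro divide_left_mono powr_mono2 mult_pos_pos) auto
        also have "\<dots> = 2 powr ?e * t * norm z powr (- ?e)" by (simp only: powr_divide powr_minus_divide) simp
        finally have S1: "S t (x - z) \<le> 2 powr ?e * t * norm z powr (- ?e)" .
        have "pt t x z \<le> C * (H t x * H t z * S t (x - z))" by (rule C(2)[OF t])
        also have "\<dots> \<le> C * (H t x * 1 * (2 powr ?e * t * norm z powr (- ?e)))"
          using C(1) H_bounds(1)[of t x] H_bounds(1)[of t z] H_bounds(2)[OF t, of z] S1 sbound_pos[OF t, of \<alpha> "x - z"]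
          by (intro mult_left_mono mult_mono) auto
        also have "\<dots> = A2 * norm z powr (- ?e)" by (simp only: A2_def mult_ac mult_1_left mult_1_right)
        finally have "pt t x z * norm z powr \<delta> \<le> A2 * norm z powr (- ?e) * norm z powr \<delta>" by (intro mult_right_mono) auto
        also have "- s = - ?e + \<delta>" by (simp add: s_def)
        then have "A2 * norm z powr (- ?e) * norm z powr \<delta> = A2 * norm z powr (- s)" by (simp only: mult.assoc powr_add)
        also have "\<dots> = A2 * (indicator {z. R' \<le> norm z} z * norm z powr (- s))" using 3 by simp
        finally show ?thesis using n by linarith
      qed
    qed
    have i1: "integrable lborel (\<lambda>z::'a. A1 * indicator (cball 0 r') z)" using ib by auto
    have i2: "integrable lborel (\<lambda>z. R' powr \<delta> * (indicator ?A z * pt t x z))" using iA by (rule integrable_mult_right)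
    have i3: "integrable lborel (\<lambda>z::'a. A2 * (indicator {z. R' \<le> norm z} z * norm z powr (- s)))" using K(2)[OF R'(1)] by (rule integrable_mult_right)
    have "norm x powr \<delta> = (LINT z|lborel. pt t x z * norm z powr \<delta>)" by (simp add: pt_norm_powr_invariant[OF False t])
    also have "\<dots> \<le> (LINT z|lborel. ?F z)"
      by (rule integral_mono[OF integrable_pt_moment[OF t] _ pw]) (intro Bochner_Integration.integrable_add i1 i2 i3)
    also have "\<dots> = A1 * measure lborel (cball (0::'a) r') + R' powr \<delta> * (LINT z|lborel. indicator ?A z * pt t x z)
        + A2 * (LINT z|lborel. indicator {z::'a. R' \<le> norm z} z * norm z powr (- s))"
      using i1 i2 i3 by (simp add: Bochner_Integration.integral_add[OF Bochner_Integration.integrable_add[OF i1 i2] i3] Bochner_Integration.integral_add[OF i1 i2])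
    also have "\<dots> \<le> norm x powr \<delta> / 4 + R' powr \<delta> * (LINT z|lborel. indicator ?A z * pt t x z) + norm x powr \<delta> / 4"
    proof (intro add_mono order_refl)
      have "measure lborel (cball (0::'a) r') = w * r' powr ?d"
        using r' by (simp add: measure_def emeasure_cball w_def powr_realpow)
      then have "A1 * measure lborel (cball (0::'a) r') = C * w * H t x * t powr (- ?d / \<alpha>) * (r' powr \<delta> * r' powr ?d)"
        by (simp add: A1_def)
      also have "r' powr \<delta> * r' powr ?d = r powr (?d + \<delta>) * (T t powr ?d * T t powr \<delta>)"
        using r T0 by (simp only: r'_def powr_mult powr_add mult_ac)
      also have "T t powr ?d = t powr (?d / \<alpha>)" by (rule T_powr[OF t])
      also have "C * w * H t x * t powr (- ?d / \<alpha>) * (r powr (?d + \<delta>) * (t powr (?d / \<alpha>) * T t powr \<delta>))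
         = (C * w * r powr (?d + \<delta>)) * (H t x * T t powr \<delta>) * (t powr (- ?d / \<alpha>) * t powr (?d / \<alpha>))" by (simp only: mult_ac)
      also have "t powr (- ?d / \<alpha>) * t powr (?d / \<alpha>) = 1" using t by (simp add: powr_minus)
      finally show "A1 * measure lborel (cball (0::'a) r') \<le> norm x powr \<delta> / 4" unfolding r_eq hx by simp
      have "A2 * (LINT z|lborel. indicator {z::'a. R' \<le> norm z} z * norm z powr (- s)) \<le> A2 * (K * R' powr (?d - s))"
        using A2 K(3)[OF R'(1)] by (intro mult_left_mono)
      also have "?d - s = \<delta> - \<alpha>" by (simp add: s_def)
      also have "R' powr (\<delta> - \<alpha>) = R powr (\<delta> - \<alpha>) * T t powr (\<delta> - \<alpha>)" using R T0 by (simp add: R'_def powr_mult)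
      also have "T t powr (\<delta> - \<alpha>) = T t powr \<delta> / t" using T_alpha[OF t] by (simp only: powr_diff)
      also have "A2 * (K * (R powr (\<delta> - \<alpha>) * (T t powr \<delta> / t))) = (C * 2 powr ?e * K * R powr (\<delta> - \<alpha>)) * (H t x * T t powr \<delta>)"
        using t by (simp add: A2_def)
      also have "\<dots> \<le> 1 / 4 * (H t x * T t powr \<delta>)" using R_le H_bounds(1)[of t x] by (intro mult_right_mono) auto
      finally show "A2 * (LINT z|lborel. indicator {z::'a. R' \<le> norm z} z * norm z powr (- s)) \<le> norm x powr \<delta> / 4"
        unfolding hx by simp
    qed
    finally have "norm x powr \<delta> / 2 \<le> R' powr \<delta> * (LINT z|lborel. indicator ?A z * pt t x z)" by simp
    then have "R' powr (- \<delta>) * (norm x powr \<delta> / 2) \<le> R' powr (- \<delta>) * (R' powr \<delta> * (LINT z|lborel. indicator ?A z * pt t x z))"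
      by (intro mult_left_mono) auto
    also have "\<dots> = (LINT z|lborel. indicator ?A z * pt t x z)" using R'(1) by (simp add: powr_minus)
    also have "R' powr (- \<delta>) * (norm x powr \<delta> / 2) = q * H t x"
      using R T0 hx[symmetric] by (simp add: R'_def q_def powr_mult powr_minus)
    finally show ?thesis .
  qed
  with that[OF r _ q, of R] R show ?thesis by simp
qed

text \<open>One Chapman-Kolmogorov step through the annulus: from \<open>x\<close> within
  \<open>T t\<close> it is reached with mass at least \<open>q * H t x\<close>, and from there the
  assumed bound takes over. \<open>L\<close> is quantified together with \<open>t\<close> and
  \<open>y\<close>, so that it can carry a factor \<open>H\<close> in \<open>y\<close> in a later
  application.\<close>

lemma pt_lower_by_annulus:
  obtains r q where "r > 0" "q > 0" "\<And>t x y L. t > 0 \<Longrightarrow> norm x \<le> T t \<Longrightarrow> L \<ge> 0 \<Longrightarrow>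
    \<forall>z. r * T t \<le> norm z \<longrightarrow> L * S t (z - y) \<le> pt t z y \<Longrightarrow> L * q * (H (2 * t) x * S (2 * t) (x - y)) \<le> pt (2 * t) x y"
proof -
  let ?e = "real DIM('a) + \<alpha>"
  obtain r R q where r: "r > 0" "R > 0" "q > 0" and mass: "\<And>t x. t > 0 \<Longrightarrow> norm x \<le> T t \<Longrightarrow>
    q * H t x \<le> (LINT z|lborel. indicator {z. r * T t \<le> norm z \<and> norm z \<le> R * T t} z * pt t x z)"
    by (rule annulus_mass) (rule that)
  define D where "D = 2 powr (1 + real DIM('a) / \<alpha>) * (R + 2) powr ?e"
  have D: "D > 0" using r by (simp add: D_def)
  have "L * (q / D) * (H (2 * t) x * S (2 * t) (x - y)) \<le> pt (2 * t) x y"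
    if t: "t > 0" and x: "norm x \<le> T t" and L: "L \<ge> 0" and lower: "\<forall>z. r * T t \<le> norm z \<longrightarrow> L * S t (z - y) \<le> pt t z y" for t x y L
  proof -
    let ?A = "{z::'a. r * T t \<le> norm z \<and> norm z \<le> R * T t}"
    note [measurable] = pt_meas[OF t]
    define Q where "Q = L * (S (2 * t) (x - y) / D)"
    have t2: "2 * t > 0" using t by simp
    have S0: "S (2 * t) (x - y) > 0" by (rule sbound_pos[OF t2])
    have Q: "Q \<ge> 0" using L S0 D by (simp add: Q_def)
    have QA: "Q \<le> pt t z y" if z: "z \<in> ?A" for z
    proof -
      have "norm (z - y) \<le> norm (x - y) + norm (z - x)" using norm_triangle_ineq[of "x - y" "z - x"] by (simp add: algebra_simps)
      also have "norm (z - x) \<le> (R + 1) * T t" using z x norm_triangle_ineq4[of z x] by (simp add: algebra_simps)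
      finally have "S t (x - y) \<le> (R + 1 + 1) powr ?e * S t (z - y)" using r by (intro S_shift[OF t]) auto
      then have s1: "S t (x - y) \<le> (R + 2) powr ?e * S t (z - y)" by (simp add: add.assoc)
      have "S (2 * t) (x - y) \<le> (2 powr (1 + real DIM('a) / \<alpha>) * 1 powr ?e) * S t (x - y)"
        using t alpha by (intro sbound_compare) auto
      also have "\<dots> \<le> 2 powr (1 + real DIM('a) / \<alpha>) * ((R + 2) powr ?e * S t (z - y))"
        using s1 by simp
      finally have "S (2 * t) (x - y) / D \<le> S t (z - y)" using D by (simp add: D_def pos_divide_le_eq mult_ac)
      then have "Q \<le> L * S t (z - y)" unfolding Q_def using L by (intro mult_left_mono)
      also have "\<dots> \<le> pt t z y" using z lower by simp
      finally show ?thesis .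
    qed
    have iA: "integrable lborel (\<lambda>z. indicator ?A z * pt t x z)"
      by (rule Bochner_Integration.integrable_bound[OF integrable_pt[OF t, of x]]) (auto simp: indicator_def)
    have "Q * (q * H (2 * t) x) \<le> Q * (q * H t x)"
      using Q r t by (intro mult_left_mono H_mono_time) auto
    also have "\<dots> \<le> Q * (LINT z|lborel. indicator ?A z * pt t x z)" using Q mass[OF t x] by (intro mult_left_mono)
    also have "\<dots> = (LINT z|lborel. Q * (indicator ?A z * pt t x z))" by simp
    also have "\<dots> \<le> (LINT z|lborel. pt t x z * pt t z y)"
    proof (rule integral_mono[OF integrable_mult_right[OF iA] CK(1)[OF t t]])
      fix z
      show "Q * (indicator ?A z * pt t x z) \<le> pt t x z * pt t z y"
      proof (cases "z \<in> ?A")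
        case True
        then show ?thesis using mult_left_mono[OF QA[OF True] pt_bounds(1)[OF t, of x z]] by (simp add: mult.commute)
      next
        case False
        then show ?thesis using mult_nonneg_nonneg[OF pt_bounds(1)[OF t, of x z] pt_bounds(1)[OF t, of z y]] by simp
      qed
    qed
    also have "\<dots> = pt (2 * t) x y" by (simp only: mult_2 CK(2)[OF t t])
    finally show ?thesis by (simp add: Q_def mult_ac)
  qed
  with that[of r "q / D"] r D show ?thesis by simp
qed

lemma T_half: "t > 0 \<Longrightarrow> T (t / 2) = 2 powr (- 1 / \<alpha>) * T t"
  by (simp add: powr_divide powr_minus_divide)

text \<open>Frees the first argument from the distance condition of \<open>pt_lower_away\<close>;
  \<open>pt_lower\<close> then frees the second one after exchanging the arguments by
  symmetry.\<close>

lemma pt_lower_one_away: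
  assumes r0: "r0 > 0"
  obtains b where "b > 0" "\<And>t x y. t > 0 \<Longrightarrow> r0 * T t \<le> norm y \<Longrightarrow> b * (H t x * S t (x - y)) \<le> pt t x y"
proof -
  obtain r q where r: "r > 0" "q > 0" and step: "\<And>t x y L. t > 0 \<Longrightarrow> norm x \<le> T t \<Longrightarrow> L \<ge> 0 \<Longrightarrow>
    \<forall>z. r * T t \<le> norm z \<longrightarrow> L * S t (z - y) \<le> pt t z y \<Longrightarrow> L * q * (H (2 * t) x * S (2 * t) (x - y)) \<le> pt (2 * t) x y"
    by (rule pt_lower_by_annulus) (rule that)
  \<comment> \<open>The entry \<open>2 powr (- 1 / \<alpha>)\<close> ensures that a starting point
    outside the radius \<open>T (t / 2)\<close> is already outside \<open>r1 * T t\<close>, where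
    \<open>pt_lower_away\<close> applies directly.\<close>
  define r1 where "r1 = min (min r r0) (2 powr (- 1 / \<alpha>))"
  have r1: "r1 > 0" "r1 \<le> r" "r1 \<le> r0" "r1 \<le> 2 powr (- 1 / \<alpha>)" using r r0 by (auto simp: r1_def)
  obtain b where b: "b > 0" "\<And>t x y. t > 0 \<Longrightarrow> norm x \<ge> r1 * T t \<Longrightarrow> norm y \<ge> r1 * T t \<Longrightarrow> b * S t (x - y) \<le> pt t x y"
    by (rule pt_lower_away[OF r1(1)]) (rule that)
  have "min b (b * q) * (H t x * S t (x - y)) \<le> pt t x y" if t: "t > 0" and y: "r0 * T t \<le> norm y" for t x y
  proof -
    let ?s = "t / 2"
    have s: "?s > 0" using t by simp
    have HS: "0 \<le> H t x * S t (x - y)" "H t x * S t (x - y) \<le> S t (x - y)"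
      using H_bounds(1)[of t x] H_bounds(2)[OF t, of x] sbound_pos[OF t, of \<alpha> "x - y"] by (auto intro: mult_left_le_one_le)
    have yt: "r1 * T t \<le> norm y" using y mult_right_mono[OF r1(3), of "T t"] by simp
    show ?thesis
    proof (cases "norm x \<le> T ?s")
      case True
      have "T ?s \<le> T t" using t alpha by (intro powr_mono2) auto
      then have ys: "r1 * T ?s \<le> norm y" using yt mult_left_mono[of "T ?s" "T t" r1] r1(1) by linarith
      have "b * q * (H (2 * ?s) x * S (2 * ?s) (x - y)) \<le> pt (2 * ?s) x y"
      proof (rule step[OF s True], goal_cases)
        case 2
        show ?case
        proof (intro allI impI)
        fix z :: 'a assume "r * T ?s \<le> norm z"
        then have "r1 * T ?s \<le> norm z" using mult_right_mono[OF r1(2), of "T ?s"] by (auto intro: order_trans)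
        then show "b * S ?s (z - y) \<le> pt ?s z y" by (rule b(2)[OF s _ ys])
        qed
      qed (use b in simp)
      then have "b * q * (H t x * S t (x - y)) \<le> pt t x y" by simp
      then show ?thesis using mult_right_mono[OF min.cobounded2 HS(1), of b "b * q"] by linarith
    next
      case False
      then have "r1 * T t \<le> norm x" using T_half[OF t] mult_right_mono[OF r1(4), of "T t"] by simp
      then have "b * S t (x - y) \<le> pt t x y" by (rule b(2)[OF t _ yt])
      moreover have "b * (H t x * S t (x - y)) \<le> b * S t (x - y)" using b(1) HS(2) by (intro mult_left_mono) auto
      ultimately show ?thesis using mult_right_mono[OF min.cobounded1 HS(1), of b "b * q"] by linarith
    qed
  qed
  with that[of "min b (b * q)"] b r show ?thesis by simp
qed

text \<open>The annulus step is repeated with \<open>L = b * H t y\<close>: by symmetry the previous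
  bound covers an outer intermediate point \<open>z\<close> and an arbitrary \<open>y\<close>, and
  \<open>H_mono_time\<close> allows \<open>H\<close> at time \<open>t\<close> instead of
  \<open>t / 2\<close>.\<close>

lemma pt_lower:
  obtains b where "b > 0" "\<And>t x y. t > 0 \<Longrightarrow> b * (H t x * H t y * S t (x - y)) \<le> pt t x y"
proof -
  obtain r q where r: "r > 0" "q > 0" and step: "\<And>t x y L. t > 0 \<Longrightarrow> norm x \<le> T t \<Longrightarrow> L \<ge> 0 \<Longrightarrow>
    \<forall>z. r * T t \<le> norm z \<longrightarrow> L * S t (z - y) \<le> pt t z y \<Longrightarrow> L * q * (H (2 * t) x * S (2 * t) (x - y)) \<le> pt (2 * t) x y"
    by (rule pt_lower_by_annulus) (rule that)
  define r1 where "r1 = min r (2 powr (- 1 / \<alpha>))"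
  have r1: "r1 > 0" "r1 \<le> r" "r1 \<le> 2 powr (- 1 / \<alpha>)" using r by (auto simp: r1_def)
  obtain b where b: "b > 0" "\<And>t x y. t > 0 \<Longrightarrow> r1 * T t \<le> norm y \<Longrightarrow> b * (H t x * S t (x - y)) \<le> pt t x y"
    by (rule pt_lower_one_away[OF r1(1)]) (rule that)
  have b': "b * (H t x * S t (x - y)) \<le> pt t y x" if "t > 0" "r1 * T t \<le> norm y" for t x y
    using b(2)[OF that, of x] pt_sym[OF that(1), of x y] by simp
  have "min b (b * q) * (H t x * H t y * S t (x - y)) \<le> pt t x y" if t: "t > 0" for t x y
  proof -
    let ?s = "t / 2"
    have s: "?s > 0" using t by simp
    have S0: "S t (x - y) > 0" by (rule sbound_pos[OF t])
    have H0: "0 \<le> H t x" "0 \<le> H t y" by (rule H_bounds)+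
    have HS: "0 \<le> H t x * H t y * S t (x - y)" using H0 S0 by simp
    show ?thesis
    proof (cases "norm x \<le> T ?s")
      case True
      have "b * H t y * q * (H (2 * ?s) x * S (2 * ?s) (x - y)) \<le> pt (2 * ?s) x y"
      proof (rule step[OF s True], goal_cases)
        case 2
        show ?case
        proof (intro allI impI)
        fix z :: 'a assume "r * T ?s \<le> norm z"
        then have "r1 * T ?s \<le> norm z" using mult_right_mono[OF r1(2), of "T ?s"] by (auto intro: order_trans)
        then have "b * (H ?s y * S ?s (y - z)) \<le> pt ?s z y" by (rule b'[OF s])
        moreover have "b * (H t y * S ?s (y - z)) \<le> b * (H ?s y * S ?s (y - z))"
          using b(1) sbound_pos[OF s, of \<alpha> "y - z"] s by (intro mult_left_mono mult_right_mono H_mono_time) auto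
        ultimately show "b * H t y * S ?s (z - y) \<le> pt ?s z y" using sbound_minus_commute[of \<alpha> ?s z y] by (simp add: mult.assoc)
        qed
      qed (use b H0 in simp)
      then have "b * q * (H t x * H t y * S t (x - y)) \<le> pt t x y" by (simp add: mult_ac)
      then show ?thesis using mult_right_mono[OF min.cobounded2 HS, of b "b * q"] by linarith
    next
      case False
      then have "r1 * T t \<le> norm x" using T_half[OF t] mult_right_mono[OF r1(3), of "T t"] by simp
      then have 1: "b * (H t y * S t (y - x)) \<le> pt t x y" by (rule b'[OF t])
      have "H t x * (H t y * S t (y - x)) \<le> H t y * S t (y - x)"
        using H0 H_bounds(2)[OF t, of x] sbound_pos[OF t, of \<alpha> "y - x"] by (intro mult_left_le_one_le) auto
      then have "b * (H t x * H t y * S t (x - y)) \<le> b * (H t y * S t (y - x))"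
        using b(1) sbound_minus_commute[of \<alpha> t x y] by (intro mult_left_mono) (auto simp: mult_ac)
      then show ?thesis using 1 mult_right_mono[OF min.cobounded1 HS, of b "b * q"] by linarith
    qed
  qed
  with that[of "min b (b * q)"] b r show ?thesis by simp
qed

text \<open>Off the axes this is \<open>continuous_pt_off_axes\<close>. On an axis the kernel is 0,
  and the factor \<open>H\<close> in the upper bound squeezes it to 0 as that argument tends to the
  origin, locally uniformly in time.\<close>

lemma continuous_pt: "continuous_on ({0<..} \<times> UNIV \<times> UNIV) (\<lambda>(t, x, y). pt t x y)"
proof -
  let ?f = "\<lambda>(t, x, y). pt t x y"
  let ?d = "real DIM('a)"
  obtain C where C: "C > 0" "\<And>t x y. t > 0 \<Longrightarrow> pt t x y \<le> C * t powr (- ?d / \<alpha>) * (H t x * H t y)"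
    by (rule pt_upper_near) (rule that)
  define \<phi> where "\<phi> t x = C * t powr (- ?d / \<alpha>) * (norm x powr \<delta> * t powr (- \<delta> / \<alpha>))" for t and x :: 'a
  have phi: "C * t powr (- ?d / \<alpha>) * H t x \<le> \<phi> t x" if "t > 0" for t x
    unfolding \<phi>_def using C(1) by (intro mult_left_mono H_le[OF that]) auto
  have le: "pt t x y \<le> \<phi> t x" "pt t x y \<le> \<phi> t y" if t: "t > 0" for t x y
  proof -
    have "H t x * H t y \<le> H t x" "H t x * H t y \<le> H t y"
      using H_bounds(1)[of t] H_bounds(2)[OF t] by (auto intro: mult_left_le_one_le mult_right_le_one_le)
    then have "C * t powr (- ?d / \<alpha>) * (H t x * H t y) \<le> C * t powr (- ?d / \<alpha>) * H t x"
      "C * t powr (- ?d / \<alpha>) * (H t x * H t y) \<le> C * t powr (- ?d / \<alpha>) * H t y"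
      using C(1) by (auto intro!: mult_left_mono)
    then show "pt t x y \<le> \<phi> t x" "pt t x y \<le> \<phi> t y" using C(2)[OF t, of x y] phi[OF t, of x] phi[OF t, of y] by linarith+
  qed
  show ?thesis unfolding continuous_on_eq_continuous_within
  proof (rule ballI)
    fix u :: "real \<times> 'a \<times> 'a" assume u: "u \<in> {0<..} \<times> UNIV \<times> UNIV"
    obtain t x y where uxy: "u = (t, x, y)" by (cases u) auto
    have t: "t > 0" using u by (simp add: uxy)
    let ?F = "at u within {0<..} \<times> UNIV \<times> UNIV"
    have ev: "eventually (\<lambda>v. fst v > 0) ?F" by (rule eventually_at_topological[THEN iffD2]) auto
    have t1: "(fst \<longlongrightarrow> t) ?F" "((\<lambda>v. fst (snd v)) \<longlongrightarrow> x) ?F" "((\<lambda>v. snd (snd v)) \<longlongrightarrow> y) ?F"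
      using tendsto_fst[OF tendsto_ident_at, of u] tendsto_fst[OF tendsto_snd[OF tendsto_ident_at, of u]] tendsto_snd[OF tendsto_snd[OF tendsto_ident_at, of u]]
      by (auto simp: uxy)
    have powr_t: "((\<lambda>v. fst v powr a) \<longlongrightarrow> t powr a) ?F" for a
      using t by (intro tendsto_powr t1 tendsto_const) auto
    have phi0: "((\<lambda>v. \<phi> (fst v) (z v)) \<longlongrightarrow> 0) ?F" if z: "(z \<longlongrightarrow> 0) ?F" for z
    proof -
      have "((\<lambda>v. norm (z v) powr \<delta>) \<longlongrightarrow> norm (0::'a) powr \<delta>) ?F"
        using del by (intro tendsto_powr' tendsto_norm z tendsto_const) auto
      then have "((\<lambda>v. \<phi> (fst v) (z v)) \<longlongrightarrow> C * t powr (- ?d / \<alpha>) * (norm (0::'a) powr \<delta> * t powr (- \<delta> / \<alpha>))) ?F"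
        unfolding \<phi>_def by (intro tendsto_mult tendsto_const powr_t)
      then show ?thesis by simp
    qed
    have sq: "continuous ?F ?f" if z: "(\<And>s x y. s > 0 \<Longrightarrow> pt s x y \<le> \<phi> s (z (s, x, y)))" "(z \<longlongrightarrow> 0) ?F" "pt t x y = 0" for z
    proof -
      have "eventually (\<lambda>v. norm (?f v) \<le> \<phi> (fst v) (z v)) ?F"
        using ev by eventually_elim (use z(1) pt_bounds(1) in \<open>auto simp: split_beta\<close>)
      then have "(?f \<longlongrightarrow> 0) ?F" by (rule Lim_null_comparison[OF _ phi0[OF z(2)]])
      then show ?thesis using z(3) by (simp add: continuous_within uxy)
    qed
    show "continuous ?F ?f"
    proof (cases "x = 0 \<or> y = 0")
      case True
      then show ?thesis
      proof
        assume "x = 0"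
        then show ?thesis using sq[of "\<lambda>v. fst (snd v)"] le(1) t1 pt_0[OF t] by simp
      next
        assume "y = 0"
        then show ?thesis using sq[of "\<lambda>v. snd (snd v)"] le(2) t1 pt_0[OF t] by simp
      qed
    next
      case False
      have "open ({0<..} \<times> (UNIV - {0}) \<times> (UNIV - {0}) :: (real \<times> 'a \<times> 'a) set)" by (intro open_Times) auto
      then have "continuous (at u) ?f" using continuous_pt_off_axes False t
        by (simp add: continuous_on_eq_continuous_at uxy)
      then show ?thesis by (rule continuous_at_imp_continuous_at_within)
    qed
  qed
qed

lemma Fbound_eq: "Fbound DIM('a) \<alpha> \<delta> t x y = H t x * H t y * S t (x - y)"
  by (simp add: Fbound_def H_def sbound_def)

end

theorem theorem1p1:
  fixes M :: "'b measure" and X :: "real \<Rightarrow> 'b \<Rightarrow> 'a::euclidean_space"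
    and pt :: "real \<Rightarrow> 'a \<Rightarrow> 'a \<Rightarrow> real" and \<alpha> \<delta> :: real
  assumes "0 < \<alpha>" and "\<alpha> < min (real DIM('a)) 2"
    and "0 < \<delta>" and "\<delta> < \<alpha>"
    and "is_stable_process M \<alpha> X"
    and "is_FK_heat_kernel M (kappa DIM('a) \<alpha> \<delta>) \<alpha> X pt"
  shows "continuous_on ({0<..} \<times> UNIV \<times> UNIV) (\<lambda>(t, x, y). pt t x y)
    \<and> (\<exists>c\<ge>1. \<forall>t>0. \<forall>x y.
          Fbound DIM('a) \<alpha> \<delta> t x y / c \<le> pt t x y \<and> pt t x y \<le> c * Fbound DIM('a) \<alpha> \<delta> t x y)"
proof -
  have a: "\<alpha> < 2" "\<alpha> < real DIM('a)" using assms by auto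
  obtain p :: "real \<Rightarrow> 'a \<Rightarrow> real" and C0 where p: "C0 \<ge> 1"
    "\<forall>t>0. \<forall>x. sbound \<alpha> t x / C0 \<le> p t x \<and> p t x \<le> C0 * sbound \<alpha> t x"
    "continuous_on ({0<..} \<times> UNIV) (\<lambda>(t, x). p t x)" "\<forall>t x. p t (- x) = p t x"
    "\<forall>t>0. \<forall>xi. (LINT y|lborel. complex_of_real (p t y) * cis (xi \<bullet> y)) = exp (- t * norm xi powr \<alpha>)"
    using stable_density_exists[OF assms(1) a(1)] by blast
  interpret fk_kernel \<alpha> C0 p M X \<delta> pt
    using assms a p by unfold_locales auto
  obtain C where C: "C > 0" "\<And>t x y. t > 0 \<Longrightarrow> pt t x y \<le> C * (H t x * H t y * S t (x - y))"
    by (rule pt_upper) (rule that)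
  obtain b where b: "b > 0" "\<And>t x y. t > 0 \<Longrightarrow> b * (H t x * H t y * S t (x - y)) \<le> pt t x y"
    by (rule pt_lower) (rule that)
  define k where "k = max 1 (max C (1 / b))"
  have k: "k \<ge> 1" "C \<le> k" "1 / b \<le> k" by (auto simp: k_def)
  have kb: "1 / k \<le> b" using k b by (simp add: field_simps)
  have "Fbound DIM('a) \<alpha> \<delta> t x y / k \<le> pt t x y \<and> pt t x y \<le> k * Fbound DIM('a) \<alpha> \<delta> t x y" if t: "t > 0" for t x y
  proof -
    let ?h = "H t x * H t y * S t (x - y)"
    have h: "?h \<ge> 0" using H_bounds(1) sbound_pos[OF t, of \<alpha> "x - y"] by (intro mult_nonneg_nonneg) auto
    have "1 / k * ?h \<le> b * ?h" "C * ?h \<le> k * ?h" using k kb h by (intro mult_right_mono; simp)+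
    then show ?thesis using b(2)[OF t, of x y] C(2)[OF t, of x y] by (simp add: Fbound_eq)
  qed
  then show ?thesis using continuous_pt k(1) by blast
qed

end
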